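(* For all $(y,z)\in\mathcal A^2$, the return trajectory subgroup $H(y,z)<\Gamma$ is of finite index in $\Gamma$.
   Context: Setting. $n\ge2$; $\mathbb K\subset\mathbb R$ is a totally real number field with ring of integers $\mathcal O_{\mathbb K}$; $\mathbf G<\mathrm{GL}_m$ is an algebraic group over $\mathbb K$ with $\mathbf G(\mathbb R)\cong\mathrm{SO}(n,1)$ and $\mathbf G^\sigma(\mathbb R)$ compact for all nontrivial embeddings $\sigma:\mathbb K\hookrightarrow\mathbb R$; $G=\mathbf G(\mathbb R)^\circ$ is the orientation preserving isometry group of $\mathbb H^n$. $\tilde\pi:\tilde{\mathbf G}\to\mathbf G$ is a simply connected cover over $\mathbb K$. $\Gamma<\mathbf G(\mathbb K)\cap G$ is Zariski dense, torsion-free, convex cocompact, $\tilde\Gamma=\tilde\pi^{-1}(\Gamma)\subset\tilde{\mathbf G}(\mathcal O_{\mathbb K})$, and $\mathbb Q(\mathrm{tr}(\mathrm{Ad}(\tilde\Gamma)))=\mathbb K$. $M\cong\mathrm{SO}(n-1)$ is the stabilizer of a reference unit vector, $\mathrm T^1(\mathbb H^n)\cong G/M$, and $A=\{a_t\}$ acts by right translation as the geodesic flow on $G/M$. Markov section. $X=\Gamma\backslash\mathbb H^n$, $\mathrm T^1(X)=\Gamma\backslash G/M$; $\Omega\subset\mathrm T^1(X)$ is the compact set of vectors whose lifts have both endpoints in the limit set $\Lambda(\Gamma)$ (the support of the Bowen–Margulis–Sullivan measure). $W^{\mathrm{su}},W^{\mathrm{ss}},W^{\mathrm{wu}}$ are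 the strong unstable, strong stable, weak unstable leaves, $W_\epsilon$ the open $\epsilon$-balls in them, $d_{\mathrm{su}},d_{\mathrm{ss}}$ the induced distances. $\epsilon_0,\epsilon_0'>0$ are such that $[u,s]=W^{\mathrm{ss}}_{\epsilon_0'}(u)\cap W^{\mathrm{wu}}_{\epsilon_0'}(s)$ is one point for $u\in W^{\mathrm{wu}}_{\epsilon_0}(w)$, $s\in W^{\mathrm{ss}}_{\epsilon_0}(w)$, and $[\cdot,\cdot]$ is a homeomorphism onto its image. A rectangle with center $w\in\Omega$ is $[U,S]=\{[u,s]:u\in U,s\in S\}\subset\Omega$ with $w\in U\subset W^{\mathrm{su}}_{\epsilon_0}(w)\cap\Omega$, $w\in S\subset W^{\mathrm{ss}}_{\epsilon_0}(w)\cap\Omega$, each the closure of its interior relative to $W^{\mathrm{su}}(w)\cap\Omega$, resp. $W^{\mathrm{ss}}(w)\cap\Omega$; put $[[u_1,s_1],[u_2,s_2]]=[u_1,s_2]$. Fix $0<\hat\delta<\min(1,\epsilon_0,\epsilon_0',\frac14\mathrm{inj}(\mathrm T^1(X)))$ and rectangles $R_j=[U_j,S_j]$, $j\in\mathcal A=\{1,\dots,N\}$, forming a Markov section of size $\hat\delta$: the $R_j$ are pairwise disjoint, $U_j,S_j$ have diameter $\le\hat\delta$, $\Omega=\bigcup_j\bigcup_{t\in[0,\hat\delta]}R_ja_t$, and with $R=\bigsqcup R_j$, $\tau(u)=\inf\{t>0:ua_t\in R\}$, $\mathcal P(u)=ua_{\tau(u)}$, one has $[\mathrm{int}(U_k),\mathcal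 P(u)]\subset\mathcal P([\mathrm{int}(U_j),u])$ and $\mathcal P([u,\mathrm{int}(S_j)])\subset[\mathcal P(u),\mathrm{int}(S_k)]$ whenever $u\in\mathrm{int}(R_j)\cap\mathcal P^{-1}(\mathrm{int}(R_k))$. A pair $(j,k)\in\mathcal A^2$ is admissible if $\mathrm{int}(R_j)\cap\mathcal P^{-1}(\mathrm{int}(R_k))\ne\varnothing$; a sequence is admissible if all consecutive pairs are. The transition matrix is topologically mixing (some power has all entries positive). Cocycle. Choose homeomorphic lifts $\mathsf R_j\subset\mathrm T^1(\mathbb H^n)$ of $R_j$, $\mathsf R=\bigsqcup\mathsf R_j$; for $u\in R$ let $\tilde u\in\mathsf R$ be its lift. $\mathtt c:R\to\Gamma$ is defined by $\tilde ua_{\tau(u)}\in\mathtt c(u)\mathsf R$; it is constant on $R_j\cap\mathcal P^{-1}(R_k)$, with value denoted $\mathtt c(j,k)$ for admissible $(j,k)$. For an admissible sequence $\alpha=(\alpha_0,\dots,\alpha_{p+1})$, $\mathtt c^{p+1}(\alpha)=\mathtt c(\alpha_0,\alpha_1)\mathtt c(\alpha_1,\alpha_2)\cdots\mathtt c(\alpha_p,\alpha_{p+1})$. Return trajectory subgroups. For $(y,z)\in\mathcal A^2$ and $p\in\mathbb N$, $S^p(y,z)=\{\mathtt c^{p+1}(\alpha)\mathtt c^{p+1}(\tilde\alpha)^{-1}\}$ over all pairs of admissible sequences $\alpha=(\alpha_0,\dots,\alpha_{p+1})$, $\tilde\alpha=(\tilde\alpha_0,\dots,\tilde\alpha_{p+1})$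 with $\alpha_0=\tilde\alpha_0=y$ and $\alpha_{p+1}=\tilde\alpha_{p+1}=z$. $H(y,z)<\Gamma$ is the subgroup generated by $\bigcup_{p\ge1}S^p(y,z)$. *)

theory Defs
  imports
    "HOL-Analysis.Analysis"
    "HOL-Algebra.Coset"
    "HOL-Algebra.Generated_Groups"
    "HOL-Library.Poly_Mapping"
    "HOL-Computational_Algebra.Polynomial"
begin

section \<open>Number fields\<close>

definition is_subfield :: "real set \<Rightarrow> bool" where
  "is_subfield F \<longleftrightarrow> 0 \<in> F \<and> 1 \<in> F \<and>
     (\<forall>x\<in>F. \<forall>y\<in>F. x + y \<in> F \<and> x - y \<in> F \<and> x * y \<in> F) \<and> (\<forall>x\<in>F. inverse x \<in> F)"

definition number_field :: "real set \<Rightarrow> bool" where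
  "number_field K \<longleftrightarrow> is_subfield K \<and>
     (\<exists>B. finite B \<and> B \<subseteq> K \<and> (\<forall>x\<in>K. \<exists>c :: real \<Rightarrow> rat. x = (\<Sum>b\<in>B. of_rat (c b) * b)))"

text \<open>Only the values of the map on \<open>K\<close> matter.\<close>

definition field_embedding :: "real set \<Rightarrow> (real \<Rightarrow> 'b::field) \<Rightarrow> bool" where
  "field_embedding K \<sigma> \<longleftrightarrow> \<sigma> 1 = 1 \<and>
     (\<forall>x\<in>K. \<forall>y\<in>K. \<sigma> (x + y) = \<sigma> x + \<sigma> y \<and> \<sigma> (x * y) = \<sigma> x * \<sigma> y)"

definition totally_real_number_field :: "real set \<Rightarrow> bool" where
  "totally_real_number_field K \<longleftrightarrow> number_field K \<and>
     (\<forall>\<sigma> :: real \<Rightarrow> complex. field_embedding K \<sigma> \<longrightarrow> \<sigma> ` K \<subseteq> \<real>)"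

definition integers_of :: "real set \<Rightarrow> real set" where
  "integers_of K = {x \<in> K. algebraic_int x}"

text \<open>A subfield of the reals contains the rationals, so this is the field \<open>\<rat>(S)\<close>.\<close>

definition generated_field :: "real set \<Rightarrow> real set" where
  "generated_field S = \<Inter>{F. is_subfield F \<and> S \<subseteq> F}"

section \<open>Linear algebraic groups\<close>

text \<open>
  Elements of the coordinate ring of \<open>GL\<^sub>m\<close> are represented by polynomials in the variables
  \<open>Some (i, j)\<close> (the matrix entries) and \<open>None\<close> (the inverse of the determinant).
\<close>

type_synonym ('m, 'a) regfun = "((('m \<times> 'm) option) \<Rightarrow>\<^sub>0 nat) \<Rightarrow>\<^sub>0 'a"

fun coordinate :: "'a::field ^ 'm ^ 'm \<Rightarrow> ('m::finite \<times> 'm) option \<Rightarrow> 'a" where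
  "coordinate g None = inverse (det g)"
| "coordinate g (Some (i, j)) = g $ i $ j"

text \<open>
  The map \<open>h\<close> is applied to the coefficients: \<open>h = of_real\<close> and \<open>h = id\<close> evaluate at complex and
  at real matrices, and for a field embedding \<open>h = \<sigma>\<close> this evaluates the conjugate
  polynomial at a matrix.
\<close>

definition regfun_eval :: "('a::zero \<Rightarrow> 'b::field) \<Rightarrow> ('m, 'a) regfun \<Rightarrow> 'b ^ 'm ^ 'm \<Rightarrow> 'b::field" where
  "regfun_eval h p g =
     (\<Sum>m \<in> Poly_Mapping.keys p. h (Poly_Mapping.lookup p m) *
        (\<Prod>v \<in> Poly_Mapping.keys m. coordinate (g :: 'b ^ 'm::finite ^ 'm) v ^ Poly_Mapping.lookup m v))"

definition defined_over :: "'a::zero set \<Rightarrow> ('m, 'a) regfun \<Rightarrow> bool" where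
  "defined_over K p \<longleftrightarrow> (\<forall>m. Poly_Mapping.lookup p m \<in> K)"

definition GL :: "('a::field ^ 'm::finite ^ 'm) monoid" where
  "GL = \<lparr>carrier = {g. invertible g}, monoid.mult = (**), one = mat 1\<rparr>"

definition points :: "('a::zero \<Rightarrow> 'b::field) \<Rightarrow> ('m::finite, 'a) regfun set \<Rightarrow> ('b ^ 'm ^ 'm) set" where
  "points h P = {g \<in> carrier GL. \<forall>p\<in>P. regfun_eval h p g = 0}"

abbreviation complex_points :: "('m::finite, real) regfun set \<Rightarrow> (complex ^ 'm ^ 'm) set" where
  "complex_points \<equiv> points complex_of_real"

abbreviation real_points :: "('m::finite, real) regfun set \<Rightarrow> (real ^ 'm ^ 'm) set" where
  "real_points \<equiv> points id"

definition algebraic_group :: "real set \<Rightarrow> ('m::finite, real) regfun set \<Rightarrow> bool" where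
  "algebraic_group K P \<longleftrightarrow> (\<forall>p\<in>P. defined_over K p) \<and> subgroup (complex_points P) GL"

definition K_points :: "real set \<Rightarrow> ('m::finite, real) regfun set \<Rightarrow> (real ^ 'm ^ 'm) set" where
  "K_points K P = {g \<in> real_points P. \<forall>i j. g $ i $ j \<in> K}"

definition integral_points :: "real set \<Rightarrow> ('m::finite, real) regfun set \<Rightarrow> (real ^ 'm ^ 'm) set" where
  "integral_points K P =
     {g \<in> real_points P. \<forall>i j. g $ i $ j \<in> integers_of K \<and> matrix_inv g $ i $ j \<in> integers_of K}"

definition identity_component :: "('a::real_normed_field ^ 'm::finite ^ 'm) set \<Rightarrow> ('a ^ 'm ^ 'm) set" where
  "identity_component H = connected_component_set H (mat 1)"

definition complex_matrix :: "real ^ 'm ^ 'm \<Rightarrow> complex ^ 'm::finite ^ 'm" where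
  "complex_matrix g = (\<chi> i j. complex_of_real (g $ i $ j))"

definition zariski_dense :: "('m::finite, real) regfun set \<Rightarrow> (real ^ 'm ^ 'm) set \<Rightarrow> bool" where
  "zariski_dense P \<Gamma> \<longleftrightarrow> \<Gamma> \<subseteq> real_points P \<and>
     (\<forall>f :: ('m, complex) regfun. (\<forall>g\<in>\<Gamma>. regfun_eval id f (complex_matrix g) = 0)
        \<longrightarrow> (\<forall>g\<in>complex_points P. regfun_eval id f g = 0))"

definition regular_map ::
    "(real \<Rightarrow> 'b::field) \<Rightarrow> ('m::finite \<Rightarrow> 'm \<Rightarrow> ('k::finite, real) regfun) \<Rightarrow> 'b ^ 'k ^ 'k \<Rightarrow> 'b ^ 'm ^ 'm" where
  "regular_map h \<pi> g = (\<chi> i j. regfun_eval h (\<pi> i j) g)"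

text \<open>
  An isogeny over \<open>K\<close> whose source is simply connected. Simple connectedness of the source (which
  includes connectedness) is that of its group of complex points in the classical topology.
\<close>

definition simply_connected_cover :: "real set \<Rightarrow> ('k::finite, real) regfun set \<Rightarrow>
    ('m::finite \<Rightarrow> 'm \<Rightarrow> ('k, real) regfun) \<Rightarrow> ('m, real) regfun set \<Rightarrow> bool" where
  "simply_connected_cover K Pt \<pi> P \<longleftrightarrow>
     algebraic_group K Pt \<and> (\<forall>i j. defined_over K (\<pi> i j)) \<and>
     regular_map complex_of_real \<pi>
       \<in> hom (GL\<lparr>carrier := complex_points Pt\<rparr>) (GL\<lparr>carrier := complex_points P\<rparr>) \<and>
     regular_map complex_of_real \<pi> ` complex_points Pt = complex_points P \<and>
     finite {g \<in> complex_points Pt. regular_map complex_of_real \<pi> g = mat 1} \<and>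
     simply_connected (complex_points Pt)"

definition cover_preimage ::
    "('k::finite, real) regfun set \<Rightarrow> ('m::finite \<Rightarrow> 'm \<Rightarrow> ('k, real) regfun) \<Rightarrow> (real ^ 'm ^ 'm) set
      \<Rightarrow> (complex ^ 'k ^ 'k) set" where
  "cover_preimage Pt \<pi> \<Gamma> =
     {g \<in> complex_points Pt. regular_map complex_of_real \<pi> g \<in> complex_matrix ` \<Gamma>}"

text \<open>The Lie algebra of a closed subgroup of \<open>GL\<^sub>m(\<real>)\<close>: velocities at the identity of its curves.\<close>

definition lie_algebra :: "(real ^ 'm ^ 'm) set \<Rightarrow> (real ^ 'm::finite ^ 'm) set" where
  "lie_algebra H = {X. \<exists>c. (\<forall>t. c t \<in> H \<and> c differentiable (at t)) \<and> c (0::real) = mat 1 \<and>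
                       (c has_vector_derivative X) (at 0)}"

definition trace_on :: "'a::real_vector set \<Rightarrow> ('a \<Rightarrow> 'a) \<Rightarrow> real" where
  "trace_on V f = (let B = (SOME B. independent B \<and> span B = V) in \<Sum>b\<in>B. representation B (f b) b)"

definition tr_Ad :: "('k::finite, real) regfun set \<Rightarrow> real ^ 'k ^ 'k \<Rightarrow> real" where
  "tr_Ad Pt g = trace_on (lie_algebra (real_points Pt)) (\<lambda>X. g ** X ** matrix_inv g)"

definition torsion_free :: "(real ^ 'm::finite ^ 'm) set \<Rightarrow> bool" where
  "torsion_free \<Gamma> \<longleftrightarrow> (\<forall>g\<in>\<Gamma>. \<forall>k::nat. k > 0 \<and> g [^]\<^bsub>GL\<^esub> k = mat 1 \<longrightarrow> g = mat 1)"

section \<open>Hyperbolic space\<close>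

text \<open>
  Hyperboloid model of hyperbolic \<open>n\<close>-space, \<open>n = CARD('n)\<close>; the coordinate \<open>None\<close> is time-like.
\<close>

type_synonym 'n mvec = "(real, 'n option) vec"

type_synonym 'n lorentz = "(('n mvec), 'n option) vec"

definition minkowski :: "'n::finite mvec \<Rightarrow> 'n mvec \<Rightarrow> real" where
  "minkowski x y = (\<Sum>i\<in>UNIV. x $ Some i * y $ Some i) - x $ None * y $ None"

definition SO_n_1 :: "'n::finite lorentz set" where
  "SO_n_1 = {g. det g = 1 \<and> (\<forall>x y. minkowski (g *v x) (g *v y) = minkowski x y)}"

definition hyp_space :: "'n::finite mvec set" where
  "hyp_space = {x. minkowski x x = -1 \<and> x $ None > 0}"

text \<open>Elements of the unit tangent bundle are pairs of a base point and a unit tangent vector.\<close>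

type_synonym 'n uvec = "'n mvec \<times> 'n mvec"

definition T1H :: "'n::finite uvec set" where
  "T1H = {(x, v). x \<in> hyp_space \<and> minkowski x v = 0 \<and> minkowski v v = 1}"

definition flow :: "real \<Rightarrow> 'n::finite uvec \<Rightarrow> 'n uvec" where
  "flow t = (\<lambda>(x, v). (cosh t *\<^sub>R x + sinh t *\<^sub>R v, sinh t *\<^sub>R x + cosh t *\<^sub>R v))"

definition lact :: "'n::finite lorentz \<Rightarrow> 'n uvec \<Rightarrow> 'n uvec" where
  "lact g = (\<lambda>(x, v). (g *v x, g *v v))"

text \<open>
  The Sasaki metric on the unit tangent bundle, which is invariant under isometries. For a tangent
  vector \<open>(\<xi>, \<eta>)\<close> at \<open>(x, v)\<close> the covariant derivative of \<open>v\<close> is the component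
  \<open>\<eta> + \<langle>\<eta>, x\<rangle> x\<close> of \<open>\<eta>\<close> tangent to the hyperboloid.
\<close>

definition sasaki_norm :: "'n::finite uvec \<Rightarrow> 'n uvec \<Rightarrow> real" where
  "sasaki_norm = (\<lambda>(x, v) (\<xi>, \<eta>).
     let D = \<eta> + minkowski \<eta> x *\<^sub>R x in sqrt (minkowski \<xi> \<xi> + minkowski D D))"

definition path_length :: "(real \<Rightarrow> 'n::finite uvec) \<Rightarrow> real" where
  "path_length c = integral {0..1} (\<lambda>t. sasaki_norm (c t) (vector_derivative c (at t)))"

text \<open>The Riemannian distance induced on a submanifold \<open>W\<close> of \<open>T1H\<close>.\<close>

definition path_dist :: "'n::finite uvec set \<Rightarrow> 'n uvec \<Rightarrow> 'n uvec \<Rightarrow> real" where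
  "path_dist W p q = Inf {path_length c | c.
      c C1_differentiable_on {0..1} \<and> c ` {0..1} \<subseteq> W \<and> c 0 = p \<and> c 1 = q}"

definition strong_stable :: "'n::finite uvec \<Rightarrow> 'n uvec set" where
  "strong_stable p = {q. p \<in> T1H \<and> q \<in> T1H \<and>
     ((\<lambda>t. path_dist T1H (flow t p) (flow t q)) \<longlongrightarrow> 0) at_top}"

definition strong_unstable :: "'n::finite uvec \<Rightarrow> 'n uvec set" where
  "strong_unstable p = {q. p \<in> T1H \<and> q \<in> T1H \<and>
     ((\<lambda>t. path_dist T1H (flow (- t) p) (flow (- t) q)) \<longlongrightarrow> 0) at_top}"

definition weak_unstable :: "'n::finite uvec \<Rightarrow> 'n uvec set" where
  "weak_unstable p = (\<Union>t. flow t ` strong_unstable p)"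

section \<open>Convex cocompact groups\<close>

text \<open>
  Throughout, \<open>\<Delta>\<close> is a group of isometries. Points of a quotient by \<open>\<Delta>\<close> are orbits.
\<close>

definition quotient_topology :: "'a::topological_space set \<Rightarrow> ('a \<Rightarrow> 'b) \<Rightarrow> 'b topology" where
  "quotient_topology S q =
     topology (\<lambda>V. V \<subseteq> q ` S \<and> openin (top_of_set S) {p \<in> S. q p \<in> V})"

lemma openin_quotient_topology:
  "openin (quotient_topology S q) V \<longleftrightarrow> V \<subseteq> q ` S \<and> openin (top_of_set S) {p \<in> S. q p \<in> V}"
proof -
  have "istopology (\<lambda>V. V \<subseteq> q ` S \<and> openin (top_of_set S) {p \<in> S. q p \<in> V})"
    unfolding istopology_def
  proof (intro conjI allI impI)
    fix A B
    assume "A \<subseteq> q ` S \<and> openin (top_of_set S) {p \<in> S. q p \<in> A}"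
      and "B \<subseteq> q ` S \<and> openin (top_of_set S) {p \<in> S. q p \<in> B}"
    moreover have "{p \<in> S. q p \<in> A \<inter> B} = {p \<in> S. q p \<in> A} \<inter> {p \<in> S. q p \<in> B}"
      by auto
    ultimately show "A \<inter> B \<subseteq> q ` S" "openin (top_of_set S) {p \<in> S. q p \<in> A \<inter> B}"
      by (auto simp: openin_Int)
  next
    fix \<K>
    assume *: "\<forall>A\<in>\<K>. A \<subseteq> q ` S \<and> openin (top_of_set S) {p \<in> S. q p \<in> A}"
    then show "\<Union>\<K> \<subseteq> q ` S"
      by auto
    have "{p \<in> S. q p \<in> \<Union>\<K>} = (\<Union>A\<in>\<K>. {p \<in> S. q p \<in> A})"
      by auto
    with * show "openin (top_of_set S) {p \<in> S. q p \<in> \<Union>\<K>}"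
      by auto
  qed
  then show ?thesis
    by (simp add: quotient_topology_def topology_inverse')
qed

text \<open>
  Boundary points are null vectors with last coordinate 1, and a point \<open>x\<close> of the hyperboloid
  converges to a boundary point in the Klein model \<open>x / x\<^sub>0\<close>.
\<close>

definition klein :: "'n::finite mvec \<Rightarrow> 'n mvec" where
  "klein x = (1 / x $ None) *\<^sub>R x"

definition boundary :: "'n::finite mvec set" where
  "boundary = {\<xi>. minkowski \<xi> \<xi> = 0 \<and> \<xi> $ None = 1}"

definition forward_endpoint :: "'n::finite uvec \<Rightarrow> 'n mvec" where
  "forward_endpoint = (\<lambda>(x, v). klein (x + v))"

definition backward_endpoint :: "'n::finite uvec \<Rightarrow> 'n mvec" where
  "backward_endpoint = (\<lambda>(x, v). klein (x - v))"

definition limit_set :: "'n::finite lorentz set \<Rightarrow> 'n mvec set" where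
  "limit_set \<Delta> = {\<xi> \<in> boundary. \<exists>g :: nat \<Rightarrow> 'n lorentz. range g \<subseteq> \<Delta> \<and>
     (\<lambda>k. klein (g k *v axis None 1)) \<longlonglongrightarrow> \<xi>}"

text \<open>
  Geodesics are straight chords in the Klein model, so hyperbolic convex hulls are Euclidean
  convex hulls there.
\<close>

definition hyp_hull :: "'n::finite lorentz set \<Rightarrow> 'n mvec set" where
  "hyp_hull \<Delta> = {x \<in> hyp_space. klein x \<in> convex hull (limit_set \<Delta>)}"

definition X_orbit :: "'n::finite lorentz set \<Rightarrow> 'n mvec \<Rightarrow> 'n mvec set" where
  "X_orbit \<Delta> x = (\<lambda>g. g *v x) ` \<Delta>"

text \<open>Discrete with compact convex core.\<close>

definition convex_cocompact :: "'n::finite lorentz set \<Rightarrow> bool" where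
  "convex_cocompact \<Delta> \<longleftrightarrow> discrete \<Delta> \<and>
     compactin (quotient_topology hyp_space (X_orbit \<Delta>)) (X_orbit \<Delta> ` hyp_hull \<Delta>)"

section \<open>The unit tangent bundle of the quotient\<close>

text \<open>The flow acts on \<open>T1X\<close> by taking images of orbits: \<open>flow t ` u\<close>.\<close>

definition orbit :: "'n::finite lorentz set \<Rightarrow> 'n uvec \<Rightarrow> 'n uvec set" where
  "orbit \<Delta> p = (\<lambda>g. lact g p) ` \<Delta>"

definition T1X :: "'n::finite lorentz set \<Rightarrow> 'n uvec set set" where
  "T1X \<Delta> = orbit \<Delta> ` T1H"

definition T1X_topology :: "'n::finite lorentz set \<Rightarrow> 'n uvec set topology" where
  "T1X_topology \<Delta> = quotient_topology T1H (orbit \<Delta>)"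

definition \<Omega> :: "'n::finite lorentz set \<Rightarrow> 'n uvec set set" where
  "\<Omega> \<Delta> = {u \<in> T1X \<Delta>. \<forall>p\<in>u. forward_endpoint p \<in> limit_set \<Delta> \<and> backward_endpoint p \<in> limit_set \<Delta>}"

text \<open>
  Injectivity radius as a Riemannian manifold: \<open>r\<close> is admitted at the image of \<open>p\<close> if the
  exponential map there, in polar coordinates, is injective on the open \<open>r\<close>-ball. Geodesics of
  \<open>T1X\<close> are images of those of \<open>T1H\<close>, which are the locally length minimizing curves.
\<close>

definition unit_speed_geodesic :: "(real \<Rightarrow> 'n::finite uvec) \<Rightarrow> bool" where
  "unit_speed_geodesic c \<longleftrightarrow> (\<forall>t. c t \<in> T1H) \<and>
     (\<forall>t. \<exists>r>0. \<forall>s\<in>ball t r. \<forall>s'\<in>ball t r. path_dist T1H (c s) (c s') = \<bar>s - s'\<bar>)"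

definition injectivity_radius_at :: "'n::finite lorentz set \<Rightarrow> 'n uvec \<Rightarrow> ereal" where
  "injectivity_radius_at \<Delta> p = Sup {ereal r | r. 0 \<le> r \<and>
     (\<forall>c c' t t'. unit_speed_geodesic c \<and> unit_speed_geodesic c' \<and> c 0 = p \<and> c' 0 = p \<and>
        t \<in> {0..<r} \<and> t' \<in> {0..<r} \<and> orbit \<Delta> (c t) = orbit \<Delta> (c' t')
        \<longrightarrow> t = t' \<and> (t = 0 \<or> c = c'))}"

definition injectivity_radius :: "'n::finite lorentz set \<Rightarrow> ereal" where
  "injectivity_radius \<Delta> = (INF p\<in>T1H. injectivity_radius_at \<Delta> p)"

text \<open>
  Leaves of \<open>T1X\<close> are the images of the leaves \<open>L\<close> of \<open>T1H\<close>; they carry the quotient of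
  the induced distance (not the subspace topology, in which a leaf is only immersed).
\<close>

definition leaf :: "('n::finite uvec \<Rightarrow> 'n uvec set) \<Rightarrow> 'n lorentz set \<Rightarrow> 'n uvec set \<Rightarrow> 'n uvec set set" where
  "leaf L \<Delta> u = {orbit \<Delta> q | p q. p \<in> u \<and> q \<in> L p}"

definition leaf_dist ::
    "('n::finite uvec \<Rightarrow> 'n uvec set) \<Rightarrow> 'n uvec set \<Rightarrow> 'n uvec set \<Rightarrow> real" where
  "leaf_dist L u u' =
     (if \<exists>p\<in>u. \<exists>q\<in>u'. q \<in> L p
      then Inf {path_dist (L p) p q | p q. p \<in> u \<and> q \<in> u' \<and> q \<in> L p} else 0)"

definition leaf_ball ::
    "('n::finite uvec \<Rightarrow> 'n uvec set) \<Rightarrow> 'n lorentz set \<Rightarrow> real \<Rightarrow> 'n uvec set \<Rightarrow> 'n uvec set set" where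
  "leaf_ball L \<Delta> e u = {u' \<in> leaf L \<Delta> u. leaf_dist L u u' < e}"

definition leaf_topology ::
    "('n::finite uvec \<Rightarrow> 'n uvec set) \<Rightarrow> 'n lorentz set \<Rightarrow> 'n uvec set \<Rightarrow> 'n uvec set topology" where
  "leaf_topology L \<Delta> u = Metric_space.mtopology (leaf L \<Delta> u) (leaf_dist L)"

section \<open>Rectangles and Markov sections\<close>

text \<open>In this section \<open>e\<close> stands for the constant \<open>\<epsilon>\<^sub>0'\<close> entering the bracket.\<close>

definition bracket :: "'n::finite lorentz set \<Rightarrow> real \<Rightarrow> 'n uvec set \<Rightarrow> 'n uvec set \<Rightarrow> 'n uvec set" where
  "bracket \<Delta> e u s = the_elem (leaf_ball strong_stable \<Delta> e u \<inter> leaf_ball weak_unstable \<Delta> e s)"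

definition local_product_structure :: "'n::finite lorentz set \<Rightarrow> real \<Rightarrow> real \<Rightarrow> bool" where
  "local_product_structure \<Delta> \<epsilon>\<^sub>0 e \<longleftrightarrow> \<epsilon>\<^sub>0 > 0 \<and> e > 0 \<and>
     (\<forall>w \<in> T1X \<Delta>.
        let B = leaf_ball weak_unstable \<Delta> \<epsilon>\<^sub>0 w; C = leaf_ball strong_stable \<Delta> \<epsilon>\<^sub>0 w;
            f = (\<lambda>(u, s). bracket \<Delta> e u s)
        in (\<forall>u\<in>B. \<forall>s\<in>C. is_singleton (leaf_ball strong_stable \<Delta> e u \<inter> leaf_ball weak_unstable \<Delta> e s)) \<and>
           homeomorphic_map
             (prod_topology (subtopology (leaf_topology weak_unstable \<Delta> w) B)
                            (subtopology (leaf_topology strong_stable \<Delta> w) C))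
             (subtopology (T1X_topology \<Delta>) (f ` (B \<times> C))) f)"

definition rect :: "'n::finite lorentz set \<Rightarrow> real \<Rightarrow> 'n uvec set set \<Rightarrow> 'n uvec set set \<Rightarrow> 'n uvec set set" where
  "rect \<Delta> e U S = {bracket \<Delta> e u s | u s. u \<in> U \<and> s \<in> S}"

definition U_topology :: "'n::finite lorentz set \<Rightarrow> 'n uvec set \<Rightarrow> 'n uvec set topology" where
  "U_topology \<Delta> w = subtopology (leaf_topology strong_unstable \<Delta> w) (\<Omega> \<Delta>)"

definition S_topology :: "'n::finite lorentz set \<Rightarrow> 'n uvec set \<Rightarrow> 'n uvec set topology" where
  "S_topology \<Delta> w = subtopology (leaf_topology strong_stable \<Delta> w) (\<Omega> \<Delta>)"

definition is_rectangle :: "'n::finite lorentz set \<Rightarrow> real \<Rightarrow> real \<Rightarrow>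
    'n uvec set \<Rightarrow> 'n uvec set set \<Rightarrow> 'n uvec set set \<Rightarrow> bool" where
  "is_rectangle \<Delta> \<epsilon>\<^sub>0 e w U S \<longleftrightarrow> w \<in> \<Omega> \<Delta> \<and>
     w \<in> U \<and> U \<subseteq> leaf_ball strong_unstable \<Delta> \<epsilon>\<^sub>0 w \<inter> \<Omega> \<Delta> \<and>
     w \<in> S \<and> S \<subseteq> leaf_ball strong_stable \<Delta> \<epsilon>\<^sub>0 w \<inter> \<Omega> \<Delta> \<and>
     U = U_topology \<Delta> w closure_of (U_topology \<Delta> w interior_of U) \<and>
     S = S_topology \<Delta> w closure_of (S_topology \<Delta> w interior_of S) \<and>
     rect \<Delta> e U S \<subseteq> \<Omega> \<Delta>"

text \<open>The product on the rectangle \<open>[U, S]\<close>: the bracket of \<open>[u\<^sub>1, s\<^sub>1]\<close> and \<open>[u\<^sub>2, s\<^sub>2]\<close> is \<open>[u\<^sub>1, s\<^sub>2]\<close>.\<close>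

definition rect_bracket :: "'n::finite lorentz set \<Rightarrow> real \<Rightarrow> 'n uvec set set \<Rightarrow> 'n uvec set set \<Rightarrow>
    'n uvec set \<Rightarrow> 'n uvec set \<Rightarrow> 'n uvec set" where
  "rect_bracket \<Delta> e U S v v' = (THE x. \<exists>u\<^sub>1\<in>U. \<exists>s\<^sub>1\<in>S. \<exists>u\<^sub>2\<in>U. \<exists>s\<^sub>2\<in>S.
      v = bracket \<Delta> e u\<^sub>1 s\<^sub>1 \<and> v' = bracket \<Delta> e u\<^sub>2 s\<^sub>2 \<and> x = bracket \<Delta> e u\<^sub>1 s\<^sub>2)"

text \<open>A finite family of rectangles \<open>[sbU j, sbS j]\<close> with centers \<open>sbw j\<close>, indexed by \<open>{1..sbN}\<close>.\<close>

record ('n::finite) rect_family =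
  sbN :: nat
  sbw :: "nat \<Rightarrow> 'n uvec set"
  sbU :: "nat \<Rightarrow> 'n uvec set set"
  sbS :: "nat \<Rightarrow> 'n uvec set set"

definition alphabet :: "('n::finite) rect_family \<Rightarrow> nat set" where
  "alphabet F = {1..sbN F}"

definition Rj :: "'n::finite lorentz set \<Rightarrow> real \<Rightarrow> 'n rect_family \<Rightarrow> nat \<Rightarrow> 'n uvec set set" where
  "Rj \<Delta> e F j = rect \<Delta> e (sbU F j) (sbS F j)"

definition int_U :: "'n::finite lorentz set \<Rightarrow> 'n rect_family \<Rightarrow> nat \<Rightarrow> 'n uvec set set" where
  "int_U \<Delta> F j = U_topology \<Delta> (sbw F j) interior_of (sbU F j)"

definition int_S :: "'n::finite lorentz set \<Rightarrow> 'n rect_family \<Rightarrow> nat \<Rightarrow> 'n uvec set set" where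
  "int_S \<Delta> F j = S_topology \<Delta> (sbw F j) interior_of (sbS F j)"

text \<open>The interior of a rectangle is its interior in the section, which is a transversal to the flow.\<close>

definition int_R :: "'n::finite lorentz set \<Rightarrow> real \<Rightarrow> 'n rect_family \<Rightarrow> nat \<Rightarrow> 'n uvec set set" where
  "int_R \<Delta> e F j = rect \<Delta> e (int_U \<Delta> F j) (int_S \<Delta> F j)"

definition section_set :: "'n::finite lorentz set \<Rightarrow> real \<Rightarrow> 'n rect_family \<Rightarrow> 'n uvec set set" where
  "section_set \<Delta> e F = (\<Union>j\<in>alphabet F. Rj \<Delta> e F j)"

definition return_time :: "'n::finite lorentz set \<Rightarrow> real \<Rightarrow> 'n rect_family \<Rightarrow> 'n uvec set \<Rightarrow> real" where
  "return_time \<Delta> e F u = Inf {t. t > 0 \<and> flow t ` u \<in> section_set \<Delta> e F}"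

definition poincare_map :: "'n::finite lorentz set \<Rightarrow> real \<Rightarrow> 'n rect_family \<Rightarrow> 'n uvec set \<Rightarrow> 'n uvec set" where
  "poincare_map \<Delta> e F u = flow (return_time \<Delta> e F u) ` u"

definition markov_section ::
    "'n::finite lorentz set \<Rightarrow> real \<Rightarrow> real \<Rightarrow> real \<Rightarrow> 'n rect_family \<Rightarrow> bool" where
  "markov_section \<Delta> \<epsilon>\<^sub>0 e \<delta> F \<longleftrightarrow>
     (\<forall>j\<in>alphabet F. is_rectangle \<Delta> \<epsilon>\<^sub>0 e (sbw F j) (sbU F j) (sbS F j)) \<and>
     disjoint_family_on (Rj \<Delta> e F) (alphabet F) \<and>
     (\<forall>j\<in>alphabet F.
        (\<forall>u\<in>sbU F j. \<forall>u'\<in>sbU F j. leaf_dist strong_unstable u u' \<le> \<delta>) \<and>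
        (\<forall>s\<in>sbS F j. \<forall>s'\<in>sbS F j. leaf_dist strong_stable s s' \<le> \<delta>)) \<and>
     \<Omega> \<Delta> = (\<Union>j\<in>alphabet F. \<Union>t\<in>{0..\<delta>}. (\<lambda>u. flow t ` u) ` Rj \<Delta> e F j) \<and>
     (\<forall>j\<in>alphabet F. \<forall>k\<in>alphabet F.
        \<forall>u \<in> int_R \<Delta> e F j. poincare_map \<Delta> e F u \<in> int_R \<Delta> e F k \<longrightarrow>
          (\<lambda>u'. rect_bracket \<Delta> e (sbU F k) (sbS F k) u' (poincare_map \<Delta> e F u)) ` int_U \<Delta> F k
            \<subseteq> poincare_map \<Delta> e F `
                (\<lambda>u'. rect_bracket \<Delta> e (sbU F j) (sbS F j) u' u) ` int_U \<Delta> F j \<and>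
          poincare_map \<Delta> e F ` (\<lambda>s'. rect_bracket \<Delta> e (sbU F j) (sbS F j) u s') ` int_S \<Delta> F j
            \<subseteq> (\<lambda>s'. rect_bracket \<Delta> e (sbU F k) (sbS F k) (poincare_map \<Delta> e F u) s') ` int_S \<Delta> F k)"

definition admissible :: "'n::finite lorentz set \<Rightarrow> real \<Rightarrow> 'n rect_family \<Rightarrow> nat \<Rightarrow> nat \<Rightarrow> bool" where
  "admissible \<Delta> e F j k \<longleftrightarrow> j \<in> alphabet F \<and> k \<in> alphabet F \<and>
     (\<exists>u \<in> int_R \<Delta> e F j. poincare_map \<Delta> e F u \<in> int_R \<Delta> e F k)"

definition transition_matrix :: "'n::finite lorentz set \<Rightarrow> real \<Rightarrow> 'n rect_family \<Rightarrow> nat \<Rightarrow> nat \<Rightarrow> nat" where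
  "transition_matrix \<Delta> e F j k = (if admissible \<Delta> e F j k then 1 else 0)"

fun matrix_power :: "nat set \<Rightarrow> (nat \<Rightarrow> nat \<Rightarrow> nat) \<Rightarrow> nat \<Rightarrow> nat \<Rightarrow> nat \<Rightarrow> nat" where
  "matrix_power A T 0 j k = (if j = k then 1 else 0)"
| "matrix_power A T (Suc q) j k = (\<Sum>l\<in>A. matrix_power A T q j l * T l k)"

definition topologically_mixing :: "'n::finite lorentz set \<Rightarrow> real \<Rightarrow> 'n rect_family \<Rightarrow> bool" where
  "topologically_mixing \<Delta> e F \<longleftrightarrow>
     (\<exists>q>0. \<forall>j\<in>alphabet F. \<forall>k\<in>alphabet F. matrix_power (alphabet F) (transition_matrix \<Delta> e F) q j k > 0)"

section \<open>The cocycle and return trajectory subgroups\<close>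

text \<open>
  From here on \<open>\<Gamma>\<close> is a group of matrices acting through an identification \<open>\<phi>\<close> with a group of
  isometries, and \<open>Lf j\<close> is the chosen lift of the \<open>j\<close>-th rectangle.
\<close>

definition homeomorphic_lifts ::
    "'n::finite lorentz set \<Rightarrow> real \<Rightarrow> 'n rect_family \<Rightarrow> (nat \<Rightarrow> 'n uvec set) \<Rightarrow> bool" where
  "homeomorphic_lifts \<Delta> e F Lf \<longleftrightarrow> (\<forall>j\<in>alphabet F. Lf j \<subseteq> T1H \<and>
     homeomorphic_map (top_of_set (Lf j)) (subtopology (T1X_topology \<Delta>) (Rj \<Delta> e F j)) (orbit \<Delta>))"

definition lifted_section :: "'n::finite rect_family \<Rightarrow> (nat \<Rightarrow> 'n uvec set) \<Rightarrow> 'n uvec set" where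
  "lifted_section F Lf = (\<Union>j\<in>alphabet F. Lf j)"

definition lift :: "'n::finite rect_family \<Rightarrow> (nat \<Rightarrow> 'n uvec set) \<Rightarrow> 'n uvec set \<Rightarrow> 'n uvec" where
  "lift F Lf u = (THE p. p \<in> lifted_section F Lf \<and> p \<in> u)"

definition cocycle :: "('g \<Rightarrow> 'n::finite lorentz) \<Rightarrow> 'g set \<Rightarrow> real \<Rightarrow> 'n rect_family \<Rightarrow>
    (nat \<Rightarrow> 'n uvec set) \<Rightarrow> 'n uvec set \<Rightarrow> 'g" where
  "cocycle \<phi> \<Gamma> e F Lf u = (THE g. g \<in> \<Gamma> \<and>
     flow (return_time (\<phi> ` \<Gamma>) e F u) (lift F Lf u) \<in> lact (\<phi> g) ` lifted_section F Lf)"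

definition transition_set :: "'n::finite lorentz set \<Rightarrow> real \<Rightarrow> 'n rect_family \<Rightarrow> nat \<Rightarrow> nat \<Rightarrow> 'n uvec set set" where
  "transition_set \<Delta> e F j k = {u \<in> Rj \<Delta> e F j. poincare_map \<Delta> e F u \<in> Rj \<Delta> e F k}"

text \<open>The value of the cocycle on the set \<open>transition_set (\<phi> ` \<Gamma>) e F j k\<close>, on which it is constant.\<close>

definition cocycle_value :: "('g \<Rightarrow> 'n::finite lorentz) \<Rightarrow> 'g set \<Rightarrow> real \<Rightarrow> 'n rect_family \<Rightarrow>
    (nat \<Rightarrow> 'n uvec set) \<Rightarrow> nat \<Rightarrow> nat \<Rightarrow> 'g" where
  "cocycle_value \<phi> \<Gamma> e F Lf j k =
     (THE g. \<forall>u \<in> transition_set (\<phi> ` \<Gamma>) e F j k. cocycle \<phi> \<Gamma> e F Lf u = g)"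

text \<open>The ordered product of \<open>c (\<alpha> i) (\<alpha> (i + 1))\<close> over \<open>i < q\<close>.\<close>

fun path_product :: "(nat \<Rightarrow> nat \<Rightarrow> real ^ 'm ^ 'm) \<Rightarrow> nat \<Rightarrow> (nat \<Rightarrow> nat) \<Rightarrow> real ^ 'm::finite ^ 'm" where
  "path_product c 0 \<alpha> = mat 1"
| "path_product c (Suc q) \<alpha> = path_product c q \<alpha> ** c (\<alpha> q) (\<alpha> (Suc q))"

text \<open>Admissible sequences from \<open>y\<close> to \<open>z\<close> with entries \<open>\<alpha> 0, \<dots>, \<alpha> q\<close>; later values of \<open>\<alpha>\<close> are irrelevant.\<close>

definition admissible_seqs ::
    "'n::finite lorentz set \<Rightarrow> real \<Rightarrow> 'n rect_family \<Rightarrow> nat \<Rightarrow> nat \<Rightarrow> nat \<Rightarrow> (nat \<Rightarrow> nat) set" where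
  "admissible_seqs \<Delta> e F q y z =
     {\<alpha>. \<alpha> 0 = y \<and> \<alpha> q = z \<and> (\<forall>i<q. admissible \<Delta> e F (\<alpha> i) (\<alpha> (Suc i)))}"

definition return_products ::
    "(real ^ 'm ^ 'm \<Rightarrow> 'n::finite lorentz) \<Rightarrow> (real ^ 'm::finite ^ 'm) set \<Rightarrow> real \<Rightarrow> 'n rect_family \<Rightarrow>
     (nat \<Rightarrow> 'n uvec set) \<Rightarrow> nat \<Rightarrow> nat \<Rightarrow> nat \<Rightarrow> (real ^ 'm ^ 'm) set" where
  "return_products \<phi> \<Gamma> e F Lf p y z =
     {path_product (cocycle_value \<phi> \<Gamma> e F Lf) (p + 1) \<alpha>
        ** matrix_inv (path_product (cocycle_value \<phi> \<Gamma> e F Lf) (p + 1) \<alpha>') | \<alpha> \<alpha>'.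
        \<alpha> \<in> admissible_seqs (\<phi> ` \<Gamma>) e F (p + 1) y z \<and> \<alpha>' \<in> admissible_seqs (\<phi> ` \<Gamma>) e F (p + 1) y z}"

definition return_subgroup ::
    "(real ^ 'm ^ 'm \<Rightarrow> 'n::finite lorentz) \<Rightarrow> (real ^ 'm::finite ^ 'm) set \<Rightarrow> real \<Rightarrow> 'n rect_family \<Rightarrow>
     (nat \<Rightarrow> 'n uvec set) \<Rightarrow> nat \<Rightarrow> nat \<Rightarrow> (real ^ 'm ^ 'm) set" where
  "return_subgroup \<phi> \<Gamma> e F Lf y z = generate GL (\<Union>p\<in>{1..}. return_products \<phi> \<Gamma> e F Lf p y z)"

end

(*
  Geodesics are coded by admissible sequences: if two points of the lifted section lie on one geodesic
  with endpoints in the limit set, at the translates by g and h of the lifts of R_j and R_k, and the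
  geodesic meets the section only in interiors of rectangles in between, then g^-1 h is a cocycle
  product along an admissible sequence from j to k. A geodesic can always be perturbed to satisfy the
  last condition. Let X be a hyperbolic element whose axis starts near a lift of R_z. Following a
  geodesic asymptotic to the axis, pigeonhole gives X^N g = g h with g a product from z to w and h a
  product from w to w. With mixing, a power of X therefore maps the right coset of H(y, z) that contains
  the products from y to z of length n to the one for length n + r. The same holds for X^-1, so these
  cosets depend on n only up to a period, and a power Y of X fixes them. Finally, for every element g of
  the group, Y^k g f is itself a product starting at z for large k and some f in a fixed finite set,
  because Y^k contracts towards the attracting point of X. So every element lies in one of finitely
  many cosets.
*)
theory Submission imports Defs "HOL-Real_Asymp.Real_Asymp" begin

section \<open>Minkowski space\<close>

text \<open>A unit tangent vector \<open>(x, v)\<close> is encoded by the null vectors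
  \<open>x + v\<close> and \<open>x - v\<close>, which represent its two endpoints. The flow scales
  them by \<open>exp t\<close> and \<open>exp (- t)\<close>, isometries act on them linearly, and
  leaves fix one of them or its ray, so brackets, limits of geodesics and axes become linear algebra
  with one quadratic form. The obstacle is that the values \<open>c j k\<close> are prescribed by
  transitions between interiors, and a given geodesic may well run through boundaries of rectangles.
  Hence the long preparation on leaf metrics, which serves two facts: interiors are open
  transversally to the flow, and the times between section hits are bounded below. The generators of
  \<open>H(y, z)\<close> compare products of equal length, so length is the quantity to control. A
  power of \<open>X\<close> and a power of its inverse both lengthen words; composing them to the
  identity therefore gives a positive shift of length, and this is the origin of the period.
  Noncommutativity, a consequence of Zariski density, provides an axis with both ends away from a
  prescribed boundary point, which lets both directions of \<open>X\<close> start near the same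
  lift.\<close>

notation minkowski (infixl "\<star>" 70)

lemma inner_eq_minkowski: "x \<bullet> y = x \<star> y + 2 * (x $ None * y $ None)" for x y :: "'n::finite mvec"
proof -
  have "x \<bullet> y = (\<Sum>i\<in>insert None (range Some). x $ i * y $ i)"
    by (simp add: inner_vec_def UNIV_option_conv)
  also have "\<dots> = x $ None * y $ None + (\<Sum>i\<in>range Some. x $ i * y $ i)"
    by (subst sum.insert) auto
  also have "(\<Sum>i\<in>range Some. x $ i * y $ i) = (\<Sum>i\<in>UNIV. x $ Some i * y $ Some i)"
    by (subst sum.reindex) auto
  finally show ?thesis by (simp add: minkowski_def)
qed

lemma minkowski_eq_inner: "x \<star> y = x \<bullet> y - 2 * (x $ None * y $ None)" for x y :: "'n::finite mvec"
  by (simp add: inner_eq_minkowski)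

lemma bounded_bilinear_minkowski: "bounded_bilinear (minkowski :: 'n::finite mvec \<Rightarrow> _)"
proof -
  have 1: "bounded_bilinear (\<lambda>x y :: 'n mvec. x $ None * y $ None)"
    using bounded_bilinear.comp[OF bounded_bilinear_mult bounded_linear_vec_nth bounded_linear_vec_nth] .
  have "bounded_bilinear (\<lambda>x y :: 'n mvec. x \<bullet> y - 2 * (x $ None * y $ None))"
  proof
    fix a a' b b' :: "'n mvec" and r :: real
    show "(a + a') \<bullet> b - 2 * ((a + a') $ None * b $ None) =
       a \<bullet> b - 2 * (a $ None * b $ None) + (a' \<bullet> b - 2 * (a' $ None * b $ None))"
      by (simp add: algebra_simps)
    show "a \<bullet> (b + b') - 2 * (a $ None * (b + b') $ None) =
       a \<bullet> b - 2 * (a $ None * b $ None) + (a \<bullet> b' - 2 * (a $ None * b' $ None))"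
      by (simp add: algebra_simps)
    show "r *\<^sub>R a \<bullet> b - 2 * ((r *\<^sub>R a) $ None * b $ None) = r *\<^sub>R (a \<bullet> b - 2 * (a $ None * b $ None))"
      by (simp add: algebra_simps)
    show "a \<bullet> r *\<^sub>R b - 2 * (a $ None * (r *\<^sub>R b) $ None) = r *\<^sub>R (a \<bullet> b - 2 * (a $ None * b $ None))"
      by (simp add: algebra_simps)
  next
    show "\<exists>K. \<forall>a b :: 'n mvec. norm (a \<bullet> b - 2 * (a $ None * b $ None)) \<le> norm a * norm b * K"
    proof (intro exI allI)
      fix a b :: "'n mvec"
      have "\<bar>a \<bullet> b\<bar> \<le> norm a * norm b" by (rule Cauchy_Schwarz_ineq2)
      moreover have "\<bar>a $ None * b $ None\<bar> \<le> norm a * norm b"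
        unfolding abs_mult by (intro mult_mono component_le_norm_cart) auto
      ultimately show "norm (a \<bullet> b - 2 * (a $ None * b $ None)) \<le> norm a * norm b * 3"
        by simp
    qed
  qed
  then show ?thesis
    by (simp add: minkowski_eq_inner[abs_def])
qed

interpretation mink: bounded_bilinear "minkowski :: 'n::finite mvec \<Rightarrow> _"
  by (rule bounded_bilinear_minkowski)

lemmas mink_simps = mink.add_left mink.add_right mink.diff_left mink.diff_right mink.scaleR_left
  mink.scaleR_right mink.minus_left mink.minus_right

lemma minkowski_commute: "x \<star> y = y \<star> x"
  by (simp add: minkowski_def mult.commute)

declare mink.tendsto [tendsto_intros]

lemma continuous_on_minkowski [continuous_intros]:
  "continuous_on S f \<Longrightarrow> continuous_on S g \<Longrightarrow> continuous_on S (\<lambda>x. f x \<star> g x)"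
  by (rule mink.continuous_on)

lemma norm_sq_minkowski: "(norm x)\<^sup>2 = x \<star> x + 2 * (x $ None)\<^sup>2" for x :: "'n::finite mvec"
  unfolding power2_norm_eq_inner inner_eq_minkowski by (simp add: power2_eq_square)

text \<open>The combination \<open>y0 x - x0 y\<close> has time coordinate zero, so its Euclidean
  norm is its Minkowski norm. Nonnegativity of the left side is the source of the reversed
  Cauchy-Schwarz inequalities below.\<close>

lemma minkowski_gram:
  fixes x y :: "'n::finite mvec"
  shows "(norm ((y $ None) *\<^sub>R x - (x $ None) *\<^sub>R y))\<^sup>2 =
    (y $ None)\<^sup>2 * (x \<star> x) + (x $ None)\<^sup>2 * (y \<star> y) - 2 * (x $ None) * (y $ None) * (x \<star> y)"
  unfolding norm_sq_minkowski
  by (simp add: mink_simps minkowski_commute[of y x] power2_eq_square algebra_simps)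

section \<open>Future pointing causal vectors\<close>

definition causal :: "'n::finite mvec \<Rightarrow> bool" where
  "causal x \<longleftrightarrow> x \<star> x \<le> 0 \<and> x $ None > 0"

definition null :: "'n::finite mvec \<Rightarrow> bool" where
  "null x \<longleftrightarrow> x \<star> x = 0 \<and> x $ None > 0"

lemma null_causal: "null x \<Longrightarrow> causal x"
  by (simp add: null_def causal_def)

lemma hyp_space_causal: "x \<in> hyp_space \<Longrightarrow> causal x"
  by (simp add: hyp_space_def causal_def)

lemma causal_minkowski_bound:
  fixes x y :: "'n::finite mvec"
  assumes "causal x" "causal y"
  shows "2 * (x $ None) * (y $ None) * (x \<star> y) \<le> - (norm ((y $ None) *\<^sub>R x - (x $ None) *\<^sub>R y))\<^sup>2"
proof -
  have "(y $ None)\<^sup>2 * (x \<star> x) \<le> 0" "(x $ None)\<^sup>2 * (y \<star> y) \<le> 0"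
    using assms by (auto simp: causal_def mult_nonneg_nonpos)
  then show ?thesis
    unfolding minkowski_gram by linarith
qed

lemma causal_minkowski_nonpos:
  assumes "causal x" "causal y"
  shows "x \<star> y \<le> 0"
proof (rule ccontr)
  assume "\<not> x \<star> y \<le> 0"
  then have "2 * (x $ None) * (y $ None) * (x \<star> y) > 0"
    using assms by (simp add: causal_def)
  then show False
    using causal_minkowski_bound[OF assms] by (smt (verit) zero_le_power2)
qed

text \<open>Equality in the Gram bound forces \<open>y0 x - x0 y\<close> to vanish. For null vectors
  this makes orthogonality the test for having the same boundary point.\<close>

lemma causal_orthogonal_parallel:
  assumes "causal x" "causal y" "x \<star> y = 0"
  shows "y = (y $ None / x $ None) *\<^sub>R x"
proof -
  have "(norm ((y $ None) *\<^sub>R x - (x $ None) *\<^sub>R y))\<^sup>2 \<le> 0"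
    using causal_minkowski_bound[OF assms(1,2)] assms(3) by simp
  then have "(y $ None) *\<^sub>R x = (x $ None) *\<^sub>R y" by simp
  then have "(1 / x $ None) *\<^sub>R ((y $ None) *\<^sub>R x) = (1 / x $ None) *\<^sub>R ((x $ None) *\<^sub>R y)"
    by simp
  then show ?thesis
    using assms(1) by (simp add: causal_def)
qed

lemma timelike_causal_neg:
  assumes "causal x" "causal y" "x \<star> x < 0"
  shows "x \<star> y < 0"
proof -
  have "x \<star> y \<noteq> 0"
  proof
    assume "x \<star> y = 0"
    from causal_orthogonal_parallel[OF assms(1,2) this] have "x \<star> y = (y $ None / x $ None) * (x \<star> x)"
      by (metis mink.scaleR_right real_scaleR_def)
    with \<open>x \<star> y = 0\<close> assms show False by (simp add: causal_def)
  qed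
  with causal_minkowski_nonpos[OF assms(1,2)] show ?thesis by simp
qed

text \<open>The time coordinate of a causal vector dominates the space coordinates, so boundedness
  can be checked on the time coordinate alone.\<close>

lemma causal_norm_le:
  fixes x :: "'n::finite mvec"
  assumes "causal x"
  shows "norm x \<le> 2 * x $ None"
proof (rule power2_le_imp_le)
  show "(norm x)\<^sup>2 \<le> (2 * x $ None)\<^sup>2"
    using norm_sq_minkowski[of x] assms
    by (auto simp: causal_def power_mult_distrib) (smt (verit) zero_le_power2)
qed (use assms in \<open>simp add: causal_def\<close>)

lemma timelike_nonzero_time:
  assumes "x \<star> x \<le> 0" "x \<noteq> 0"
  shows "x $ None \<noteq> 0"
proof
  assume "x $ None = 0"
  with norm_sq_minkowski[of x] assms(1) have "(norm x)\<^sup>2 \<le> 0" by simp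
  with assms(2) show False by simp
qed

lemma null_scale: "null x \<Longrightarrow> r > 0 \<Longrightarrow> null (r *\<^sub>R x)"
  by (simp add: null_def mink_simps)

lemma causal_scale: "causal x \<Longrightarrow> r > 0 \<Longrightarrow> causal (r *\<^sub>R x)"
  by (simp add: causal_def mink_simps mult_nonneg_nonpos)

lemma null_nonzero: "null x \<Longrightarrow> x \<noteq> 0"
  by (auto simp: null_def)

text \<open>A past pointing null vector would have nonnegative product with \<open>b\<close>. This
  recognizes the future cone from a product, for curves whose time coordinate is not
  computed.\<close>

lemma null_neg_future:
  assumes "x \<star> x = 0" "x \<star> b < 0" "null b"
  shows "null x"
proof -
  have "x $ None > 0"
  proof (rule ccontr)
    assume *: "\<not> x $ None > 0"
    have "x \<noteq> 0" using assms(2) mink.zero_left[of b] by auto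
    then have "x $ None \<noteq> 0" using timelike_nonzero_time[of x] assms by auto
    with * have "causal (- x)" using assms by (simp add: causal_def mink_simps)
    from causal_minkowski_nonpos[OF this null_causal[OF assms(3)]] assms(2) show False
      by (simp add: mink_simps)
  qed
  with assms show ?thesis by (simp add: null_def)
qed

text \<open>A timelike vector is future pointing up to sign, and then
  \<open>timelike_causal_neg\<close> excludes orthogonality to a causal vector.\<close>

lemma null_perp_nonneg:
  assumes "null a" "x \<star> a = 0"
  shows "x \<star> x \<ge> 0"
proof (rule ccontr)
  assume *: "\<not> x \<star> x \<ge> 0"
  then have "x \<noteq> 0" using mink.zero_left[of x] by auto
  then have "x $ None \<noteq> 0" using * timelike_nonzero_time[of x] by simp
  define s where "s = sgn (x $ None)"
  have s: "s = 1 \<or> s = -1" using \<open>x $ None \<noteq> 0\<close> by (auto simp: s_def sgn_if)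
  have "causal (s *\<^sub>R x)" "(s *\<^sub>R x) \<star> (s *\<^sub>R x) < 0"
    using * s \<open>x $ None \<noteq> 0\<close> by (auto simp: causal_def mink_simps s_def sgn_if)
  from timelike_causal_neg[OF this(1) null_causal[OF assms(1)] this(2)] assms(2) show False
    by (simp add: mink_simps)
qed

lemma hyp_perp_nonneg:
  assumes "x \<in> hyp_space" "y \<star> x = 0"
  shows "y \<star> y \<ge> 0"
proof (rule ccontr)
  assume *: "\<not> y \<star> y \<ge> 0"
  then have "y \<noteq> 0" using mink.zero_left[of y] by auto
  then have "y $ None \<noteq> 0" using * timelike_nonzero_time[of y] by simp
  define s where "s = sgn (y $ None)"
  have s: "s = 1 \<or> s = -1" using \<open>y $ None \<noteq> 0\<close> by (auto simp: s_def sgn_if)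
  have "causal (s *\<^sub>R y)" "(s *\<^sub>R y) \<star> (s *\<^sub>R y) < 0"
    using * s \<open>y $ None \<noteq> 0\<close> by (auto simp: causal_def mink_simps s_def sgn_if)
  from timelike_causal_neg[OF this(1) hyp_space_causal[OF assms(1)] this(2)] assms(2) show False
    by (simp add: mink_simps)
qed

text \<open>Nonnegativity is asked on the plane of \<open>x\<close> and \<open>y\<close>, so that
  the inequality covers both the complement of a point of hyperbolic space, where the form is
  definite, and the complement of a null vector, where it degenerates.\<close>

lemma minkowski_Cauchy_Schwarz:
  assumes nn: "\<And>s t. (s *\<^sub>R x + t *\<^sub>R y) \<star> (s *\<^sub>R x + t *\<^sub>R y) \<ge> 0"
  shows "(x \<star> y)\<^sup>2 \<le> (x \<star> x) * (y \<star> y)"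
proof (cases "y \<star> y = 0")
  case False
  have "y \<star> y \<ge> 0" using nn[of 0 1] by simp
  with False have pos: "y \<star> y > 0" by simp
  have "((y \<star> y) *\<^sub>R x + (- (x \<star> y)) *\<^sub>R y) \<star> ((y \<star> y) *\<^sub>R x + (- (x \<star> y)) *\<^sub>R y)
      = (y \<star> y) * ((x \<star> x) * (y \<star> y) - (x \<star> y)\<^sup>2)"
    by (simp add: mink_simps minkowski_commute[of y x] power2_eq_square algebra_simps)
  with nn[of "y \<star> y" "- (x \<star> y)"] have "0 \<le> (y \<star> y) * ((x \<star> x) * (y \<star> y) - (x \<star> y)\<^sup>2)" by metis
  with pos show ?thesis by (simp add: zero_le_mult_iff)
next
  case True
  have "x \<star> y = 0"
  proof (rule ccontr)
    assume ne: "x \<star> y \<noteq> 0"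
    \<comment> \<open>With \<open>y\<close> isotropic the form is affine in \<open>t\<close>; this
      value makes it -1.\<close>
    define t where "t = - (x \<star> x + 1) / (2 * (x \<star> y))"
    have "(1 *\<^sub>R x + t *\<^sub>R y) \<star> (1 *\<^sub>R x + t *\<^sub>R y) = x \<star> x + 2 * t * (x \<star> y)"
      using True by (simp add: mink_simps minkowski_commute[of y x])
    also have "\<dots> = -1" using ne by (simp add: t_def field_simps)
    finally show False using nn[of 1 t] by simp
  qed
  then show ?thesis using True by simp
qed

section \<open>The unit tangent bundle in terms of null vectors\<close>

text \<open>The direction of \<open>np p\<close> is the forward endpoint and its scale fixes a
  horosphere there; likewise \<open>nm p\<close> for the backward endpoint. \<open>mk\<close>
  inverts the change of coordinates.\<close>

definition np :: "'n::finite uvec \<Rightarrow> 'n mvec" where "np p = fst p + snd p"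
definition nm :: "'n::finite uvec \<Rightarrow> 'n mvec" where "nm p = fst p - snd p"
definition mk :: "'n::finite mvec \<Rightarrow> 'n mvec \<Rightarrow> 'n uvec" where
  "mk a b = ((1/2) *\<^sub>R (a + b), (1/2) *\<^sub>R (a - b))"

lemma np_mk [simp]: "np (mk a b) = a" and nm_mk [simp]: "nm (mk a b) = b"
  by (simp_all add: np_def nm_def mk_def scaleR_add_right scaleR_diff_right flip: scaleR_left_distrib)

lemma mk_np_nm [simp]: "mk (np p) (nm p) = p"
  by (simp add: np_def nm_def mk_def prod_eq_iff scaleR_add_right[symmetric] flip: scaleR_2)

lemma uvec_eqI: "np p = np q \<Longrightarrow> nm p = nm q \<Longrightarrow> p = q"
  by (metis mk_np_nm)

lemma tendsto_mk [tendsto_intros]: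
  "(f \<longlongrightarrow> a) F \<Longrightarrow> (g \<longlongrightarrow> b) F \<Longrightarrow> ((\<lambda>x. mk (f x) (g x)) \<longlongrightarrow> mk a b) F"
  unfolding mk_def by (intro tendsto_intros)

lemma tendsto_np [tendsto_intros]: "(f \<longlongrightarrow> a) F \<Longrightarrow> ((\<lambda>x. np (f x)) \<longlongrightarrow> np a) F"
  unfolding np_def by (intro tendsto_intros)

lemma tendsto_nm [tendsto_intros]: "(f \<longlongrightarrow> a) F \<Longrightarrow> ((\<lambda>x. nm (f x)) \<longlongrightarrow> nm a) F"
  unfolding nm_def by (intro tendsto_intros)

text \<open>Expanding the products of \<open>x + v\<close> and \<open>x - v\<close> gives the scalar
  equations. The work is in the signs: both null vectors are nonzero, and the Gram identity bounds
  the time coordinate of \<open>v\<close> by that of \<open>x\<close>, so both point to the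
  future.\<close>

lemma T1H_iff: "p \<in> T1H \<longleftrightarrow> null (np p) \<and> null (nm p) \<and> np p \<star> nm p = -2"
proof -
  obtain x v where p: "p = (x, v)" by fastforce
  have e: "(x + v) \<star> (x + v) = x \<star> x + 2 * (x \<star> v) + v \<star> v"
    "(x - v) \<star> (x - v) = x \<star> x - 2 * (x \<star> v) + v \<star> v"
    "(x + v) \<star> (x - v) = x \<star> x - v \<star> v"
    by (simp_all add: mink_simps minkowski_commute[of v x])
  show ?thesis
  proof
    assume "p \<in> T1H"
    then have h: "x \<star> x = -1" "x $ None > 0" "x \<star> v = 0" "v \<star> v = 1"
      by (auto simp: p T1H_def hyp_space_def)
    have "0 \<le> - (v $ None)\<^sup>2 + (x $ None)\<^sup>2"
    proof -
      have "(norm ((x $ None) *\<^sub>R v - (v $ None) *\<^sub>R x))\<^sup>2 = - (v $ None)\<^sup>2 + (x $ None)\<^sup>2"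
        using minkowski_gram[of x v] h minkowski_commute[of v x] by simp
      then show ?thesis by (metis zero_le_power2)
    qed
    then have le: "\<bar>v $ None\<bar> \<le> x $ None"
      using h abs_le_square_iff[of "v $ None" "x $ None"] by simp
    have n: "(x + v) \<star> (x + v) = 0" "(x - v) \<star> (x - v) = 0" using e h by auto
    have "x + v \<noteq> 0"
    proof
      assume "x + v = 0"
      then have "v = - x" by (simp add: add_eq_0_iff)
      with h show False by (simp add: mink_simps)
    qed
    moreover have "x - v \<noteq> 0" using h by auto
    ultimately have "(x + v) $ None \<noteq> 0" "(x - v) $ None \<noteq> 0"
      using timelike_nonzero_time n by (metis order_refl)+
    with le n show "null (np p) \<and> null (nm p) \<and> np p \<star> nm p = -2"
      using e h by (auto simp: null_def np_def nm_def p)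
  next
    assume *: "null (np p) \<and> null (nm p) \<and> np p \<star> nm p = -2"
    then have n: "(x + v) \<star> (x + v) = 0" "(x - v) \<star> (x - v) = 0" "(x + v) \<star> (x - v) = -2"
      "x $ None > 0"
      by (auto simp: null_def np_def nm_def p)
    with e have "x \<star> x = -1" "x \<star> v = 0" "v \<star> v = 1" by linarith+
    with n show "p \<in> T1H" by (auto simp: p T1H_def hyp_space_def)
  qed
qed

lemma mk_in_T1H: "null a \<Longrightarrow> null b \<Longrightarrow> a \<star> b = -2 \<Longrightarrow> mk a b \<in> T1H"
  by (simp add: T1H_iff)

lemma T1HD:
  assumes "p \<in> T1H"
  shows "null (np p)" "null (nm p)" "np p \<star> nm p = -2"
  using assms by (auto simp: T1H_iff)

lemma fst_T1H: "p \<in> T1H \<Longrightarrow> fst p \<in> hyp_space"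
  by (auto simp: T1H_def)

lemma flow_np [simp]: "np (flow t p) = exp t *\<^sub>R np p"
proof -
  have "np (flow t p) = (cosh t + sinh t) *\<^sub>R fst p + (cosh t + sinh t) *\<^sub>R snd p"
    by (simp add: np_def flow_def case_prod_beta scaleR_left_distrib)
  then show ?thesis
    by (simp add: np_def sinh_plus_cosh add.commute[of "cosh t"] scaleR_right_distrib)
qed

lemma flow_nm [simp]: "nm (flow t p) = exp (- t) *\<^sub>R nm p"
proof -
  have "nm (flow t p) = (cosh t - sinh t) *\<^sub>R fst p - (cosh t - sinh t) *\<^sub>R snd p"
    by (simp add: nm_def flow_def case_prod_beta scaleR_left_diff_distrib)
  then show ?thesis
    by (simp add: nm_def cosh_minus_sinh scaleR_right_diff_distrib)
qed

lemma lact_np [simp]: "np (lact g p) = g *v np p"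
  by (simp add: np_def lact_def case_prod_beta matrix_vector_right_distrib)

lemma lact_nm [simp]: "nm (lact g p) = g *v nm p"
  by (simp add: nm_def lact_def case_prod_beta matrix_vector_mult_diff_distrib)

lemma flow_add: "flow s (flow t p) = flow (s + t) p"
  by (rule uvec_eqI) (simp_all flip: exp_add add: algebra_simps)

lemma flow_0 [simp]: "flow 0 p = p"
  by (rule uvec_eqI) simp_all

lemma flow_lact: "flow t (lact g p) = lact g (flow t p)"
  by (rule uvec_eqI) (simp_all add: scaleR_matrix_vector_assoc matrix_vector_mult_scaleR)

lemma flow_in_T1H [simp]: "flow t p \<in> T1H \<longleftrightarrow> p \<in> T1H"
proof -
  have "flow t p \<in> T1H" if "p \<in> T1H" for t p
    using T1HD[OF that] by (simp add: T1H_iff null_scale mink_simps flip: exp_add)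
  from this[of p t] this[of "flow t p" "- t"] show ?thesis by (auto simp: flow_add)
qed

lemma continuous_flow: "continuous_on UNIV (\<lambda>(t, p). flow t p)"
  unfolding flow_def case_prod_beta by (intro continuous_intros)

lemma tendsto_flow [tendsto_intros]:
  assumes "(f \<longlongrightarrow> t) F" "(g \<longlongrightarrow> p) F"
  shows "((\<lambda>x. flow (f x) (g x)) \<longlongrightarrow> flow t p) F"
proof -
  have "isCont (\<lambda>(t, p). flow t p) (t, p)"
    using continuous_flow continuous_on_eq_continuous_at by blast
  from isCont_tendsto_compose[OF this tendsto_Pair[OF assms]] show ?thesis by simp
qed

text \<open>The bracket in null coordinates: \<open>a\<close> is kept as it is, while of
  \<open>b\<close> only the direction matters, since it is rescaled to reach the product -2.\<close>

definition nmk :: "'n::finite mvec \<Rightarrow> 'n mvec \<Rightarrow> 'n uvec" where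
  "nmk a b = mk a ((- 2 / (a \<star> b)) *\<^sub>R b)"

lemma nmk_in_T1H: "null a \<Longrightarrow> null b \<Longrightarrow> a \<star> b < 0 \<Longrightarrow> nmk a b \<in> T1H"
  unfolding nmk_def by (rule mk_in_T1H) (auto intro!: null_scale simp: mink_simps divide_neg_neg simp del: scaleR_minus_left)

lemma tendsto_nmk [tendsto_intros]:
  assumes "(f \<longlongrightarrow> a) F" "(g \<longlongrightarrow> b) F" "a \<star> b \<noteq> 0"
  shows "((\<lambda>x. nmk (f x) (g x)) \<longlongrightarrow> nmk a b) F"
  unfolding nmk_def using assms by (intro tendsto_intros)

lemma nmk_self: "p \<in> T1H \<Longrightarrow> nmk (np p) (nm p) = p"
  by (simp add: nmk_def T1HD)

lemma closed_T1H: "closed (T1H :: 'n::finite uvec set)"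
proof -
  \<comment> \<open>The strict inequality for the time coordinate may be replaced by a weak one,
    which is a closed condition, because time cannot vanish on the hyperboloid.\<close>
  have "x $ None \<noteq> 0" if "x \<star> x = -1" for x :: "'n mvec"
    using that by (intro timelike_nonzero_time) (auto simp: mink.zero_left)
  then have eq: "T1H = {p :: 'n uvec. fst p \<star> fst p = -1} \<inter> {p. fst p $ None \<ge> 0} \<inter> {p. fst p \<star> snd p = 0} \<inter> {p. snd p \<star> snd p = 1}"
    by (fastforce simp: T1H_def hyp_space_def less_le)
  show ?thesis
    unfolding eq by (intro closed_Int closed_Collect_eq closed_Collect_le continuous_intros)
qed

section \<open>Lengths of paths\<close>

lemma bounded_linear_np: "bounded_linear (np :: 'n::finite uvec \<Rightarrow> _)"
  unfolding np_def by (intro bounded_linear_add bounded_linear_fst bounded_linear_snd)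

lemma bounded_linear_nm: "bounded_linear (nm :: 'n::finite uvec \<Rightarrow> _)"
  unfolding nm_def by (intro bounded_linear_sub bounded_linear_fst bounded_linear_snd)

lemma continuous_on_np [continuous_intros]: "continuous_on S f \<Longrightarrow> continuous_on S (\<lambda>x. np (f x))"
  unfolding np_def by (intro continuous_intros)

lemma continuous_on_nm [continuous_intros]: "continuous_on S f \<Longrightarrow> continuous_on S (\<lambda>x. nm (f x))"
  unfolding nm_def by (intro continuous_intros)

lemma fst_np_nm: "fst p = (1/2) *\<^sub>R (np p + nm p)" and snd_np_nm: "snd p = (1/2) *\<^sub>R (np p - nm p)"
  by (metis mk_np_nm mk_def fst_conv) (metis mk_np_nm mk_def snd_conv)

text \<open>The derivatives of the three equations in \<open>T1H_iff\<close>.\<close>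

definition tang :: "'n::finite uvec \<Rightarrow> 'n uvec \<Rightarrow> bool" where
  "tang p w \<longleftrightarrow> np p \<star> np w = 0 \<and> nm p \<star> nm w = 0 \<and> np w \<star> nm p + np p \<star> nm w = 0"

lemma tangD:
  assumes "tang p w"
  shows "fst w \<star> fst p = 0" "snd w \<star> snd p = 0" "snd w \<star> fst p = - (fst w \<star> snd p)"
  using assms
  by (simp_all add: tang_def fst_np_nm snd_np_nm mink_simps minkowski_commute[of "np w" "np p"]
      minkowski_commute[of "nm w" "nm p"] minkowski_commute[of "nm w" "np p"] minkowski_commute[of "nm p" "np w"] algebra_simps)

text \<open>In null coordinates the flatness of horospheres is visible: if one of
  \<open>np w\<close>, \<open>nm w\<close> is zero, what remains is a constant multiple of the form
  on the other.\<close>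

lemma sasaki_tang:
  assumes "p \<in> T1H" "tang p w"
  shows "sasaki_norm p w = sqrt ((np w \<star> np w + nm w \<star> nm w) / 2 + (np w \<star> nm p / 2)\<^sup>2)"
proof -
  have xx: "fst p \<star> fst p = -1" using fst_T1H[OF assms(1)] by (simp add: hyp_space_def)
  have *: "snd w \<star> fst p = np w \<star> nm p / 2"
    using assms(2) unfolding tang_def fst_np_nm[of p] snd_np_nm[of w]
    by (simp add: mink_simps minkowski_commute[of "np w" "np p"]
      minkowski_commute[of "nm w" "nm p"] minkowski_commute[of "nm w" "np p"] algebra_simps)
  define D where "D = snd w + (snd w \<star> fst p) *\<^sub>R fst p"
  have "D \<star> D = snd w \<star> snd w + (snd w \<star> fst p)\<^sup>2"
    using xx by (simp add: D_def mink_simps minkowski_commute[of "fst p" "snd w"] power2_eq_square algebra_simps)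
  moreover have "fst w \<star> fst w + snd w \<star> snd w = (np w \<star> np w + nm w \<star> nm w) / 2"
    by (simp add: fst_np_nm snd_np_nm mink_simps algebra_simps)
  ultimately have "fst w \<star> fst w + D \<star> D = (np w \<star> np w + nm w \<star> nm w) / 2 + (np w \<star> nm p / 2)\<^sup>2"
    by (simp add: *)
  then show ?thesis
    by (simp add: sasaki_norm_def case_prod_beta Let_def D_def)
qed

lemma hyp_Cauchy_Schwarz:
  assumes "x \<in> hyp_space" "y \<star> x = 0" "z \<star> x = 0"
  shows "(y \<star> z)\<^sup>2 \<le> (y \<star> y) * (z \<star> z)"
  by (rule minkowski_Cauchy_Schwarz, rule hyp_perp_nonneg[OF assms(1)]) (simp add: mink_simps assms)

text \<open>Because \<open>m\<close> is causal, its projection \<open>m'\<close> to the complement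
  of the base point \<open>x\<close> has square at most that of \<open>m \<star> x\<close>, and
  Cauchy-Schwarz gives the rate. The second bound pays twice, as \<open>snd w\<close> also has a
  component along the base point.\<close>

lemma sasaki_bounds:
  assumes p: "p \<in> T1H" and w: "tang p w" and m: "causal m"
  shows "\<bar>m \<star> fst w\<bar> \<le> - (m \<star> fst p) * sasaki_norm p w"
    and "\<bar>m \<star> snd w\<bar> \<le> 2 * (- (m \<star> fst p)) * sasaki_norm p w"
    and "sasaki_norm p w \<ge> 0"
proof -
  note t = tangD[OF w]
  define x where "x = fst p" define v where "v = snd p"
  define y where "y = fst w" define z where "z = snd w"
  have x: "x \<in> hyp_space" "x \<star> x = -1" and v: "v \<star> v = 1" "v \<star> x = 0"
    using p by (auto simp: x_def v_def T1H_def hyp_space_def minkowski_commute)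
  define D where "D = z + (z \<star> x) *\<^sub>R x"
  have Dx: "D \<star> x = 0" using x by (simp add: D_def mink_simps)
  have yx: "y \<star> x = 0" using t by (simp add: y_def x_def)
  have zx: "z \<star> x = - (y \<star> v)" using t by (simp add: y_def x_def z_def v_def)
  define s where "s = sasaki_norm p w"
  have s: "s = sqrt (y \<star> y + D \<star> D)"
    by (simp add: s_def sasaki_norm_def case_prod_beta Let_def D_def x_def y_def z_def)
  have nn: "y \<star> y \<ge> 0" "D \<star> D \<ge> 0" using hyp_perp_nonneg[OF x(1)] yx Dx by auto
  then have s0: "s \<ge> 0" and s2: "s\<^sup>2 = y \<star> y + D \<star> D" unfolding s by auto
  then show "sasaki_norm p w \<ge> 0" by (simp add: s_def)
  define h where "h = - (m \<star> x)"
  have h0: "h \<ge> 0" using causal_minkowski_nonpos[OF m hyp_space_causal[OF x(1)]] by (simp add: h_def)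
  define m' where "m' = m + (m \<star> x) *\<^sub>R x"
  have m'x: "m' \<star> x = 0" using x by (simp add: m'_def mink_simps)
  have m'm': "m' \<star> m' \<le> h\<^sup>2"
    using x m by (simp add: m'_def mink_simps h_def minkowski_commute[of x m] power2_eq_square causal_def)
  have key: "\<bar>m \<star> u\<bar> \<le> h * s" if "u \<star> x = 0" "u \<star> u \<le> s\<^sup>2" for u
  proof (rule power2_le_imp_le)
    have "m \<star> u = m' \<star> u" using that by (simp add: m'_def mink_simps minkowski_commute[of x u])
    then have "\<bar>m \<star> u\<bar>\<^sup>2 \<le> (m' \<star> m') * (u \<star> u)"
      using hyp_Cauchy_Schwarz[OF x(1) m'x that(1)] by simp
    also have "\<dots> \<le> h\<^sup>2 * s\<^sup>2"
      using m'm' that hyp_perp_nonneg[OF x(1) that(1)] by (intro mult_mono) auto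
    finally show "\<bar>m \<star> u\<bar>\<^sup>2 \<le> (h * s)\<^sup>2" by (simp add: power_mult_distrib)
  qed (use h0 s0 in auto)
  have k1: "\<bar>m \<star> y\<bar> \<le> h * s" using yx s2 nn by (intro key) auto
  then show "\<bar>m \<star> fst w\<bar> \<le> - (m \<star> fst p) * sasaki_norm p w"
    by (simp add: h_def s_def y_def x_def)
  have k2: "\<bar>m \<star> D\<bar> \<le> h * s" using Dx s2 nn by (intro key) auto
  have "\<bar>y \<star> v\<bar> \<le> s"
  proof (rule power2_le_imp_le)
    show "\<bar>y \<star> v\<bar>\<^sup>2 \<le> s\<^sup>2" using hyp_Cauchy_Schwarz[OF x(1) yx v(2)] v s2 nn by simp
  qed (rule s0)
  then have k3: "\<bar>(z \<star> x) * (m \<star> x)\<bar> \<le> s * h"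
    unfolding abs_mult using h0 by (intro mult_mono) (auto simp: zx h_def)
  have "m \<star> z = m \<star> D - (z \<star> x) * (m \<star> x)" by (simp add: D_def mink_simps)
  then have "\<bar>m \<star> z\<bar> \<le> 2 * h * s" using k2 k3 by (auto simp: mult.commute[of s h])
  then show "\<bar>m \<star> snd w\<bar> \<le> 2 * (- (m \<star> fst p)) * sasaki_norm p w"
    by (simp add: h_def s_def z_def x_def)
qed

section \<open>Lengths of paths and their control of linear functionals\<close>

definition upath :: "(real \<Rightarrow> 'n::finite uvec) \<Rightarrow> 'n uvec set \<Rightarrow> 'n uvec \<Rightarrow> 'n uvec \<Rightarrow> bool" where
  "upath c W p q \<longleftrightarrow> c C1_differentiable_on {0..1} \<and> c ` {0..1} \<subseteq> W \<and> c 0 = p \<and> c 1 = q"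

lemma path_dist_upath: "path_dist W p q = Inf {path_length c | c. upath c W p q}"
  by (simp add: path_dist_def upath_def)

text \<open>The derivative is two-sided while \<open>f\<close> is constant on a closed interval, so
  both are compared as derivatives within the interval; this includes the endpoints.\<close>

lemma has_vector_derivative_constant_on:
  fixes f :: "real \<Rightarrow> 'a::euclidean_space"
  assumes "(f has_vector_derivative f') (at t)" "t \<in> {0..1}" "\<And>s. s \<in> {0..1} \<Longrightarrow> f s = k"
  shows "f' = 0"
proof -
  have "(f has_vector_derivative f') (at t within cbox 0 1)"
    using assms(1) by (rule has_vector_derivative_at_within)
  moreover have "(f has_vector_derivative 0) (at t within cbox 0 1)"
    by (rule has_vector_derivative_transform[OF _ _ has_vector_derivative_const[of k]])
       (use assms in auto)
  ultimately show ?thesis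
    using vector_derivative_unique_within_closed_interval[of 0 1 t] assms(2) by auto
qed

lemma upathD:
  assumes "upath c W p q" "W \<subseteq> T1H"
  defines "D \<equiv> \<lambda>t. vector_derivative c (at t)"
  shows "\<And>t. t \<in> {0..1} \<Longrightarrow> (c has_vector_derivative D t) (at t)" "continuous_on {0..1} D"
    "\<And>t. t \<in> {0..1} \<Longrightarrow> c t \<in> W" "c 0 = p" "c 1 = q" "\<And>t. t \<in> {0..1} \<Longrightarrow> tang (c t) (D t)"
    "continuous_on {0..1} c" "continuous_on {0..1} (\<lambda>t. sasaki_norm (c t) (D t))"
    "path_length c = integral {0..1} (\<lambda>t. sasaki_norm (c t) (D t))"
    "\<And>t. t \<in> {0..1} \<Longrightarrow> c t \<in> T1H"
proof -
  obtain D' where D': "\<And>t. t \<in> {0..1} \<Longrightarrow> (c has_vector_derivative D' t) (at t)" "continuous_on {0..1} D'"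
    using assms(1) unfolding upath_def C1_differentiable_on_def by blast
  have DD: "D t = D' t" if "t \<in> {0..1}" for t
    using vector_derivative_at[OF D'(1)[OF that]] by (simp add: D_def)
  have D1: "(c has_vector_derivative D t) (at t)" if "t \<in> {0..1}" for t
    using D'(1)[OF that] DD[OF that] by simp
  then show "\<And>t. t \<in> {0..1} \<Longrightarrow> (c has_vector_derivative D t) (at t)" .
  have D2: "continuous_on {0..1} D"
    by (rule continuous_on_eq[OF D'(2)]) (rule DD[symmetric])
  then show "continuous_on {0..1} D" .
  have cW: "c t \<in> W" if "t \<in> {0..1}" for t using assms that by (auto simp: upath_def)
  then show "\<And>t. t \<in> {0..1} \<Longrightarrow> c t \<in> W" .
  have cT: "c t \<in> T1H" if "t \<in> {0..1}" for t using cW[OF that] assms(2) by auto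
  then show "\<And>t. t \<in> {0..1} \<Longrightarrow> c t \<in> T1H" .
  have cc: "continuous_on {0..1} c"
    using D1 by (meson continuous_at_imp_continuous_on has_vector_derivative_continuous)
  then show "continuous_on {0..1} c" .
  have tang: "tang (c t) (D t)" if t: "t \<in> {0..1}" for t
  proof -
    note dp = bounded_linear.has_vector_derivative[OF bounded_linear_np D1[OF t]]
    note dm = bounded_linear.has_vector_derivative[OF bounded_linear_nm D1[OF t]]
    have "np (c t) \<star> np (D t) + np (D t) \<star> np (c t) = 0"
      by (rule has_vector_derivative_constant_on[OF mink.has_vector_derivative[OF dp dp] t, of 0])
        (use T1HD(1)[OF cT] in \<open>auto simp: null_def\<close>)
    moreover have "nm (c t) \<star> nm (D t) + nm (D t) \<star> nm (c t) = 0"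
      by (rule has_vector_derivative_constant_on[OF mink.has_vector_derivative[OF dm dm] t, of 0])
        (use T1HD(2)[OF cT] in \<open>auto simp: null_def\<close>)
    moreover have "np (c t) \<star> nm (D t) + np (D t) \<star> nm (c t) = 0"
      by (rule has_vector_derivative_constant_on[OF mink.has_vector_derivative[OF dp dm] t, of "-2"])
        (use T1HD(3)[OF cT] in auto)
    ultimately show ?thesis
      by (auto simp: tang_def minkowski_commute[of "np (D t)" "np (c t)"] minkowski_commute[of "nm (D t)" "nm (c t)"])
  qed
  then show "\<And>t. t \<in> {0..1} \<Longrightarrow> tang (c t) (D t)" .
  have "continuous_on {0..1} (\<lambda>t. sqrt ((np (D t) \<star> np (D t) + nm (D t) \<star> nm (D t)) / 2 + (np (D t) \<star> nm (c t) / 2)\<^sup>2))"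
    using D2 cc by (intro continuous_intros) auto
  moreover have "sqrt ((np (D t) \<star> np (D t) + nm (D t) \<star> nm (D t)) / 2 + (np (D t) \<star> nm (c t) / 2)\<^sup>2)
      = sasaki_norm (c t) (D t)" if "t \<in> {0..1}" for t
    by (rule sasaki_tang[symmetric, OF cT[OF that] tang[OF that]])
  ultimately show "continuous_on {0..1} (\<lambda>t. sasaki_norm (c t) (D t))"
    by (rule continuous_on_eq)
  show "path_length c = integral {0..1} (\<lambda>t. sasaki_norm (c t) (D t))"
    by (simp add: path_length_def D_def)
  show "c 0 = p" "c 1 = q" using assms(1) by (auto simp: upath_def)
qed

lemma path_length_nonneg:
  assumes c: "upath c W p q" "W \<subseteq> T1H"
  shows "path_length c \<ge> 0"
  unfolding upathD(9)[OF c]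
  by (intro integral_nonneg integrable_continuous_real upathD(8)[OF c]
      sasaki_bounds(3)[of _ _ "axis None 1"] upathD(6)[OF c] upathD(10)[OF c])
    (auto simp: causal_def minkowski_def axis_def)

lemma path_dist_le:
  assumes "upath c W p q" "W \<subseteq> T1H"
  shows "path_dist W p q \<le> path_length c"
proof -
  have "bdd_below {path_length c | c. upath c W p q}"
    using path_length_nonneg[of _ W p q] assms(2) by (intro bdd_belowI[of _ 0]) blast
  then show ?thesis
    unfolding path_dist_upath using assms(1) by (intro cInf_lower) blast
qed

lemma path_dist_nonneg:
  assumes "upath c W p q" "W \<subseteq> T1H"
  shows "path_dist W p q \<ge> 0"
  unfolding path_dist_upath
  using assms path_length_nonneg[of _ W p q] by (intro cInf_greatest) blast+

lemma path_dist_less: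
  assumes "path_dist W p q < r" "upath c W p q"
  obtains c' where "upath c' W p q" "path_length c' < r"
proof -
  have "\<exists>x\<in>{path_length c | c. upath c W p q}. x < r"
    by (rule cInf_lessD) (use assms in \<open>auto simp: path_dist_upath\<close>)
  then show ?thesis using that by auto
qed

lemma abs_diff_le_integral:
  fixes f f' S :: "real \<Rightarrow> real"
  assumes "0 \<le> s" "s \<le> 1"
    and df: "\<And>t. t \<in> {0..1} \<Longrightarrow> (f has_vector_derivative f' t) (at t)"
    and le: "\<And>t. t \<in> {0..s} \<Longrightarrow> \<bar>f' t\<bar> \<le> S t"
    and S: "continuous_on {0..1} S" "\<And>t. t \<in> {0..1} \<Longrightarrow> S t \<ge> 0"
  shows "\<bar>f s - f 0\<bar> \<le> integral {0..1} S"
proof -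
  have i: "(f' has_integral (f s - f 0)) {0..s}"
    by (rule fundamental_theorem_of_calculus) (use assms in \<open>auto intro: has_vector_derivative_at_within\<close>)
  have S': "S integrable_on {0..1}" "S integrable_on {0..s}"
    using S assms by (auto intro!: integrable_continuous_real continuous_on_subset[OF S(1)])
  have "norm (integral {0..s} f') \<le> integral {0..s} S"
    by (rule integral_norm_bound_integral) (use i S' le in auto)
  also have "\<dots> \<le> integral {0..1} S"
    by (rule integral_subset_le) (use S' S assms in auto)
  finally show ?thesis using integral_unique[OF i] by simp
qed

text \<open>The logarithmic derivative of the positive function
  \<open>- (m \<star> fst (c t))\<close> is at most the speed. This lower bound for lengths is
  behind both the growth estimates and the identification of the strong leaves.\<close>

lemma upath_ln_bound:
  assumes c: "upath c W p q" "W \<subseteq> T1H" and m: "causal m" "m \<star> m < 0" and s: "0 \<le> s" "s \<le> 1"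
  shows "\<bar>ln (- (m \<star> fst (c s))) - ln (- (m \<star> fst p))\<bar> \<le> path_length c"
proof -
  define D where "D t = vector_derivative c (at t)" for t
  note D = upathD(1,3,4,6,8,9)[OF c, folded D_def]
  have T: "c t \<in> T1H" if "t \<in> {0..1}" for t using D(2)[OF that] c(2) by auto
  define h where "h t = - (m \<star> fst (c t))" for t
  define h' where "h' t = - (m \<star> fst (D t))" for t
  have hpos: "h t > 0" if "t \<in> {0..1}" for t
    using timelike_causal_neg[OF m(1) hyp_space_causal[OF fst_T1H[OF T[OF that]]] m(2)] by (simp add: h_def)
  have bl: "bounded_linear (\<lambda>w. - (m \<star> fst w))"
    by (intro bounded_linear_minus bounded_linear_compose[OF mink.bounded_linear_right] bounded_linear_fst)
  have dh: "(h has_real_derivative h' t) (at t)" if "t \<in> {0..1}" for t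
    using bounded_linear.has_vector_derivative[OF bl D(1)[OF that]]
    by (simp add: h_def[abs_def] h'_def has_real_derivative_iff_has_vector_derivative)
  have "\<bar>ln (h s) - ln (h 0)\<bar> \<le> integral {0..1} (\<lambda>t. sasaki_norm (c t) (D t))"
  proof (rule abs_diff_le_integral[where f' = "\<lambda>t. h' t / h t"])
    fix t :: real assume t: "t \<in> {0..1}"
    have "((\<lambda>t. ln (h t)) has_real_derivative 1 / h t * h' t) (at t)"
      by (rule DERIV_chain2[OF DERIV_ln_divide dh[OF t]]) (use hpos[OF t] in simp)
    then show "((\<lambda>t. ln (h t)) has_vector_derivative h' t / h t) (at t)"
      by (simp add: has_real_derivative_iff_has_vector_derivative[symmetric])
    show "0 \<le> sasaki_norm (c t) (D t)"
      using sasaki_bounds(3)[OF T[OF t] D(4)[OF t] m(1)] .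
  next
    fix t assume "t \<in> {0..s}"
    then have t: "t \<in> {0..1}" using s by auto
    have "\<bar>h' t\<bar> \<le> h t * sasaki_norm (c t) (D t)"
      using sasaki_bounds(1)[OF T[OF t] D(4)[OF t] m(1)] by (simp add: h'_def h_def)
    then show "\<bar>h' t / h t\<bar> \<le> sasaki_norm (c t) (D t)"
      using hpos[OF t] by (simp add: abs_div_pos[symmetric] pos_divide_le_eq mult.commute)
  qed (use s D in auto)
  then show ?thesis by (simp add: h_def D)
qed

text \<open>A Gronwall argument: \<open>upath_ln_bound\<close> controls the size of the functional
  along the path, and its size controls its change.\<close>

lemma upath_close:
  assumes c: "upath c W p q" "W \<subseteq> T1H" and m: "causal m" "m \<star> m < 0"
  defines "L \<equiv> path_length c"
  shows "\<bar>m \<star> fst q - m \<star> fst p\<bar> \<le> - (m \<star> fst p) * exp L * L"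
    and "\<bar>m \<star> snd q - m \<star> snd p\<bar> \<le> 2 * (- (m \<star> fst p)) * exp L * L"
proof -
  define D where "D t = vector_derivative c (at t)" for t
  note D = upathD(1,3,4,5,6,8,9)[OF c, folded D_def]
  define S where "S t = sasaki_norm (c t) (D t)" for t
  have T: "c t \<in> T1H" if "t \<in> {0..1}" for t using D(2)[OF that] c(2) by auto
  define h where "h t = - (m \<star> fst (c t))" for t
  have hpos: "h t > 0" if "t \<in> {0..1}" for t
    using timelike_causal_neg[OF m(1) hyp_space_causal[OF fst_T1H[OF T[OF that]]] m(2)] by (simp add: h_def)
  have S0: "0 \<le> S t" if "t \<in> {0..1}" for t
    using sasaki_bounds(3)[OF T[OF that] D(5)[OF that] m(1)] by (simp add: S_def)
  have hle: "h t \<le> h 0 * exp L" if t: "t \<in> {0..1}" for t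
  proof -
    have "ln (h t) \<le> ln (h 0) + L"
      using upath_ln_bound[OF c m, of t] t by (simp add: h_def D L_def)
    then have "exp (ln (h t)) \<le> exp (ln (h 0) + L)" by simp
    then show ?thesis using hpos[OF t] hpos[of 0] by (simp add: exp_add)
  qed
  have gen: "\<bar>m \<star> F q - m \<star> F p\<bar> \<le> k * (h 0 * exp L * L)"
    if F: "bounded_linear F" and k: "k \<ge> 0"
      "\<And>t. t \<in> {0..1} \<Longrightarrow> \<bar>m \<star> F (D t)\<bar> \<le> k * h t * S t" for F :: "'a uvec \<Rightarrow> 'a mvec" and k
  proof -
    have bl: "bounded_linear (\<lambda>w. m \<star> F w)"
      by (intro bounded_linear_compose[OF mink.bounded_linear_right F])
    have "\<bar>m \<star> F (c 1) - m \<star> F (c 0)\<bar> \<le> integral {0..1} (\<lambda>t. k * (h 0 * exp L) * S t)"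
    proof (rule abs_diff_le_integral)
      fix t :: real assume t: "t \<in> {0..1}"
      show "((\<lambda>t. m \<star> F (c t)) has_vector_derivative m \<star> F (D t)) (at t)"
        using bounded_linear.has_vector_derivative[OF bl D(1)[OF t]] .
      show "0 \<le> k * (h 0 * exp L) * S t" using k S0[OF t] hpos[of 0] by simp
      have "\<bar>m \<star> F (D t)\<bar> \<le> k * h t * S t" using k(2)[OF t] .
      also have "\<dots> \<le> k * (h 0 * exp L) * S t"
        using hle[OF t] k S0[OF t] by (intro mult_right_mono mult_left_mono) auto
      finally show "\<bar>m \<star> F (D t)\<bar> \<le> k * (h 0 * exp L) * S t" .
    next
      show "continuous_on {0..1} (\<lambda>t. k * (h 0 * exp L) * S t)"
        using D(6) by (auto simp: S_def intro!: continuous_intros)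
    qed auto
    also have "\<dots> = k * (h 0 * exp L * L)" by (simp add: L_def D(7) S_def)
    finally show ?thesis by (simp add: D)
  qed
  have "\<bar>m \<star> fst q - m \<star> fst p\<bar> \<le> 1 * (h 0 * exp L * L)"
    by (rule gen[OF bounded_linear_fst]) (use sasaki_bounds(1)[OF T D(5) m(1)] in \<open>auto simp: h_def S_def\<close>)
  then show "\<bar>m \<star> fst q - m \<star> fst p\<bar> \<le> - (m \<star> fst p) * exp L * L" by (simp add: h_def D)
  have "\<bar>m \<star> snd q - m \<star> snd p\<bar> \<le> 2 * (h 0 * exp L * L)"
    by (rule gen[OF bounded_linear_snd]) (use sasaki_bounds(2)[OF T D(5) m(1)] in \<open>auto simp: h_def S_def\<close>)
  then show "\<bar>m \<star> snd q - m \<star> snd p\<bar> \<le> 2 * (- (m \<star> fst p)) * exp L * L" by (simp add: h_def D)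
qed

text \<open>The vectors \<open>e0\<close> and \<open>es i\<close> are timelike and their products
  determine all coordinates, so estimates for timelike functionals become estimates in the Euclidean
  norm. The factor 2 makes \<open>es i\<close> timelike.\<close>

definition e0 :: "'n::finite mvec" where "e0 = axis None 1"
definition es :: "'n::finite \<Rightarrow> 'n mvec" where "es i = 2 *\<^sub>R e0 + axis (Some i) 1"

lemma e0_minkowski [simp]: "e0 \<star> x = - (x $ None)"
  by (simp add: minkowski_eq_inner e0_def inner_axis')

lemma es_minkowski [simp]: "es i \<star> x = x $ Some i - 2 * x $ None"
  by (simp add: es_def mink_simps) (simp add: minkowski_eq_inner inner_axis', simp add: axis_def)

lemma e0_timelike: "causal e0" "e0 \<star> e0 < 0"
  by (simp_all add: causal_def) (simp_all add: e0_def)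

lemma es_timelike: "causal (es i)" "es i \<star> es i < 0"
  by (simp_all add: causal_def) (simp_all add: es_def e0_def axis_def)

lemma e0_hyp_space: "e0 \<in> hyp_space"
  by (simp add: hyp_space_def) (simp add: e0_def)

lemma minkowski_eqI:
  fixes x y :: "'n::finite mvec"
  assumes "\<And>m. causal m \<Longrightarrow> m \<star> m < 0 \<Longrightarrow> m \<star> x = m \<star> y"
  shows "x = y"
proof -
  have 0: "x $ None = y $ None" using assms[OF e0_timelike] by simp
  have "x $ Some i = y $ Some i" for i using assms[OF es_timelike, of i] 0 by simp
  with 0 have "x $ i = y $ i" for i by (cases i) auto
  then show ?thesis by (simp add: vec_eq_iff)
qed

lemma norm_le_of_timelike:
  fixes z :: "'n::finite mvec"
  assumes "\<bar>e0 \<star> z\<bar> \<le> B" "\<And>i. \<bar>es i \<star> z\<bar> \<le> B"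
  shows "norm z \<le> real CARD('n option) * (3 * B)"
proof -
  have B: "B \<ge> 0" using assms(1) by linarith
  have "\<bar>z $ i\<bar> \<le> 3 * B" for i
    using assms(1) assms(2)[of "the i"] B by (cases i) auto
  then have "(\<Sum>i\<in>UNIV. \<bar>z $ i\<bar>) \<le> real CARD('n option) * (3 * B)"
    by (intro sum_bounded_above) auto
  then show ?thesis using norm_le_l1_cart[of z] by linarith
qed

lemma upath_norm_diff:
  fixes p q :: "'n::finite uvec"
  assumes c: "upath c W p q" "W \<subseteq> T1H" 
  defines "L \<equiv> path_length c"
  shows "norm (q - p) \<le> real CARD('n option) * 36 * (fst p $ None) * exp L * L"
proof -
  have pT: "p \<in> T1H" using c by (force simp: upath_def)
  define x where "x = fst p $ None"
  have x: "x > 0" using fst_T1H[OF pT] by (simp add: x_def hyp_space_def)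
  have L: "L \<ge> 0" unfolding L_def by (rule path_length_nonneg[OF c])
  have n: "\<bar>fst p $ Some i\<bar> \<le> 2 * x" for i
    using causal_norm_le[OF hyp_space_causal[OF fst_T1H[OF pT]]] component_le_norm_cart[of "fst p" "Some i"]
    by (simp add: x_def)
  have le: "- (es i \<star> fst p) * exp L * L \<le> 4 * x * exp L * L" for i
    using n[of i] L by (intro mult_right_mono) (auto simp: x_def[symmetric])
  have le2: "x * exp L * L \<le> 4 * x * exp L * L" using x L by (intro mult_right_mono) auto
  define B where "B = x * exp L * L"
  have 1: "norm (fst q - fst p) \<le> real CARD('n option) * (3 * (4 * B))"
  proof (rule norm_le_of_timelike)
    show "\<bar>e0 \<star> (fst q - fst p)\<bar> \<le> 4 * B"
      using upath_close(1)[OF c e0_timelike] le2 by (simp add: mink.diff_right x_def L_def B_def mult.assoc)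
    show "\<bar>es i \<star> (fst q - fst p)\<bar> \<le> 4 * B" for i
      unfolding mink.diff_right
      using order_trans[OF upath_close(1)[OF c es_timelike[of i], folded L_def] le[of i]]
      by (simp add: B_def mult.assoc)
  qed
  have 2: "norm (snd q - snd p) \<le> real CARD('n option) * (3 * (8 * B))"
  proof (rule norm_le_of_timelike)
    show "\<bar>e0 \<star> (snd q - snd p)\<bar> \<le> 8 * B"
      using upath_close(2)[OF c e0_timelike, folded L_def] le2 by (simp add: mink.diff_right x_def B_def mult.assoc)
    show "\<bar>es i \<star> (snd q - snd p)\<bar> \<le> 8 * B" for i
    proof -
      have "\<bar>es i \<star> (snd q - snd p)\<bar> \<le> 2 * (- (es i \<star> fst p) * exp L * L)"
        unfolding mink.diff_right using upath_close(2)[OF c es_timelike[of i], folded L_def] by argo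
      also have "\<dots> \<le> 2 * (4 * x * exp L * L)" by (rule mult_left_mono[OF le]) simp
      finally show ?thesis by (simp add: B_def)
    qed
  qed
  have "norm (q - p) \<le> norm (fst (q - p)) + norm (snd (q - p))"
    using norm_Pair_le[of "fst (q - p)" "snd (q - p)"] by (simp only: prod.collapse)
  with 1 2 have "norm (q - p) \<le> real CARD('n option) * (3 * (4 * B)) + real CARD('n option) * (3 * (8 * B))"
    unfolding fst_diff snd_diff by linarith
  \<comment> \<open>36 is 12 for the base point plus 24 for the direction;
    \<open>norm_le_of_timelike\<close> contributes a factor 3 to each.\<close>
  also have "\<dots> = real CARD('n option) * 36 * x * exp L * L" by (simp add: B_def)
  finally show ?thesis by (simp add: x_def)
qed

text \<open>Leaf topologies are defined by path lengths, but limits are taken in the ambient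
  Euclidean space; this is the bridge from the former to the latter.\<close>

lemma short_path_close:
  fixes p :: "'n::finite uvec"
  assumes "p \<in> T1H" "e > 0"
  obtains r where "r > 0" "\<And>c W q. upath c W p q \<Longrightarrow> W \<subseteq> T1H \<Longrightarrow> path_length c < r \<Longrightarrow> dist q p < e"
proof -
  define K where "K = real CARD('n option) * 36 * (fst p $ None) * exp 1"
  have K: "K > 0" using fst_T1H[OF assms(1)] by (simp add: K_def hyp_space_def)
  define r where "r = min 1 (e / K)"
  have r: "r > 0" "r \<le> 1" "r \<le> e / K" using K assms by (auto simp: r_def)
  show ?thesis
  proof (rule that[OF r(1)])
    fix c W q assume c: "upath c W p q" "W \<subseteq> T1H" "path_length c < r"
    define L where "L = path_length c"
    have L: "0 \<le> L" "L \<le> 1" "L < r" using path_length_nonneg[OF c(1,2)] c r by (auto simp: L_def)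
    have "norm (q - p) \<le> real CARD('n option) * 36 * (fst p $ None) * exp L * L"
      using upath_norm_diff[OF c(1,2)] by (simp add: L_def)
    also have "\<dots> \<le> K * L"
      unfolding K_def using L fst_T1H[OF assms(1)] by (intro mult_right_mono mult_left_mono) (auto simp: hyp_space_def)
    also have "\<dots> < K * r" using K L by simp
    also have "\<dots> \<le> e" using r K by (simp add: pos_le_divide_eq mult.commute)
    finally show "dist q p < e" by (simp add: dist_norm)
  qed
qed

lemma upath_time_bound:
  assumes "upath c W p q" "W \<subseteq> T1H"
  shows "fst q $ None \<le> fst p $ None * exp (path_length c)"
proof -
  have T: "p \<in> T1H" "q \<in> T1H" using assms by (force simp: upath_def)+
  then have pos: "fst p $ None > 0" "fst q $ None > 0"
    by (auto dest!: fst_T1H simp: hyp_space_def)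
  have "\<bar>ln (fst q $ None) - ln (fst p $ None)\<bar> \<le> path_length c"
    using upath_ln_bound[OF assms e0_timelike, of 1] assms(1) by (simp add: upath_def)
  then have "exp (ln (fst q $ None)) \<le> exp (ln (fst p $ None) + path_length c)" by simp
  then show ?thesis using pos by (simp add: exp_add)
qed

section \<open>Isometries\<close>

lemma upath_image:
  assumes "bounded_linear f" "upath c W p q"
  shows "upath (f \<circ> c) (f ` W) (f p) (f q)"
proof -
  from assms(2) obtain D where D: "\<forall>t\<in>{0..1}. (c has_vector_derivative D t) (at t)" "continuous_on {0..1} D"
    unfolding upath_def C1_differentiable_on_def by blast
  have "(f \<circ> c) C1_differentiable_on {0..1}"
    unfolding C1_differentiable_on_def
  proof (intro exI conjI ballI)
    show "((f \<circ> c) has_vector_derivative f (D t)) (at t)" if "t \<in> {0..1}" for t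
      using bounded_linear.has_vector_derivative[OF assms(1)] D(1) that by (auto simp: o_def)
    show "continuous_on {0..1} (\<lambda>t. f (D t))"
      by (rule bounded_linear.continuous_on[OF assms(1) D(2)])
  qed
  then show ?thesis using assms(2) by (auto simp: upath_def)
qed

lemma path_length_image:
  assumes f: "bounded_linear f" "\<And>p w. sasaki_norm (f p) (f w) = sasaki_norm p w"
    and c: "upath c W p q"
  shows "path_length (f \<circ> c) = path_length c"
  unfolding path_length_def
proof (rule integral_cong)
  fix t :: real assume t: "t \<in> {0..1}"
  from c t have "c differentiable (at t)"
    by (auto simp: upath_def C1_differentiable_on_def intro: differentiableI_vector)
  then have "(c has_vector_derivative vector_derivative c (at t)) (at t)"
    by (simp add: vector_derivative_works)
  from bounded_linear.has_vector_derivative[OF f(1) this]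
  have "vector_derivative (f \<circ> c) (at t) = f (vector_derivative c (at t))"
    by (simp add: vector_derivative_at o_def)
  then show "sasaki_norm ((f \<circ> c) t) (vector_derivative (f \<circ> c) (at t)) =
      sasaki_norm (c t) (vector_derivative c (at t))"
    by (simp add: f(2))
qed

lemma path_dist_image:
  assumes f: "bounded_linear f" "\<And>p w. sasaki_norm (f p) (f w) = sasaki_norm p w"
    and g: "bounded_linear g" "\<And>p. g (f p) = p" "\<And>p. f (g p) = p"
  shows "path_dist (f ` W) (f p) (f q) = path_dist W p q"
proof -
  have "{path_length c | c. upath c (f ` W) (f p) (f q)} = {path_length c | c. upath c W p q}"
  proof (rule subset_antisym; rule subsetI)
    fix x assume "x \<in> {path_length c | c. upath c (f ` W) (f p) (f q)}"
    then obtain c where x: "x = path_length c" and c: "upath c (f ` W) (f p) (f q)" by blast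
    have "upath (g \<circ> c) (g ` f ` W) (g (f p)) (g (f q))" by (rule upath_image[OF g(1) c])
    moreover have "g ` f ` W = W" by (simp add: image_image g(2))
    ultimately have u: "upath (g \<circ> c) W p q" by (simp add: g)
    have "path_length c = path_length (f \<circ> (g \<circ> c))" by (simp add: o_def g)
    then show "x \<in> {path_length c | c. upath c W p q}" using path_length_image[OF f u] u x by auto
  next
    fix x assume "x \<in> {path_length c | c. upath c W p q}"
    then obtain c where x: "x = path_length c" and c: "upath c W p q" by blast
    show "x \<in> {path_length c | c. upath c (f ` W) (f p) (f q)}"
      using upath_image[OF f(1) c] path_length_image[OF f c] x by (intro CollectI exI[of _ "f \<circ> c"]) simp
  qed
  then show ?thesis by (simp add: path_dist_upath)
qed

text \<open>Time reversal. It exchanges \<open>np\<close> and \<open>nm\<close> and turns statements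
  on stable leaves into statements on unstable ones.\<close>

definition flip :: "'n::finite uvec \<Rightarrow> 'n uvec" where "flip p = (fst p, - snd p)"

lemma flip_np [simp]: "np (flip p) = nm p" and flip_nm [simp]: "nm (flip p) = np p"
  by (simp_all add: flip_def np_def nm_def)

lemma flip_flip [simp]: "flip (flip p) = p" by (simp add: flip_def)

lemma flip_T1H [simp]: "flip p \<in> T1H \<longleftrightarrow> p \<in> T1H"
  by (auto simp: T1H_iff minkowski_commute)

lemma bounded_linear_flip: "bounded_linear (flip :: 'n::finite uvec \<Rightarrow> _)"
  unfolding flip_def by (intro bounded_linear_Pair bounded_linear_fst bounded_linear_minus bounded_linear_snd)

lemma sasaki_flip: "sasaki_norm (flip p) (flip w) = sasaki_norm p w"
proof -
  have "- snd w + (- (snd w \<star> fst p)) *\<^sub>R fst p = - (snd w + (snd w \<star> fst p) *\<^sub>R fst p)" by simp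
  then have "(- snd w + (- (snd w \<star> fst p)) *\<^sub>R fst p) \<star> (- snd w + (- (snd w \<star> fst p)) *\<^sub>R fst p) =
      (snd w + (snd w \<star> fst p) *\<^sub>R fst p) \<star> (snd w + (snd w \<star> fst p) *\<^sub>R fst p)"
    by (simp only: mink.minus_left mink.minus_right minus_minus)
  then show ?thesis
    by (simp add: sasaki_norm_def flip_def case_prod_beta Let_def mink.minus_left)
qed

lemma path_dist_flip: "path_dist (flip ` W) (flip p) (flip q) = path_dist W p q"
  by (rule path_dist_image[OF bounded_linear_flip sasaki_flip bounded_linear_flip]) simp_all

lemma flip_flow: "flip (flow t p) = flow (- t) (flip p)"
  by (rule uvec_eqI) simp_all

lemma flip_image_T1H: "flip ` T1H = T1H"
  by (metis (no_types, lifting) flip_T1H flip_flip image_eqI image_subsetI subsetI subset_antisym)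

section \<open>Strong leaves\<close>

text \<open>A strong leaf fixes one null vector, that is, a horosphere, while the weak unstable leaf
  fixes only the ray of \<open>nm p\<close>, that is, the backward endpoint. These explicit sets are
  matched with the dynamical definitions below.\<close>

definition ssl :: "'n::finite uvec \<Rightarrow> 'n uvec set" where "ssl p = {q \<in> T1H. np q = np p}"
definition sul :: "'n::finite uvec \<Rightarrow> 'n uvec set" where "sul p = {q \<in> T1H. nm q = nm p}"
definition wul :: "'n::finite uvec \<Rightarrow> 'n uvec set" where "wul p = {q \<in> T1H. \<exists>r>0. nm q = r *\<^sub>R nm p}"

lemma leaf_subset: "ssl p \<subseteq> T1H" "sul p \<subseteq> T1H" "wul p \<subseteq> T1H" "sul p \<subseteq> wul p"
  by (auto simp: ssl_def sul_def wul_def intro!: exI[of _ 1])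

lemma flip_ssl: "flip ` ssl p = sul (flip p)"
proof
  show "sul (flip p) \<subseteq> flip ` ssl p"
  proof
    fix q assume "q \<in> sul (flip p)"
    then have "flip q \<in> ssl p" by (auto simp: sul_def ssl_def)
    then show "q \<in> flip ` ssl p" by (metis flip_flip imageI)
  qed
qed (auto simp: sul_def ssl_def)

text \<open>The points with fixed \<open>np\<close> form a flat paraboloid; its straight lines are the following parabolas.\<close>

lemma ssl_path:
  assumes p: "p \<in> T1H" and q: "q \<in> ssl p"
  obtains c where "upath c (ssl p) p q" "path_length c = sqrt (- (nm p \<star> nm q))"
proof -
  define a b b' where "a = np p" "b = nm p" "b' = nm q"
  have qT: "q \<in> T1H" "np q = a" using q by (auto simp: ssl_def a_b_b'_def)
  have nn: "a \<star> a = 0" "b \<star> b = 0" "b' \<star> b' = 0" "a \<star> b = -2" "a \<star> b' = -2" "b \<star> a = -2" "b' \<star> a = -2"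
    using T1HD[OF p] T1HD[OF qT(1)] qT(2) by (auto simp: a_b_b'_def null_def minkowski_commute)
  \<comment> \<open>The multiple of \<open>a\<close> with this coefficient compensates the square of
    the chord from \<open>b\<close> to \<open>b'\<close>, so that the curve stays null.\<close>
  define k where "k = (b \<star> b') / 2"
  define \<beta> where "\<beta> t = (1 - t) *\<^sub>R b + t *\<^sub>R b' + (k * t * (1 - t)) *\<^sub>R a" for t :: real
  define \<beta>' where "\<beta>' t = b' - b + (k * (1 - 2 * t)) *\<^sub>R a" for t :: real
  have d: "(\<beta> has_vector_derivative \<beta>' t) (at t)" for t
    unfolding \<beta>_def[abs_def] \<beta>'_def
    by (auto intro!: derivative_eq_intros simp: algebra_simps)
  have b0: "\<beta> t \<star> \<beta> t = 0" "a \<star> \<beta> t = -2" for t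
    using nn by (simp_all add: \<beta>_def mink_simps minkowski_commute[of b' b] k_def field_simps)
  have \<beta>null: "null (\<beta> t)" for t
  proof (rule null_neg_future[OF b0(1), of _ a])
    show "\<beta> t \<star> a < 0" using b0(2)[of t] minkowski_commute[of a "\<beta> t"] by simp
    show "null a" using T1HD(1)[OF p] by (simp add: a_b_b'_def)
  qed
  define c where "c t = mk a (\<beta> t)" for t
  define D where "D t = mk 0 (\<beta>' t)" for t
  have dc: "(c has_vector_derivative D t) (at t)" for t
    unfolding c_def[abs_def] D_def mk_def using d[of t]
    by (auto intro!: has_vector_derivative_Pair derivative_eq_intros)
  have cD: "continuous_on {0..1} D"
    unfolding D_def mk_def \<beta>'_def by (intro continuous_intros)
  have cT: "c t \<in> T1H" for t
    unfolding c_def by (rule mk_in_T1H) (use \<beta>null b0 T1HD(1)[OF p] in \<open>auto simp: a_b_b'_def\<close>)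
  have u: "upath c (ssl p) p q"
    unfolding upath_def C1_differentiable_on_def
  proof (intro conjI exI)
    show "c ` {0..1} \<subseteq> ssl p" using cT by (auto simp: ssl_def c_def a_b_b'_def)
    show "c 0 = p" by (rule uvec_eqI) (simp_all add: c_def \<beta>_def a_b_b'_def)
    show "c 1 = q" using qT by (intro uvec_eqI) (simp_all add: c_def \<beta>_def a_b_b'_def)
  qed (use dc cD in auto)
  have vd: "vector_derivative c (at t) = D t" for t using vector_derivative_at[OF dc] .
  have sas: "sasaki_norm (c t) (D t) = sqrt (- (b \<star> b'))" if "t \<in> {0..1}" for t
  proof -
    have "tang (c t) (D t)" using upathD(6)[OF u leaf_subset(1) that] by (simp add: vd)
    from sasaki_tang[OF cT this] have "sasaki_norm (c t) (D t) = sqrt ((\<beta>' t \<star> \<beta>' t) / 2)"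
      by (simp add: D_def mink.zero_left)
    also have "\<beta>' t \<star> \<beta>' t = - 2 * (b \<star> b')"
      using nn by (simp add: \<beta>'_def mink_simps minkowski_commute[of b' b])
    finally show ?thesis by simp
  qed
  have "path_length c = integral {0..1::real} (\<lambda>t. sqrt (- (b \<star> b')))"
    unfolding path_length_def vd by (rule integral_cong) (rule sas)
  then have "path_length c = sqrt (- (b \<star> b'))" by simp
  with u show ?thesis by (rule that[unfolded a_b_b'_def[symmetric]])
qed

text \<open>The parabola of \<open>ssl_path\<close> has constant speed and plays the role of a
  straight line. For the lower bound a competitor is paired with the chord \<open>w\<close>, as for
  straight lines in Euclidean space.\<close>

lemma ssl_dist:
  assumes p: "p \<in> T1H" and q: "q \<in> ssl p"
  shows "path_dist (ssl p) p q = sqrt (- (nm p \<star> nm q))"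
proof (rule antisym)
  obtain c0 where c0: "upath c0 (ssl p) p q" "path_length c0 = sqrt (- (nm p \<star> nm q))"
    using ssl_path[OF p q] .
  show "path_dist (ssl p) p q \<le> sqrt (- (nm p \<star> nm q))"
    using path_dist_le[OF c0(1) leaf_subset(1)] c0(2) by simp
  define w where "w = nm q - nm p"
  have qT: "q \<in> T1H" "np q = np p" using q by (auto simp: ssl_def)
  have wa: "w \<star> np p = 0" using T1HD(3)[OF p] T1HD(3)[OF qT(1)] qT(2)
    by (simp add: w_def mink_simps minkowski_commute)
  have ww: "w \<star> w = - 2 * (nm p \<star> nm q)"
    using T1HD(2)[OF p] T1HD(2)[OF qT(1)] by (simp add: w_def mink_simps null_def minkowski_commute[of "nm q" "nm p"])
  have ww0: "w \<star> w \<ge> 0" by (rule null_perp_nonneg[OF T1HD(1)[OF p] wa])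
  have "sqrt (- (nm p \<star> nm q)) \<le> path_length c" if c: "upath c (ssl p) p q" for c
  proof -
    note D = upathD[OF c leaf_subset(1)]
    define D' where "D' t = vector_derivative c (at t)" for t
    note D = upathD[OF c leaf_subset(1), folded D'_def]
    have np0: "np (D' t) = 0" if t: "t \<in> {0..1}" for t
      by (rule has_vector_derivative_constant_on[OF bounded_linear.has_vector_derivative[OF bounded_linear_np D(1)[OF t]] t, of "np p"])
        (use D(3) in \<open>auto simp: ssl_def\<close>)
    have perp: "nm (D' t) \<star> np p = 0" if t: "t \<in> {0..1}" for t
      using D(6)[OF t] D(3)[OF t] np0[OF t] by (simp add: tang_def ssl_def mink.zero_left minkowski_commute)
    have "\<bar>nm (c 1) \<star> w - nm (c 0) \<star> w\<bar> \<le> integral {0..1} (\<lambda>t. sqrt 2 * sqrt (w \<star> w) * sasaki_norm (c t) (D' t))"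
    proof (rule abs_diff_le_integral[where f = "\<lambda>t. nm (c t) \<star> w"])
      fix t :: real assume t: "t \<in> {0..1}"
      have bl: "bounded_linear (\<lambda>u. nm u \<star> w)"
        by (intro bounded_linear_compose[OF mink.bounded_linear_left] bounded_linear_nm)
      show "((\<lambda>t. nm (c t) \<star> w) has_vector_derivative nm (D' t) \<star> w) (at t)"
        by (rule bounded_linear.has_vector_derivative[OF bl D(1)[OF t]])
      show "0 \<le> sqrt 2 * sqrt (w \<star> w) * sasaki_norm (c t) (D' t)"
        using sasaki_bounds(3)[OF D(10)[OF t] D(6)[OF t] e0_timelike(1)] ww0 by simp
      have "(nm (D' t) \<star> w)\<^sup>2 \<le> (nm (D' t) \<star> nm (D' t)) * (w \<star> w)"
        by (rule minkowski_Cauchy_Schwarz, rule null_perp_nonneg[OF T1HD(1)[OF p]])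
          (simp add: mink_simps wa perp[OF t])
      then have "\<bar>nm (D' t) \<star> w\<bar> \<le> sqrt ((nm (D' t) \<star> nm (D' t)) * (w \<star> w))"
        by (rule real_le_rsqrt[of "\<bar>nm (D' t) \<star> w\<bar>", simplified])
      also have "\<dots> = sqrt 2 * sqrt (w \<star> w) * sqrt ((nm (D' t) \<star> nm (D' t)) / 2)"
        by (simp add: real_sqrt_mult real_sqrt_divide)
      also have "sqrt ((nm (D' t) \<star> nm (D' t)) / 2) = sasaki_norm (c t) (D' t)"
        using sasaki_tang[OF D(10)[OF t] D(6)[OF t]] by (simp add: np0[OF t] mink.zero_left)
      finally show "\<bar>nm (D' t) \<star> w\<bar> \<le> sqrt 2 * sqrt (w \<star> w) * sasaki_norm (c t) (D' t)" .
    qed (use D(8) in \<open>auto intro!: continuous_intros\<close>)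
    also have "\<dots> = sqrt 2 * sqrt (w \<star> w) * path_length c" by (simp add: D(9))
    finally have "\<bar>w \<star> w\<bar> \<le> sqrt 2 * sqrt (w \<star> w) * path_length c"
      by (simp add: D(4,5) w_def mink.diff_left)
    then have *: "sqrt (w \<star> w) * sqrt (w \<star> w) \<le> sqrt (w \<star> w) * (sqrt 2 * path_length c)"
      using ww0 by (simp add: mult_ac)
    have "sqrt (w \<star> w) \<le> sqrt 2 * path_length c"
    proof (cases "sqrt (w \<star> w) = 0")
      case True
      then show ?thesis using path_length_nonneg[OF c leaf_subset(1)] by simp
    next
      case False
      then have "sqrt (w \<star> w) > 0" using ww0 by simp
      with * show ?thesis by (simp only: mult_le_cancel_left_pos)
    qed
    also have "sqrt (w \<star> w) = sqrt 2 * sqrt (- (nm p \<star> nm q))"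
      unfolding ww real_sqrt_mult[symmetric] by simp
    finally show ?thesis by simp
  qed
  then show "sqrt (- (nm p \<star> nm q)) \<le> path_dist (ssl p) p q"
    unfolding path_dist_upath using c0(1) by (intro cInf_greatest) blast+
qed

lemma sul_dist:
  assumes p: "p \<in> T1H" and q: "q \<in> sul p"
  shows "path_dist (sul p) p q = sqrt (- (np p \<star> np q))"
proof -
  have "path_dist (flip ` ssl (flip p)) (flip (flip p)) (flip (flip q)) = sqrt (- (np p \<star> np q))"
    unfolding path_dist_flip using ssl_dist[of "flip p" "flip q"] p q
    by (simp add: ssl_def sul_def)
  then show ?thesis by (simp add: flip_ssl)
qed

lemma sul_path:
  assumes p: "p \<in> T1H" and q: "q \<in> sul p"
  obtains c where "upath c (sul p) p q"
proof -
  have "flip p \<in> T1H" "flip q \<in> ssl (flip p)" using p q by (auto simp: ssl_def sul_def)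
  then obtain c where "upath c (ssl (flip p)) (flip p) (flip q)" by (rule ssl_path)
  from upath_image[OF bounded_linear_flip this] show ?thesis by (simp add: flip_ssl that)
qed

section \<open>Joining vectors by smooth paths\<close>

text \<open>The squared positive part is the C1 cutoff used to concatenate paths in
  \<open>upath_trans\<close>: both pieces come to rest at the junction.\<close>

lemma DERIV_pos_part_sq: "((\<lambda>t. (max 0 t)\<^sup>2) has_real_derivative 2 * max 0 t) (at (t::real))"
proof -
  consider "t > 0" | "t < 0" | "t = 0" by linarith
  then show ?thesis
  proof cases
    case 1
    have "((\<lambda>t. t\<^sup>2) has_real_derivative 2 * max 0 t) (at t)"
      using 1 by (auto intro!: derivative_eq_intros)
    then show ?thesis
      by (rule has_field_derivative_transform_within_open[of _ _ _ "{0<..}"]) (use 1 in auto)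
  next
    case 2
    have "((\<lambda>t. 0) has_real_derivative 2 * max 0 t) (at t)"
      using 2 by (auto intro!: derivative_eq_intros)
    then show ?thesis
      by (rule has_field_derivative_transform_within_open[of _ _ _ "{..<0}"]) (use 2 in auto)
  next
    case 3
    have "((\<lambda>h::real. (max 0 h)\<^sup>2 / h) \<longlongrightarrow> 0) (at 0)"
    proof (rule Lim_null_comparison)
      show "((\<lambda>h::real. \<bar>h\<bar>) \<longlongrightarrow> 0) (at 0)" by (auto intro!: tendsto_eq_intros)
      show "\<forall>\<^sub>F h in at 0. norm ((max 0 h)\<^sup>2 / h) \<le> \<bar>h::real\<bar>"
        by (rule always_eventually) (auto simp: max_def power2_eq_square)
    qed
    then show ?thesis using 3 by (simp add: DERIV_def)
  qed
qed

lemma sasaki_scale: "sasaki_norm p (k *\<^sub>R w) = \<bar>k\<bar> * sasaki_norm p w"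
proof -
  define D where "D = snd w + (snd w \<star> fst p) *\<^sub>R fst p"
  have eq: "snd (k *\<^sub>R w) + (snd (k *\<^sub>R w) \<star> fst p) *\<^sub>R fst p = k *\<^sub>R D"
    by (simp add: D_def mink_simps algebra_simps)
  have "sasaki_norm p (k *\<^sub>R w) = sqrt ((k *\<^sub>R fst w) \<star> (k *\<^sub>R fst w) + (k *\<^sub>R D) \<star> (k *\<^sub>R D))"
    by (simp only: sasaki_norm_def case_prod_beta Let_def eq fst_scaleR)
  also have "\<dots> = sqrt (k\<^sup>2 * (fst w \<star> fst w + D \<star> D))"
    by (simp add: mink_simps power2_eq_square algebra_simps)
  also have "\<dots> = \<bar>k\<bar> * sasaki_norm p w"
    by (simp add: real_sqrt_mult sasaki_norm_def case_prod_beta Let_def D_def)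
  finally show ?thesis .
qed

lemma upath_trans:
  assumes 1: "upath c1 W p q" and 2: "upath c2 W q r" and WT: "W \<subseteq> T1H"
  obtains c where "upath c W p r" "path_length c = path_length c1 + path_length c2"
proof -
  define D1 where "D1 t = vector_derivative c1 (at t)" for t
  note D1 = upathD[OF 1 WT, folded D1_def]
  define D2 where "D2 t = vector_derivative c2 (at t)" for t
  note D2 = upathD[OF 2 WT, folded D2_def]
  have W: "c1 t \<in> W" "c2 t \<in> W" if "t \<in> {0..1}" for t using 1 2 that by (auto simp: upath_def)
  have e: "c1 0 = p" "c1 1 = q" "c2 0 = q" "c2 1 = r" using 1 2 by (auto simp: upath_def)
  define s1 where "s1 t = 1 - (max 0 (1 - 2 * t))\<^sup>2" for t :: real
  define s2 where "s2 t = (max 0 (2 * t - 1))\<^sup>2" for t :: real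
  define d1 where "d1 t = 4 * max 0 (1 - 2 * t)" for t :: real
  define d2 where "d2 t = 4 * max 0 (2 * t - 1)" for t :: real
  have s1d: "(s1 has_real_derivative d1 t) (at t)" for t
  proof -
    have "((\<lambda>t. (max 0 (1 - 2 * t))\<^sup>2) has_real_derivative 2 * max 0 (1 - 2 * t) * (- 2)) (at t)"
      by (rule DERIV_chain2[OF DERIV_pos_part_sq]) (auto intro!: derivative_eq_intros)
    from DERIV_diff[OF DERIV_const[of 1] this] show ?thesis by (simp add: s1_def[abs_def] d1_def)
  qed
  have s2d: "(s2 has_real_derivative d2 t) (at t)" for t
  proof -
    have "((\<lambda>t. (max 0 (2 * t - 1))\<^sup>2) has_real_derivative 2 * max 0 (2 * t - 1) * 2) (at t)"
      by (rule DERIV_chain2[OF DERIV_pos_part_sq]) (auto intro!: derivative_eq_intros)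
    then show ?thesis by (simp add: s2_def[abs_def] d2_def)
  qed
  have sq: "(max 0 x)\<^sup>2 \<le> 1" if "x \<le> 1" for x :: real
    using that by (auto simp: power_le_one_iff abs_square_le_1 max_def)
  have r1: "s1 t \<in> {0..1}" and r2: "s2 t \<in> {0..1}" if "t \<in> {0..1}" for t
    using that sq[of "1 - 2 * t"] sq[of "2 * t - 1"] by (auto simp: s1_def s2_def)
  \<comment> \<open>On each half of the interval one of the two summands is constantly
    \<open>q\<close>, so the sum minus \<open>q\<close> runs through the other piece.\<close>
  define c where "c t = c1 (s1 t) + c2 (s2 t) - q" for t
  define D where "D t = d1 t *\<^sub>R D1 (s1 t) + d2 t *\<^sub>R D2 (s2 t)" for t
  have dc: "(c has_vector_derivative D t) (at t)" if t: "t \<in> {0..1}" for t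
  proof -
    have "((c1 \<circ> s1) has_vector_derivative d1 t *\<^sub>R D1 (s1 t)) (at t)"
      by (rule vector_diff_chain_at)
        (use s1d D1 r1[OF t] in \<open>auto simp: has_real_derivative_iff_has_vector_derivative\<close>)
    moreover have "((c2 \<circ> s2) has_vector_derivative d2 t *\<^sub>R D2 (s2 t)) (at t)"
      by (rule vector_diff_chain_at)
        (use s2d D2 r2[OF t] in \<open>auto simp: has_real_derivative_iff_has_vector_derivative\<close>)
    ultimately show ?thesis
      unfolding c_def[abs_def] D_def o_def has_vector_derivative_diff_const
      by (rule has_vector_derivative_add)
  qed
  have cs: "continuous_on {0..1} s1" "continuous_on {0..1} s2"
    unfolding s1_def s2_def by (intro continuous_intros)+
  have cD: "continuous_on {0..1} D"
    unfolding D_def d1_def d2_def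
    by (intro continuous_intros continuous_on_compose2[OF D1(2)] continuous_on_compose2[OF D2(2)] cs)
       (use r1 r2 in auto)
  have "c t \<in> W" if t: "t \<in> {0..1}" for t
  proof (cases "t \<le> 1/2")
    case True
    then have "s2 t = 0" by (simp add: s2_def)
    then show ?thesis using W(1)[OF r1[OF t]] by (simp add: c_def e)
  next
    case False
    then have "s1 t = 1" by (simp add: s1_def)
    then show ?thesis using W(2)[OF r2[OF t]] by (simp add: c_def e)
  qed
  moreover have "c 0 = p" "c 1 = r" by (simp_all add: c_def s1_def s2_def e)
  ultimately have u: "upath c W p r"
    unfolding upath_def C1_differentiable_on_def using dc cD by blast
  define S where "S t = sasaki_norm (c t) (vector_derivative c (at t))" for t
  define S1 where "S1 t = sasaki_norm (c1 t) (D1 t)" for t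
  define S2 where "S2 t = sasaki_norm (c2 t) (D2 t)" for t
  have vd: "vector_derivative c (at t) = D t" if "t \<in> {0..1}" for t
    by (rule vector_derivative_at[OF dc[OF that]])
  have i1: "(S has_integral path_length c1) {0..1/2}"
  proof -
    have "((\<lambda>t. d1 t *\<^sub>R S1 (s1 t)) has_integral integral {s1 0..s1 (1/2)} S1) {0..1/2}"
    proof (rule has_integral_substitution)
      show "continuous_on {0..1} S1" unfolding S1_def by (rule D1(8))
      show "s1 ` {0..1/2} \<subseteq> {0..1}" using r1 by force
      show "(s1 has_real_derivative d1 t) (at t within {0..1/2})" for t
        by (rule has_field_derivative_at_within[OF s1d])
    qed (auto simp: s1_def)
    moreover have "s1 0 = 0" "s1 (1/2) = 1" by (simp_all add: s1_def)
    moreover have "S t = d1 t *\<^sub>R S1 (s1 t)" if "t \<in> {0..1/2}" for t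
      using that vd[of t] sasaki_scale[of "c1 (s1 t)" "d1 t" "D1 (s1 t)"]
      by (simp add: S_def S1_def D_def c_def s2_def d2_def e) (simp add: d1_def)
    ultimately have "(S has_integral integral {0..1} S1) {0..1/2}"
      using has_integral_eq[of "{0..1/2}" "\<lambda>t. d1 t *\<^sub>R S1 (s1 t)" S] by simp
    then show ?thesis using D1(9) by (simp add: S1_def[abs_def])
  qed
  have i2: "(S has_integral path_length c2) {1/2..1}"
  proof -
    have "((\<lambda>t. d2 t *\<^sub>R S2 (s2 t)) has_integral integral {s2 (1/2)..s2 1} S2) {1/2..1}"
    proof (rule has_integral_substitution)
      show "continuous_on {0..1} S2" unfolding S2_def by (rule D2(8))
      show "s2 ` {1/2..1} \<subseteq> {0..1}" using r2 by force
      show "(s2 has_real_derivative d2 t) (at t within {1/2..1})" for t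
        by (rule has_field_derivative_at_within[OF s2d])
    qed (auto simp: s2_def)
    moreover have "s2 (1/2) = 0" "s2 1 = 1" by (simp_all add: s2_def)
    moreover have "S t = d2 t *\<^sub>R S2 (s2 t)" if "t \<in> {1/2..1}" for t
      using that vd[of t] sasaki_scale[of "c2 (s2 t)" "d2 t" "D2 (s2 t)"]
      by (simp add: S_def S2_def D_def c_def s1_def d1_def e) (simp add: d2_def)
    ultimately have "(S has_integral integral {0..1} S2) {1/2..1}"
      using has_integral_eq[of "{1/2..1}" "\<lambda>t. d2 t *\<^sub>R S2 (s2 t)" S] by simp
    then show ?thesis using D2(9) by (simp add: S2_def[abs_def])
  qed
  have "(S has_integral path_length c1 + path_length c2) {0..1}"
    by (rule has_integral_combine[OF _ _ i1 i2]) auto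
  then have "integral {0..1} S = path_length c1 + path_length c2" by (rule integral_unique)
  then have "path_length c = path_length c1 + path_length c2"
    by (simp add: path_length_def[of c] S_def[abs_def])
  with u show ?thesis by (rule that)
qed

lemma upath_rev:
  assumes c: "upath c W p q" and WT: "W \<subseteq> T1H"
  shows "upath (\<lambda>t. c (1 - t)) W q p" "path_length (\<lambda>t. c (1 - t)) = path_length c"
proof -
  define D where "D t = vector_derivative c (at t)" for t
  note D = upathD[OF c WT, folded D_def]
  have d: "((\<lambda>t. c (1 - t)) has_vector_derivative - D (1 - t)) (at t)" if t: "t \<in> {0..1}" for t
  proof -
    have "((c \<circ> (\<lambda>t. 1 - t)) has_vector_derivative (-1) *\<^sub>R D (1 - t)) (at t)"
      by (rule vector_diff_chain_at) (use t D(1)[of "1 - t"] in \<open>auto intro!: derivative_eq_intros\<close>)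
    then show ?thesis by (simp add: o_def)
  qed
  have "continuous_on {0..1} (\<lambda>t. - D (1 - t))"
    by (intro continuous_intros continuous_on_compose2[OF D(2)]) auto
  moreover have "(\<lambda>t. c (1 - t)) ` {0..1} \<subseteq> W" using D(3) by auto
  ultimately show "upath (\<lambda>t. c (1 - t)) W q p"
    unfolding upath_def C1_differentiable_on_def
    by (intro conjI exI[of _ "\<lambda>t. - D (1 - t)"]) (use d D(4,5) in auto)
  define S where "S t = sasaki_norm (c t) (D t)" for t
  have "(S has_integral path_length c) {0..1}"
    unfolding D(9) S_def by (intro integrable_integral integrable_continuous_real D(8))
  then have "((\<lambda>t. S (1 - t)) has_integral path_length c) {0..1}"
    using has_integral_affinity01[of S "path_length c" "-1" 1]
    by (simp add: image_diff_atLeastAtMost[of 1 0 "1::real", simplified] algebra_simps)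
  moreover have "sasaki_norm (c (1 - t)) (vector_derivative (\<lambda>t. c (1 - t)) (at t)) = S (1 - t)" if "t \<in> {0..1}" for t
    using vector_derivative_at[OF d[OF that]] sasaki_scale[of "c (1 - t)" "-1" "D (1 - t)"] by (simp add: S_def)
  ultimately have "((\<lambda>t. sasaki_norm (c (1 - t)) (vector_derivative (\<lambda>t. c (1 - t)) (at t))) has_integral path_length c) {0..1}"
    using has_integral_eq[of "{0..1}" "\<lambda>t. S (1 - t)"] by simp
  then show "path_length (\<lambda>t. c (1 - t)) = path_length c"
    unfolding path_length_def[of "\<lambda>t. c (1 - t)"] by (rule integral_unique)
qed

lemma path_dist_commute:
  assumes WT: "W \<subseteq> T1H"
  shows "path_dist W p q = path_dist W q p"
proof -
  have *: "{path_length c | c. upath c W p q} \<subseteq> {path_length c | c. upath c W q p}" for p q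
    using upath_rev[OF _ WT, of _ p q] by (auto, metis)
  show ?thesis unfolding path_dist_upath using *[of p q] *[of q p] by (simp add: subset_antisym)
qed

lemma path_dist_triangle:
  assumes WT: "W \<subseteq> T1H" and 1: "upath c1 W p q" and 2: "upath c2 W q r"
  shows "path_dist W p r \<le> path_dist W p q + path_dist W q r"
proof (rule field_le_epsilon)
  fix \<epsilon> :: real assume \<epsilon>: "\<epsilon> > 0"
  obtain d1 where d1: "upath d1 W p q" "path_length d1 < path_dist W p q + \<epsilon> / 2"
    using path_dist_less[OF _ 1, of "path_dist W p q + \<epsilon> / 2"] \<epsilon> by auto
  obtain d2 where d2: "upath d2 W q r" "path_length d2 < path_dist W q r + \<epsilon> / 2"
    using path_dist_less[OF _ 2, of "path_dist W q r + \<epsilon> / 2"] \<epsilon> by auto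
  obtain c where c: "upath c W p r" "path_length c = path_length d1 + path_length d2"
    using upath_trans[OF d1(1) d2(1) WT] .
  show "path_dist W p r \<le> path_dist W p q + path_dist W q r + \<epsilon>"
    using path_dist_le[OF c(1) WT] c(2) d1(2) d2(2) by linarith
qed

lemma path_dist_self:
  assumes "p \<in> W" "W \<subseteq> T1H"
  shows "upath (\<lambda>_. p) W p p" "path_dist W p p = 0"
proof -
  show u: "upath (\<lambda>_. p) W p p"
    unfolding upath_def C1_differentiable_on_def using assms by (auto intro!: exI[of _ "\<lambda>_. 0"])
  have "path_length (\<lambda>_. p) = 0"
    using sasaki_scale[of p 0 0] by (simp add: path_length_def)
  then show "path_dist W p p = 0"
    using path_dist_le[OF u assms(2)] path_dist_nonneg[OF u assms(2)] by simp
qed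

lemma upath_mono: "upath c W p q \<Longrightarrow> W \<subseteq> W' \<Longrightarrow> upath c W' p q"
  by (auto simp: upath_def)

lemma flow_path:
  assumes "p \<in> T1H"
  obtains c where "upath c T1H p (flow t p)"
proof (rule that[of "\<lambda>s. flow (t * s) p"])
  have d: "((\<lambda>s. flow (t * s) p) has_vector_derivative
      mk ((t * exp (t * s)) *\<^sub>R np p) ((- t * exp (- (t * s))) *\<^sub>R nm p)) (at s)" for s
  proof -
    have *: "(\<lambda>s. flow (t * s) p) = (\<lambda>s. mk (exp (t * s) *\<^sub>R np p) (exp (- (t * s)) *\<^sub>R nm p))"
      by (intro ext uvec_eqI) simp_all
    show ?thesis unfolding * mk_def
      by (auto intro!: has_vector_derivative_Pair derivative_eq_intros simp: algebra_simps)
  qed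
  show "upath (\<lambda>s. flow (t * s) p) T1H p (flow t p)"
    unfolding upath_def C1_differentiable_on_def
  proof (intro conjI exI ballI)
    show "continuous_on {0..1} (\<lambda>s. mk ((t * exp (t * s)) *\<^sub>R np p) ((- t * exp (- (t * s))) *\<^sub>R nm p))"
      unfolding mk_def by (intro continuous_intros)
  qed (use d assms in auto)
qed

lemma null_eq_scale_of_orthogonal:
  assumes "null a" "null b" "a \<star> b = 0"
  shows "\<exists>r>0. b = r *\<^sub>R a"
  using causal_orthogonal_parallel[OF assms(1,2)[THEN null_causal] assms(3)] assms(1,2)
  by (intro exI[of _ "b $ None / a $ None"]) (auto simp: null_def)

text \<open>Two space axes give three pairwise nonorthogonal null vectors. Each of \<open>a\<close>
  and \<open>a'\<close> can be parallel to at most one of them, so one is left.\<close>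

lemma third_null:
  fixes a a' :: "'n::finite mvec"
  assumes n: "CARD('n) \<ge> 2" and a: "null a" "null a'"
  obtains b where "null b" "a \<star> b < 0" "a' \<star> b < 0"
proof -
  obtain i j :: 'n where ij: "i \<noteq> j"
    using n by (metis One_nat_def UNIV_I card_le_Suc0_iff_eq finite not_less_eq_eq numeral_2_eq_2)
  define N where "N = {e0 + axis (Some i) 1, e0 - axis (Some i) 1, e0 + axis (Some j) (1::real)}"
  have ip: "axis (Some k) (1::real) \<star> axis (Some l) 1 = (if k = l then 1 else 0)"
    "axis (Some k) (1::real) \<star> e0 = 0" "axis (Some k) (1::real) $ (None :: 'n option) = 0" for k l :: 'n
    by (simp_all add: minkowski_eq_inner inner_axis_axis e0_def) (simp_all add: axis_def)
  have e00: "(e0 :: 'n mvec) $ None = 1" by (simp add: e0_def)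
  have null: "null x" if "x \<in> N" for x
    using that ip e00 by (auto simp: N_def null_def mink_simps axis_def)
  have neg: "x \<star> y < 0" if "x \<in> N" "y \<in> N" "x \<noteq> y" for x y
    using that ip ij ij[symmetric] e00 by (auto simp: N_def mink_simps)
  have one: "\<not> (x \<star> u = 0 \<and> y \<star> u = 0)" if "x \<in> N" "y \<in> N" "x \<noteq> y" "null u" for x y u
  proof
    assume *: "x \<star> u = 0 \<and> y \<star> u = 0"
    from null_eq_scale_of_orthogonal[OF null[OF that(1)] that(4)] * obtain r where "r > 0" "u = r *\<^sub>R x" by auto
    with * neg[OF that(1-3)] show False by (simp add: mink_simps minkowski_commute)
  qed
  have dist: "e0 + axis (Some i) 1 \<noteq> e0 - axis (Some i) (1::real)"
    "e0 + axis (Some i) 1 \<noteq> e0 + axis (Some j) (1::real)" "e0 - axis (Some i) 1 \<noteq> e0 + axis (Some j) (1::real)"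
  proof -
    have "(e0 + axis (Some i) 1 :: 'n mvec) $ Some i \<noteq> (e0 - axis (Some i) 1 :: 'n mvec) $ Some i"
      by (simp add: axis_def)
    then show "e0 + axis (Some i) 1 \<noteq> e0 - axis (Some i) (1::real)" by metis
    have "(e0 + axis (Some i) 1 :: 'n mvec) $ Some i \<noteq> (e0 + axis (Some j) 1 :: 'n mvec) $ Some i"
      using ij by (simp add: axis_def)
    then show "e0 + axis (Some i) 1 \<noteq> e0 + axis (Some j) (1::real)" by metis
    have "(e0 - axis (Some i) 1 :: 'n mvec) $ Some i \<noteq> (e0 + axis (Some j) 1 :: 'n mvec) $ Some i"
      using ij by (simp add: axis_def)
    then show "e0 - axis (Some i) 1 \<noteq> e0 + axis (Some j) (1::real)" by metis
  qed
  have "\<exists>b\<in>N. b \<star> a \<noteq> 0 \<and> b \<star> a' \<noteq> 0"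
    using one[of "e0 + axis (Some i) 1" "e0 - axis (Some i) 1"] one[of "e0 + axis (Some i) 1" "e0 + axis (Some j) 1"]
      one[of "e0 - axis (Some i) 1" "e0 + axis (Some j) 1"] dist a
    unfolding N_def by blast
  then obtain b where "b \<in> N" "b \<star> a \<noteq> 0" "b \<star> a' \<noteq> 0" by blast
  then show ?thesis
    using causal_minkowski_nonpos[OF null_causal null_causal, of b a] null[of b] a
      causal_minkowski_nonpos[OF null_causal null_causal, of b a']
    by (intro that[of b]) (auto simp: minkowski_commute less_le)
qed

text \<open>\<open>path_dist\<close> is an infimum and needs some path. One is assembled from a
  stable, an unstable, a flow and a stable piece, through vectors whose backward endpoint is a third
  boundary point \<open>b\<close>.\<close>

lemma T1H_path:
  fixes p q :: "'n::finite uvec"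
  assumes n: "CARD('n) \<ge> 2" and p: "p \<in> T1H" and q: "q \<in> T1H"
  obtains c where "upath c T1H p q"
proof -
  define J where "J p q \<longleftrightarrow> (\<exists>c. upath c (T1H :: 'n uvec set) p q)" for p q
  have tr: "J x z" if "J x y" "J y z" for x y z using that upath_trans[OF _ _ order_refl] unfolding J_def by metis
  have s: "J x y" if "x \<in> T1H" "y \<in> T1H" "np x = np y" for x y
  proof -
    have "y \<in> ssl x" using that by (simp add: ssl_def)
    then show ?thesis using ssl_path[OF that(1)] upath_mono[OF _ leaf_subset(1)] unfolding J_def by metis
  qed
  have u: "J x y" if "x \<in> T1H" "y \<in> T1H" "nm x = nm y" for x y
  proof -
    have "y \<in> sul x" using that by (simp add: sul_def)
    then show ?thesis using sul_path[OF that(1)] upath_mono[OF _ leaf_subset(2)] unfolding J_def by metis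
  qed
  obtain b where b: "null b" "np p \<star> b < 0" "np q \<star> b < 0"
    using third_null[OF n T1HD(1)[OF p] T1HD(1)[OF q]] .
  define x where "x = nmk (np p) b"
  define y where "y = nmk (np q) b"
  have xy: "x \<in> T1H" "y \<in> T1H"
    unfolding x_def y_def using b p q by (auto intro!: nmk_in_T1H T1HD)
  have xy': "np x = np p" "np y = np q"
    by (simp_all add: x_def y_def nmk_def)
  note xy = xy xy'
  \<comment> \<open>The flow time that aligns the scales at \<open>b\<close>: it makes
    \<open>nm (flow t y)\<close> equal to \<open>nm x\<close>.\<close>
  define t where "t = ln ((np p \<star> b) / (np q \<star> b))"
  have et: "exp t = (np p \<star> b) / (np q \<star> b)" using b by (simp add: t_def divide_neg_neg)
  have nm: "nm (flow t y) = nm x"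
    using b by (simp add: x_def y_def nmk_def exp_minus et)
  have "J p x" using s xy p by auto
  moreover have "J x (flow t y)" using u xy nm by auto
  moreover have "J (flow t y) y" using flow_path[of "flow t y" "- t"] xy unfolding J_def by (auto simp: flow_add)
  moreover have "J y q" using s xy q by auto
  ultimately have "J p q" using tr by blast
  then show ?thesis using that by (auto simp: J_def)
qed

section \<open>The stable and unstable leaves\<close>

lemma path_dist_T1H_bound:
  fixes p q :: "'n::finite uvec"
  assumes n: "CARD('n) \<ge> 2" and p: "p \<in> T1H" and q: "q \<in> T1H" and m: "causal m" "m \<star> m < 0"
  shows "\<bar>ln (- (m \<star> fst q)) - ln (- (m \<star> fst p))\<bar> \<le> path_dist T1H p q"
proof -
  obtain c where c: "upath c T1H p q" using T1H_path[OF n p q] .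
  show ?thesis
    unfolding path_dist_upath
    using c upath_ln_bound[OF _ order_refl m, of _ p q 1]
    by (intro cInf_greatest) (auto simp: upath_def)
qed

text \<open>In one direction the flow contracts the leaf by \<open>exp (- t)\<close>. In the other,
  the distance bounds the difference of logarithms of every timelike functional; in the limit this
  compares the functional at \<open>np p\<close> and \<open>np q\<close>, and such functionals
  separate points.\<close>

lemma strong_stable_eq:
  fixes p :: "'n::finite uvec"
  assumes n: "CARD('n) \<ge> 2" and p: "p \<in> T1H"
  shows "strong_stable p = ssl p"
proof
  show "ssl p \<subseteq> strong_stable p"
  proof
    fix q assume q: "q \<in> ssl p"
    then have qT: "q \<in> T1H" by (simp add: ssl_def)
    have bd: "0 \<le> path_dist T1H (flow t p) (flow t q) \<and> path_dist T1H (flow t p) (flow t q) \<le> exp (- t) * sqrt (- (nm p \<star> nm q))" for t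
    proof -
      have "flow t q \<in> ssl (flow t p)" using q by (simp add: ssl_def)
      then obtain c where c: "upath c (ssl (flow t p)) (flow t p) (flow t q)"
        "path_length c = sqrt (- (nm (flow t p) \<star> nm (flow t q)))"
        using ssl_path[of "flow t p" "flow t q"] p by auto
      have c': "upath c T1H (flow t p) (flow t q)" by (rule upath_mono[OF c(1) leaf_subset(1)])
      have *: "- (nm (flow t p) \<star> nm (flow t q)) = (exp (- t))\<^sup>2 * - (nm p \<star> nm q)"
        by (simp add: mink_simps power2_eq_square)
      have "path_length c = exp (- t) * sqrt (- (nm p \<star> nm q))"
        unfolding c(2) * real_sqrt_mult by simp
      with path_dist_le[OF c' order_refl] path_dist_nonneg[OF c' order_refl] show ?thesis by simp
    qed
    have "((\<lambda>t. exp (- t) * sqrt (- (nm p \<star> nm q))) \<longlongrightarrow> 0) at_top"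
      by real_asymp
    then have "((\<lambda>t. path_dist T1H (flow t p) (flow t q)) \<longlongrightarrow> 0) at_top"
      by (rule tendsto_sandwich[OF _ _ tendsto_const, rotated 2]) (use bd in auto)
    then show "q \<in> strong_stable p" using p qT by (simp add: strong_stable_def)
  qed
  show "strong_stable p \<subseteq> ssl p"
  proof
    fix q assume q: "q \<in> strong_stable p"
    then have qT: "q \<in> T1H" and lim: "((\<lambda>t. path_dist T1H (flow t p) (flow t q)) \<longlongrightarrow> 0) at_top"
      by (auto simp: strong_stable_def)
    have "np p = np q"
    proof (rule minkowski_eqI)
      fix m :: "'n mvec" assume m: "causal m" "m \<star> m < 0"
      \<comment> \<open>The factor \<open>exp (- t)\<close> cancels the growth along the flow and
        drops out of differences of logarithms; the limit sees \<open>np r\<close> alone.\<close>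
      define f where "f r t = exp (- t) * - (m \<star> fst (flow t r))" for r t
      have neg: "m \<star> np r < 0" "m \<star> fst (flow t r) < 0" if "r \<in> T1H" for r t
        using timelike_causal_neg[OF m(1) null_causal[OF T1HD(1)[OF that]] m(2)]
          timelike_causal_neg[OF m(1) hyp_space_causal[OF fst_T1H, of "flow t r"] m(2)] that by auto
      have f: "(f r \<longlongrightarrow> - (m \<star> np r) / 2) at_top" for r
      proof -
        have "f r = (\<lambda>t. - (m \<star> np r) / 2 - (m \<star> nm r) / 2 * exp (- 2 * t))"
        proof
          fix t
          have "m \<star> fst (flow t r) = (exp t * (m \<star> np r) + exp (- t) * (m \<star> nm r)) / 2"
            by (simp add: fst_np_nm mink_simps)
          then have "f r t = - (exp (- t) * exp t * (m \<star> np r) + exp (- t) * exp (- t) * (m \<star> nm r)) / 2"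
            unfolding f_def by (simp only:) (simp add: field_simps)
          also have "exp (- t) * exp t = 1" by (simp flip: exp_add)
          also have "exp (- t) * exp (- t) = exp (- 2 * t)" by (simp flip: exp_add)
          finally show "f r t = - (m \<star> np r) / 2 - (m \<star> nm r) / 2 * exp (- 2 * t)"
            by (simp add: field_simps)
        qed
        moreover have e: "((\<lambda>t. exp (- 2 * t)) \<longlongrightarrow> (0::real)) at_top" by real_asymp
        have "((\<lambda>t. - (m \<star> np r) / 2 - (m \<star> nm r) / 2 * exp (- 2 * t)) \<longlongrightarrow>
            - (m \<star> np r) / 2 - (m \<star> nm r) / 2 * 0) at_top"
          by (intro tendsto_diff tendsto_mult tendsto_const e)
        ultimately show ?thesis by simp
      qed
      have 1: "((\<lambda>t. ln (f q t) - ln (f p t)) \<longlongrightarrow> ln (- (m \<star> np q) / 2) - ln (- (m \<star> np p) / 2)) at_top"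
        using neg(1)[OF p] neg(1)[OF qT] by (intro tendsto_intros f) auto
      have 2: "((\<lambda>t. ln (f q t) - ln (f p t)) \<longlongrightarrow> 0) at_top"
      proof (rule Lim_null_comparison[OF _ lim])
        have "ln (f r t) = - t + ln (- (m \<star> fst (flow t r)))" if "r \<in> T1H" for r t
          unfolding f_def by (subst ln_mult_pos) (use neg(2)[OF that, of t] in auto)
        then have "\<bar>ln (f q t) - ln (f p t)\<bar> \<le> path_dist T1H (flow t p) (flow t q)" for t
          using path_dist_T1H_bound[OF n, of "flow t p" "flow t q" m] p qT m
          by simp
        then show "\<forall>\<^sub>F t in at_top. norm (ln (f q t) - ln (f p t)) \<le> path_dist T1H (flow t p) (flow t q)"
          by simp
      qed
      have "ln (- (m \<star> np q) / 2) - ln (- (m \<star> np p) / 2) = 0"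
        using tendsto_unique[OF _ 1 2] by simp
      then show "m \<star> np p = m \<star> np q" using neg(1)[OF p] neg(1)[OF qT] by simp
    qed
    then show "q \<in> ssl p" using qT by (simp add: ssl_def)
  qed
qed

lemma strong_unstable_eq:
  fixes p :: "'n::finite uvec"
  assumes n: "CARD('n) \<ge> 2" and p: "p \<in> T1H"
  shows "strong_unstable p = sul p"
proof -
  have "path_dist T1H (flow (- t) p) (flow (- t) q) = path_dist T1H (flow t (flip p)) (flow t (flip q))" for t q
    using path_dist_flip[of T1H "flow (- t) p" "flow (- t) q"] by (simp add: flip_image_T1H flip_flow)
  then have "strong_unstable p = {q. flip q \<in> strong_stable (flip p)}"
    by (auto simp: strong_unstable_def strong_stable_def)
  also have "\<dots> = sul p" using strong_stable_eq[OF n, of "flip p"] p by (auto simp: ssl_def sul_def)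
  finally show ?thesis .
qed

lemma weak_unstable_eq:
  fixes p :: "'n::finite uvec"
  assumes n: "CARD('n) \<ge> 2" and p: "p \<in> T1H"
  shows "weak_unstable p = wul p"
  unfolding weak_unstable_def strong_unstable_eq[OF assms]
proof
  show "(\<Union>t. flow t ` sul p) \<subseteq> wul p"
  proof (rule UN_least, rule subsetI)
    fix t x assume "x \<in> flow t ` sul p"
    then obtain q where "x = flow t q" "q \<in> sul p" by blast
    then show "x \<in> wul p"
      unfolding wul_def by (intro CollectI conjI exI[of _ "exp (- t)"]) (auto simp: sul_def)
  qed
  show "wul p \<subseteq> (\<Union>t. flow t ` sul p)"
  proof
    fix q assume "q \<in> wul p"
    then obtain r where r: "r > 0" "nm q = r *\<^sub>R nm p" "q \<in> T1H" by (auto simp: wul_def)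
    have "flow (ln r) q \<in> sul p" using r by (simp add: sul_def exp_minus)
    moreover have "q = flow (- ln r) (flow (ln r) q)" by (simp add: flow_add)
    ultimately show "q \<in> (\<Union>t. flow t ` sul p)" by blast
  qed
qed

section \<open>Paths in weak unstable leaves\<close>

text \<open>The Sasaki speed after projection along \<open>b\<close>, in terms of \<open>y\<close>,
  \<open>y'\<close> and \<open>b\<close> and for \<open>y\<close> that need not be null. This makes
  the length of the projected curve visibly continuous in its data.\<close>

definition wspeed :: "'n::finite mvec \<Rightarrow> 'n mvec \<Rightarrow> 'n mvec \<Rightarrow> real" where
  "wspeed y y' b = sqrt ((y' \<star> y' + 2 * (- (y \<star> y') / (y \<star> b) + (y \<star> y) * (y' \<star> b) / (2 * (y \<star> b)\<^sup>2)) * (y' \<star> b)) / 2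
     + ((y' \<star> b) / (y \<star> b))\<^sup>2)"

text \<open>A curve \<open>y\<close> is projected along \<open>b\<close> to a curve of null vectors, which determines a curve in a weak unstable leaf.\<close>

lemma wul_lift:
  fixes y y' :: "real \<Rightarrow> 'n::finite mvec"
  assumes b: "null b"
    and d: "\<And>t. t \<in> {0..1} \<Longrightarrow> (y has_vector_derivative y' t) (at t)" "continuous_on {0..1} y'"
    and neg: "\<And>t. t \<in> {0..1} \<Longrightarrow> y t \<star> b < 0"
    and ends: "null (y 0)" "null (y 1)"
  obtains c where "upath c (wul (nmk (y 0) b)) (nmk (y 0) b) (nmk (y 1) b)"
    "path_length c = integral {0..1} (\<lambda>t. wspeed (y t) (y' t) b)"
proof -
  have bb: "b \<star> b = 0" using b by (simp add: null_def)
  define g where "g t = y t \<star> b" for t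
  define g' where "g' t = y' t \<star> b" for t
  have gneg: "g t < 0" if "t \<in> {0..1}" for t using neg[OF that] by (simp add: g_def)
  \<comment> \<open>This multiple of \<open>b\<close> makes \<open>\<alpha> t\<close> null, because
    \<open>b\<close> itself is null.\<close>
  define k where "k t = - (y t \<star> y t) / (2 * g t)" for t
  define k' where "k' t = - (y t \<star> y' t) / g t + (y t \<star> y t) * g' t / (2 * (g t)\<^sup>2)" for t
  define \<alpha> where "\<alpha> t = y t + k t *\<^sub>R b" for t
  define \<alpha>' where "\<alpha>' t = y' t + k' t *\<^sub>R b" for t
  define \<beta> where "\<beta> t = (- 2 / g t) *\<^sub>R b" for t
  define \<beta>' where "\<beta>' t = (2 * g' t / (g t)\<^sup>2) *\<^sub>R b" for t
  define c where "c t = mk (\<alpha> t) (\<beta> t)" for t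
  define D where "D t = mk (\<alpha>' t) (\<beta>' t)" for t
  have dg: "(g has_real_derivative g' t) (at t)" if t: "t \<in> {0..1}" for t
    using bounded_linear.has_vector_derivative[OF mink.bounded_linear_left d(1)[OF t], of b]
    by (simp add: g_def[abs_def] g'_def has_real_derivative_iff_has_vector_derivative)
  have dyy: "((\<lambda>t. y t \<star> y t) has_real_derivative 2 * (y t \<star> y' t)) (at t)" if t: "t \<in> {0..1}" for t
    using mink.has_vector_derivative[OF d(1)[OF t] d(1)[OF t]]
    by (simp add: has_real_derivative_iff_has_vector_derivative minkowski_commute[of "y' t" "y t"])
  have dk: "(k has_real_derivative k' t) (at t)" if t: "t \<in> {0..1}" for t
    unfolding k_def[abs_def] k'_def
    using gneg[OF t] by (auto intro!: derivative_eq_intros dg[OF t] dyy[OF t] simp: field_simps power2_eq_square)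
  have d\<alpha>: "(\<alpha> has_vector_derivative \<alpha>' t) (at t)" if t: "t \<in> {0..1}" for t
    unfolding \<alpha>_def[abs_def] \<alpha>'_def
    by (rule has_vector_derivative_add[OF d(1)[OF t]])
       (use has_vector_derivative_scaleR[OF dk[OF t] has_vector_derivative_const] in simp)
  have d\<beta>: "(\<beta> has_vector_derivative \<beta>' t) (at t)" if t: "t \<in> {0..1}" for t
  proof -
    have "((\<lambda>t. - 2 / g t) has_real_derivative 2 * g' t / (g t)\<^sup>2) (at t)"
      using gneg[OF t] by (auto intro!: derivative_eq_intros dg[OF t] simp: field_simps power2_eq_square)
    from has_vector_derivative_scaleR[OF this has_vector_derivative_const] show ?thesis
      by (simp add: \<beta>_def[abs_def] \<beta>'_def)
  qed
  have dc: "(c has_vector_derivative D t) (at t)" if t: "t \<in> {0..1}" for t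
    unfolding c_def[abs_def] D_def mk_def
    by (intro has_vector_derivative_Pair bounded_linear.has_vector_derivative[OF bounded_linear_scaleR_right]
        has_vector_derivative_add has_vector_derivative_diff d\<alpha>[OF t] d\<beta>[OF t])
  have cy: "continuous_on {0..1} y"
    using d(1) by (meson continuous_at_imp_continuous_on has_vector_derivative_continuous)
  have cg: "continuous_on {0..1} g" "continuous_on {0..1} g'"
    unfolding g_def g'_def by (intro continuous_intros cy d(2))+
  have cD: "continuous_on {0..1} D"
    unfolding D_def mk_def \<alpha>'_def \<beta>'_def k'_def
    by (intro continuous_intros cy cg d(2)) (use gneg in force)+
  have \<alpha>b: "\<alpha> t \<star> b = g t" for t using bb by (simp add: \<alpha>_def g_def mink_simps)
  have \<alpha>\<alpha>: "\<alpha> t \<star> \<alpha> t = 0" if t: "t \<in> {0..1}" for t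
    using gneg[OF t] bb by (simp add: \<alpha>_def mink_simps minkowski_commute[of b "y t"] k_def flip: g_def)
  have cn: "c t = nmk (\<alpha> t) b" for t by (simp add: c_def nmk_def \<beta>_def \<alpha>b)
  have \<alpha>null: "null (\<alpha> t)" if t: "t \<in> {0..1}" for t
    by (rule null_neg_future[OF \<alpha>\<alpha>[OF t] _ b]) (use gneg[OF t] in \<open>simp add: \<alpha>b\<close>)
  have cT: "c t \<in> T1H" if t: "t \<in> {0..1}" for t
    unfolding cn by (rule nmk_in_T1H[OF \<alpha>null[OF t] b]) (use gneg[OF t] in \<open>simp add: \<alpha>b\<close>)
  have ends': "\<alpha> 0 = y 0" "\<alpha> 1 = y 1"
    using ends by (auto simp: \<alpha>_def k_def null_def)
  have cW: "c t \<in> wul (nmk (y 0) b)" if t: "t \<in> {0..1}" for t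
  proof -
    have "nm (c t) = (g 0 / g t) *\<^sub>R nm (nmk (y 0) b)"
      using gneg[of 0] by (simp add: c_def \<beta>_def nmk_def flip: g_def)
    moreover have "g 0 / g t > 0" using gneg[of 0] gneg[OF t] by (simp add: divide_neg_neg)
    ultimately show ?thesis using cT[OF t] by (auto simp: wul_def)
  qed
  have u: "upath c (wul (nmk (y 0) b)) (nmk (y 0) b) (nmk (y 1) b)"
    unfolding upath_def C1_differentiable_on_def
  proof (intro conjI exI[of _ D])
    show "c ` {0..1} \<subseteq> wul (nmk (y 0) b)" using cW by blast
  qed (use dc cD cn ends' in auto)
  have "path_length c = integral {0..1} (\<lambda>t. wspeed (y t) (y' t) b)"
    unfolding path_length_def
  proof (rule integral_cong)
    fix t :: real assume t: "t \<in> {0..1}"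
    have vd: "vector_derivative c (at t) = D t" by (rule vector_derivative_at[OF dc[OF t]])
    have tang: "tang (c t) (D t)"
      using upathD(6)[OF u leaf_subset(3) t] by (simp add: vd)
    have 1: "\<alpha>' t \<star> \<alpha>' t = y' t \<star> y' t + 2 * k' t * (y' t \<star> b)"
      using bb by (simp add: \<alpha>'_def mink_simps minkowski_commute[of b "y' t"])
    have 2: "\<alpha>' t \<star> \<beta> t / 2 = - ((y' t \<star> b) / (y t \<star> b))"
      using bb by (simp add: \<alpha>'_def \<beta>_def mink_simps g_def)
    have 3: "\<beta>' t \<star> \<beta>' t = 0" using bb by (simp add: \<beta>'_def mink_simps)
    have "sasaki_norm (c t) (D t) = sqrt ((\<alpha>' t \<star> \<alpha>' t + 0) / 2 + (\<alpha>' t \<star> \<beta> t / 2)\<^sup>2)"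
      using sasaki_tang[OF cT[OF t] tang] 3 by (simp add: D_def c_def)
    also have "\<dots> = wspeed (y t) (y' t) b"
      unfolding 1 2 wspeed_def k'_def g_def g'_def by simp
    finally show "sasaki_norm (c t) (vector_derivative c (at t)) = wspeed (y t) (y' t) b"
      by (simp add: vd)
  qed
  with u show ?thesis by (rule that)
qed

lemma wul_neg: "p \<in> T1H \<Longrightarrow> q \<in> wul p \<Longrightarrow> np q \<star> nm p < 0"
proof -
  assume p: "p \<in> T1H" and "q \<in> wul p"
  then obtain r where r: "r > 0" "nm q = r *\<^sub>R nm p" "q \<in> T1H" by (auto simp: wul_def)
  have "r * (np q \<star> nm p) = -2" using T1HD(3)[OF r(3)] r(2) by (simp add: mink_simps)
  then show "np q \<star> nm p < 0" using r(1) by (smt (verit) mult_nonneg_nonneg)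
qed

lemma wul_nmk: "p \<in> T1H \<Longrightarrow> q \<in> wul p \<Longrightarrow> nmk (np q) (nm p) = q"
proof -
  assume p: "p \<in> T1H" and "q \<in> wul p"
  then obtain r where r: "r > 0" "nm q = r *\<^sub>R nm p" "q \<in> T1H" by (auto simp: wul_def)
  have *: "r * (np q \<star> nm p) = -2" using T1HD(3)[OF r(3)] r(2) by (simp add: mink_simps)
  then have "np q \<star> nm p \<noteq> 0" by auto
  with * have "- 2 / (np q \<star> nm p) = r" by (metis nonzero_mult_div_cancel_right)
  then show "nmk (np q) (nm p) = q" by (intro uvec_eqI) (simp_all add: nmk_def r(2))
qed

lemma wul_path:
  assumes p: "p \<in> T1H" and q: "q \<in> wul p"
  obtains c where "upath c (wul p) p q"
proof -
  have qT: "q \<in> T1H" using q by (simp add: wul_def)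
  have n: "np p \<star> nm p < 0" "np q \<star> nm p < 0" using wul_neg[OF p q] T1HD(3)[OF p] by auto
  define y where "y t = (1 - t) *\<^sub>R np p + t *\<^sub>R np q" for t :: real
  have 1: "(y has_vector_derivative np q - np p) (at t)" for t
    unfolding y_def[abs_def] by (auto intro!: derivative_eq_intros)
  have 2: "y t \<star> nm p < 0" if "t \<in> {0..1}" for t
  proof (cases "t = 0")
    case False
    with that n have "t * (np q \<star> nm p) < 0" "(1 - t) * (np p \<star> nm p) \<le> 0"
      by (auto simp: mult_pos_neg mult_nonneg_nonpos)
    then show ?thesis by (simp add: y_def mink_simps)
  qed (use n in \<open>simp add: y_def\<close>)
  have 3: "null (y 0)" "null (y 1)" using T1HD(1)[OF p] T1HD(1)[OF qT] by (simp_all add: y_def)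
  obtain c where "upath c (wul (nmk (y 0) (nm p))) (nmk (y 0) (nm p)) (nmk (y 1) (nm p))"
    by (rule wul_lift[OF T1HD(2)[OF p] 1 continuous_on_const 2 3])
  then show ?thesis using that by (simp add: y_def nmk_self[OF p] wul_nmk[OF p q])
qed

text \<open>Within a weak unstable leaf \<open>nm\<close> stays on one ray and is determined by
  \<open>np\<close> through the product -2, so the length can be read off from the \<open>np\<close>
  part.\<close>

lemma wul_length:
  assumes p: "p \<in> T1H" and c: "upath c (wul p) p q"
  shows "path_length c = integral {0..1} (\<lambda>t. wspeed (np (c t)) (np (vector_derivative c (at t))) (nm p))"
  unfolding upathD(9)[OF c leaf_subset(3)]
proof (rule integral_cong)
  fix t :: real assume t: "t \<in> {0..1}"
  define D where "D t = vector_derivative c (at t)" for t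
  note D = upathD[OF c leaf_subset(3), folded D_def]
  define b where "b = nm p"
  have bb: "b \<star> b = 0" "b $ None > 0" using T1HD(2)[OF p] by (auto simp: b_def null_def)
  obtain r where r: "r > 0" "nm (c t) = r *\<^sub>R b" using D(3)[OF t] by (auto simp: wul_def b_def)
  have "r * (np (c t) \<star> b) = -2" using T1HD(3)[OF D(10)[OF t]] r(2) by (simp add: mink_simps)
  then have ne: "np (c t) \<star> b \<noteq> 0" and r2: "r = - 2 / (np (c t) \<star> b)"
    by (auto, metis divide_minus_left mult_zero_right neg_equal_0_iff_equal nonzero_mult_div_cancel_right zero_neq_numeral)
  have bl: "bounded_linear (\<lambda>w. (nm w $ None) *\<^sub>R b - (b $ None) *\<^sub>R nm w)"
    by (intro bounded_linear_sub bounded_linear_compose[OF bounded_linear_scaleR_left]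
        bounded_linear_compose[OF bounded_linear_scaleR_right] bounded_linear_compose[OF bounded_linear_vec_nth] bounded_linear_nm)
  have "(nm (D t) $ None) *\<^sub>R b - (b $ None) *\<^sub>R nm (D t) = 0"
  proof (rule has_vector_derivative_constant_on[OF bounded_linear.has_vector_derivative[OF bl D(1)[OF t]] t])
    fix s :: real assume s: "s \<in> {0..1}"
    then show "(nm (c s) $ None) *\<^sub>R b - (b $ None) *\<^sub>R nm (c s) = 0"
      using D(3)[OF s] by (auto simp: wul_def b_def)
  qed
  then have e: "(b $ None) *\<^sub>R nm (D t) = (nm (D t) $ None) *\<^sub>R b" by simp
  have "(b $ None)\<^sup>2 * (nm (D t) \<star> nm (D t)) = ((b $ None) *\<^sub>R nm (D t)) \<star> ((b $ None) *\<^sub>R nm (D t))"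
    by (simp add: mink_simps power2_eq_square)
  also have "\<dots> = 0" unfolding e using bb by (simp add: mink_simps)
  finally have 0: "nm (D t) \<star> nm (D t) = 0" using bb by simp
  have y: "np (c t) \<star> np (c t) = 0" "np (c t) \<star> np (D t) = 0"
    using T1HD(1)[OF D(10)[OF t]] D(6)[OF t] by (auto simp: null_def tang_def)
  have "sasaki_norm (c t) (D t) = sqrt ((np (D t) \<star> np (D t)) / 2 + (np (D t) \<star> b / (np (c t) \<star> b))\<^sup>2)"
    unfolding sasaki_tang[OF D(10)[OF t] D(6)[OF t]] 0 r(2) by (simp add: mink_simps r2)
  then show "sasaki_norm (c t) (vector_derivative c (at t)) = wspeed (np (c t)) (np (vector_derivative c (at t))) (nm p)"
    using y by (simp add: wspeed_def b_def D_def)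
qed

text \<open>Instead of computing the distance, a path shorter than \<open>e\<close> is perturbed:
  its \<open>np\<close> part is corrected affinely to the new endpoints and projected into the new
  leaf by \<open>wul_lift\<close>, and the resulting length depends continuously on the
  data.\<close>

lemma wul_dist_eventually:
  fixes p q :: "'n::finite uvec"
  assumes p: "p \<in> T1H" and q: "q \<in> wul p" and e: "path_dist (wul p) p q < e"
    and A: "(A \<longlongrightarrow> np p) F" and A1: "(A1 \<longlongrightarrow> np q) F" and B: "(B \<longlongrightarrow> nm p) F"
    and null: "\<forall>\<^sub>F i in F. null (A i)" "\<forall>\<^sub>F i in F. null (A1 i)" "\<forall>\<^sub>F i in F. null (B i)"
  shows "\<forall>\<^sub>F i in F. path_dist (wul (nmk (A i) (B i))) (nmk (A i) (B i)) (nmk (A1 i) (B i)) < e"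
proof -
  obtain c0 where c0: "upath c0 (wul p) p q" using wul_path[OF p q] .
  obtain c where c: "upath c (wul p) p q" "path_length c < e" using path_dist_less[OF e c0] .
  define D where "D t = vector_derivative c (at t)" for t
  note D = upathD[OF c(1) leaf_subset(3), folded D_def]
  \<comment> \<open>The parameter collects the displacements of the two endpoints and the new
    backward vector; \<open>Y\<close> spreads the displacements linearly over the path.\<close>
  define Y :: "'n mvec \<times> 'n mvec \<times> 'n mvec \<Rightarrow> real \<Rightarrow> 'n mvec"
    where "Y \<theta> t = np (c t) + (1 - t) *\<^sub>R fst \<theta> + t *\<^sub>R fst (snd \<theta>)" for \<theta> t
  define Y' :: "'n mvec \<times> 'n mvec \<times> 'n mvec \<Rightarrow> real \<Rightarrow> 'n mvec"
    where "Y' \<theta> t = np (D t) + (fst (snd \<theta>) - fst \<theta>)" for \<theta> t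
  define G where "G = (\<lambda>(\<theta> :: 'n mvec \<times> 'n mvec \<times> 'n mvec, t). Y \<theta> t \<star> snd (snd \<theta>))"
  have dY: "(Y \<theta> has_vector_derivative Y' \<theta> t) (at t)" if "t \<in> {0..1}" for \<theta> t
    unfolding Y_def[abs_def] Y'_def
    using bounded_linear.has_vector_derivative[OF bounded_linear_np D(1)[OF that]]
    by (auto intro!: derivative_eq_intros simp: algebra_simps)
  have cY': "continuous_on {0..1} (Y' \<theta>)" for \<theta>
    unfolding Y'_def[abs_def] by (intro continuous_intros D(2))
  have snd_cont: "continuous_on (V \<times> {0..1}) (\<lambda>z. c (snd z))" "continuous_on (V \<times> {0..1}) (\<lambda>z. D (snd z))"
    for V :: "('n mvec \<times> 'n mvec \<times> 'n mvec) set"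
    by (rule continuous_on_compose2[OF D(7)] continuous_on_compose2[OF D(2)], auto intro!: continuous_intros)+
  have cY2: "continuous_on (V \<times> {0..1}) (\<lambda>z. Y (fst z) (snd z))" "continuous_on (V \<times> {0..1}) (\<lambda>z. Y' (fst z) (snd z))"
    for V :: "('n mvec \<times> 'n mvec \<times> 'n mvec) set"
    unfolding Y_def Y'_def by (intro continuous_intros snd_cont)+
  have cG: "continuous_on (UNIV \<times> {0..1}) G"
    unfolding G_def case_prod_beta by (intro continuous_intros cY2)
  define \<theta>0 :: "'n mvec \<times> 'n mvec \<times> 'n mvec" where "\<theta>0 = (0, 0, nm p)"
  have Y0: "Y \<theta>0 t = np (c t)" "Y' \<theta>0 t = np (D t)" for t by (simp_all add: Y_def Y'_def \<theta>0_def)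
  have G0: "G (\<theta>0, t) < 0" if t: "t \<in> {0..1}" for t
    using wul_neg[OF p D(3)[OF t]] by (simp add: G_def Y0) (simp add: \<theta>0_def)
  have "continuous_on {0..1} (\<lambda>t. G (\<theta>0, t))"
    by (rule continuous_on_compose2[OF cG]) (auto intro!: continuous_intros)
  then obtain tm where tm: "tm \<in> {0..1}" "\<forall>t\<in>{0..1}. G (\<theta>0, t) \<le> G (\<theta>0, tm)"
    using continuous_attains_sup[of "{0..1}" "\<lambda>t. G (\<theta>0, t)"] by auto
  \<comment> \<open>Compactness of the interval gives a uniform negative bound, so perturbed curves
    stay where the projection along the backward vector is defined.\<close>
  define \<mu> where "\<mu> = - G (\<theta>0, tm) / 2"
  have \<mu>: "\<mu> > 0" using G0[OF tm(1)] by (simp add: \<mu>_def)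
  obtain V where V: "\<theta>0 \<in> V" "open V" "\<forall>\<theta>\<in>V \<inter> UNIV. \<forall>t\<in>{0..1}. dist (G (\<theta>, t)) (G (\<theta>0, t)) \<le> \<mu>"
    using continuous_on_prod_compactE[OF cG compact_Icc UNIV_I \<mu>] by blast
  have GV: "Y \<theta> t \<star> snd (snd \<theta>) < 0" if "\<theta> \<in> V" "t \<in> {0..1}" for \<theta> t
  proof -
    have "\<bar>G (\<theta>, t) - G (\<theta>0, t)\<bar> \<le> \<mu>" using V(3) that by (auto simp: dist_real_def)
    moreover have "G (\<theta>0, t) \<le> - 2 * \<mu>" using tm(2) that(2) by (auto simp: \<mu>_def)
    ultimately have "G (\<theta>, t) < 0" using \<mu> by linarith
    then show ?thesis by (simp add: G_def)
  qed
  define L where "L \<theta> = integral (cbox 0 1) (\<lambda>t. wspeed (Y \<theta> t) (Y' \<theta> t) (snd (snd \<theta>)))" for \<theta>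
  have "continuous_on V L"
    unfolding L_def
  proof (rule integral_continuous_on_param)
    show "continuous_on (V \<times> cbox 0 1) (\<lambda>(\<theta>, t). wspeed (Y \<theta> t) (Y' \<theta> t) (snd (snd \<theta>)))"
      unfolding wspeed_def case_prod_beta cbox_interval
      by (intro continuous_intros cY2) (use GV in force)+
  qed
  then have contL: "isCont L \<theta>0" using V continuous_on_eq_continuous_at by blast
  have "L \<theta>0 = path_length c"
    using wul_length[OF p c(1)] by (simp add: L_def Y0 D_def[symmetric]) (simp add: \<theta>0_def D_def)
  then have "L \<theta>0 < e" using c(2) by simp
  then have ev: "\<forall>\<^sub>F \<theta> in nhds \<theta>0. L \<theta> < e \<and> \<theta> \<in> V"
    using contL V(1,2) by (auto intro!: eventually_conj eventually_nhds_in_open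
        order_tendstoD(2)[of L "L \<theta>0"] simp: isCont_def tendsto_at_iff_tendsto_nhds)
  define \<Theta> where "\<Theta> i = (A i - np p, A1 i - np q, B i)" for i
  have "(\<Theta> \<longlongrightarrow> (np p - np p, np q - np q, nm p)) F"
    unfolding \<Theta>_def by (intro tendsto_intros A A1 B)
  then have "(\<Theta> \<longlongrightarrow> \<theta>0) F" by (simp add: \<theta>0_def)
  then have "\<forall>\<^sub>F i in F. L (\<Theta> i) < e \<and> \<Theta> i \<in> V"
    using eventually_compose_filterlim[OF ev] by blast
  with null show ?thesis
  proof eventually_elim
    case (elim i)
    have ends: "Y (\<Theta> i) 0 = A i" "Y (\<Theta> i) 1 = A1 i" "snd (snd (\<Theta> i)) = B i"
      by (simp_all add: Y_def \<Theta>_def D(4,5))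
    have \<Theta>V: "\<Theta> i \<in> V" using elim by simp
    obtain c' where c': "upath c' (wul (nmk (A i) (B i))) (nmk (A i) (B i)) (nmk (A1 i) (B i))"
      "path_length c' = integral {0..1} (\<lambda>t. wspeed (Y (\<Theta> i) t) (Y' (\<Theta> i) t) (B i))"
      using wul_lift[of "B i" "Y (\<Theta> i)" "Y' (\<Theta> i)", OF elim(3) dY cY', unfolded ends,
        OF _ GV[OF \<Theta>V, unfolded ends] elim(1,2)] by blast
    have "path_length c' = L (\<Theta> i)" by (simp add: c'(2) L_def ends)
    with path_dist_le[OF c'(1) leaf_subset(3)] elim show ?case by simp
  qed
qed

section \<open>Discrete groups of isometries\<close>

lemma continuous_on_lact: "continuous_on UNIV (\<lambda>p. lact g p)"
  unfolding lact_def case_prod_beta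
  by (intro continuous_on_Pair linear_continuous_on bounded_linear_compose[OF matrix_vector_mul_bounded_linear]
      bounded_linear_fst bounded_linear_snd)

lemma tendsto_matrix_vector [tendsto_intros]: "(f \<longlongrightarrow> l) F \<Longrightarrow> ((\<lambda>x. g *v f x) \<longlongrightarrow> g *v l) F" for g :: "real^'a^'b"
  by (rule bounded_linear.tendsto[OF matrix_vector_mul_bounded_linear])

lemma tendsto_lact [tendsto_intros]: "(f \<longlongrightarrow> p) F \<Longrightarrow> ((\<lambda>x. lact g (f x)) \<longlongrightarrow> lact g p) F"
  unfolding lact_def case_prod_beta by (intro tendsto_intros)

lemma lact_lact: "lact g (lact h p) = lact (g ** h) p"
  by (simp add: lact_def case_prod_beta matrix_vector_mul_assoc)

lemma lact_1 [simp]: "lact (mat 1) p = p"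
  by (simp add: lact_def case_prod_beta)

lemma e0_None [simp]: "e0 $ None = 1"
  by (simp add: e0_def)

lemma norm_matrix_le:
  fixes A :: "real^'n^'m"
  assumes "\<And>i j. \<bar>A $ i $ j\<bar> \<le> B"
  shows "norm A \<le> real CARD('m) * (real CARD('n) * B)"
proof -
  have "norm A \<le> (\<Sum>i\<in>UNIV. norm (A $ i))" unfolding norm_vec_def by (rule L2_set_le_sum) simp
  also have "\<dots> \<le> (\<Sum>i\<in>(UNIV::'m set). real CARD('n) * B)"
  proof (rule sum_mono)
    fix i
    have "norm (A $ i) \<le> (\<Sum>j\<in>UNIV. \<bar>A $ i $ j\<bar>)" by (rule norm_le_l1_cart)
    also have "\<dots> \<le> real CARD('n) * B" by (intro sum_bounded_above assms)
    finally show "norm (A $ i) \<le> real CARD('n) * B" .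
  qed
  finally show ?thesis by simp
qed

lemma entry_le_norm: "\<bar>A $ i $ j\<bar> \<le> norm (A :: real^'n^'m)"
  by (rule order_trans[OF component_le_norm_cart Finite_Cartesian_Product.norm_nth_le])

lemma norm_matrix_mult_le:
  fixes A :: "real^'n^'m" and B :: "real^'p^'n"
  shows "norm (A ** B) \<le> real CARD('m) * (real CARD('p) * (real CARD('n) * (norm A * norm B)))"
proof (rule norm_matrix_le)
  fix i j
  have "\<bar>(A ** B) $ i $ j\<bar> \<le> (\<Sum>k\<in>UNIV. \<bar>A $ i $ k * B $ k $ j\<bar>)"
    by (simp add: matrix_matrix_mult_def)
  also have "\<dots> \<le> real CARD('n) * (norm A * norm B)"
    by (intro sum_bounded_above) (simp add: abs_mult mult_mono entry_le_norm)
  finally show "\<bar>(A ** B) $ i $ j\<bar> \<le> real CARD('n) * (norm A * norm B)" .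
qed

lemma causalI:
  assumes "x \<star> x \<le> 0" "x \<star> b < 0" "causal b"
  shows "causal x"
proof -
  have "x $ None > 0"
  proof (rule ccontr)
    assume *: "\<not> x $ None > 0"
    have "x \<noteq> 0" using assms(2) mink.zero_left[of b] by auto
    then have "x $ None \<noteq> 0" using timelike_nonzero_time[of x] assms by auto
    with * have "causal (- x)" using assms by (simp add: causal_def mink_simps)
    from causal_minkowski_nonpos[OF this assms(3)] assms(2) show False
      by (simp add: mink_simps)
  qed
  with assms show ?thesis by (simp add: causal_def)
qed

lemma hyp_time_ge_1:
  assumes "x \<in> hyp_space"
  shows "x $ None \<ge> 1"
proof -
  have "0 \<le> (norm (x - (x $ None) *\<^sub>R e0))\<^sup>2" by simp
  also have "\<dots> = (x $ None)\<^sup>2 - 1"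
    using minkowski_gram[of e0 x] assms minkowski_commute[of x e0]
    by (simp add: hyp_space_def) (simp add: e0_def power2_eq_square)
  finally have "1 \<le> (x $ None)\<^sup>2" by simp
  then show ?thesis using assms power2_le_imp_le[of 1 "x $ None"] by (simp add: hyp_space_def)
qed

lemma matrix_inv_inverse:
  fixes A :: "'a::semiring_1^'n^'m"
  assumes "invertible A"
  shows "A ** matrix_inv A = mat 1" "matrix_inv A ** A = mat 1"
  using someI_ex[of "\<lambda>B. A ** B = mat 1 \<and> B ** A = mat 1"] assms
  by (auto simp: invertible_def matrix_inv_def)

primrec matpow :: "real^'n^'n \<Rightarrow> nat \<Rightarrow> real^'n^'n" where
  "matpow g 0 = mat 1" | "matpow g (Suc k) = g ** matpow g k"

lemma matpow_add: "matpow g (i + j) = matpow g i ** matpow g j"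
  by (induction i) (simp_all add: matrix_mul_assoc)

lemma matpow_commute: "matpow g k ** g = g ** matpow g k"
  using matpow_add[of g k 1] matpow_add[of g 1 k] by (simp add: add.commute)

lemma matpow_mult: "matpow g (i * j) = matpow (matpow g i) j"
proof (induction j)
  case (Suc j)
  have "matpow g (i * Suc j) = matpow g (i + i * j)" by simp
  also have "\<dots> = matpow g i ** matpow g (i * j)" by (rule matpow_add)
  finally show ?case using Suc by simp
qed simp

text \<open>A discrete torsion free group of isometries of the hyperboloid; \<open>orth\<close>
  prevents the two sheets from being exchanged. Elements are plain matrices, so powers are taken
  with \<open>matpow\<close>.\<close>

locale kleinian =
  fixes \<Delta> :: "'n::finite lorentz set"
  assumes dim: "CARD('n) \<ge> 2"
    and one_mem [simp]: "mat 1 \<in> \<Delta>"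
    and mult_mem: "g \<in> \<Delta> \<Longrightarrow> h \<in> \<Delta> \<Longrightarrow> g ** h \<in> \<Delta>"
    and invert: "g \<in> \<Delta> \<Longrightarrow> invertible g"
    and inv_mem: "g \<in> \<Delta> \<Longrightarrow> matrix_inv g \<in> \<Delta>"
    and iso: "g \<in> \<Delta> \<Longrightarrow> (g *v x) \<star> (g *v y) = x \<star> y"
    and orth: "g \<in> \<Delta> \<Longrightarrow> (g *v e0) $ None > 0"
    and disc: "discrete \<Delta>"
    and tf: "g \<in> \<Delta> \<Longrightarrow> k > 0 \<Longrightarrow> matpow g k = mat 1 \<Longrightarrow> g = mat 1"
begin

lemma inv_left [simp]: "g \<in> \<Delta> \<Longrightarrow> matrix_inv g ** g = mat 1"
  and inv_right [simp]: "g \<in> \<Delta> \<Longrightarrow> g ** matrix_inv g = mat 1"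
  using invert matrix_inv_inverse by blast+

lemma inv_left_v [simp]: "g \<in> \<Delta> \<Longrightarrow> matrix_inv g *v (g *v x) = x"
  and inv_right_v [simp]: "g \<in> \<Delta> \<Longrightarrow> g *v (matrix_inv g *v x) = x"
  by (simp_all add: matrix_vector_mul_assoc)

lemma lact_inv_left [simp]: "g \<in> \<Delta> \<Longrightarrow> lact (matrix_inv g) (lact g p) = p"
  and lact_inv_right [simp]: "g \<in> \<Delta> \<Longrightarrow> lact g (lact (matrix_inv g) p) = p"
  by (simp_all add: lact_lact)

lemma inv_iso: "g \<in> \<Delta> \<Longrightarrow> (matrix_inv g *v x) \<star> y = x \<star> (g *v y)"
  using iso[of g "matrix_inv g *v x" y] by simp

lemma causal_mem [simp]:
  assumes "g \<in> \<Delta>"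
  shows "causal (g *v x) \<longleftrightarrow> causal x"
proof -
  have *: "causal (g *v x)" if "g \<in> \<Delta>" "causal x" for g x
  proof (rule causalI[of _ "g *v e0"])
    show "(g *v x) \<star> (g *v x) \<le> 0" using iso that by (simp add: causal_def)
    show "(g *v x) \<star> (g *v e0) < 0"
      using iso[OF that(1), of x e0] that(2) minkowski_commute[of x e0] by (simp add: causal_def)
    show "causal (g *v e0)"
      using iso[OF that(1), of e0 e0] orth[OF that(1)] e0_timelike by (simp add: causal_def)
  qed
  from *[OF assms] *[OF inv_mem[OF assms], of "g *v x"] show ?thesis using assms by auto
qed

lemma null_mem [simp]: "g \<in> \<Delta> \<Longrightarrow> null (g *v x) \<longleftrightarrow> null x"
  using causal_mem[of g x] iso[of g x x] by (auto simp: null_def causal_def)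

lemma hyp_mem [simp]: "g \<in> \<Delta> \<Longrightarrow> g *v x \<in> hyp_space \<longleftrightarrow> x \<in> hyp_space"
  using causal_mem[of g x] iso[of g x x] by (auto simp: hyp_space_def causal_def)

lemma T1H_mem [simp]: "g \<in> \<Delta> \<Longrightarrow> lact g p \<in> T1H \<longleftrightarrow> p \<in> T1H"
  by (simp add: T1H_iff iso)

text \<open>With \<open>x0\<close> the time coordinate, \<open>2 x0 x - e0\<close> is the image of
  \<open>e0\<close> under the point reflection in \<open>x\<close>, hence causal, and
  \<open>g\<close> keeps it causal. So control at one point \<open>x\<close> gives control at
  \<open>e0\<close>.\<close>

lemma time_le:
  assumes "g \<in> \<Delta>" "x \<in> hyp_space"
  shows "(g *v e0) $ None \<le> 2 * x $ None * (g *v x) $ None"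
proof -
  have x1: "x $ None \<ge> 1" by (rule hyp_time_ge_1[OF assms(2)])
  have "causal ((2 * x $ None) *\<^sub>R x - e0)"
    unfolding causal_def
  proof
    have "((2 * x $ None) *\<^sub>R x - e0) \<star> ((2 * x $ None) *\<^sub>R x - e0) = - 1"
      using assms(2) minkowski_commute[of x e0]
      by (simp add: mink_simps hyp_space_def)
    then show "((2 * x $ None) *\<^sub>R x - e0) \<star> ((2 * x $ None) *\<^sub>R x - e0) \<le> 0" by simp
    have "x $ None * x $ None \<ge> 1 * 1" using x1 by (intro mult_mono) auto
    then show "((2 * x $ None) *\<^sub>R x - e0) $ None > 0" by (simp add: e0_def)
  qed
  then have "causal (g *v ((2 * x $ None) *\<^sub>R x - e0))" using assms by simp
  then show ?thesis
    by (simp add: causal_def matrix_vector_mult_diff_distrib matrix_vector_mult_scaleR)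
qed

text \<open>The sum and difference of \<open>e0\<close> and a space axis are null, so their images
  are causal, and the time coordinates of the images add up to twice that of the image of
  \<open>e0\<close>.\<close>

lemma norm_bound:
  assumes g: "g \<in> \<Delta>" and C: "(g *v e0) $ None \<le> C"
  shows "norm g \<le> real CARD('n option) * (real CARD('n option) * (6 * C))"
proof (rule norm_matrix_le)
  fix i j :: "'n option"
  have col: "g $ i $ j = (g *v axis j 1) $ i" by (simp add: matrix_vector_mul_component inner_axis)
  have 0: "norm (g *v e0) \<le> 2 * C"
  proof -
    have "causal (g *v e0)" using g e0_timelike(1) by simp
    from causal_norm_le[OF this] C show ?thesis by linarith
  qed
  have "C > 0" using orth[OF g] C by linarith
  have "norm (g *v axis j 1) \<le> 6 * C"
  proof (cases j)
    case None
    then show ?thesis using 0 \<open>C > 0\<close> by (simp add: e0_def[symmetric])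
  next
    case (Some k)
    have ip: "axis (Some k) (1::real) \<star> axis (Some k) 1 = 1" "axis (Some k) (1::real) \<star> e0 = 0"
      "axis (Some k) (1::real) $ (None :: 'n option) = 0"
      by (simp_all add: minkowski_eq_inner inner_axis_axis e0_def) (simp_all add: axis_def)
    have e00: "(e0 :: 'n mvec) $ None = 1" by (simp add: e0_def)
    have "causal (e0 + axis (Some k) 1)" "causal (e0 - axis (Some k) 1)"
      using ip e00 by (simp_all add: causal_def mink_simps)
    then have c: "causal (g *v e0 + g *v axis (Some k) 1)" "causal (g *v e0 - g *v axis (Some k) 1)"
      using g by (simp_all flip: matrix_vector_right_distrib matrix_vector_mult_diff_distrib)
    then have "(g *v e0 + g *v axis (Some k) 1) $ None \<le> 2 * C" using C by (simp add: causal_def)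
    with causal_norm_le[OF c(1)] have "norm (g *v e0 + g *v axis (Some k) 1) \<le> 4 * C" by simp
    then show ?thesis
      using 0 norm_triangle_ineq4[of "g *v e0 + g *v axis (Some k) 1" "g *v e0"] Some by simp
  qed
  then show "\<bar>g $ i $ j\<bar> \<le> 6 * C"
    using component_le_norm_cart[of "g *v axis j 1" i] unfolding col by linarith
qed

text \<open>If \<open>g\<close> and \<open>h\<close> are close, then \<open>g^-1 h\<close> is close
  to 1, uniformly because inverses satisfy the same time bound. Discreteness at 1 makes this bounded
  set uniformly discrete, hence finite.\<close>

lemma finite_time_bound: "finite {g \<in> \<Delta>. (g *v e0) $ None \<le> C}"
proof -
  define S where "S = {g \<in> \<Delta>. (g *v e0) $ None \<le> C}"
  define N where "N = real CARD('n option)"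
  have N: "N \<ge> 1" unfolding N_def by simp
  define B where "B = N * (N * (6 * C))"
  have bS: "norm g \<le> B" if "g \<in> S" for g
    using norm_bound[of g C] that by (simp add: S_def B_def N_def)
  have invS: "matrix_inv g \<in> S" if "g \<in> S" for g
  proof -
    have g: "g \<in> \<Delta>" using that by (simp add: S_def)
    have "e0 \<star> (matrix_inv g *v e0) = (g *v e0) \<star> e0"
      using inv_iso[OF inv_mem[OF g]] inv_iso[OF g, of e0 e0] minkowski_commute[of e0] by metis
    then have "(matrix_inv g *v e0) $ None = (g *v e0) $ None"
      using minkowski_commute[of "g *v e0" e0] by simp
    then show ?thesis using that inv_mem[OF g] by (simp add: S_def)
  qed
  obtain r where r: "r > 0" "\<And>g. g \<in> \<Delta> \<Longrightarrow> dist g (mat 1) < r \<Longrightarrow> g = mat 1"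
    using discreteD[OF disc one_mem] unfolding isolated_in_dist_Ex_iff
    by (metis dist_commute not_less)
  define K where "K = N * (N * (N * (\<bar>B\<bar> + 1)))"
  have K: "K > 0" using N by (simp add: K_def)
  have "uniform_discrete S"
    unfolding uniform_discrete_def
  proof (intro exI[of _ "r / K"] conjI ballI impI)
    show "r / K > 0" using r K by simp
    fix g h assume gh: "g \<in> S" "h \<in> S" "dist g h < r / K"
    then have D: "g \<in> \<Delta>" "h \<in> \<Delta>" by (auto simp: S_def)
    have "matrix_inv g ** h - mat 1 = matrix_inv g ** (h - g)"
      using D matrix_add_ldistrib[of "matrix_inv g" "h - g" g] by simp
    then have "norm (matrix_inv g ** h - mat 1) \<le> N * (N * (N * (norm (matrix_inv g) * norm (h - g))))"
      using norm_matrix_mult_le[of "matrix_inv g" "h - g"] by (simp add: N_def)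
    also have "\<dots> \<le> N * (N * (N * ((\<bar>B\<bar> + 1) * norm (h - g))))"
      using bS[OF invS[OF gh(1)]] N by (intro mult_left_mono mult_right_mono) auto
    also have "\<dots> = K * norm (h - g)" by (simp add: K_def)
    also have "\<dots> < r" using gh(3) K by (simp add: dist_norm norm_minus_commute pos_less_divide_eq mult.commute)
    finally have "matrix_inv g ** h = mat 1"
      using r(2)[of "matrix_inv g ** h"] D by (simp add: mult_mem inv_mem dist_norm)
    then have "g ** (matrix_inv g ** h) = g" by simp
    then show "g = h" using D by (simp add: matrix_mul_assoc)
  qed
  moreover have "bounded S" using bS by (auto simp: bounded_iff)
  ultimately have "finite S" using uniform_discrete_finite_iff by blast
  then show ?thesis by (simp add: S_def)
qed

section \<open>Proper discontinuity and freeness of the action\<close>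

lemma proper:
  "finite {g \<in> \<Delta>. \<exists>x\<in>hyp_space. x $ None \<le> M \<and> (g *v x) $ None \<le> M}" (is "finite ?S")
proof (rule finite_subset[OF _ finite_time_bound[of "2 * M * M"]])
  show "?S \<subseteq> {g \<in> \<Delta>. (g *v e0) $ None \<le> 2 * M * M}"
  proof
    fix g assume "g \<in> ?S"
    then obtain x where g: "g \<in> \<Delta>" and x: "x \<in> hyp_space" "x $ None \<le> M" "(g *v x) $ None \<le> M" by auto
    have "(g *v e0) $ None \<le> 2 * x $ None * (g *v x) $ None" by (rule time_le[OF g x(1)])
    also have "\<dots> \<le> 2 * M * M"
      using x hyp_time_ge_1[OF x(1)] hyp_time_ge_1[of "g *v x"] g by (intro mult_mono) auto
    finally show "g \<in> {g \<in> \<Delta>. (g *v e0) $ None \<le> 2 * M * M}" using g by simp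
  qed
qed

lemma matpow_mem: "g \<in> \<Delta> \<Longrightarrow> matpow g k \<in> \<Delta>"
  by (induction k) (auto intro: mult_mem)

lemma left_cancel:
  assumes "g \<in> \<Delta>" "g ** a = g ** b"
  shows "a = b"
proof -
  have "(matrix_inv g ** g) ** a = (matrix_inv g ** g) ** b"
    unfolding matrix_mul_assoc[symmetric] by (simp only: assms(2))
  then show ?thesis using assms(1) by simp
qed

text \<open>All powers of \<open>g\<close> fix \<open>x\<close>, and properness leaves finitely many
  of them; so \<open>g\<close> has finite order and torsion freeness applies.\<close>

lemma free:
  assumes g: "g \<in> \<Delta>" and x: "x \<in> hyp_space" and fixed: "g *v x = x"
  shows "g = mat 1"
proof -
  have px: "matpow g k *v x = x" for k by (induction k) (simp_all add: fixed flip: matrix_vector_mul_assoc)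
  have "range (matpow g) \<subseteq> {h \<in> \<Delta>. \<exists>y\<in>hyp_space. y $ None \<le> x $ None \<and> (h *v y) $ None \<le> x $ None}"
    using x px matpow_mem[OF g] by force
  then have "finite (range (matpow g))" using proper finite_subset by blast
  then have "\<not> inj (matpow g)" using finite_imageD infinite_UNIV_nat by blast
  then obtain i j where ij: "i < j" "matpow g i = matpow g j"
    by (metis inj_def linorder_neqE_nat)
  have "matpow g i ** mat 1 = matpow g i ** matpow g (j - i)"
    using ij matpow_add[of g i "j - i"] by simp
  then have "matpow g (j - i) = mat 1" using left_cancel[OF matpow_mem[OF g]] by metis
  then show ?thesis using tf[OF g, of "j - i"] ij by simp
qed

lemma free_lact:
  assumes "g \<in> \<Delta>" "p \<in> T1H" "lact g p = p"
  shows "g = mat 1"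
proof (rule free[OF assms(1) fst_T1H[OF assms(2)]])
  have "fst (lact g p) = g *v fst p" by (simp add: lact_def case_prod_beta)
  then show "g *v fst p = fst p" unfolding assms(3) by simp
qed

lemma free_lact2:
  assumes "g \<in> \<Delta>" "h \<in> \<Delta>" "p \<in> T1H" "lact g p = lact h p"
  shows "g = h"
proof -
  have "lact (matrix_inv h ** g) p = p" using assms by (simp flip: lact_lact)
  then have "matrix_inv h ** g = mat 1" using free_lact assms by (meson inv_mem mult_mem)
  then have "h ** (matrix_inv h ** g) = h" by simp
  then show ?thesis using assms by (simp add: matrix_mul_assoc)
qed

lemma time_bound_bounded:
  fixes B :: "'n uvec set"
  assumes "bounded B"
  obtains M where "\<And>p. p \<in> B \<Longrightarrow> fst p $ None \<le> M"
proof -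
  obtain M where M: "\<And>p. p \<in> B \<Longrightarrow> norm p \<le> M" using assms by (auto simp: bounded_iff)
  have "fst p $ None \<le> M" if "p \<in> B" for p
    using M[OF that] component_le_norm_cart[of "fst p" None] norm_fst_le[of "fst p" "snd p"] by simp
  then show ?thesis by (rule that)
qed

lemma proper_bounded:
  assumes "bounded B" "B \<subseteq> T1H"
  shows "finite {g \<in> \<Delta>. \<exists>p\<in>B. lact g p \<in> B}"
proof -
  obtain M where M: "\<And>p. p \<in> B \<Longrightarrow> fst p $ None \<le> M" using time_bound_bounded[OF assms(1)] by blast
  show ?thesis
  proof (rule finite_subset[OF _ proper[of M]])
    show "{g \<in> \<Delta>. \<exists>p\<in>B. lact g p \<in> B} \<subseteq> {g \<in> \<Delta>. \<exists>x\<in>hyp_space. x $ None \<le> M \<and> (g *v x) $ None \<le> M}"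
    proof clarify
      fix g x v assume "(x, v) \<in> B" "lact g (x, v) \<in> B"
      then show "\<exists>x\<in>hyp_space. x $ None \<le> M \<and> (g *v x) $ None \<le> M"
        using M[of "(x, v)"] M[of "lact g (x, v)"] fst_T1H[of "(x, v)"] assms(2)
        by (intro bexI[of _ x]) (auto simp: lact_def)
    qed
  qed
qed

text \<open>Properness leaves finitely many candidates near \<open>p\<close>, and each nontrivial
  one moves \<open>p\<close> by a positive distance.\<close>

lemma locally_free:
  assumes p: "p \<in> T1H"
  obtains e where "e > 0" "\<And>g q. g \<in> \<Delta> \<Longrightarrow> q \<in> T1H \<Longrightarrow> dist q p < e \<Longrightarrow> dist (lact g q) p < e \<Longrightarrow> g = mat 1"
proof -
  define F where "F = {g \<in> \<Delta>. \<exists>q\<in>ball p 1 \<inter> T1H. lact g q \<in> ball p 1 \<inter> T1H}"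
  have F: "finite F" unfolding F_def by (rule proper_bounded) auto
  have "\<forall>\<^sub>F e in at_right 0. \<forall>q. dist q p < e \<longrightarrow> \<not> dist (lact g q) p < e" if g: "g \<in> F - {mat 1}" for g
  proof -
    define d where "d = dist (lact g p) p"
    have "lact g p \<noteq> p" using g free_lact[of g p] p by (auto simp: F_def)
    then have d: "d > 0" by (simp add: d_def)
    have "isCont (lact g) p" using continuous_on_lact[of g] continuous_on_eq_continuous_at[OF open_UNIV] by blast
    then obtain e1 where e1: "e1 > 0" "\<And>q. dist q p < e1 \<Longrightarrow> dist (lact g q) (lact g p) < d / 2"
      unfolding continuous_at_eps_delta using d by (metis half_gt_zero)
    show ?thesis
    proof (rule eventually_at_rightI[of 0 "min e1 (d / 2)"], intro allI impI notI)
      fix e q assume "e \<in> {0<..<min e1 (d / 2)}" "dist q p < e" "dist (lact g q) p < e"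
      then have "dist (lact g q) (lact g p) < d / 2" "dist (lact g q) p < d / 2" using e1(2) by auto
      then show False unfolding d_def using dist_triangle[of "lact g p" p "lact g q"]
        by (simp add: dist_commute)
    qed (use e1 d in auto)
  qed
  then have "\<forall>\<^sub>F e in at_right 0. \<forall>g\<in>F - {mat 1}. \<forall>q. dist q p < e \<longrightarrow> \<not> dist (lact g q) p < e"
    using F by (intro eventually_ball_finite) auto
  then obtain b where b: "b > 0" "\<And>e. 0 < e \<Longrightarrow> e < b \<Longrightarrow> \<forall>g\<in>F - {mat 1}. \<forall>q. dist q p < e \<longrightarrow> \<not> dist (lact g q) p < e"
    unfolding eventually_at_right_field by blast
  define e where "e = min (b / 2) (1 / 2)"
  have e: "e > 0" "e < b" "e < 1" using b by (auto simp: e_def)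
  show ?thesis
  proof (rule that[OF e(1)])
    fix g q assume g: "g \<in> \<Delta>" "q \<in> T1H" "dist q p < e" "dist (lact g q) p < e"
    then have "g \<in> F" using e by (auto simp: F_def dist_commute intro!: bexI[of _ q])
    then show "g = mat 1" using b(2)[OF e(1,2)] g by blast
  qed
qed

text \<open>The form in which local freeness is used: lifts of the same orbits that converge to the
  same vector eventually agree, which removes the ambiguity of choosing group elements along a
  sequence.\<close>

lemma tendsto_lact_trivial:
  assumes p: "p \<in> T1H" and P: "(P \<longlongrightarrow> p) F" and Q: "((\<lambda>i. lact (g i) (P i)) \<longlongrightarrow> p) F"
    and g: "\<forall>\<^sub>F i in F. g i \<in> \<Delta>" and T: "\<forall>\<^sub>F i in F. P i \<in> T1H"
  shows "\<forall>\<^sub>F i in F. g i = mat 1"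
proof -
  obtain e where e: "e > 0" "\<And>g q. g \<in> \<Delta> \<Longrightarrow> q \<in> T1H \<Longrightarrow> dist q p < e \<Longrightarrow> dist (lact g q) p < e \<Longrightarrow> g = mat 1"
    using locally_free[OF p] by blast
  have "\<forall>\<^sub>F i in F. dist (P i) p < e" "\<forall>\<^sub>F i in F. dist (lact (g i) (P i)) p < e"
    using P Q e(1) tendstoD by blast+
  with g T show ?thesis by eventually_elim (use e(2) in blast)
qed

lemma orbit_self [simp]: "p \<in> orbit \<Delta> p"
  unfolding orbit_def by (rule image_eqI[of _ _ "mat 1"]) simp_all

lemma lact_in_orbit: "g \<in> \<Delta> \<Longrightarrow> lact g p \<in> orbit \<Delta> p"
  by (simp add: orbit_def)

lemma orbitE:
  assumes "q \<in> orbit \<Delta> p"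
  obtains g where "g \<in> \<Delta>" "q = lact g p"
  using assms by (auto simp: orbit_def)

lemma orbit_lact [simp]:
  assumes "g \<in> \<Delta>"
  shows "orbit \<Delta> (lact g p) = orbit \<Delta> p"
proof -
  have *: "orbit \<Delta> (lact g p) \<subseteq> orbit \<Delta> p" if "g \<in> \<Delta>" for g p
    using that by (auto simp: orbit_def lact_lact intro!: mult_mem)
  from *[OF assms, of p] *[OF inv_mem[OF assms], of "lact g p"] show ?thesis
    unfolding lact_inv_left[OF assms] by (rule subset_antisym)
qed

lemma orbit_eqI: "q \<in> orbit \<Delta> p \<Longrightarrow> orbit \<Delta> q = orbit \<Delta> p"
  by (auto elim: orbitE)

lemma orbit_eq_iff: "orbit \<Delta> p = orbit \<Delta> q \<longleftrightarrow> (\<exists>g\<in>\<Delta>. p = lact g q)"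
  by (metis orbitE orbit_lact orbit_self)

lemma flow_orbit: "flow t ` orbit \<Delta> p = orbit \<Delta> (flow t p)"
  by (simp add: orbit_def image_image flow_lact)

lemma T1X_orbit: "p \<in> T1H \<Longrightarrow> orbit \<Delta> p \<in> T1X \<Delta>"
  by (simp add: T1X_def)

lemma T1X_E:
  assumes "u \<in> T1X \<Delta>"
  obtains p where "p \<in> T1H" "u = orbit \<Delta> p"
  using assms by (auto simp: T1X_def)

subsection \<open>The limit set\<close>

lemma klein_scale: "r > 0 \<Longrightarrow> klein (r *\<^sub>R x) = klein x"
  by (simp add: klein_def)

lemma klein_tendsto [tendsto_intros]:
  "(f \<longlongrightarrow> a) F \<Longrightarrow> a $ None \<noteq> 0 \<Longrightarrow> ((\<lambda>x. klein (f x)) \<longlongrightarrow> klein a) F"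
  unfolding klein_def by (intro tendsto_intros tendsto_vec_nth) auto

lemma null_klein: "null a \<Longrightarrow> null (klein a)" "null a \<Longrightarrow> klein a $ None = 1" "null a \<Longrightarrow> klein a \<in> boundary"
  by (auto simp: null_def klein_def boundary_def mink_simps)

lemma klein_lact:
  assumes "g \<in> \<Delta>" "causal x"
  shows "klein (g *v klein x) = klein (g *v x)"
proof -
  have "g *v klein x = (1 / x $ None) *\<^sub>R (g *v x)" by (simp add: klein_def matrix_vector_mult_scaleR)
  then show ?thesis using assms(2) by (simp add: klein_scale causal_def)
qed

definition inL :: "'n mvec \<Rightarrow> bool" where "inL a \<longleftrightarrow> null a \<and> klein a \<in> limit_set \<Delta>"

lemma inL_scale: "r > 0 \<Longrightarrow> inL a \<Longrightarrow> inL (r *\<^sub>R a)"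
  by (simp add: inL_def null_scale klein_scale)

lemma inL_scale_iff [simp]: "r > 0 \<Longrightarrow> inL (r *\<^sub>R a) \<longleftrightarrow> inL a"
  using inL_scale[of r a] inL_scale[of "1 / r" "r *\<^sub>R a"] by auto

lemma inL_lact: 
  assumes g: "g \<in> \<Delta>" and a: "inL a"
  shows "inL (g *v a)"
proof -
  have na: "null a" and ka: "klein a \<in> limit_set \<Delta>" using a by (auto simp: inL_def)
  obtain h where h: "range h \<subseteq> \<Delta>" "(\<lambda>k. klein (h k *v e0)) \<longlonglongrightarrow> klein a"
    using ka unfolding limit_set_def e0_def by blast
  have hc: "causal (h k *v e0)" for k using h(1) e0_timelike(1) by (simp add: range_subsetD)
  have "null (g *v klein a)" using g null_klein(1)[OF na] by simp
  then have "(\<lambda>k. klein (g *v klein (h k *v e0))) \<longlonglongrightarrow> klein (g *v klein a)"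
    by (intro tendsto_intros h(2)) (simp add: null_def)
  then have "(\<lambda>k. klein ((g ** h k) *v e0)) \<longlonglongrightarrow> klein (g *v a)"
    by (simp add: klein_lact[OF g hc] klein_lact[OF g null_causal[OF na]] matrix_vector_mul_assoc)
  moreover have "range (\<lambda>k. g ** h k) \<subseteq> \<Delta>" using h(1) g by (auto intro!: mult_mem)
  ultimately have "klein (g *v a) \<in> limit_set \<Delta>"
    unfolding limit_set_def e0_def[symmetric] using null_klein(3)[of "g *v a"] g na by auto
  then show ?thesis using g na by (simp add: inL_def)
qed

lemma inL_lact_iff [simp]: "g \<in> \<Delta> \<Longrightarrow> inL (g *v a) \<longleftrightarrow> inL a"
  using inL_lact[of g a] inL_lact[of "matrix_inv g" "g *v a"] inv_mem by auto

lemma limit_set_closed_seq: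
  assumes x: "\<And>k. x k \<in> limit_set \<Delta>" and lim: "x \<longlonglongrightarrow> \<xi>"
  shows "\<xi> \<in> limit_set \<Delta>"
proof -
  have "\<exists>g\<in>\<Delta>. dist (klein (g *v e0)) (x k) < 1 / real (Suc k)" for k
  proof -
    obtain h where h: "range h \<subseteq> \<Delta>" "(\<lambda>k. klein (h k *v e0)) \<longlonglongrightarrow> x k"
      using x[of k] unfolding limit_set_def e0_def by blast
    have "\<forall>\<^sub>F j in sequentially. dist (klein (h j *v e0)) (x k) < 1 / real (Suc k)"
      using tendstoD[OF h(2)] by simp
    then obtain j where "dist (klein (h j *v e0)) (x k) < 1 / real (Suc k)"
      using eventually_happens trivial_limit_sequentially by blast
    then show ?thesis using h(1) by blast
  qed
  then obtain g where g: "\<And>k. g k \<in> \<Delta>" "\<And>k. dist (klein (g k *v e0)) (x k) < 1 / real (Suc k)"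
    by metis
  have "(\<lambda>k. klein (g k *v e0) - x k) \<longlonglongrightarrow> 0"
    by (rule Lim_null_comparison[OF _ LIMSEQ_inverse_real_of_nat])
      (use g(2) in \<open>auto simp: dist_norm inverse_eq_divide intro!: always_eventually less_imp_le\<close>)
  from tendsto_add[OF this lim] have "(\<lambda>k. klein (g k *v e0)) \<longlonglongrightarrow> \<xi>" by simp
  moreover have "\<xi> \<in> boundary"
  proof -
    have "\<And>k. x k \<star> x k = 0" "\<And>k. x k $ None = 1" using x by (auto simp: limit_set_def boundary_def)
    moreover have "(\<lambda>k. x k \<star> x k) \<longlonglongrightarrow> \<xi> \<star> \<xi>" "(\<lambda>k. x k $ None) \<longlonglongrightarrow> \<xi> $ None"
      by (intro tendsto_intros lim tendsto_vec_nth)+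
    ultimately show ?thesis by (auto simp: boundary_def LIMSEQ_const_iff)
  qed
  ultimately show ?thesis unfolding limit_set_def e0_def[symmetric] using g(1) by auto
qed

lemma inL_closed:
  assumes a: "\<And>k. inL (a k)" and lim: "a \<longlonglongrightarrow> b" and b: "b $ None \<noteq> 0"
  shows "inL b"
proof -
  have "klein b \<in> limit_set \<Delta>"
    by (rule limit_set_closed_seq[of "\<lambda>k. klein (a k)"]) (use a b in \<open>auto simp: inL_def intro!: tendsto_intros lim\<close>)
  have "(\<lambda>k. a k \<star> a k) \<longlonglongrightarrow> b \<star> b" "(\<lambda>k. a k $ None) \<longlonglongrightarrow> b $ None"
    by (intro tendsto_intros lim tendsto_vec_nth)+
  moreover have "a k \<star> a k = 0" "a k $ None > 0" for k using a[of k] by (auto simp: inL_def null_def)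
  ultimately have "b \<star> b = 0" "b $ None \<ge> 0"
    using LIMSEQ_le_const[of "\<lambda>k. a k $ None" "b $ None" 0] by (auto simp: LIMSEQ_const_iff less_imp_le)
  with b \<open>klein b \<in> limit_set \<Delta>\<close> show ?thesis by (simp add: inL_def null_def)
qed

text \<open>The preimage of \<open>\<Omega>\<close> in \<open>T1H\<close>, invariant under the group
  and the flow.\<close>

definition Z :: "'n uvec set" where "Z = {p \<in> T1H. inL (np p) \<and> inL (nm p)}"

lemma Z_T1H: "p \<in> Z \<Longrightarrow> p \<in> T1H" by (simp add: Z_def)

lemma Z_lact [simp]: "g \<in> \<Delta> \<Longrightarrow> lact g p \<in> Z \<longleftrightarrow> p \<in> Z" by (simp add: Z_def)

lemma Z_flow [simp]: "flow t p \<in> Z \<longleftrightarrow> p \<in> Z" by (simp add: Z_def)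

lemma orbit_in_\<Omega>: "p \<in> T1H \<Longrightarrow> orbit \<Delta> p \<in> \<Omega> \<Delta> \<longleftrightarrow> p \<in> Z"
proof
  assume p: "p \<in> T1H" "orbit \<Delta> p \<in> \<Omega> \<Delta>"
  then have "forward_endpoint p \<in> limit_set \<Delta>" "backward_endpoint p \<in> limit_set \<Delta>" by (auto simp: \<Omega>_def)
  then show "p \<in> Z"
    using p T1HD[OF p(1)] by (simp add: Z_def inL_def forward_endpoint_def backward_endpoint_def case_prod_beta np_def nm_def)
next
  assume p: "p \<in> T1H" "p \<in> Z"
  have "forward_endpoint q \<in> limit_set \<Delta>" "backward_endpoint q \<in> limit_set \<Delta>" if "q \<in> orbit \<Delta> p" for q
  proof -
    have "q \<in> Z" using that p by (auto elim!: orbitE)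
    then show "forward_endpoint q \<in> limit_set \<Delta>" "backward_endpoint q \<in> limit_set \<Delta>"
      by (simp_all add: Z_def inL_def forward_endpoint_def backward_endpoint_def case_prod_beta np_def nm_def)
  qed
  then show "orbit \<Delta> p \<in> \<Omega> \<Delta>" using p by (auto simp: \<Omega>_def T1X_orbit)
qed

lemma \<Omega>_E:
  assumes "u \<in> \<Omega> \<Delta>"
  obtains p where "p \<in> Z" "u = orbit \<Delta> p"
proof -
  have "u \<in> T1X \<Delta>" using assms by (simp add: \<Omega>_def)
  then obtain p where "p \<in> T1H" "u = orbit \<Delta> p" by (rule T1X_E)
  with assms orbit_in_\<Omega> that show ?thesis by blast
qed

lemma Z_closed_seq:
  assumes "\<And>k. p k \<in> Z" "p \<longlonglongrightarrow> q"
  shows "q \<in> Z"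
proof -
  have "q \<in> T1H" using closed_sequentially[OF closed_T1H, of p q] assms Z_T1H by blast
  then have ne: "np q $ None \<noteq> 0" "nm q $ None \<noteq> 0" using T1HD(1,2)[of q] by (auto simp: null_def)
  have lim: "(\<lambda>k. np (p k)) \<longlonglongrightarrow> np q" "(\<lambda>k. nm (p k)) \<longlonglongrightarrow> nm q"
    by (intro tendsto_intros assms)+
  have "inL (np (p k))" "inL (nm (p k))" for k using assms(1) by (simp_all add: Z_def)
  then have "inL (np q)" "inL (nm q)" using inL_closed[OF _ lim(1) ne(1)] inL_closed[OF _ lim(2) ne(2)] by blast+
  with \<open>q \<in> T1H\<close> show ?thesis by (simp add: Z_def)
qed

lemma openin_T1X_iff:
  "openin (T1X_topology \<Delta>) V \<longleftrightarrow> V \<subseteq> T1X \<Delta> \<and> openin (top_of_set T1H) {p \<in> T1H. orbit \<Delta> p \<in> V}"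
  by (simp add: T1X_topology_def openin_quotient_topology T1X_def)

end

section \<open>Leaves of the quotient\<close>

lemma bounded_linear_lact: "bounded_linear (lact g)"
  unfolding lact_def case_prod_beta
  by (intro bounded_linear_Pair bounded_linear_compose[OF matrix_vector_mul_bounded_linear]
      bounded_linear_fst bounded_linear_snd)

context kleinian
begin

lemma sasaki_lact:
  assumes "g \<in> \<Delta>"
  shows "sasaki_norm (lact g p) (lact g w) = sasaki_norm p w"
proof -
  have "g *v snd w + (snd w \<star> fst p) *\<^sub>R (g *v fst p) = g *v (snd w + (snd w \<star> fst p) *\<^sub>R fst p)"
    by (simp add: matrix_vector_right_distrib matrix_vector_mult_scaleR)
  then show ?thesis using assms
    by (simp add: sasaki_norm_def lact_def case_prod_beta Let_def iso)
qed

lemma path_dist_lact: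
  assumes "g \<in> \<Delta>"
  shows "path_dist (lact g ` W) (lact g p) (lact g q) = path_dist W p q"
  by (rule path_dist_image[OF bounded_linear_lact sasaki_lact bounded_linear_lact[of "matrix_inv g"]])
    (use assms in auto)

end

text \<open>Strong stable, strong unstable and weak unstable leaves are treated at once.
  \<open>L\<close> is the dynamical leaf, empty outside \<open>T1H\<close>, and \<open>W\<close> its
  explicit description.\<close>

locale leaf_family = kleinian \<Delta> for \<Delta> :: "'n::finite lorentz set" +
  fixes L W :: "'n uvec \<Rightarrow> 'n uvec set"
  assumes L_eq: "p \<in> T1H \<Longrightarrow> L p = W p" and L_empty: "p \<notin> T1H \<Longrightarrow> L p = {}"
    and W_T: "W p \<subseteq> T1H" and W_self: "p \<in> T1H \<Longrightarrow> p \<in> W p"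
    and W_eq: "p \<in> T1H \<Longrightarrow> q \<in> W p \<Longrightarrow> W q = W p"
    and W_path: "p \<in> T1H \<Longrightarrow> q \<in> W p \<Longrightarrow> \<exists>c. upath c (W p) p q"
    and W_lact: "g \<in> \<Delta> \<Longrightarrow> p \<in> T1H \<Longrightarrow> lact g ` W p = W (lact g p)"
begin

lemma W_lact_mem: "g \<in> \<Delta> \<Longrightarrow> p \<in> T1H \<Longrightarrow> lact g q \<in> W (lact g p) \<longleftrightarrow> q \<in> W p"
  using W_lact[of g p] lact_inv_left by (metis image_iff)

lemma W_dist_nonneg: "p \<in> T1H \<Longrightarrow> q \<in> W p \<Longrightarrow> path_dist (W p) p q \<ge> 0"
  using W_path path_dist_nonneg W_T by metis

lemma W_dist_lact:
  "g \<in> \<Delta> \<Longrightarrow> p \<in> T1H \<Longrightarrow> path_dist (W (lact g p)) (lact g p) (lact g q) = path_dist (W p) p q"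
  using path_dist_lact[of g "W p" p q] W_lact by simp

lemma W_dist_commute: "p \<in> T1H \<Longrightarrow> q \<in> W p \<Longrightarrow> path_dist (W q) q p = path_dist (W p) p q"
  using W_eq path_dist_commute[OF W_T] by metis

lemma W_sym: "p \<in> T1H \<Longrightarrow> q \<in> W p \<Longrightarrow> p \<in> W q"
  using W_eq W_self by metis

lemma L_mem: "q \<in> L p \<longleftrightarrow> p \<in> T1H \<and> q \<in> W p"
  using L_eq L_empty by (cases "p \<in> T1H") auto

definition dset :: "'n uvec set \<Rightarrow> 'n uvec set \<Rightarrow> real set" where
  "dset u v = {path_dist (W p) p q | p q. p \<in> u \<and> q \<in> v \<and> p \<in> T1H \<and> q \<in> W p}"

lemma leaf_dist_dset: "leaf_dist L u v = (if dset u v = {} then 0 else Inf (dset u v))"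
proof -
  have "{path_dist (L p) p q | p q. p \<in> u \<and> q \<in> v \<and> q \<in> L p} = dset u v"
    unfolding dset_def L_mem using L_eq by (intro Collect_cong) (auto; metis)
  moreover have "(\<exists>p\<in>u. \<exists>q\<in>v. q \<in> L p) \<longleftrightarrow> dset u v \<noteq> {}"
    unfolding dset_def L_mem by blast
  ultimately show ?thesis by (simp add: leaf_dist_def)
qed

lemma dset_nonneg: "x \<in> dset u v \<Longrightarrow> x \<ge> 0"
  unfolding dset_def using W_dist_nonneg by blast

lemma dset_commute: "dset u v = dset v u"
proof -
  have "dset u v \<subseteq> dset v u" for u v
    unfolding dset_def using W_dist_commute W_sym W_T by blast
  then show ?thesis by blast
qed

lemma leaf_dist_nonneg: "leaf_dist L u v \<ge> 0"
  unfolding leaf_dist_dset using dset_nonneg by (auto intro!: cInf_greatest)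

lemma leaf_dist_commute: "leaf_dist L u v = leaf_dist L v u"
  by (simp add: leaf_dist_dset dset_commute[of u v])

lemma leaf_dist_le: "x \<in> dset u v \<Longrightarrow> leaf_dist L u v \<le> x"
  unfolding leaf_dist_dset using dset_nonneg by (auto intro!: cInf_lower bdd_belowI[of _ 0])

lemma leaf_dist_lessE:
  assumes "leaf_dist L u v < r" "dset u v \<noteq> {}"
  obtains x where "x \<in> dset u v" "x < r"
  using assms cInf_lessD[of "dset u v" r] by (auto simp: leaf_dist_dset)

lemma leaf_iff:
  assumes "p \<in> T1H"
  shows "v \<in> leaf L \<Delta> (orbit \<Delta> p) \<longleftrightarrow> (\<exists>q\<in>W p. v = orbit \<Delta> q)"
proof
  assume "v \<in> leaf L \<Delta> (orbit \<Delta> p)"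
  then obtain p' q where "v = orbit \<Delta> q" "p' \<in> orbit \<Delta> p" "q \<in> L p'" by (auto simp: leaf_def)
  then obtain g where g: "g \<in> \<Delta>" "p' = lact g p" "q \<in> W (lact g p)" using L_mem by (metis orbitE)
  then have "lact (matrix_inv g) q \<in> W p" using W_lact_mem[OF g(1) assms, of "lact (matrix_inv g) q"] by simp
  moreover have "v = orbit \<Delta> (lact (matrix_inv g) q)" using \<open>v = orbit \<Delta> q\<close> g inv_mem by simp
  ultimately show "\<exists>q\<in>W p. v = orbit \<Delta> q" by blast
next
  assume "\<exists>q\<in>W p. v = orbit \<Delta> q"
  then show "v \<in> leaf L \<Delta> (orbit \<Delta> p)" unfolding leaf_def L_mem using assms by (metis (mono_tags, lifting) CollectI orbit_self)
qed

lemma dset_orbit: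
  assumes "p \<in> T1H"
  shows "dset (orbit \<Delta> p) (orbit \<Delta> q) = {path_dist (W p) p q' | q'. q' \<in> orbit \<Delta> q \<and> q' \<in> W p}"
proof
  show "{path_dist (W p) p q' | q'. q' \<in> orbit \<Delta> q \<and> q' \<in> W p} \<subseteq> dset (orbit \<Delta> p) (orbit \<Delta> q)"
    unfolding dset_def using assms orbit_self by blast
  show "dset (orbit \<Delta> p) (orbit \<Delta> q) \<subseteq> {path_dist (W p) p q' | q'. q' \<in> orbit \<Delta> q \<and> q' \<in> W p}"
  proof
    fix x assume "x \<in> dset (orbit \<Delta> p) (orbit \<Delta> q)"
    then obtain p' q' where x: "x = path_dist (W p') p' q'" "p' \<in> orbit \<Delta> p" "q' \<in> orbit \<Delta> q" "q' \<in> W p'"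
      unfolding dset_def by blast
    then obtain g where g: "g \<in> \<Delta>" "p' = lact g p" by (metis orbitE)
    define q'' where "q'' = lact (matrix_inv g) q'"
    have q': "q' = lact g q''" using g by (simp add: q''_def)
    have "q'' \<in> W p" using W_lact_mem[OF g(1) assms] x(4) g(2) q' by simp
    moreover have "q'' \<in> orbit \<Delta> q"
      using lact_in_orbit[OF inv_mem[OF g(1)], of q'] orbit_eqI[OF x(3)] by (simp add: q''_def)
    moreover have "x = path_dist (W p) p q''" using x(1) g(2) q' W_dist_lact[OF g(1) assms] by simp
    ultimately show "x \<in> {path_dist (W p) p q' | q'. q' \<in> orbit \<Delta> q \<and> q' \<in> W p}" by blast
  qed
qed

lemma leaf_ball_iff:
  assumes "p \<in> T1H"
  shows "v \<in> leaf_ball L \<Delta> r (orbit \<Delta> p) \<longleftrightarrow> (\<exists>q\<in>W p. v = orbit \<Delta> q \<and> path_dist (W p) p q < r)"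
proof
  assume "v \<in> leaf_ball L \<Delta> r (orbit \<Delta> p)"
  then have v: "v \<in> leaf L \<Delta> (orbit \<Delta> p)" "leaf_dist L (orbit \<Delta> p) v < r" by (auto simp: leaf_ball_def)
  then obtain q where q: "q \<in> W p" "v = orbit \<Delta> q" using leaf_iff[OF assms] by blast
  have "dset (orbit \<Delta> p) v \<noteq> {}" unfolding q(2) dset_orbit[OF assms] using q(1) orbit_self by blast
  with v(2) obtain x where "x \<in> dset (orbit \<Delta> p) v" "x < r" by (rule leaf_dist_lessE)
  then obtain q' where "q' \<in> orbit \<Delta> q" "q' \<in> W p" "path_dist (W p) p q' < r"
    unfolding q(2) dset_orbit[OF assms] by blast
  then show "\<exists>q\<in>W p. v = orbit \<Delta> q \<and> path_dist (W p) p q < r" using q(2) orbit_eqI by metis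
next
  assume "\<exists>q\<in>W p. v = orbit \<Delta> q \<and> path_dist (W p) p q < r"
  then obtain q where q: "q \<in> W p" "v = orbit \<Delta> q" "path_dist (W p) p q < r" by blast
  have "path_dist (W p) p q \<in> dset (orbit \<Delta> p) v"
    unfolding q(2) dset_orbit[OF assms] using q(1) orbit_self by blast
  then show "v \<in> leaf_ball L \<Delta> r (orbit \<Delta> p)"
    using leaf_dist_le q leaf_iff[OF assms] by (fastforce simp: leaf_ball_def)
qed

lemma leaf_eq:
  assumes "p \<in> T1H" "q \<in> W p"
  shows "leaf L \<Delta> (orbit \<Delta> q) = leaf L \<Delta> (orbit \<Delta> p)"
proof -
  have "q \<in> T1H" using assms W_T by blast
  then show ?thesis
    using leaf_iff[OF \<open>q \<in> T1H\<close>, unfolded W_eq[OF assms]] leaf_iff[OF assms(1)] by (intro subset_antisym subsetI) simp_all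
qed

lemma W_triangle:
  assumes "p \<in> T1H" "q \<in> W p" "r \<in> W p"
  shows "path_dist (W p) p r \<le> path_dist (W p) p q + path_dist (W q) q r"
proof -
  have q: "q \<in> T1H" using assms W_T by blast
  obtain c1 where "upath c1 (W p) p q" using W_path[OF assms(1,2)] by blast
  moreover obtain c2 where "upath c2 (W q) q r" using W_path[OF q, of r] W_eq[OF assms(1,2)] assms(3) by blast
  ultimately show ?thesis using path_dist_triangle[OF W_T] W_eq[OF assms(1,2)] by metis
qed

text \<open>\<open>leaf_topology\<close> is meaningful once the infimum over pairs of lifts is known
  to be a metric on the quotient leaf. Definiteness is the delicate point, since the infimum is not
  known to be attained.\<close>

lemma metric:
  assumes u: "u \<in> T1X \<Delta>"
  shows "Metric_space (leaf L \<Delta> u) (leaf_dist L)"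
proof
  fix x y z assume x: "x \<in> leaf L \<Delta> u" and y: "y \<in> leaf L \<Delta> u"
  obtain p0 where p0: "p0 \<in> T1H" "u = orbit \<Delta> p0" using T1X_E[OF u] .
  obtain p where p: "p \<in> W p0" "x = orbit \<Delta> p" using x leaf_iff[OF p0(1)] p0(2) by blast
  have pT: "p \<in> T1H" using p(1) W_T by blast
  have lu: "leaf L \<Delta> u = leaf L \<Delta> (orbit \<Delta> p)" using leaf_eq[OF p0(1) p(1)] p0 by simp
  obtain q where q: "q \<in> W p" "y = orbit \<Delta> q" using y leaf_iff[OF pT] lu by blast
  have qT: "q \<in> T1H" using q(1) W_T by blast
  have ne: "dset x y \<noteq> {}" unfolding p(2) q(2) dset_orbit[OF pT] using q(1) orbit_self by blast
  show "leaf_dist L x y = 0 \<longleftrightarrow> x = y"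
  proof
    assume "x = y"
    then have "path_dist (W p) p p \<in> dset x y"
      unfolding p(2) using p(2) dset_orbit[OF pT] W_self[OF pT] orbit_self by blast
    then show "leaf_dist L x y = 0"
      using leaf_dist_le[of _ x y] leaf_dist_nonneg[of x y] path_dist_self(2)[OF W_self[OF pT] W_T] by force
  next
    assume 0: "leaf_dist L x y = 0"
    \<comment> \<open>Local freeness allows at most one lift of \<open>y\<close> within
      \<open>e\<close> of \<open>p\<close>; since lifts are found at every scale, this one must be
      \<open>p\<close> itself.\<close>
    obtain e where e: "e > 0" "\<And>g q. g \<in> \<Delta> \<Longrightarrow> q \<in> T1H \<Longrightarrow> dist q p < e \<Longrightarrow> dist (lact g q) p < e \<Longrightarrow> g = mat 1"
      using locally_free[OF pT] by blast
    have near: "\<exists>q'\<in>orbit \<Delta> q. q' \<in> W p \<and> dist q' p < \<eta>" if \<eta>: "\<eta> > 0" for \<eta>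
    proof -
      obtain r where r: "r > 0" "\<And>c V q. upath c V p q \<Longrightarrow> V \<subseteq> T1H \<Longrightarrow> path_length c < r \<Longrightarrow> dist q p < \<eta>"
        using short_path_close[OF pT \<eta>] by blast
      obtain d where "d \<in> dset x y" "d < r" using leaf_dist_lessE[of x y r] 0 r(1) ne by auto
      then obtain q' where q': "q' \<in> orbit \<Delta> q" "q' \<in> W p" "path_dist (W p) p q' < r"
        unfolding p(2) q(2) dset_orbit[OF pT] by blast
      obtain c0 where "upath c0 (W p) p q'" using W_path[OF pT q'(2)] by blast
      then obtain c where "upath c (W p) p q'" "path_length c < r" using path_dist_less[OF q'(3)] by blast
      then have "dist q' p < \<eta>" using r(2) W_T by blast
      with q' show ?thesis by blast
    qed
    obtain q1 where q1: "q1 \<in> orbit \<Delta> q" "q1 \<in> W p" "dist q1 p < e" using near[OF e(1)] by blast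
    have "q1 = p"
    proof (rule ccontr)
      assume "q1 \<noteq> p"
      then have "min e (dist q1 p) > 0" using e(1) by simp
      then obtain q2 where q2: "q2 \<in> orbit \<Delta> q" "q2 \<in> W p" "dist q2 p < min e (dist q1 p)" using near by blast
      obtain g where g: "g \<in> \<Delta>" "q2 = lact g q1" using q1(1) q2(1) by (metis orbitE orbit_eqI)
      have "q1 \<in> T1H" using q1(2) W_T by blast
      moreover have "dist (lact g q1) p < e" using q2(3) g(2) by simp
      ultimately have "g = mat 1" using e(2)[OF g(1), of q1] q1(3) by simp
      then show False using g q2 by simp
    qed
    then show "x = y" using p(2) q(2) q1(1) orbit_eqI by metis
  qed
  assume z: "z \<in> leaf L \<Delta> u"
  have lq: "leaf L \<Delta> u = leaf L \<Delta> (orbit \<Delta> q)" using leaf_eq[OF pT q(1)] lu by simp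
  obtain r where r: "r \<in> W q" "z = orbit \<Delta> r" using z leaf_iff[OF qT] lq by blast
  have ne2: "dset y z \<noteq> {}" unfolding r(2) q(2) dset_orbit[OF qT] using r(1) orbit_self by blast
  show "leaf_dist L x z \<le> leaf_dist L x y + leaf_dist L y z"
  proof (rule field_le_epsilon)
    fix \<epsilon> :: real assume \<epsilon>: "\<epsilon> > 0"
    obtain d1 where "d1 \<in> dset x y" "d1 < leaf_dist L x y + \<epsilon> / 2"
      using leaf_dist_lessE[of x y "leaf_dist L x y + \<epsilon> / 2"] ne \<epsilon> by auto
    then obtain q' where q': "q' \<in> orbit \<Delta> q" "q' \<in> W p" "path_dist (W p) p q' < leaf_dist L x y + \<epsilon> / 2"
      unfolding p(2) q(2) dset_orbit[OF pT] by blast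
    have q'T: "q' \<in> T1H" using q'(2) W_T by blast
    have y': "y = orbit \<Delta> q'" using q(2) q'(1) orbit_eqI by metis
    obtain d2 where "d2 \<in> dset y z" "d2 < leaf_dist L y z + \<epsilon> / 2"
      using leaf_dist_lessE[of y z "leaf_dist L y z + \<epsilon> / 2"] ne2 \<epsilon> by auto
    then obtain r' where r': "r' \<in> orbit \<Delta> r" "r' \<in> W q'" "path_dist (W q') q' r' < leaf_dist L y z + \<epsilon> / 2"
      unfolding y' r(2) dset_orbit[OF q'T] by blast
    have "r' \<in> W p" using r'(2) W_eq[OF pT q'(2)] by simp
    then have "path_dist (W p) p r' \<in> dset x z" unfolding p(2) r(2) dset_orbit[OF pT] using r'(1) by blast
    then have "leaf_dist L x z \<le> path_dist (W p) p r'" by (rule leaf_dist_le)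
    also have "\<dots> \<le> path_dist (W p) p q' + path_dist (W q') q' r'"
      by (rule W_triangle[OF pT q'(2) \<open>r' \<in> W p\<close>])
    finally show "leaf_dist L x z \<le> leaf_dist L x y + leaf_dist L y z + \<epsilon>" using q'(3) r'(3) by linarith
  qed
qed (rule leaf_dist_nonneg leaf_dist_commute)+

lemma openin_leaf:
  assumes u: "u \<in> T1X \<Delta>"
  shows "openin (leaf_topology L \<Delta> u) V \<longleftrightarrow> V \<subseteq> leaf L \<Delta> u \<and> (\<forall>v\<in>V. \<exists>r>0. leaf_ball L \<Delta> r v \<subseteq> V)"
proof -
  interpret M: Metric_space "leaf L \<Delta> u" "leaf_dist L" by (rule metric[OF u])
  obtain p0 where p0: "p0 \<in> T1H" "u = orbit \<Delta> p0" using T1X_E[OF u] .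
  have mb: "M.mball v r = leaf_ball L \<Delta> r v" if v: "v \<in> leaf L \<Delta> u" for v r
  proof -
    obtain p where "p \<in> W p0" "v = orbit \<Delta> p" using v leaf_iff[OF p0(1)] p0(2) by blast
    then have *: "leaf L \<Delta> v = leaf L \<Delta> u" using leaf_eq[OF p0(1)] p0(2) by simp
    show ?thesis unfolding M.mball_def leaf_ball_def * using v by blast
  qed
  show ?thesis
  proof (cases "V \<subseteq> leaf L \<Delta> u")
    case True
    have "M.mball v r = leaf_ball L \<Delta> r v" if "v \<in> V" for v r
      by (rule mb[OF subsetD[OF True that]])
    then show ?thesis unfolding leaf_topology_def M.openin_mtopology Ball_def using True by simp
  qed (simp add: leaf_topology_def M.openin_mtopology)
qed

lemma topspace_leaf: "u \<in> T1X \<Delta> \<Longrightarrow> topspace (leaf_topology L \<Delta> u) = leaf L \<Delta> u"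
  unfolding leaf_topology_def using Metric_space.topspace_mtopology[OF metric] by blast

text \<open>Short leaf paths stay close in the Euclidean sense, so Euclidean neighbourhoods within a
  leaf are open for the leaf metric. This connects closures taken in the leaf topology with
  convergence of lifts.\<close>

lemma open_lift_nbhd:
  assumes q: "q \<in> T1H" and \<eta>: "\<eta> > 0"
  shows "openin (leaf_topology L \<Delta> (orbit \<Delta> q)) {orbit \<Delta> q' | q'. q' \<in> W q \<and> dist q' q < \<eta>}"
  unfolding openin_leaf[OF T1X_orbit[OF q]]
proof (intro conjI ballI)
  show "{orbit \<Delta> q' | q'. q' \<in> W q \<and> dist q' q < \<eta>} \<subseteq> leaf L \<Delta> (orbit \<Delta> q)"
    using leaf_iff[OF q] by blast
  fix v assume "v \<in> {orbit \<Delta> q' | q'. q' \<in> W q \<and> dist q' q < \<eta>}"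
  then obtain q1 where q1: "v = orbit \<Delta> q1" "q1 \<in> W q" "dist q1 q < \<eta>" by blast
  have q1T: "q1 \<in> T1H" using q1 W_T by blast
  have "\<eta> - dist q1 q > 0" using q1 by simp
  then obtain r where r: "r > 0" "\<And>c V x. upath c V q1 x \<Longrightarrow> V \<subseteq> T1H \<Longrightarrow> path_length c < r \<Longrightarrow> dist x q1 < \<eta> - dist q1 q"
    using short_path_close[OF q1T] by blast
  have "leaf_ball L \<Delta> r v \<subseteq> {orbit \<Delta> q' | q'. q' \<in> W q \<and> dist q' q < \<eta>}"
  proof
    fix x assume "x \<in> leaf_ball L \<Delta> r v"
    then obtain q2 where q2: "q2 \<in> W q1" "x = orbit \<Delta> q2" "path_dist (W q1) q1 q2 < r"
      using leaf_ball_iff[OF q1T] q1(1) by blast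
    obtain c0 where "upath c0 (W q1) q1 q2" using W_path[OF q1T q2(1)] by blast
    then obtain c where "upath c (W q1) q1 q2" "path_length c < r" using path_dist_less[OF q2(3)] by blast
    then have "dist q2 q1 < \<eta> - dist q1 q" using r(2) W_T by blast
    then have "dist q2 q < \<eta>" using dist_triangle[of q2 q q1] by linarith
    then show "x \<in> {orbit \<Delta> q' | q'. q' \<in> W q \<and> dist q' q < \<eta>}" using q2 W_eq[OF q q1(2)] by blast
  qed
  with r(1) show "\<exists>r>0. leaf_ball L \<Delta> r v \<subseteq> {orbit \<Delta> q' | q'. q' \<in> W q \<and> dist q' q < \<eta>}" by blast
qed

lemma open_leaf_eventually:
  assumes w: "w \<in> T1X \<Delta>" and V: "openin (leaf_topology L \<Delta> w) V" and q: "q \<in> T1H" "orbit \<Delta> q \<in> V"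
    and Q: "\<forall>\<^sub>F i in F. Q i \<in> W q" "((\<lambda>i. path_dist (W q) q (Q i)) \<longlongrightarrow> 0) F"
  shows "\<forall>\<^sub>F i in F. orbit \<Delta> (Q i) \<in> V"
proof -
  obtain r where r: "r > 0" "leaf_ball L \<Delta> r (orbit \<Delta> q) \<subseteq> V" using V q(2) unfolding openin_leaf[OF w] by blast
  have "\<forall>\<^sub>F i in F. path_dist (W q) q (Q i) < r" using order_tendstoD(2)[OF Q(2) r(1)] .
  with Q(1) show ?thesis
  proof eventually_elim
    case (elim i)
    then have "orbit \<Delta> (Q i) \<in> leaf_ball L \<Delta> r (orbit \<Delta> q)" using leaf_ball_iff[OF q(1)] by blast
    then show ?case using r(2) by blast
  qed
qed

end

sublocale kleinian \<subseteq> ss: leaf_family \<Delta> strong_stable ssl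
proof
  fix p q :: "'n uvec" and g
  show "strong_stable p = ssl p" if "p \<in> T1H" using strong_stable_eq[OF dim that] .
  show "strong_stable p = {}" if "p \<notin> T1H" using that by (simp add: strong_stable_def)
  show "ssl p \<subseteq> T1H" by (rule leaf_subset)
  show "p \<in> ssl p" if "p \<in> T1H" using that by (simp add: ssl_def)
  show "ssl q = ssl p" if "p \<in> T1H" "q \<in> ssl p" using that by (simp add: ssl_def)
  show "\<exists>c. upath c (ssl p) p q" if "p \<in> T1H" "q \<in> ssl p" using ssl_path[OF that] by metis
  show "lact g ` ssl p = ssl (lact g p)" if g: "g \<in> \<Delta>" and "p \<in> T1H"
  proof
    show "ssl (lact g p) \<subseteq> lact g ` ssl p"
    proof
      fix x assume x: "x \<in> ssl (lact g p)"
      then have "lact (matrix_inv g) x \<in> ssl p" using g inv_mem[OF g] by (simp add: ssl_def)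
      moreover have "x = lact g (lact (matrix_inv g) x)" using g by simp
      ultimately show "x \<in> lact g ` ssl p" by blast
    qed
  qed (use g in \<open>auto simp: ssl_def\<close>)
qed

sublocale kleinian \<subseteq> su: leaf_family \<Delta> strong_unstable sul
proof
  fix p q :: "'n uvec" and g
  show "strong_unstable p = sul p" if "p \<in> T1H" using strong_unstable_eq[OF dim that] .
  show "strong_unstable p = {}" if "p \<notin> T1H" using that by (simp add: strong_unstable_def)
  show "sul p \<subseteq> T1H" by (rule leaf_subset)
  show "p \<in> sul p" if "p \<in> T1H" using that by (simp add: sul_def)
  show "sul q = sul p" if "p \<in> T1H" "q \<in> sul p" using that by (simp add: sul_def)
  show "\<exists>c. upath c (sul p) p q" if "p \<in> T1H" "q \<in> sul p" using sul_path[OF that] by metis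
  show "lact g ` sul p = sul (lact g p)" if g: "g \<in> \<Delta>" and "p \<in> T1H"
  proof
    show "sul (lact g p) \<subseteq> lact g ` sul p"
    proof
      fix x assume x: "x \<in> sul (lact g p)"
      then have "lact (matrix_inv g) x \<in> sul p" using g inv_mem[OF g] by (simp add: sul_def)
      moreover have "x = lact g (lact (matrix_inv g) x)" using g by simp
      ultimately show "x \<in> lact g ` sul p" by blast
    qed
  qed (use g in \<open>auto simp: sul_def\<close>)
qed

sublocale kleinian \<subseteq> wu: leaf_family \<Delta> weak_unstable wul
proof
  fix p q :: "'n uvec" and g
  show "weak_unstable p = wul p" if "p \<in> T1H" using weak_unstable_eq[OF dim that] .
  show "weak_unstable p = {}" if "p \<notin> T1H" using that by (simp add: weak_unstable_def strong_unstable_def)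
  show "wul p \<subseteq> T1H" by (rule leaf_subset)
  show "p \<in> wul p" if "p \<in> T1H" using that leaf_subset(4)[of p] by (auto simp: sul_def)
  show "wul q = wul p" if "p \<in> T1H" "q \<in> wul p"
  proof -
    from that(2) obtain r where r: "r > 0" "nm q = r *\<^sub>R nm p" by (auto simp: wul_def)
    have "(\<exists>s>0. v = s *\<^sub>R nm q) \<longleftrightarrow> (\<exists>s>0. v = s *\<^sub>R nm p)" for v
    proof
      assume "\<exists>s>0. v = s *\<^sub>R nm q"
      then obtain s where "s > 0" "v = s *\<^sub>R nm q" by blast
      then show "\<exists>s>0. v = s *\<^sub>R nm p" using r by (intro exI[of _ "s * r"]) auto
    next
      assume "\<exists>s>0. v = s *\<^sub>R nm p"
      then obtain s where "s > 0" "v = s *\<^sub>R nm p" by blast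
      then show "\<exists>s>0. v = s *\<^sub>R nm q" using r by (intro exI[of _ "s / r"]) auto
    qed
    then show ?thesis by (simp add: wul_def)
  qed
  show "\<exists>c. upath c (wul p) p q" if "p \<in> T1H" "q \<in> wul p" using wul_path[OF that] by metis
  show "lact g ` wul p = wul (lact g p)" if g: "g \<in> \<Delta>" and "p \<in> T1H"
  proof
    show "wul (lact g p) \<subseteq> lact g ` wul p"
    proof
      fix x assume x: "x \<in> wul (lact g p)"
      then obtain r where r: "r > 0" "nm x = r *\<^sub>R (g *v nm p)" "x \<in> T1H" by (auto simp: wul_def)
      then have "nm (lact (matrix_inv g) x) = r *\<^sub>R nm p" using g by (simp add: matrix_vector_mult_scaleR)
      then have "lact (matrix_inv g) x \<in> wul p" using r inv_mem[OF g] by (auto simp: wul_def)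
      moreover have "x = lact g (lact (matrix_inv g) x)" using g by simp
      ultimately show "x \<in> lact g ` wul p" by blast
    qed
  qed (use g in \<open>auto simp: wul_def matrix_vector_mult_scaleR\<close>)
qed

context kleinian
begin

text \<open>The side \<open>U\<close> of a rectangle lies in a strong unstable ball, while the local
  product structure speaks of weak unstable balls. A path in the strong leaf is also one in the weak
  leaf, so the radius is kept.\<close>

lemma su_ball_subset_wu_ball:
  assumes w: "w \<in> T1X \<Delta>"
  shows "leaf_ball strong_unstable \<Delta> r w \<subseteq> leaf_ball weak_unstable \<Delta> r w"
proof
  obtain p where p: "p \<in> T1H" "w = orbit \<Delta> p" using T1X_E[OF w] .
  fix v assume "v \<in> leaf_ball strong_unstable \<Delta> r w"
  then obtain q where q: "q \<in> sul p" "v = orbit \<Delta> q" "path_dist (sul p) p q < r"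
    unfolding p(2) su.leaf_ball_iff[OF p(1)] by blast
  obtain c0 where "upath c0 (sul p) p q" using sul_path[OF p(1) q(1)] .
  then obtain c where c: "upath c (sul p) p q" "path_length c < r" using path_dist_less[OF q(3)] by blast
  have "path_dist (wul p) p q < r"
    using path_dist_le[OF upath_mono[OF c(1) leaf_subset(4)] leaf_subset(3)] c(2) by linarith
  then show "v \<in> leaf_ball weak_unstable \<Delta> r w"
    unfolding p(2) wu.leaf_ball_iff[OF p(1)] using q leaf_subset(4) by blast
qed

end

section \<open>Local product structure and rectangles\<close>

lemma T1H_norm_le:
  assumes "p \<in> T1H"
  shows "norm p \<le> 10 * fst p $ None"
proof -
  have c: "causal (np p)" "causal (nm p)" using T1HD[OF assms] by (auto intro: null_causal)
  have "norm (np p) \<le> 2 * np p $ None" "norm (nm p) \<le> 2 * nm p $ None"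
    by (intro causal_norm_le c)+
  moreover have "np p $ None + nm p $ None = 2 * fst p $ None" by (simp add: np_def nm_def)
  moreover have "np p $ None > 0" "nm p $ None > 0" using c by (auto simp: causal_def)
  ultimately have 1: "norm (np p) + norm (nm p) \<le> 4 * fst p $ None" by linarith
  have 2: "norm (fst p) \<le> 1/2 * (norm (np p) + norm (nm p))" "norm (snd p) \<le> 1/2 * (norm (np p) + norm (nm p))"
    unfolding fst_np_nm[of p] snd_np_nm[of p]
    using norm_triangle_ineq[of "np p" "nm p"] norm_triangle_ineq4[of "np p" "nm p"] by simp_all
  have 3: "norm p \<le> norm (fst p) + norm (snd p)"
    using norm_Pair_le[of "fst p" "snd p"] by (simp only: prod.collapse)
  have 4: "fst p $ None > 0" using fst_T1H[OF assms] by (simp add: hyp_space_def)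
  define t where "t = fst p $ None"
  from 1 2 have "norm (fst p) \<le> 2 * t" "norm (snd p) \<le> 2 * t" unfolding t_def by argo+
  with 3 have "norm p \<le> 4 * t" by linarith
  with 4 show ?thesis unfolding t_def by linarith
qed

locale markov = kleinian \<Delta> for \<Delta> :: "'n::finite lorentz set" +
  fixes \<epsilon>\<^sub>0 e \<delta> :: real and F :: "'n rect_family"
  assumes lps: "local_product_structure \<Delta> \<epsilon>\<^sub>0 e"
    and ms: "markov_section \<Delta> \<epsilon>\<^sub>0 e \<delta> F"
begin

abbreviation "B w \<equiv> leaf_ball weak_unstable \<Delta> \<epsilon>\<^sub>0 w"
abbreviation "C w \<equiv> leaf_ball strong_stable \<Delta> \<epsilon>\<^sub>0 w"
abbreviation "bra \<equiv> bracket \<Delta> e"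

lemma bracket_singleton:
  assumes "w \<in> T1X \<Delta>" "u \<in> B w" "s \<in> C w"
  shows "leaf_ball strong_stable \<Delta> e u \<inter> leaf_ball weak_unstable \<Delta> e s = {bra u s}"
proof -
  have "is_singleton (leaf_ball strong_stable \<Delta> e u \<inter> leaf_ball weak_unstable \<Delta> e s)"
    using lps assms unfolding local_product_structure_def Let_def by blast
  then show ?thesis unfolding bracket_def by (rule is_singleton_the_elem[THEN iffD1])
qed

lemma bracket_inj:
  assumes w: "w \<in> T1X \<Delta>" and "u \<in> B w" "s \<in> C w" "u' \<in> B w" "s' \<in> C w" and "bra u s = bra u' s'"
  shows "u = u' \<and> s = s'"
proof -
  have "homeomorphic_map
             (prod_topology (subtopology (leaf_topology weak_unstable \<Delta> w) (B w))
                            (subtopology (leaf_topology strong_stable \<Delta> w) (C w)))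
             (subtopology (T1X_topology \<Delta>) ((\<lambda>(u, s). bra u s) ` (B w \<times> C w))) (\<lambda>(u, s). bra u s)"
    using lps w unfolding local_product_structure_def Let_def by blast
  from homeomorphic_imp_injective_map[OF this]
  have "inj_on (\<lambda>(u, s). bra u s) ((leaf weak_unstable \<Delta> w \<inter> B w) \<times> (leaf strong_stable \<Delta> w \<inter> C w))"
    by (simp add: wu.topspace_leaf[OF w] ss.topspace_leaf[OF w])
  moreover have "leaf weak_unstable \<Delta> w \<inter> B w = B w" "leaf strong_stable \<Delta> w \<inter> C w = C w"
    by (auto simp: leaf_ball_def)
  ultimately have "inj_on (\<lambda>(u, s). bra u s) (B w \<times> C w)" by simp
  from inj_onD[OF this, of "(u, s)" "(u', s')"] assms(2-) show ?thesis by simp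
qed

text \<open>A lift \<open>p\<close> of \<open>[u, s]\<close> together with lifts \<open>p1\<close> of \<open>u\<close> and \<open>q1\<close> of \<open>s\<close> in its leaves.\<close>

definition corner :: "'n uvec \<Rightarrow> 'n uvec \<Rightarrow> 'n uvec \<Rightarrow> bool" where
  "corner p p1 q1 \<longleftrightarrow> p1 \<in> T1H \<and> q1 \<in> T1H \<and> p \<in> ssl p1 \<and> path_dist (ssl p1) p1 p < e \<and>
     p \<in> wul q1 \<and> path_dist (wul q1) q1 p < e"

lemma corner_exists:
  assumes w: "w \<in> T1X \<Delta>" and u: "u \<in> B w" and s: "s \<in> C w" and p: "orbit \<Delta> p = bra u s"
  obtains p1 q1 where "corner p p1 q1" "orbit \<Delta> p1 = u" "orbit \<Delta> q1 = s"
proof -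
  obtain w0 where w0: "w0 \<in> T1H" "w = orbit \<Delta> w0" using T1X_E[OF w] .
  obtain u0 where u0: "u0 \<in> T1H" "u = orbit \<Delta> u0" using u unfolding w0(2) wu.leaf_ball_iff[OF w0(1)] using leaf_subset(3) by blast
  obtain s0 where s0: "s0 \<in> T1H" "s = orbit \<Delta> s0" using s unfolding w0(2) ss.leaf_ball_iff[OF w0(1)] using leaf_subset(1) by blast
  have "orbit \<Delta> p \<in> leaf_ball strong_stable \<Delta> e u" "orbit \<Delta> p \<in> leaf_ball weak_unstable \<Delta> e s"
    using bracket_singleton[OF w u s] p by auto
  then obtain x y where x: "x \<in> ssl u0" "orbit \<Delta> p = orbit \<Delta> x" "path_dist (ssl u0) u0 x < e"
    and y: "y \<in> wul s0" "orbit \<Delta> p = orbit \<Delta> y" "path_dist (wul s0) s0 y < e"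
    unfolding u0(2) s0(2) ss.leaf_ball_iff[OF u0(1)] wu.leaf_ball_iff[OF s0(1)] by blast
  obtain g where g: "g \<in> \<Delta>" "p = lact g x" using x(2) orbit_eq_iff by blast
  obtain h where h: "h \<in> \<Delta>" "p = lact h y" using y(2) orbit_eq_iff by blast
  have "corner p (lact g u0) (lact h s0)"
    unfolding corner_def
  proof (intro conjI)
    show "p \<in> ssl (lact g u0)" unfolding g(2) using ss.W_lact_mem[OF g(1) u0(1)] x(1) by simp
    show "path_dist (ssl (lact g u0)) (lact g u0) p < e" unfolding g(2) ss.W_dist_lact[OF g(1) u0(1)] by (rule x(3))
    show "p \<in> wul (lact h s0)" unfolding h(2) using wu.W_lact_mem[OF h(1) s0(1)] y(1) by simp
    show "path_dist (wul (lact h s0)) (lact h s0) p < e" unfolding h(2) wu.W_dist_lact[OF h(1) s0(1)] by (rule y(3))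
  qed (use u0 s0 g h in auto)
  then show ?thesis using that u0 s0 g h by simp
qed

lemma cornerD:
  assumes "corner p p1 q1"
  shows "p \<in> T1H" "np p1 = np p" "nmk (np p) (nm q1) = p" "np p \<star> nm q1 < 0"
proof -
  have q1: "q1 \<in> T1H" "p \<in> wul q1" using assms by (auto simp: corner_def)
  show "p \<in> T1H" "np p1 = np p" using assms by (auto simp: corner_def ssl_def)
  show "nmk (np p) (nm q1) = p" by (rule wul_nmk[OF q1])
  show "np p \<star> nm q1 < 0" by (rule wul_neg[OF q1])
qed

text \<open>The vector \<open>nmk (np (P i)) (nm (Q i))\<close> is in the stable leaf of
  \<open>P i\<close> and the weak unstable leaf of \<open>Q i\<close>. Both leaf distances are
  strictly below \<open>e\<close> in the limit, hence eventually, and the intersection defining the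
  bracket is a single point. So brackets near a corner are given by this formula.\<close>

lemma corner_eventually:
  assumes w: "w \<in> T1X \<Delta>" and c: "corner p p1 q1"
    and P: "(P \<longlongrightarrow> p1) G" "\<forall>\<^sub>F i in G. P i \<in> T1H \<and> orbit \<Delta> (P i) \<in> B w"
    and Q: "(Q \<longlongrightarrow> q1) G" "\<forall>\<^sub>F i in G. Q i \<in> T1H \<and> orbit \<Delta> (Q i) \<in> C w"
  shows "\<forall>\<^sub>F i in G. nmk (np (P i)) (nm (Q i)) \<in> T1H \<and>
      orbit \<Delta> (nmk (np (P i)) (nm (Q i))) = bra (orbit \<Delta> (P i)) (orbit \<Delta> (Q i))"
    and "((\<lambda>i. nmk (np (P i)) (nm (Q i))) \<longlongrightarrow> p) G"
proof -
  note D = cornerD[OF c]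
  have c': "p1 \<in> T1H" "q1 \<in> T1H" "p \<in> ssl p1" "path_dist (ssl p1) p1 p < e" "p \<in> wul q1" "path_dist (wul q1) q1 p < e"
    using c by (auto simp: corner_def)
  have lim: "((\<lambda>i. nmk (np (P i)) (nm (Q i))) \<longlongrightarrow> nmk (np p1) (nm q1)) G"
    by (intro tendsto_intros P(1) Q(1)) (use D in simp)
  then show lim': "((\<lambda>i. nmk (np (P i)) (nm (Q i))) \<longlongrightarrow> p) G" by (simp add: D)
  have "((\<lambda>i. np (P i) \<star> nm (Q i)) \<longlongrightarrow> np p1 \<star> nm q1) G" by (intro tendsto_intros P(1) Q(1))
  then have neg: "\<forall>\<^sub>F i in G. np (P i) \<star> nm (Q i) < 0"
    using D(2,4) by (auto dest: order_tendstoD(2)[of _ _ _ 0])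
  have "((\<lambda>i. sqrt (- (nm (P i) \<star> nm (nmk (np (P i)) (nm (Q i)))))) \<longlongrightarrow> sqrt (- (nm p1 \<star> nm p))) G"
    by (intro tendsto_intros P(1) lim')
  moreover have "sqrt (- (nm p1 \<star> nm p)) < e" using ssl_dist[OF c'(1,3)] c'(4) by simp
  ultimately have d1: "\<forall>\<^sub>F i in G. sqrt (- (nm (P i) \<star> nm (nmk (np (P i)) (nm (Q i))))) < e"
    by (auto dest: order_tendstoD(2))
  have n1: "\<forall>\<^sub>F i in G. null (np (Q i))" "\<forall>\<^sub>F i in G. null (nm (Q i))"
    using Q(2) by (eventually_elim, auto dest: T1HD)+
  have n2: "\<forall>\<^sub>F i in G. null (np (P i))" using P(2) by eventually_elim (auto dest: T1HD)
  have l1: "((\<lambda>i. np (Q i)) \<longlongrightarrow> np q1) G" "((\<lambda>i. nm (Q i)) \<longlongrightarrow> nm q1) G"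
    by (intro tendsto_intros Q(1))+
  have l2: "((\<lambda>i. np (P i)) \<longlongrightarrow> np p) G"
    unfolding D(2)[symmetric] by (intro tendsto_intros P(1))
  have d2: "\<forall>\<^sub>F i in G. path_dist (wul (nmk (np (Q i)) (nm (Q i)))) (nmk (np (Q i)) (nm (Q i))) (nmk (np (P i)) (nm (Q i))) < e"
    by (rule wul_dist_eventually[OF c'(2,5,6) l1(1) l2 l1(2) n1(1) n2 n1(2)])
  show "\<forall>\<^sub>F i in G. nmk (np (P i)) (nm (Q i)) \<in> T1H \<and>
      orbit \<Delta> (nmk (np (P i)) (nm (Q i))) = bra (orbit \<Delta> (P i)) (orbit \<Delta> (Q i))"
    using P(2) Q(2) neg d1 d2
  proof eventually_elim
    case (elim i)
    define x where "x = nmk (np (P i)) (nm (Q i))"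
    have xT: "x \<in> T1H" unfolding x_def using elim T1HD(1)[of "P i"] T1HD(2)[of "Q i"] by (intro nmk_in_T1H) auto
    have npx: "np x = np (P i)" by (simp add: x_def nmk_def)
    have x1: "x \<in> ssl (P i)" using xT npx by (simp add: ssl_def)
    then have "path_dist (ssl (P i)) (P i) x < e" using ssl_dist[of "P i" x] elim by (simp add: x_def)
    then have 1: "orbit \<Delta> x \<in> leaf_ball strong_stable \<Delta> e (orbit \<Delta> (P i))"
      using ss.leaf_ball_iff[of "P i"] elim x1 by blast
    have "nm x = (- 2 / (np (P i) \<star> nm (Q i))) *\<^sub>R nm (Q i)" by (simp add: x_def nmk_def)
    moreover have "- 2 / (np (P i) \<star> nm (Q i)) > 0" using elim by (simp add: divide_neg_neg)
    ultimately have x2: "x \<in> wul (Q i)" unfolding wul_def using xT by blast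
    have "nmk (np (Q i)) (nm (Q i)) = Q i" using elim by (intro nmk_self) simp
    then have "path_dist (wul (Q i)) (Q i) x < e" using elim by (simp add: x_def)
    then have 2: "orbit \<Delta> x \<in> leaf_ball weak_unstable \<Delta> e (orbit \<Delta> (Q i))"
      using wu.leaf_ball_iff[of "Q i"] elim x2 by blast
    show ?case using bracket_singleton[OF w, of "orbit \<Delta> (P i)" "orbit \<Delta> (Q i)"] 1 2 elim xT
      unfolding x_def[symmetric] by blast
  qed
qed

subsection \<open>The rectangles of the section\<close>

lemma rectD:
  assumes "j \<in> alphabet F"
  shows "sbw F j \<in> \<Omega> \<Delta>" "sbw F j \<in> T1X \<Delta>" "sbw F j \<in> sbU F j" "sbw F j \<in> sbS F j"
    "sbU F j \<subseteq> leaf_ball strong_unstable \<Delta> \<epsilon>\<^sub>0 (sbw F j) \<inter> \<Omega> \<Delta>"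
    "sbS F j \<subseteq> C (sbw F j) \<inter> \<Omega> \<Delta>"
    "sbU F j = (U_topology \<Delta> (sbw F j)) closure_of (int_U \<Delta> F j)"
    "sbS F j = (S_topology \<Delta> (sbw F j)) closure_of (int_S \<Delta> F j)"
    "Rj \<Delta> e F j \<subseteq> \<Omega> \<Delta>" "sbU F j \<subseteq> B (sbw F j)"
    "int_U \<Delta> F j \<subseteq> sbU F j" "int_S \<Delta> F j \<subseteq> sbS F j"
proof -
  have "is_rectangle \<Delta> \<epsilon>\<^sub>0 e (sbw F j) (sbU F j) (sbS F j)"
    using bspec[OF conjunct1[OF ms[unfolded markov_section_def]] assms] .
  note r = this[unfolded is_rectangle_def, folded int_U_def int_S_def Rj_def]
  show 1: "sbw F j \<in> \<Omega> \<Delta>" using r by (elim conjE)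
  then show w: "sbw F j \<in> T1X \<Delta>" by (simp add: \<Omega>_def)
  show "sbw F j \<in> sbU F j" using r by (elim conjE)
  show "sbw F j \<in> sbS F j" using r by (elim conjE)
  show U: "sbU F j \<subseteq> leaf_ball strong_unstable \<Delta> \<epsilon>\<^sub>0 (sbw F j) \<inter> \<Omega> \<Delta>" using r by (elim conjE)
  show "sbS F j \<subseteq> C (sbw F j) \<inter> \<Omega> \<Delta>" using r by (elim conjE)
  show "sbU F j = (U_topology \<Delta> (sbw F j)) closure_of (int_U \<Delta> F j)" using r by (elim conjE)
  show "sbS F j = (S_topology \<Delta> (sbw F j)) closure_of (int_S \<Delta> F j)" using r by (elim conjE)
  show "Rj \<Delta> e F j \<subseteq> \<Omega> \<Delta>" using r by (elim conjE)
  show "sbU F j \<subseteq> B (sbw F j)" using U su_ball_subset_wu_ball[OF w, of \<epsilon>\<^sub>0] by blast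
  show "int_U \<Delta> F j \<subseteq> sbU F j" "int_S \<Delta> F j \<subseteq> sbS F j"
    unfolding int_U_def int_S_def by (rule interior_of_subset)+
qed

text \<open>Full preimages in \<open>T1H\<close>, hence invariant under the group, in contrast to
  the chosen lifts \<open>Lf\<close> introduced later.\<close>

definition Rt :: "nat \<Rightarrow> 'n uvec set" where "Rt j = {p \<in> T1H. orbit \<Delta> p \<in> Rj \<Delta> e F j}"
definition It :: "nat \<Rightarrow> 'n uvec set" where "It j = {p \<in> T1H. orbit \<Delta> p \<in> int_R \<Delta> e F j}"

lemma Rt_lact [simp]: "g \<in> \<Delta> \<Longrightarrow> lact g p \<in> Rt j \<longleftrightarrow> p \<in> Rt j"
  and It_lact [simp]: "g \<in> \<Delta> \<Longrightarrow> lact g p \<in> It j \<longleftrightarrow> p \<in> It j"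
  by (simp_all add: Rt_def It_def)

lemma int_R_subset: "j \<in> alphabet F \<Longrightarrow> int_R \<Delta> e F j \<subseteq> Rj \<Delta> e F j"
  using rectD(11,12)[of j] unfolding int_R_def Rj_def rect_def by blast

lemma It_subset: "j \<in> alphabet F \<Longrightarrow> It j \<subseteq> Rt j"
  using int_R_subset[of j] by (auto simp: Rt_def It_def)

lemma Rt_Z: "j \<in> alphabet F \<Longrightarrow> p \<in> Rt j \<Longrightarrow> p \<in> Z"
  using rectD(9)[of j] orbit_in_\<Omega>[of p] by (auto simp: Rt_def)

lemma Rt_disjoint: "i \<in> alphabet F \<Longrightarrow> j \<in> alphabet F \<Longrightarrow> p \<in> Rt i \<Longrightarrow> p \<in> Rt j \<Longrightarrow> i = j"
  using conjunct1[OF conjunct2[OF ms[unfolded markov_section_def]]]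
  unfolding disjoint_family_on_def Rt_def by blast

lemma It_E:
  assumes j: "j \<in> alphabet F" and p: "p \<in> It j"
  obtains p1 q1 where "corner p p1 q1" "orbit \<Delta> p1 \<in> int_U \<Delta> F j" "orbit \<Delta> q1 \<in> int_S \<Delta> F j"
proof -
  obtain u s where us: "u \<in> int_U \<Delta> F j" "s \<in> int_S \<Delta> F j" "orbit \<Delta> p = bra u s"
    using p by (auto simp: It_def int_R_def rect_def)
  have "u \<in> B (sbw F j)" "s \<in> C (sbw F j)" using us rectD(6,10,11,12)[OF j] by blast+
  from corner_exists[OF rectD(2)[OF j] this us(3)] us that show ?thesis by metis
qed

lemma Rt_E:
  assumes j: "j \<in> alphabet F" and p: "p \<in> Rt j"
  obtains p1 q1 where "corner p p1 q1" "orbit \<Delta> p1 \<in> sbU F j" "orbit \<Delta> q1 \<in> sbS F j"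
proof -
  obtain u s where us: "u \<in> sbU F j" "s \<in> sbS F j" "orbit \<Delta> p = bra u s"
    using p by (auto simp: Rt_def Rj_def rect_def)
  have "u \<in> B (sbw F j)" "s \<in> C (sbw F j)" using us rectD(6,10)[OF j] by blast+
  from corner_exists[OF rectD(2)[OF j] this us(3)] us that show ?thesis by metis
qed

lemma ssl_dist_tendsto:
  assumes "q \<in> T1H" "\<forall>\<^sub>F i in G. Q i \<in> ssl q" "(Q \<longlongrightarrow> q) G"
  shows "((\<lambda>i. path_dist (ssl q) q (Q i)) \<longlongrightarrow> 0) G"
proof -
  have "((\<lambda>i. sqrt (- (nm q \<star> nm (Q i)))) \<longlongrightarrow> sqrt (- (nm q \<star> nm q))) G"
    by (intro tendsto_intros assms)
  then have "((\<lambda>i. sqrt (- (nm q \<star> nm (Q i)))) \<longlongrightarrow> 0) G"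
    using T1HD(2)[OF assms(1)] by (simp add: null_def)
  then show ?thesis
    by (rule Lim_transform_eventually) (use assms(2) in eventually_elim, simp add: ssl_dist[OF assms(1)])
qed

lemma sul_dist_tendsto:
  assumes "q \<in> T1H" "\<forall>\<^sub>F i in G. Q i \<in> sul q" "(Q \<longlongrightarrow> q) G"
  shows "((\<lambda>i. path_dist (sul q) q (Q i)) \<longlongrightarrow> 0) G"
proof -
  have "((\<lambda>i. sqrt (- (np q \<star> np (Q i)))) \<longlongrightarrow> sqrt (- (np q \<star> np q))) G"
    by (intro tendsto_intros assms)
  then have "((\<lambda>i. sqrt (- (np q \<star> np (Q i)))) \<longlongrightarrow> 0) G"
    using T1HD(1)[OF assms(1)] by (simp add: null_def)
  then show ?thesis
    by (rule Lim_transform_eventually) (use assms(2) in eventually_elim, simp add: sul_dist[OF assms(1)])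
qed

lemma openin_U_eventually:
  assumes w: "w \<in> T1X \<Delta>" and V: "openin (U_topology \<Delta> w) V" and q: "q \<in> T1H" "orbit \<Delta> q \<in> V"
    and Q: "\<forall>\<^sub>F i in G. Q i \<in> sul q \<and> Q i \<in> Z" "(Q \<longlongrightarrow> q) G"
  shows "\<forall>\<^sub>F i in G. orbit \<Delta> (Q i) \<in> V"
proof -
  obtain V' where V': "openin (leaf_topology strong_unstable \<Delta> w) V'" "V = V' \<inter> \<Omega> \<Delta>"
    using V unfolding U_topology_def openin_subtopology by blast
  have Qs: "\<forall>\<^sub>F i in G. Q i \<in> sul q" using Q(1) by eventually_elim simp
  have "\<forall>\<^sub>F i in G. orbit \<Delta> (Q i) \<in> V'"
    by (rule su.open_leaf_eventually[OF w V'(1) q(1) _ Qs sul_dist_tendsto[OF q(1) Qs Q(2)]]) (use q V' in blast)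
  with Q(1) show ?thesis
    by eventually_elim (use V'(2) orbit_in_\<Omega> Z_T1H in blast)
qed

lemma openin_S_eventually:
  assumes w: "w \<in> T1X \<Delta>" and V: "openin (S_topology \<Delta> w) V" and q: "q \<in> T1H" "orbit \<Delta> q \<in> V"
    and Q: "\<forall>\<^sub>F i in G. Q i \<in> ssl q \<and> Q i \<in> Z" "(Q \<longlongrightarrow> q) G"
  shows "\<forall>\<^sub>F i in G. orbit \<Delta> (Q i) \<in> V"
proof -
  obtain V' where V': "openin (leaf_topology strong_stable \<Delta> w) V'" "V = V' \<inter> \<Omega> \<Delta>"
    using V unfolding S_topology_def openin_subtopology by blast
  have Qs: "\<forall>\<^sub>F i in G. Q i \<in> ssl q" using Q(1) by eventually_elim simp
  have "\<forall>\<^sub>F i in G. orbit \<Delta> (Q i) \<in> V'"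
    by (rule ss.open_leaf_eventually[OF w V'(1) q(1) _ Qs ssl_dist_tendsto[OF q(1) Qs Q(2)]]) (use q V' in blast)
  with Q(1) show ?thesis
    by eventually_elim (use V'(2) orbit_in_\<Omega> Z_T1H in blast)
qed

text \<open>A vector near \<open>p\<close> has its forward direction realised in the unstable leaf
  of \<open>p1\<close> and its backward direction in the stable leaf of \<open>q1\<close>. Its
  endpoints are limit points, so these realisations lie in the open sides, and their bracket is the
  vector itself moved by the flow for a short time.\<close>

lemma It_open:
  assumes j: "j \<in> alphabet F" and p: "p \<in> It j" and Q: "(Q \<longlongrightarrow> p) G" "\<forall>\<^sub>F i in G. Q i \<in> Z"
  obtains T where "(T \<longlongrightarrow> 0) G" "\<forall>\<^sub>F i in G. flow (T i) (Q i) \<in> It j"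
proof -
  obtain p1 q1 where c: "corner p p1 q1" "orbit \<Delta> p1 \<in> int_U \<Delta> F j" "orbit \<Delta> q1 \<in> int_S \<Delta> F j"
    using It_E[OF j p] .
  note D = cornerD[OF c(1)]
  have T1: "p1 \<in> T1H" "q1 \<in> T1H" using c(1) by (auto simp: corner_def)
  have Z1: "p1 \<in> Z" "q1 \<in> Z" using c(2,3) rectD(5,6,11,12)[OF j] orbit_in_\<Omega> T1 by blast+
  \<comment> \<open>The factor that gives \<open>np (Q i)\<close> the product -2 with
    \<open>nm p1\<close>; its logarithm is the flow time to the rectangle.\<close>
  define k where "k i = - 2 / (np (Q i) \<star> nm p1)" for i
  define T where "T i = ln (k i)" for i
  define P where "P i = mk (k i *\<^sub>R np (Q i)) (nm p1)" for i
  define R where "R i = nmk (np q1) (nm (Q i))" for i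
  have pp: "np p \<star> nm p1 = -2" using T1HD(3)[OF T1(1)] D(2) by simp
  have lk: "(k \<longlongrightarrow> 1) G"
  proof -
    have "(k \<longlongrightarrow> - 2 / (np p \<star> nm p1)) G" unfolding k_def by (intro tendsto_intros Q(1)) (use pp in simp)
    then show ?thesis by (simp add: pp)
  qed
  then have kpos: "\<forall>\<^sub>F i in G. k i > 0" by (auto dest: order_tendstoD(1)[of _ _ _ 0])
  have lT: "(T \<longlongrightarrow> 0) G"
  proof -
    have "(T \<longlongrightarrow> ln 1) G" unfolding T_def by (intro tendsto_intros lk) simp
    then show ?thesis by simp
  qed
  have lP: "(P \<longlongrightarrow> p1) G"
  proof -
    have "(P \<longlongrightarrow> mk (1 *\<^sub>R np p) (nm p1)) G" unfolding P_def by (intro tendsto_intros lk Q(1))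
    then show ?thesis unfolding D(2)[symmetric] by simp
  qed
  obtain r where r: "r > 0" "nm p = r *\<^sub>R nm q1" using c(1) by (auto simp: corner_def wul_def)
  have neg: "np q1 \<star> nm p < 0" using T1HD(3)[OF T1(2)] r by (simp add: mink_simps)
  have lR: "(R \<longlongrightarrow> q1) G"
  proof -
    have "(R \<longlongrightarrow> nmk (np q1) (nm p)) G" unfolding R_def by (intro tendsto_intros Q(1)) (use neg in simp)
    moreover have "nmk (np q1) (nm p) = nmk (np q1) (nm q1)" using r by (simp add: nmk_def mink_simps)
    ultimately show ?thesis by (simp add: nmk_self[OF T1(2)])
  qed
  have "((\<lambda>i. np q1 \<star> nm (Q i)) \<longlongrightarrow> np q1 \<star> nm p) G" by (intro tendsto_intros Q(1))
  then have negR: "\<forall>\<^sub>F i in G. np q1 \<star> nm (Q i) < 0" using neg by (auto dest: order_tendstoD(2)[of _ _ _ 0])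
  have PZ: "\<forall>\<^sub>F i in G. P i \<in> sul p1 \<and> P i \<in> Z"
    using Q(2) kpos
  proof eventually_elim
    case (elim i)
    have "np (Q i) \<star> nm p1 \<noteq> 0" using elim(2) by (auto simp: k_def)
    then have "P i \<in> T1H"
      unfolding P_def using elim T1HD(1)[OF Z_T1H[OF elim(1)]] T1HD(2)[OF T1(1)]
      by (intro mk_in_T1H null_scale) (auto simp: mink_simps k_def)
    then show ?case using elim Z1(1) by (simp add: sul_def Z_def P_def)
  qed
  have RZ: "\<forall>\<^sub>F i in G. R i \<in> ssl q1 \<and> R i \<in> Z"
    using Q(2) negR
  proof eventually_elim
    case (elim i)
    have RT: "R i \<in> T1H"
      unfolding R_def using elim T1HD(2)[OF Z_T1H[OF elim(1)]] T1HD(1)[OF T1(2)] by (intro nmk_in_T1H) auto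
    have "- 2 / (np q1 \<star> nm (Q i)) > 0" using elim by (simp add: divide_neg_neg)
    then have "inL ((- 2 / (np q1 \<star> nm (Q i))) *\<^sub>R nm (Q i))" using elim(1) by (intro inL_scale) (simp_all add: Z_def)
    then show ?case using RT Z1(2) by (simp add: ssl_def Z_def R_def nmk_def)
  qed
  have w: "sbw F j \<in> T1X \<Delta>" by (rule rectD(2)[OF j])
  have U: "\<forall>\<^sub>F i in G. orbit \<Delta> (P i) \<in> int_U \<Delta> F j"
    by (rule openin_U_eventually[OF w _ T1(1) c(2) PZ lP]) (simp add: int_U_def)
  have S: "\<forall>\<^sub>F i in G. orbit \<Delta> (R i) \<in> int_S \<Delta> F j"
    by (rule openin_S_eventually[OF w _ T1(2) c(3) RZ lR]) (simp add: int_S_def)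
  have PB: "\<forall>\<^sub>F i in G. P i \<in> T1H \<and> orbit \<Delta> (P i) \<in> B (sbw F j)"
    using U PZ by eventually_elim (use rectD(10,11)[OF j] Z_T1H in blast)
  have RC: "\<forall>\<^sub>F i in G. R i \<in> T1H \<and> orbit \<Delta> (R i) \<in> C (sbw F j)"
    using S RZ by eventually_elim (use rectD(6,12)[OF j] Z_T1H in blast)
  have "\<forall>\<^sub>F i in G. flow (T i) (Q i) \<in> It j"
    using corner_eventually(1)[OF w c(1) lP PB lR RC] U S kpos Q(2) negR
  proof eventually_elim
    case (elim i)
    have QT: "Q i \<in> T1H" using elim Z_T1H by blast
    have "nmk (np (P i)) (nm (R i)) = flow (T i) (Q i)"
    proof (rule uvec_eqI)
      show "np (nmk (np (P i)) (nm (R i))) = np (flow (T i) (Q i))"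
        using elim by (simp add: nmk_def P_def T_def)
      show "nm (nmk (np (P i)) (nm (R i))) = nm (flow (T i) (Q i))"
        using elim T1HD(3)[OF QT] by (simp add: nmk_def P_def R_def T_def mink_simps exp_minus field_simps)
    qed
    then show ?case using elim unfolding It_def int_R_def rect_def by auto
  qed
  with lT show ?thesis by (rule that)
qed

lemma U_leaf_topology:
  assumes "w \<in> T1X \<Delta>" "orbit \<Delta> q \<in> leaf strong_unstable \<Delta> w"
  shows "leaf_topology strong_unstable \<Delta> (orbit \<Delta> q) = leaf_topology strong_unstable \<Delta> w"
proof -
  obtain w0 where w0: "w0 \<in> T1H" "w = orbit \<Delta> w0" using T1X_E[OF assms(1)] .
  then obtain q' where "q' \<in> sul w0" "orbit \<Delta> q = orbit \<Delta> q'" using assms(2) su.leaf_iff by blast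
  then show ?thesis using su.leaf_eq[OF w0(1)] w0(2) by (simp add: leaf_topology_def)
qed

lemma S_leaf_topology:
  assumes "w \<in> T1X \<Delta>" "orbit \<Delta> q \<in> leaf strong_stable \<Delta> w"
  shows "leaf_topology strong_stable \<Delta> (orbit \<Delta> q) = leaf_topology strong_stable \<Delta> w"
proof -
  obtain w0 where w0: "w0 \<in> T1H" "w = orbit \<Delta> w0" using T1X_E[OF assms(1)] .
  then obtain q' where "q' \<in> ssl w0" "orbit \<Delta> q = orbit \<Delta> q'" using assms(2) ss.leaf_iff by blast
  then show ?thesis using ss.leaf_eq[OF w0(1)] w0(2) by (simp add: leaf_topology_def)
qed

lemma int_U_dense:
  assumes j: "j \<in> alphabet F" and q: "q \<in> T1H" "orbit \<Delta> q \<in> sbU F j" and \<eta>: "\<eta> > 0"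
  obtains q' where "q' \<in> sul q" "dist q' q < \<eta>" "orbit \<Delta> q' \<in> int_U \<Delta> F j"
proof -
  have w: "sbw F j \<in> T1X \<Delta>" by (rule rectD(2)[OF j])
  define N where "N = {orbit \<Delta> q' | q'. q' \<in> sul q \<and> dist q' q < \<eta>}"
  have "orbit \<Delta> q \<in> leaf strong_unstable \<Delta> (sbw F j)" using rectD(5)[OF j] q(2) by (auto simp: leaf_ball_def)
  then have "openin (leaf_topology strong_unstable \<Delta> (sbw F j)) N"
    using su.open_lift_nbhd[OF q(1) \<eta>] U_leaf_topology[OF w] by (simp add: N_def)
  then have "openin (U_topology \<Delta> (sbw F j)) (N \<inter> \<Omega> \<Delta>)"
    unfolding U_topology_def openin_subtopology by blast
  moreover have "orbit \<Delta> q \<in> N \<inter> \<Omega> \<Delta>"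
  proof
    show "orbit \<Delta> q \<in> N" unfolding N_def using \<eta> su.W_self[OF q(1)] by (intro CollectI exI[of _ q]) simp
    show "orbit \<Delta> q \<in> \<Omega> \<Delta>" using rectD(5)[OF j] q(2) by blast
  qed
  moreover have "orbit \<Delta> q \<in> (U_topology \<Delta> (sbw F j)) closure_of (int_U \<Delta> F j)"
    using q(2) rectD(7)[OF j] by blast
  ultimately obtain v where "v \<in> int_U \<Delta> F j" "v \<in> N \<inter> \<Omega> \<Delta>"
    unfolding in_closure_of by blast
  then show ?thesis using that by (auto simp: N_def)
qed

lemma int_S_dense:
  assumes j: "j \<in> alphabet F" and q: "q \<in> T1H" "orbit \<Delta> q \<in> sbS F j" and \<eta>: "\<eta> > 0"
  obtains q' where "q' \<in> ssl q" "dist q' q < \<eta>" "orbit \<Delta> q' \<in> int_S \<Delta> F j"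
proof -
  have w: "sbw F j \<in> T1X \<Delta>" by (rule rectD(2)[OF j])
  define N where "N = {orbit \<Delta> q' | q'. q' \<in> ssl q \<and> dist q' q < \<eta>}"
  have "orbit \<Delta> q \<in> leaf strong_stable \<Delta> (sbw F j)" using rectD(6)[OF j] q(2) by (auto simp: leaf_ball_def)
  then have "openin (leaf_topology strong_stable \<Delta> (sbw F j)) N"
    using ss.open_lift_nbhd[OF q(1) \<eta>] S_leaf_topology[OF w] by (simp add: N_def)
  then have "openin (S_topology \<Delta> (sbw F j)) (N \<inter> \<Omega> \<Delta>)"
    unfolding S_topology_def openin_subtopology by blast
  moreover have "orbit \<Delta> q \<in> N \<inter> \<Omega> \<Delta>"
  proof
    show "orbit \<Delta> q \<in> N" unfolding N_def using \<eta> ss.W_self[OF q(1)] by (intro CollectI exI[of _ q]) simp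
    show "orbit \<Delta> q \<in> \<Omega> \<Delta>" using rectD(6)[OF j] q(2) by blast
  qed
  moreover have "orbit \<Delta> q \<in> (S_topology \<Delta> (sbw F j)) closure_of (int_S \<Delta> F j)"
    using q(2) rectD(8)[OF j] by blast
  ultimately obtain v where "v \<in> int_S \<Delta> F j" "v \<in> N \<inter> \<Omega> \<Delta>"
    unfolding in_closure_of by blast
  then show ?thesis using that by (auto simp: N_def)
qed

text \<open>Both sides are closures of their interiors, and the local formula for the bracket
  carries density over to the rectangle.\<close>

lemma It_dense:
  assumes j: "j \<in> alphabet F" and p: "p \<in> Rt j"
  obtains Q where "\<And>n::nat. Q n \<in> It j" "Q \<longlonglongrightarrow> p"
proof -
  obtain p1 q1 where c: "corner p p1 q1" "orbit \<Delta> p1 \<in> sbU F j" "orbit \<Delta> q1 \<in> sbS F j"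
    using Rt_E[OF j p] .
  have T1: "p1 \<in> T1H" "q1 \<in> T1H" using c(1) by (auto simp: corner_def)
  have "\<exists>x. x \<in> sul p1 \<and> dist x p1 < inverse (real (Suc n)) \<and> orbit \<Delta> x \<in> int_U \<Delta> F j" for n
    using int_U_dense[OF j T1(1) c(2), of "inverse (real (Suc n))"] by (metis inverse_positive_iff_positive of_nat_0_less_iff zero_less_Suc)
  then obtain P where P: "\<And>n. P n \<in> sul p1" "\<And>n. dist (P n) p1 < inverse (real (Suc n))" "\<And>n. orbit \<Delta> (P n) \<in> int_U \<Delta> F j"
    by metis
  have "\<exists>x. x \<in> ssl q1 \<and> dist x q1 < inverse (real (Suc n)) \<and> orbit \<Delta> x \<in> int_S \<Delta> F j" for n
    using int_S_dense[OF j T1(2) c(3), of "inverse (real (Suc n))"] by (metis inverse_positive_iff_positive of_nat_0_less_iff zero_less_Suc)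
  then obtain R where R: "\<And>n. R n \<in> ssl q1" "\<And>n. dist (R n) q1 < inverse (real (Suc n))" "\<And>n. orbit \<Delta> (R n) \<in> int_S \<Delta> F j"
    by metis
  have lim: "X \<longlonglongrightarrow> x" if "\<And>n. dist (X n) x < inverse (real (Suc n))" for X :: "nat \<Rightarrow> 'n uvec" and x
  proof (rule tendsto_dist_iff[THEN iffD2], rule tendsto_sandwich[OF _ _ tendsto_const LIMSEQ_inverse_real_of_nat])
    show "\<forall>\<^sub>F n in sequentially. dist (X n) x \<le> inverse (real (Suc n))" using that by (simp add: less_imp_le)
  qed simp
  define x where "x n = nmk (np (P n)) (nm (R n))" for n
  have PB: "\<forall>\<^sub>F i in sequentially. P i \<in> T1H \<and> orbit \<Delta> (P i) \<in> B (sbw F j)"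
    using P rectD(10,11)[OF j] leaf_subset(2) by (intro always_eventually) blast
  have RC: "\<forall>\<^sub>F i in sequentially. R i \<in> T1H \<and> orbit \<Delta> (R i) \<in> C (sbw F j)"
    using R rectD(6,12)[OF j] leaf_subset(1) by (intro always_eventually) blast
  note ce = corner_eventually[OF rectD(2)[OF j] c(1) lim[OF P(2)] PB lim[OF R(2)] RC]
  have "\<forall>\<^sub>F n in sequentially. x n \<in> It j"
    using ce(1)
  proof eventually_elim
    case (elim n)
    then show ?case using P(3)[of n] R(3)[of n] unfolding It_def int_R_def rect_def x_def by blast
  qed
  then obtain N where N: "\<And>n. n \<ge> N \<Longrightarrow> x n \<in> It j" unfolding eventually_sequentially by blast
  have "(\<lambda>n. x (n + N)) \<longlonglongrightarrow> p" using ce(2) LIMSEQ_ignore_initial_segment unfolding x_def by blast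
  with N show ?thesis by (intro that[of "\<lambda>n. x (n + N)"]) auto
qed

end

section \<open>Compactness of rectangles and separation of return times\<close>

lemma frequently_zero_limit:
  fixes f :: "nat \<Rightarrow> real"
  assumes "f \<longlonglongrightarrow> l" "\<exists>\<^sub>F n in sequentially. f n = 0"
  shows "l = 0"
proof (rule ccontr)
  assume "l \<noteq> 0"
  then have "\<forall>\<^sub>F n in sequentially. f n \<noteq> 0" using tendsto_imp_eventually_ne[OF assms(1)] by blast
  then show False using assms(2) by (simp add: frequently_def)
qed

text \<open>Rounding to multiples of \<open>\<epsilon>\<close> is injective on a set of points that
  are at least \<open>\<epsilon>\<close> apart.\<close>

lemma separated_card:
  fixes S :: "real set"
  assumes S: "S \<subseteq> {a<..<b}" and \<epsilon>: "\<epsilon> > 0" and sep: "\<And>s t. s \<in> S \<Longrightarrow> t \<in> S \<Longrightarrow> s < t \<Longrightarrow> t - s \<ge> \<epsilon>"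
  shows "finite S" "card S \<le> card {0..\<lfloor>(b - a) / \<epsilon>\<rfloor>}"
proof -
  define f where "f t = \<lfloor>(t - a) / \<epsilon>\<rfloor>" for t
  have lt: "f s < f t" if "s \<in> S" "t \<in> S" "s < t" for s t
  proof -
    have "(s - a) / \<epsilon> + 1 = (s - a + \<epsilon>) / \<epsilon>" using \<epsilon> by (simp add: add_divide_distrib)
    also have "\<dots> \<le> (t - a) / \<epsilon>" using sep[OF that] \<epsilon> by (intro divide_right_mono) auto
    finally have "(t - a) / \<epsilon> \<ge> (s - a) / \<epsilon> + 1" .
    then have "\<lfloor>(t - a) / \<epsilon>\<rfloor> \<ge> \<lfloor>(s - a) / \<epsilon> + 1\<rfloor>" by (rule floor_mono)
    then show ?thesis unfolding f_def by simp
  qed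
  have inj: "inj_on f S"
  proof (rule inj_onI)
    fix s t assume "s \<in> S" "t \<in> S" "f s = f t"
    then show "s = t" using lt[of s t] lt[of t s] by (cases s t rule: linorder_cases) auto
  qed
  have im: "f ` S \<subseteq> {0..\<lfloor>(b - a) / \<epsilon>\<rfloor>}"
  proof
    fix x assume "x \<in> f ` S"
    then obtain t where t: "t \<in> S" "x = f t" by blast
    then have "a < t" "t < b" using S by auto
    then have "0 \<le> (t - a) / \<epsilon>" "(t - a) / \<epsilon> \<le> (b - a) / \<epsilon>" using \<epsilon> by (auto simp: divide_right_mono)
    then show "x \<in> {0..\<lfloor>(b - a) / \<epsilon>\<rfloor>}" unfolding t(2) f_def by (auto intro: floor_mono)
  qed
  show "finite S" using finite_imageD[OF finite_subset[OF im] inj] by simp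
  show "card S \<le> card {0..\<lfloor>(b - a) / \<epsilon>\<rfloor>}" using card_inj_on_le[OF inj im] by simp
qed

context kleinian
begin

lemma path_dist_bounded:
  assumes w: "w \<in> T1H" and p: "upath c0 V w p" "V \<subseteq> T1H" and d: "path_dist V w p < r"
  shows "norm p \<le> 10 * (fst w $ None * exp r)"
proof -
  obtain c where c: "upath c V w p" "path_length c < r" using path_dist_less[OF d p(1)] .
  have pT: "p \<in> T1H" using p by (force simp: upath_def)
  have "fst p $ None \<le> fst w $ None * exp (path_length c)" by (rule upath_time_bound[OF c(1) p(2)])
  also have "\<dots> \<le> fst w $ None * exp r"
    using c(2) fst_T1H[OF w] by (intro mult_left_mono) (auto simp: hyp_space_def)
  finally show ?thesis using T1H_norm_le[OF pT] by linarith
qed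

text \<open>Properness leaves finitely many group elements relating \<open>z n\<close> to
  \<open>y n\<close>; one occurs infinitely often and relates the limits. This is the Hausdorff
  property of the quotient.\<close>

lemma orbit_limit:
  assumes z: "z \<longlonglongrightarrow> p" "\<And>n. z n \<in> T1H" and y: "y \<longlonglongrightarrow> q" "\<And>n. y n \<in> T1H"
    and o: "\<forall>\<^sub>F n in sequentially. orbit \<Delta> (y n) = orbit \<Delta> (z n)"
  shows "orbit \<Delta> q = orbit \<Delta> p"
proof -
  define Bd where "Bd = (ball p 1 \<union> ball q 1) \<inter> T1H"
  have fin: "finite {g \<in> \<Delta>. \<exists>x\<in>Bd. lact g x \<in> Bd}"
    by (rule proper_bounded) (auto simp: Bd_def bounded_Un intro: bounded_Int)
  have "\<forall>\<^sub>F n in sequentially. z n \<in> Bd" using tendstoD[OF z(1), of 1] z(2)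
    by (auto simp: Bd_def dist_commute elim: eventually_mono)
  moreover have "\<forall>\<^sub>F n in sequentially. y n \<in> Bd" using tendstoD[OF y(1), of 1] y(2)
    by (auto simp: Bd_def dist_commute elim: eventually_mono)
  ultimately have "\<forall>\<^sub>F n in sequentially. \<exists>g\<in>{g \<in> \<Delta>. \<exists>x\<in>Bd. lact g x \<in> Bd}. y n = lact g (z n)"
    using o
  proof eventually_elim
    case (elim n)
    then obtain g where "g \<in> \<Delta>" "y n = lact g (z n)" using orbit_eq_iff by blast
    with elim show ?case by auto
  qed
  then have "\<exists>\<^sub>F n in sequentially. \<exists>g\<in>{g \<in> \<Delta>. \<exists>x\<in>Bd. lact g x \<in> Bd}. y n = lact g (z n)"
    by (rule eventually_frequently[OF sequentially_bot])
  then have "\<exists>g\<in>{g \<in> \<Delta>. \<exists>x\<in>Bd. lact g x \<in> Bd}. \<exists>\<^sub>F n in sequentially. y n = lact g (z n)"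
    by (rule frequently_bex_finite[OF fin])
  then obtain g where g: "g \<in> \<Delta>" "\<exists>\<^sub>F n in sequentially. y n = lact g (z n)" by auto
  have "(\<lambda>n. dist (y n) (lact g (z n))) \<longlonglongrightarrow> dist q (lact g p)" by (intro tendsto_intros z y)
  moreover have "\<exists>\<^sub>F n in sequentially. dist (y n) (lact g (z n)) = 0" using g(2) by simp
  ultimately have "dist q (lact g p) = 0" by (rule frequently_zero_limit)
  then show ?thesis using g(1) by simp
qed

end

context markov
begin

text \<open>The side is bounded in its leaf and closed as a closure, which gives sequential
  compactness. Lifts are kept in the single leaf of \<open>w0\<close>, so that the limit is again in
  it.\<close>

lemma U_seq:
  fixes u :: "nat \<Rightarrow> 'n uvec set"
  assumes j: "j \<in> alphabet F" and w: "w0 \<in> T1H" "sbw F j = orbit \<Delta> w0" and u: "\<And>n. u n \<in> sbU F j"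
  obtains r P X where "strict_mono r" "P \<in> sul w0" "orbit \<Delta> P \<in> sbU F j" "X \<longlonglongrightarrow> P"
    "\<And>n. X n \<in> sul w0" "\<And>n. orbit \<Delta> (X n) = u (r n)"
proof -
  have wT: "sbw F j \<in> T1X \<Delta>" by (rule rectD(2)[OF j])
  have "\<exists>x\<in>sul w0. u n = orbit \<Delta> x \<and> path_dist (sul w0) w0 x < \<epsilon>\<^sub>0" for n
    using u[of n] rectD(5)[OF j] unfolding w(2) by (subst su.leaf_ball_iff[OF w(1), symmetric]) blast
  then obtain X where X: "\<And>n. X n \<in> sul w0" "\<And>n. u n = orbit \<Delta> (X n)" "\<And>n. path_dist (sul w0) w0 (X n) < \<epsilon>\<^sub>0"
    by metis
  have "norm (X n) \<le> 10 * (fst w0 $ None * exp \<epsilon>\<^sub>0)" for n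
  proof -
    obtain c where "upath c (sul w0) w0 (X n)" using sul_path[OF w(1) X(1)] .
    then show ?thesis using path_dist_bounded[OF w(1) _ leaf_subset(2) X(3)] by blast
  qed
  then have "bounded (range X)" by (auto simp: bounded_iff)
  then obtain P r where r: "strict_mono r" "(X \<circ> r) \<longlonglongrightarrow> P" using bounded_imp_convergent_subsequence by blast
  have XT: "X n \<in> T1H" for n using X(1) leaf_subset(2) by blast
  have XZ: "X n \<in> Z" for n 
  proof -
    have "u n \<in> \<Omega> \<Delta>" using u[of n] rectD(5)[OF j] by blast
    then show ?thesis using orbit_in_\<Omega>[OF XT[of n]] X(2)[of n] by simp
  qed
  have PZ: "P \<in> Z" by (rule Z_closed_seq[OF _ r(2)]) (simp add: XZ)
  have "(\<lambda>n. nm ((X \<circ> r) n)) \<longlonglongrightarrow> nm P" by (intro tendsto_intros r(2))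
  then have "nm P = nm w0" using X(1) by (simp add: sul_def LIMSEQ_const_iff)
  then have Ps: "P \<in> sul w0" using PZ Z_T1H by (simp add: sul_def)
  have "orbit \<Delta> P \<in> sbU F j"
  proof (rule ccontr)
    assume n: "orbit \<Delta> P \<notin> sbU F j"
    have "closedin (U_topology \<Delta> (sbw F j)) (sbU F j)"
      by (subst rectD(7)[OF j]) (rule closedin_closure_of)
    then have op: "openin (U_topology \<Delta> (sbw F j)) (topspace (U_topology \<Delta> (sbw F j)) - sbU F j)"
      by (rule openin_diff[OF openin_topspace])
    have "orbit \<Delta> P \<in> leaf strong_unstable \<Delta> (sbw F j)" unfolding w(2) su.leaf_iff[OF w(1)] using Ps by blast
    then have "orbit \<Delta> P \<in> topspace (U_topology \<Delta> (sbw F j))"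
      using PZ orbit_in_\<Omega>[OF Z_T1H[OF PZ]] by (simp add: U_topology_def su.topspace_leaf[OF wT])
    then have "\<forall>\<^sub>F n in sequentially. orbit \<Delta> ((X \<circ> r) n) \<in> topspace (U_topology \<Delta> (sbw F j)) - sbU F j"
      by (intro openin_U_eventually[OF wT op Z_T1H[OF PZ] _ _ r(2)])
        (use n XZ X(1) Ps in \<open>auto simp: sul_def\<close>)
    then have "\<exists>n. orbit \<Delta> ((X \<circ> r) n) \<notin> sbU F j" by (auto simp: eventually_sequentially)
    then show False using X(2) u by (metis comp_apply)
  qed
  then show ?thesis using that[OF r(1) Ps _ r(2)] X by simp
qed

lemma S_seq:
  fixes u :: "nat \<Rightarrow> 'n uvec set"
  assumes j: "j \<in> alphabet F" and w: "w0 \<in> T1H" "sbw F j = orbit \<Delta> w0" and u: "\<And>n. u n \<in> sbS F j"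
  obtains r P X where "strict_mono r" "P \<in> ssl w0" "orbit \<Delta> P \<in> sbS F j" "X \<longlonglongrightarrow> P"
    "\<And>n. X n \<in> ssl w0" "\<And>n. orbit \<Delta> (X n) = u (r n)"
proof -
  have wT: "sbw F j \<in> T1X \<Delta>" by (rule rectD(2)[OF j])
  have "\<exists>x\<in>ssl w0. u n = orbit \<Delta> x \<and> path_dist (ssl w0) w0 x < \<epsilon>\<^sub>0" for n
    using u[of n] rectD(6)[OF j] unfolding w(2) by (subst ss.leaf_ball_iff[OF w(1), symmetric]) blast
  then obtain X where X: "\<And>n. X n \<in> ssl w0" "\<And>n. u n = orbit \<Delta> (X n)" "\<And>n. path_dist (ssl w0) w0 (X n) < \<epsilon>\<^sub>0"
    by metis
  have "norm (X n) \<le> 10 * (fst w0 $ None * exp \<epsilon>\<^sub>0)" for n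
  proof -
    obtain c where "upath c (ssl w0) w0 (X n)" using ssl_path[OF w(1) X(1)] .
    then show ?thesis using path_dist_bounded[OF w(1) _ leaf_subset(1) X(3)] by blast
  qed
  then have "bounded (range X)" by (auto simp: bounded_iff)
  then obtain P r where r: "strict_mono r" "(X \<circ> r) \<longlonglongrightarrow> P" using bounded_imp_convergent_subsequence by blast
  have XT: "X n \<in> T1H" for n using X(1) leaf_subset(1) by blast
  have XZ: "X n \<in> Z" for n 
  proof -
    have "u n \<in> \<Omega> \<Delta>" using u[of n] rectD(6)[OF j] by blast
    then show ?thesis using orbit_in_\<Omega>[OF XT[of n]] X(2)[of n] by simp
  qed
  have PZ: "P \<in> Z" by (rule Z_closed_seq[OF _ r(2)]) (simp add: XZ)
  have "(\<lambda>n. np ((X \<circ> r) n)) \<longlonglongrightarrow> np P" by (intro tendsto_intros r(2))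
  then have "np P = np w0" using X(1) by (simp add: ssl_def LIMSEQ_const_iff)
  then have Ps: "P \<in> ssl w0" using PZ Z_T1H by (simp add: ssl_def)
  have "orbit \<Delta> P \<in> sbS F j"
  proof (rule ccontr)
    assume n: "orbit \<Delta> P \<notin> sbS F j"
    have "closedin (S_topology \<Delta> (sbw F j)) (sbS F j)"
      by (subst rectD(8)[OF j]) (rule closedin_closure_of)
    then have op: "openin (S_topology \<Delta> (sbw F j)) (topspace (S_topology \<Delta> (sbw F j)) - sbS F j)"
      by (rule openin_diff[OF openin_topspace])
    have "orbit \<Delta> P \<in> leaf strong_stable \<Delta> (sbw F j)" unfolding w(2) ss.leaf_iff[OF w(1)] using Ps by blast
    then have "orbit \<Delta> P \<in> topspace (S_topology \<Delta> (sbw F j))"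
      using PZ orbit_in_\<Omega>[OF Z_T1H[OF PZ]] by (simp add: S_topology_def ss.topspace_leaf[OF wT])
    then have "\<forall>\<^sub>F n in sequentially. orbit \<Delta> ((X \<circ> r) n) \<in> topspace (S_topology \<Delta> (sbw F j)) - sbS F j"
      by (intro openin_S_eventually[OF wT op Z_T1H[OF PZ] _ _ r(2)])
        (use n XZ X(1) Ps in \<open>auto simp: ssl_def\<close>)
    then have "\<exists>n. orbit \<Delta> ((X \<circ> r) n) \<notin> sbS F j" by (auto simp: eventually_sequentially)
    then show False using X(2) u by (metis comp_apply)
  qed
  then show ?thesis using that[OF r(1) Ps _ r(2)] X by simp
qed

text \<open>Convergent lifts of points of the two sides of a rectangle. Lifts of the first side
  share \<open>nm\<close> with their limit and those of the second share \<open>np\<close>; this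
  later makes positions along the flow comparable.\<close>

definition cseq :: "nat \<Rightarrow> 'n uvec \<Rightarrow> 'n uvec \<Rightarrow> (nat \<Rightarrow> 'n uvec) \<Rightarrow> (nat \<Rightarrow> 'n uvec) \<Rightarrow> bool" where
  "cseq j P Q X Y \<longleftrightarrow> P \<in> T1H \<and> Q \<in> T1H \<and> orbit \<Delta> P \<in> sbU F j \<and> orbit \<Delta> Q \<in> sbS F j \<and>
     X \<longlonglongrightarrow> P \<and> Y \<longlonglongrightarrow> Q \<and> (\<forall>n. X n \<in> T1H \<and> orbit \<Delta> (X n) \<in> sbU F j \<and> nm (X n) = nm P) \<and>
     (\<forall>n. Y n \<in> T1H \<and> orbit \<Delta> (Y n) \<in> sbS F j \<and> np (Y n) = np Q)"

lemma cseq_subseq: "cseq j P Q X Y \<Longrightarrow> strict_mono r \<Longrightarrow> cseq j P Q (X \<circ> r) (Y \<circ> r)"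
  unfolding cseq_def using LIMSEQ_subseq_LIMSEQ[of X P r] LIMSEQ_subseq_LIMSEQ[of Y Q r] by simp

lemma Rt_seq:
  fixes p :: "nat \<Rightarrow> 'n uvec"
  assumes j: "j \<in> alphabet F" and p: "\<And>n. p n \<in> Rt j"
  obtains r P Q X Y where "strict_mono r" "cseq j P Q X Y"
    "\<And>n. orbit \<Delta> (p (r n)) = bra (orbit \<Delta> (X n)) (orbit \<Delta> (Y n))"
proof -
  obtain w0 where w: "w0 \<in> T1H" "sbw F j = orbit \<Delta> w0" using T1X_E[OF rectD(2)[OF j]] .
  have "\<exists>u s. u \<in> sbU F j \<and> s \<in> sbS F j \<and> orbit \<Delta> (p n) = bra u s" for n
    using p[of n] unfolding Rt_def Rj_def rect_def by blast
  then obtain u s where us: "\<And>n. u n \<in> sbU F j" "\<And>n. s n \<in> sbS F j" "\<And>n. orbit \<Delta> (p n) = bra (u n) (s n)" by metis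
  obtain r1 P X where 1: "strict_mono r1" "P \<in> sul w0" "orbit \<Delta> P \<in> sbU F j" "X \<longlonglongrightarrow> P"
    "\<And>n. X n \<in> sul w0" "\<And>n. orbit \<Delta> (X n) = u (r1 n)"
    by (rule U_seq[OF j w, of u]) (use us(1) in blast)+
  obtain r2 Q Y where 2: "strict_mono r2" "Q \<in> ssl w0" "orbit \<Delta> Q \<in> sbS F j" "Y \<longlonglongrightarrow> Q"
    "\<And>n. Y n \<in> ssl w0" "\<And>n. orbit \<Delta> (Y n) = s (r1 (r2 n))"
    by (rule S_seq[OF j w, of "\<lambda>n. s (r1 n)"]) (use us(2) in blast)+
  have "(X \<circ> r2) \<longlonglongrightarrow> P" by (rule LIMSEQ_subseq_LIMSEQ[OF 1(4) 2(1)])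
  then have "cseq j P Q (X \<circ> r2) Y"
    unfolding cseq_def using 1 2 us by (simp add: sul_def ssl_def)
  moreover have "strict_mono (r1 \<circ> r2)" using 1(1) 2(1) by (rule strict_mono_o)
  moreover have "orbit \<Delta> (p ((r1 \<circ> r2) n)) = bra (orbit \<Delta> ((X \<circ> r2) n)) (orbit \<Delta> (Y n))" for n
    using us(3) 1(6) 2(6) by simp
  ultimately show ?thesis using that by blast
qed

lemma bracket_rep:
  assumes j: "j \<in> alphabet F" and "u \<in> sbU F j" "s \<in> sbS F j"
  obtains p where "p \<in> T1H" "orbit \<Delta> p = bra u s" "p \<in> Rt j"
proof -
  have uB: "u \<in> B (sbw F j)" "s \<in> C (sbw F j)" using assms rectD(6,10)[OF j] by blast+
  have uT: "u \<in> T1X \<Delta>" using assms rectD(5)[OF j] by (auto simp: \<Omega>_def)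
  obtain u0 where u0: "u0 \<in> T1H" "u = orbit \<Delta> u0" using T1X_E[OF uT] .
  have "bra u s \<in> leaf_ball strong_stable \<Delta> e (orbit \<Delta> u0)"
    using bracket_singleton[OF rectD(2)[OF j] uB] u0(2) by blast
  then obtain p where p: "p \<in> ssl u0" "bra u s = orbit \<Delta> p" using ss.leaf_ball_iff[OF u0(1)] by blast
  have pT: "p \<in> T1H" using p(1) leaf_subset(1) by blast
  then have "p \<in> Rt j" using p(2) assms unfolding Rt_def Rj_def rect_def mem_Collect_eq by metis
  then show ?thesis using that[OF pT] p(2) by simp
qed

text \<open>Translating the lifts to the corner at \<open>p\<close> turns the brackets into an
  explicit convergent sequence. The last property fixes the position along the flow and is what
  \<open>separation\<close> exploits.\<close>

lemma cseq_corner: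
  assumes j: "j \<in> alphabet F" and c: "cseq j P Q X Y" and k: "corner p p1 q1" "orbit \<Delta> p1 = orbit \<Delta> P" "orbit \<Delta> q1 = orbit \<Delta> Q"
  obtains x where "x \<longlonglongrightarrow> p" "\<forall>\<^sub>F n in sequentially. x n \<in> T1H \<and> orbit \<Delta> (x n) = bra (orbit \<Delta> (X n)) (orbit \<Delta> (Y n))"
    "\<And>n. np (x n) \<star> nm p1 = -2"
proof -
  note c' = c[unfolded cseq_def]
  obtain g where g: "g \<in> \<Delta>" "p1 = lact g P" using k(2) orbit_eq_iff by blast
  obtain h where h: "h \<in> \<Delta>" "q1 = lact h Q" using k(3) orbit_eq_iff by blast
  define X' where "X' n = lact g (X n)" for n
  define Y' where "Y' n = lact h (Y n)" for n
  have lX: "X' \<longlonglongrightarrow> p1" unfolding X'_def g(2) using c' by (intro tendsto_intros) blast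
  have lY: "Y' \<longlonglongrightarrow> q1" unfolding Y'_def h(2) using c' by (intro tendsto_intros) blast
  have X': "X' n \<in> T1H" "orbit \<Delta> (X' n) = orbit \<Delta> (X n)" "nm (X' n) = nm p1" for n
    using c' g by (auto simp: X'_def)
  have Y': "Y' n \<in> T1H" "orbit \<Delta> (Y' n) = orbit \<Delta> (Y n)" for n
    using c' h by (auto simp: Y'_def)
  have eX: "\<forall>\<^sub>F n in sequentially. X' n \<in> T1H \<and> orbit \<Delta> (X' n) \<in> B (sbw F j)"
    using X' c' rectD(10)[OF j] by (intro always_eventually) auto
  have eY: "\<forall>\<^sub>F n in sequentially. Y' n \<in> T1H \<and> orbit \<Delta> (Y' n) \<in> C (sbw F j)"
    using Y' c' rectD(6)[OF j] by (intro always_eventually) auto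
  note ce = corner_eventually[OF rectD(2)[OF j] k(1) lX eX lY eY]
  show ?thesis
  proof (rule that[of "\<lambda>n. nmk (np (X' n)) (nm (Y' n))"])
    show "np (nmk (np (X' n)) (nm (Y' n))) \<star> nm p1 = - 2" for n
      using T1HD(3)[OF X'(1)[of n]] X'(3)[of n] by (simp add: nmk_def)
  qed (use ce X' Y' in auto)
qed

lemma Rt_compact:
  fixes p :: "nat \<Rightarrow> 'n uvec"
  assumes j: "j \<in> alphabet F" and p: "\<And>n. p n \<in> Rt j"
  obtains r x q where "strict_mono r" "q \<in> Rt j" "x \<longlonglongrightarrow> q" "\<And>n. x n \<in> orbit \<Delta> (p (r n))"
proof -
  obtain r P Q X Y where r: "strict_mono r" "cseq j P Q X Y"
    "\<And>n. orbit \<Delta> (p (r n)) = bra (orbit \<Delta> (X n)) (orbit \<Delta> (Y n))"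
    by (rule Rt_seq[OF j, of p]) (use p in blast)+
  note c' = r(2)[unfolded cseq_def]
  obtain q where q: "q \<in> T1H" "orbit \<Delta> q = bra (orbit \<Delta> P) (orbit \<Delta> Q)" "q \<in> Rt j"
    using bracket_rep[OF j, of "orbit \<Delta> P" "orbit \<Delta> Q"] c' by blast
  obtain p1 q1 where k: "corner q p1 q1" "orbit \<Delta> p1 = orbit \<Delta> P" "orbit \<Delta> q1 = orbit \<Delta> Q"
    using corner_exists[OF rectD(2)[OF j] _ _ q(2)] c' rectD(6,10)[OF j] by blast
  obtain x where x: "x \<longlonglongrightarrow> q" "\<forall>\<^sub>F n in sequentially. x n \<in> T1H \<and> orbit \<Delta> (x n) = bra (orbit \<Delta> (X n)) (orbit \<Delta> (Y n))"
    using cseq_corner[OF j r(2) k] by blast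
  then obtain N where N: "\<And>n. n \<ge> N \<Longrightarrow> orbit \<Delta> (x n) = orbit \<Delta> (p (r n))"
    unfolding eventually_sequentially r(3) by blast
  have "(\<lambda>n. x (n + N)) \<longlonglongrightarrow> q" by (rule LIMSEQ_ignore_initial_segment[OF x(1)])
  moreover have "x (n + N) \<in> orbit \<Delta> (p (r (n + N)))" for n using N[of "n + N"] orbit_self by (metis le_add2)
  moreover have "strict_mono (\<lambda>n. r (n + N))" using r(1) by (simp add: strict_mono_def)
  ultimately show ?thesis using that[of "\<lambda>n. r (n + N)" q] q(3) by blast
qed

section \<open>Separation of section hits and perturbation to interior hits\<close>

definition Rall :: "'n uvec set" where "Rall = (\<Union>j\<in>alphabet F. Rt j)"
definition Iall :: "'n uvec set" where "Iall = (\<Union>j\<in>alphabet F. It j)"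

lemma Iall_subset: "Iall \<subseteq> Rall" and Rall_Z: "Rall \<subseteq> Z"
  using It_subset Rt_Z by (auto simp: Iall_def Rall_def)

lemma finite_alphabet: "finite (alphabet F)"
  by (simp add: alphabet_def)

text \<open>Otherwise a limit of short flow segments between rectangles would
  contradict the injectivity of the bracket.\<close>

lemma separation:
  obtains \<epsilon> where "\<epsilon> > 0" "\<And>p t. p \<in> Rall \<Longrightarrow> 0 < t \<Longrightarrow> t < \<epsilon> \<Longrightarrow> flow t p \<notin> Rall"
proof (rule ccontr)
  assume "\<not> thesis"
  then have "\<exists>p t. p \<in> Rall \<and> 0 < t \<and> t < inverse (real (Suc n)) \<and> flow t p \<in> Rall" for n
    using that[of "inverse (real (Suc n))"] by (metis inverse_positive_iff_positive of_nat_0_less_iff zero_less_Suc)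
  then obtain p t where pt: "\<And>n. p n \<in> Rall" "\<And>n. 0 < t n" "\<And>n. t n < inverse (real (Suc n))" "\<And>n. flow (t n) (p n) \<in> Rall"
    by metis
  have "\<exists>i k. i \<in> alphabet F \<and> k \<in> alphabet F \<and> p n \<in> Rt i \<and> flow (t n) (p n) \<in> Rt k" for n
    using pt(1,4)[of n] unfolding Rall_def by blast
  then obtain i k where ik: "\<And>n. i n \<in> alphabet F" "\<And>n. k n \<in> alphabet F" "\<And>n. p n \<in> Rt (i n)" "\<And>n. flow (t n) (p n) \<in> Rt (k n)"
    by metis
  have "finite (range (\<lambda>n. (i n, k n)))"
    by (rule finite_subset[of _ "alphabet F \<times> alphabet F"]) (use ik finite_alphabet in auto)
  then obtain y where "infinite ((\<lambda>n. (i n, k n)) -` {y})" using inf_img_fin_domE[OF _ infinite_UNIV_nat] by blast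
  then obtain i0 k0 where inf: "infinite {n. i n = i0 \<and> k n = k0}"
    by (cases y) (simp add: vimage_def)
  define r0 where "r0 = enumerate {n. i n = i0 \<and> k n = k0}"
  have r0: "strict_mono r0" "\<And>n. i (r0 n) = i0" "\<And>n. k (r0 n) = k0"
    unfolding r0_def using strict_mono_enumerate[OF inf] enumerate_in_set[OF inf] by auto
  have i0: "i0 \<in> alphabet F" "k0 \<in> alphabet F" using ik(1,2)[of "r0 0"] r0(2,3)[of 0] by auto
  have "p (r0 n) \<in> Rt i0" for n using ik(3)[of "r0 n"] r0(2) by simp
  then obtain r1 P Q X Y where 1: "strict_mono r1" "cseq i0 P Q X Y"
    "\<And>n. orbit \<Delta> (p (r0 (r1 n))) = bra (orbit \<Delta> (X n)) (orbit \<Delta> (Y n))"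
    by (rule Rt_seq[OF i0(1), of "\<lambda>n. p (r0 n)"]) blast+
  have "flow (t (r0 (r1 n))) (p (r0 (r1 n))) \<in> Rt k0" for n using ik(4)[of "r0 (r1 n)"] r0(3) by simp
  then obtain r2 P' Q' X' Y' where 2: "strict_mono r2" "cseq k0 P' Q' X' Y'"
    "\<And>n. orbit \<Delta> (flow (t (r0 (r1 (r2 n)))) (p (r0 (r1 (r2 n))))) = bra (orbit \<Delta> (X' n)) (orbit \<Delta> (Y' n))"
    by (rule Rt_seq[OF i0(2), of "\<lambda>n. flow (t (r0 (r1 n))) (p (r0 (r1 n)))"]) blast+
  define r where "r n = r0 (r1 (r2 n))" for n
  have rm: "strict_mono r" unfolding r_def using r0(1) 1(1) 2(1) by (simp add: strict_mono_def)
  have lt0: "t \<longlonglongrightarrow> 0"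
  proof (rule tendsto_sandwich[OF _ _ tendsto_const LIMSEQ_inverse_real_of_nat])
    show "\<forall>\<^sub>F n in sequentially. 0 \<le> t n" using pt(2) by (simp add: less_imp_le)
    show "\<forall>\<^sub>F n in sequentially. t n \<le> inverse (real (Suc n))" using pt(3) by (simp add: less_imp_le)
  qed
  then have lt: "(\<lambda>n. t (r n)) \<longlonglongrightarrow> 0" using LIMSEQ_subseq_LIMSEQ[OF lt0 rm] by (simp add: o_def)
  have c1: "cseq i0 P Q (X \<circ> r2) (Y \<circ> r2)" by (rule cseq_subseq[OF 1(2) 2(1)])
  note c1' = c1[unfolded cseq_def] and c2' = 2(2)[unfolded cseq_def]
  obtain q where q: "q \<in> T1H" "orbit \<Delta> q = bra (orbit \<Delta> P) (orbit \<Delta> Q)" "q \<in> Rt i0"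
    using bracket_rep[OF i0(1), of "orbit \<Delta> P" "orbit \<Delta> Q"] c1' by blast
  obtain q' where q': "q' \<in> T1H" "orbit \<Delta> q' = bra (orbit \<Delta> P') (orbit \<Delta> Q')" "q' \<in> Rt k0"
    using bracket_rep[OF i0(2), of "orbit \<Delta> P'" "orbit \<Delta> Q'"] c2' by blast
  obtain p1 q1 where k1: "corner q p1 q1" "orbit \<Delta> p1 = orbit \<Delta> P" "orbit \<Delta> q1 = orbit \<Delta> Q"
    using corner_exists[OF rectD(2)[OF i0(1)] _ _ q(2)] c1' rectD(6,10)[OF i0(1)] by blast
  obtain p1' q1' where k2: "corner q' p1' q1'" "orbit \<Delta> p1' = orbit \<Delta> P'" "orbit \<Delta> q1' = orbit \<Delta> Q'"
    using corner_exists[OF rectD(2)[OF i0(2)] _ _ q'(2)] c2' rectD(6,10)[OF i0(2)] by blast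
  obtain x where x: "x \<longlonglongrightarrow> q" "\<forall>\<^sub>F n in sequentially. x n \<in> T1H \<and> orbit \<Delta> (x n) = bra (orbit \<Delta> ((X \<circ> r2) n)) (orbit \<Delta> ((Y \<circ> r2) n))"
    "\<And>n. np (x n) \<star> nm p1 = -2"
    using cseq_corner[OF i0(1) c1 k1] by blast
  obtain y where y: "y \<longlonglongrightarrow> q'" "\<forall>\<^sub>F n in sequentially. y n \<in> T1H \<and> orbit \<Delta> (y n) = bra (orbit \<Delta> (X' n)) (orbit \<Delta> (Y' n))"
    using cseq_corner[OF i0(2) 2(2) k2] by blast
  define z where "z n = flow (t (r n)) (x n)" for n
  have lz: "z \<longlonglongrightarrow> q"
  proof -
    have "z \<longlonglongrightarrow> flow 0 q" unfolding z_def by (intro tendsto_intros lt x(1))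
    then show ?thesis by simp
  qed
  have oz: "\<forall>\<^sub>F n in sequentially. z n \<in> T1H \<and> orbit \<Delta> (z n) = bra (orbit \<Delta> (X' n)) (orbit \<Delta> (Y' n))"
    using x(2)
  proof eventually_elim
    case (elim n)
    then have "orbit \<Delta> (x n) = orbit \<Delta> (p (r n))" using 1(3)[of "r2 n"] by (simp add: r_def)
    then have "orbit \<Delta> (z n) = orbit \<Delta> (flow (t (r n)) (p (r n)))" by (simp add: z_def flip: flow_orbit)
    with elim 2(3)[of n] show ?case by (simp add: z_def r_def)
  qed
  obtain N where N: "\<And>n. n \<ge> N \<Longrightarrow> z n \<in> T1H \<and> y n \<in> T1H \<and> orbit \<Delta> (y n) = orbit \<Delta> (z n)"
    using eventually_conj[OF oz y(2)] unfolding eventually_sequentially by auto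
  have "orbit \<Delta> q' = orbit \<Delta> q"
  proof (rule orbit_limit)
    show "(\<lambda>n. z (n + N)) \<longlonglongrightarrow> q" "(\<lambda>n. y (n + N)) \<longlonglongrightarrow> q'"
      by (rule LIMSEQ_ignore_initial_segment, fact)+
  qed (use N in auto)
  then have eq: "bra (orbit \<Delta> P) (orbit \<Delta> Q) = bra (orbit \<Delta> P') (orbit \<Delta> Q')" using q(2) q'(2) by simp
  have "q \<in> Rt k0" using \<open>orbit \<Delta> q' = orbit \<Delta> q\<close> q' q(1) by (simp add: Rt_def)
  then have ik0: "k0 = i0" using Rt_disjoint[OF i0(2,1)] q(3) by blast
  \<comment> \<open>Disjointness has made the two rectangles equal; injectivity of the bracket makes
    the limit points on the sides equal, so one corner describes both sequences.\<close>
  have PQ: "orbit \<Delta> P = orbit \<Delta> P' \<and> orbit \<Delta> Q = orbit \<Delta> Q'"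
    by (rule bracket_inj[OF rectD(2)[OF i0(1)] _ _ _ _ eq]) (use c1' c2' ik0 rectD(6,10)[OF i0(1)] in blast)+
  have c2: "cseq i0 P' Q' X' Y'" using 2(2) ik0 by simp
  obtain x' where x': "x' \<longlonglongrightarrow> q" "\<forall>\<^sub>F n in sequentially. x' n \<in> T1H \<and> orbit \<Delta> (x' n) = bra (orbit \<Delta> (X' n)) (orbit \<Delta> (Y' n))"
    "\<And>n. np (x' n) \<star> nm p1 = -2"
    by (rule cseq_corner[OF i0(1) c2 k1(1)]) (use k1 PQ in auto)
  define g where "g n = (SOME g. g \<in> \<Delta> \<and> x' n = lact g (z n))" for n
  have g: "\<forall>\<^sub>F n in sequentially. g n \<in> \<Delta> \<and> x' n = lact (g n) (z n)"
    using x'(2) oz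
  proof eventually_elim
    case (elim n)
    then have "\<exists>g. g \<in> \<Delta> \<and> x' n = lact g (z n)" using orbit_eq_iff by metis
    then show ?case unfolding g_def by (rule someI_ex)
  qed
  have "\<forall>\<^sub>F n in sequentially. g n = mat 1"
  proof (rule tendsto_lact_trivial[OF q(1) lz])
    show "(\<lambda>n. lact (g n) (z n)) \<longlonglongrightarrow> q"
      by (rule Lim_transform_eventually[OF x'(1)]) (use g in eventually_elim, simp)
    show "\<forall>\<^sub>F n in sequentially. g n \<in> \<Delta>" using g by eventually_elim simp
    show "\<forall>\<^sub>F n in sequentially. z n \<in> T1H" using oz by eventually_elim simp
  qed
  then have "\<forall>\<^sub>F n in sequentially. x' n = z n" using g by eventually_elim simp
  then obtain n where n: "x' n = z n" by (auto simp: eventually_sequentially)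
  \<comment> \<open>Both \<open>x n\<close> and \<open>x' n\<close> have product -2 with
    \<open>nm p1\<close>, but \<open>x' n\<close> is \<open>x n\<close> moved by the flow for time
    \<open>t (r n)\<close>, so this time would be zero.\<close>
  have "exp (t (r n)) * (np (x n) \<star> nm p1) = -2" using x'(3)[of n] unfolding n by (simp add: z_def mink_simps)
  then have "exp (t (r n)) = 1" using x(3)[of n] by simp
  then show False using pt(2)[of "r n"] by simp
qed

lemma cover:
  assumes "q \<in> Z"
  obtains s where "s \<in> {0..\<delta>}" "flow (- s) q \<in> Rall"
proof -
  have cov: "\<Omega> \<Delta> = (\<Union>j\<in>alphabet F. \<Union>t\<in>{0..\<delta>}. (\<lambda>u. flow t ` u) ` Rj \<Delta> e F j)"
    using conjunct1[OF conjunct2[OF conjunct2[OF conjunct2[OF ms[unfolded markov_section_def]]]]] .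
  have "orbit \<Delta> q \<in> \<Omega> \<Delta>" using orbit_in_\<Omega>[OF Z_T1H[OF assms]] assms by blast
  then obtain j s u where jsu: "j \<in> alphabet F" "s \<in> {0..\<delta>}" "u \<in> Rj \<Delta> e F j" "orbit \<Delta> q = flow s ` u"
    unfolding cov by blast
  obtain x where x: "x \<in> Z" "u = orbit \<Delta> x" using \<Omega>_E rectD(9)[OF jsu(1)] jsu(3) by blast
  obtain g where g: "g \<in> \<Delta>" "q = lact g (flow s x)" using jsu(4) x(2) flow_orbit orbit_eq_iff by metis
  have "flow (- s) q = lact g x" using g by (simp add: flow_lact flow_add)
  moreover have "lact g x \<in> Rt j" using g x jsu(3) Z_T1H by (simp add: Rt_def)
  ultimately have "flow (- s) q \<in> Rall" using jsu(1) by (auto simp: Rall_def)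
  then show ?thesis by (rule that[OF jsu(2)])
qed

text \<open>Maximize the number of times at which interiors are met.\<close>

lemma generic:
  assumes N: "open N" and p: "p \<in> N" "p \<in> Z"
  obtains q where "q \<in> N" "q \<in> Z" "\<And>t. a < t \<Longrightarrow> t < b \<Longrightarrow> flow t q \<in> Rall \<Longrightarrow> flow t q \<in> Iall"
proof -
  obtain \<epsilon> where \<epsilon>: "\<epsilon> > 0" "\<And>p t. p \<in> Rall \<Longrightarrow> 0 < t \<Longrightarrow> t < \<epsilon> \<Longrightarrow> flow t p \<notin> Rall" by (rule separation) blast
  define S where "S q = {t \<in> {a<..<b}. flow t q \<in> Iall}" for q
  have sep: "t - s \<ge> \<epsilon>" if "s \<in> S q" "t \<in> S q" "s < t" for s t q
  proof (rule ccontr)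
    assume "\<not> t - s \<ge> \<epsilon>"
    moreover have "flow s q \<in> Rall" "flow (t - s) (flow s q) \<in> Rall" using that Iall_subset by (auto simp: S_def flow_add)
    ultimately show False using \<epsilon>(2)[of "flow s q" "t - s"] that by auto
  qed
  have fin: "finite (S q)" "card (S q) \<le> card {0..\<lfloor>(b - a) / \<epsilon>\<rfloor>}" for q
    by (rule separated_card[of "S q" a b \<epsilon>, OF _ \<epsilon>(1) sep]; (assumption | force simp: S_def))+
  \<comment> \<open>Separation bounds the number of interior hits in the window, so a vector with
    the maximal number exists.\<close>
  have "\<exists>q. (q \<in> N \<and> q \<in> Z) \<and> (\<forall>x. x \<in> N \<and> x \<in> Z \<longrightarrow> card (S x) \<le> card (S q))"
    using p fin(2) by (intro ex_has_greatest_nat[of _ p _ "Suc (card {0..\<lfloor>(b - a) / \<epsilon>\<rfloor>})"]) (auto simp: less_Suc_eq_le)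
  then obtain q where q: "q \<in> N" "q \<in> Z" "\<And>x. x \<in> N \<Longrightarrow> x \<in> Z \<Longrightarrow> card (S x) \<le> card (S q)" by blast
  show ?thesis
  proof (rule that[OF q(1,2)], rule ccontr)
    fix s assume s: "a < s" "s < b" "flow s q \<in> Rall" "flow s q \<notin> Iall"
    obtain k where k: "k \<in> alphabet F" "flow s q \<in> Rt k" using s(3) by (auto simp: Rall_def)
    \<comment> \<open>If the hit at time \<open>s\<close> is not interior, it is approximated by
      interior ones. All counted hits persist up to small shifts \<open>T\<close>, and
      \<open>s\<close> becomes a new interior hit, against maximality.\<close>
    obtain R where R: "\<And>n::nat. R n \<in> It k" "R \<longlonglongrightarrow> flow s q" by (rule It_dense[OF k]) blast
    define x where "x n = flow (- s) (R n)" for n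
    have lx: "x \<longlonglongrightarrow> q"
    proof -
      have "x \<longlonglongrightarrow> flow (- s) (flow s q)" unfolding x_def by (intro tendsto_intros R(2))
      then show ?thesis by (simp add: flow_add)
    qed
    have xZ: "x n \<in> Z" for n
    proof -
      have "R n \<in> Z" using R(1)[of n] It_subset[OF k(1)] Rt_Z[OF k(1)] by blast
      then show ?thesis by (simp add: x_def)
    qed
    have "\<exists>T. T \<longlonglongrightarrow> 0 \<and> (\<forall>\<^sub>F n in sequentially. flow (T n) (flow t (x n)) \<in> Iall)" if t: "t \<in> S q" for t
    proof -
      obtain j where j: "j \<in> alphabet F" "flow t q \<in> It j" using t by (auto simp: S_def Iall_def)
      have "(\<lambda>n. flow t (x n)) \<longlonglongrightarrow> flow t q" by (intro tendsto_intros lx)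
      then obtain T where "T \<longlonglongrightarrow> 0" "\<forall>\<^sub>F n in sequentially. flow (T n) (flow t (x n)) \<in> It j"
        by (rule It_open[OF j]) (use xZ in simp)
      then show ?thesis using j(1) by (intro exI[of _ T]) (auto simp: Iall_def elim: eventually_mono)
    qed
    then have "\<exists>T. \<forall>t\<in>S q. T t \<longlonglongrightarrow> 0 \<and> (\<forall>\<^sub>F n in sequentially. flow (T t n) (flow t (x n)) \<in> Iall)"
      by (intro bchoice ballI)
    then obtain T where T: "\<And>t. t \<in> S q \<Longrightarrow> T t \<longlonglongrightarrow> 0"
      "\<And>t. t \<in> S q \<Longrightarrow> \<forall>\<^sub>F n in sequentially. flow (T t n) (flow t (x n)) \<in> Iall" by blast
    have sS: "s \<notin> S q" using s by (simp add: S_def)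
    define f where "f n t = (if t = s then s else t + T t n)" for n t
    define S' where "S' = insert s (S q)"
    have finS': "finite S'" using fin by (simp add: S'_def)
    have lf: "(\<lambda>n. f n t) \<longlonglongrightarrow> t" if "t \<in> S'" for t
    proof (cases "t = s")
      case False
      then have "(\<lambda>n. t + T t n) \<longlonglongrightarrow> t + 0" using that T(1) by (intro tendsto_intros) (auto simp: S'_def)
      then show ?thesis using False by (simp add: f_def)
    qed (simp add: f_def)
    have tab: "a < t \<and> t < b" if "t \<in> S'" for t using that s by (auto simp: S'_def S_def)
    have e1: "\<forall>\<^sub>F n in sequentially. \<forall>t\<in>S'. f n t \<in> S (x n)"
    proof (rule eventually_ball_finite[OF finS'], rule ballI)
      fix t assume t: "t \<in> S'"
      have "\<forall>\<^sub>F n in sequentially. flow (f n t) (x n) \<in> Iall"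
      proof (cases "t = s")
        case True
        have "flow (f n t) (x n) \<in> Iall" for n using R(1)[of n] k(1) True by (auto simp: f_def x_def flow_add Iall_def)
        then show ?thesis by simp
      next
        case False
        then have "t \<in> S q" using t by (simp add: S'_def)
        from T(2)[OF this] show ?thesis by eventually_elim (use False in \<open>simp add: f_def flow_add add.commute\<close>)
      qed
      with order_tendstoD(1)[OF lf[OF t], of a] order_tendstoD(2)[OF lf[OF t], of b] tab[OF t]
      show "\<forall>\<^sub>F n in sequentially. f n t \<in> S (x n)" by (auto simp: S_def elim: eventually_elim2 intro: eventually_conj)
    qed
    have e2: "\<forall>\<^sub>F n in sequentially. \<forall>t\<in>S'. \<forall>t'\<in>S'. t \<noteq> t' \<longrightarrow> f n t \<noteq> f n t'"
    proof (rule eventually_ball_finite[OF finS'], rule ballI, rule eventually_ball_finite[OF finS'], rule ballI)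
      fix t t' assume t: "t \<in> S'" "t' \<in> S'"
      show "\<forall>\<^sub>F n in sequentially. t \<noteq> t' \<longrightarrow> f n t \<noteq> f n t'"
      proof (cases "t = t'")
        case False
        have "(\<lambda>n. f n t - f n t') \<longlonglongrightarrow> t - t'" by (intro tendsto_intros lf t)
        then have "\<forall>\<^sub>F n in sequentially. f n t - f n t' \<noteq> 0" by (rule tendsto_imp_eventually_ne) (use False in simp)
        then show ?thesis by eventually_elim simp
      qed simp
    qed
    have e3: "\<forall>\<^sub>F n in sequentially. x n \<in> N" by (rule topological_tendstoD[OF lx N q(1)])
    obtain n where n: "\<forall>t\<in>S'. f n t \<in> S (x n)" "\<forall>t\<in>S'. \<forall>t'\<in>S'. t \<noteq> t' \<longrightarrow> f n t \<noteq> f n t'" "x n \<in> N"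
      using eventually_conj[OF e1 eventually_conj[OF e2 e3]] unfolding eventually_sequentially by blast
    have "card S' \<le> card (S (x n))"
      by (rule card_inj_on_le[of "f n"]) (use n fin in \<open>auto simp: inj_on_def\<close>)
    moreover have "card S' = Suc (card (S q))" using sS fin by (simp add: S'_def)
    ultimately show False using q(3)[OF n(3) xZ] by simp
  qed
qed

end

section \<open>Coding of geodesics\<close>

lemma path_product_append:
  assumes "\<And>i. i \<le> m \<Longrightarrow> \<gamma> i = \<alpha> i" "\<And>i. \<gamma> (m + i) = \<beta> i"
  shows "path_product c (m + n) \<gamma> = path_product c m \<alpha> ** path_product c n \<beta>"
proof (induction n)
  case 0
  have "path_product c k \<gamma> = path_product c k \<alpha>" if "k \<le> m" for k
    using that assms(1) by (induction k) auto
  then show ?case by simp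
next
  case (Suc n)
  have "\<gamma> (Suc (m + n)) = \<beta> (Suc n)" using assms(2)[of "Suc n"] by simp
  then show ?case using Suc assms(2)[of n] by (simp add: matrix_mul_assoc)
qed

lemma mixing_path:
  "matrix_power A (transition_matrix \<Delta> e F) q j k > 0 \<Longrightarrow> \<exists>\<alpha>. \<alpha> \<in> admissible_seqs \<Delta> e F q j k"
proof (induction q arbitrary: k)
  case 0
  then have "(\<lambda>_. j) \<in> admissible_seqs \<Delta> e F 0 j k" by (simp add: admissible_seqs_def split: if_splits)
  then show ?case by blast
next
  case (Suc q)
  have "\<exists>l. matrix_power A (transition_matrix \<Delta> e F) q j l > 0 \<and> admissible \<Delta> e F l k"
  proof (rule ccontr)
    assume "\<not> ?thesis"
    then have "matrix_power A (transition_matrix \<Delta> e F) q j l * transition_matrix \<Delta> e F l k = 0" for l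
      by (auto simp: transition_matrix_def)
    with Suc.prems show False by simp
  qed
  then obtain l \<alpha> where l: "\<alpha> \<in> admissible_seqs \<Delta> e F q j l" "admissible \<Delta> e F l k" using Suc.IH by blast
  then have "\<alpha>(Suc q := k) \<in> admissible_seqs \<Delta> e F (Suc q) j k"
    by (auto simp: admissible_seqs_def less_Suc_eq)
  then show ?case by blast
qed

context kleinian
begin

lemma topspace_T1X: "topspace (T1X_topology \<Delta>) = T1X \<Delta>"
proof (rule subset_antisym)
  show "topspace (T1X_topology \<Delta>) \<subseteq> T1X \<Delta>" using openin_T1X_iff openin_topspace by blast
  have "{p \<in> T1H. orbit \<Delta> p \<in> T1X \<Delta>} = T1H" using T1X_orbit by blast
  then have "openin (T1X_topology \<Delta>) (T1X \<Delta>)" by (simp add: openin_T1X_iff)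
  then show "T1X \<Delta> \<subseteq> topspace (T1X_topology \<Delta>)" by (rule openin_subset)
qed

lemma continuous_map_orbit: "continuous_map (top_of_set T1H) (T1X_topology \<Delta>) (orbit \<Delta>)"
  unfolding continuous_map_def topspace_T1X using T1X_orbit openin_T1X_iff by auto

end

locale lifted = markov \<Delta> \<epsilon>\<^sub>0 e \<delta> F for \<Delta> :: "'n::finite lorentz set" and \<epsilon>\<^sub>0 e \<delta> F +
  fixes Lf :: "nat \<Rightarrow> 'n uvec set"
  assumes lifts: "homeomorphic_lifts \<Delta> e F Lf"
begin

lemma Lf_homeo:
  assumes "j \<in> alphabet F"
  shows "Lf j \<subseteq> T1H" "homeomorphic_map (top_of_set (Lf j)) (subtopology (T1X_topology \<Delta>) (Rj \<Delta> e F j)) (orbit \<Delta>)"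
  using lifts assms unfolding homeomorphic_lifts_def by blast+

lemma Rj_T1X: "j \<in> alphabet F \<Longrightarrow> Rj \<Delta> e F j \<subseteq> T1X \<Delta>"
  using rectD(9)[of j] by (auto simp: \<Omega>_def)

lemma Lf_image:
  assumes "j \<in> alphabet F"
  shows "orbit \<Delta> ` Lf j = Rj \<Delta> e F j" "inj_on (orbit \<Delta>) (Lf j)"
  using homeomorphic_imp_surjective_map[OF Lf_homeo(2)[OF assms]] homeomorphic_imp_injective_map[OF Lf_homeo(2)[OF assms]]
    Rj_T1X[OF assms] by (auto simp: topspace_T1X)

lemma Lf_Rt: "j \<in> alphabet F \<Longrightarrow> Lf j \<subseteq> Rt j"
  using Lf_image(1)[of j] Lf_homeo(1)[of j] unfolding Rt_def by blast

lemma Rt_Lf: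
  assumes j: "j \<in> alphabet F" and p: "p \<in> Rt j"
  obtains g where "g \<in> \<Delta>" "p \<in> lact g ` Lf j"
proof -
  have "orbit \<Delta> p \<in> orbit \<Delta> ` Lf j" using p Lf_image(1)[OF j] by (simp add: Rt_def)
  then obtain l where l: "l \<in> Lf j" "orbit \<Delta> p = orbit \<Delta> l" by blast
  then obtain g where "g \<in> \<Delta>" "p = lact g l" using orbit_eq_iff by blast
  with that l(1) show ?thesis by blast
qed

lemma Lf_unique:
  assumes j: "j \<in> alphabet F" "k \<in> alphabet F" and g: "g \<in> \<Delta>" "h \<in> \<Delta>"
    and p: "p \<in> lact g ` Lf j" "p \<in> lact h ` Lf k"
  shows "g = h \<and> j = k"
proof -
  obtain l where l: "l \<in> Lf j" "p = lact g l" using p(1) by blast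
  obtain l' where l': "l' \<in> Lf k" "p = lact h l'" using p(2) by blast
  have R: "l \<in> Rt j" "l' \<in> Rt k" using l l' Lf_Rt j by blast+
  have o: "orbit \<Delta> l = orbit \<Delta> l'" using orbit_lact[OF g(1), of l] orbit_lact[OF g(2), of l'] l(2) l'(2) by simp
  then have "l' \<in> Rt j" using R by (simp add: Rt_def)
  then have jk: "j = k" using Rt_disjoint[OF j] R by blast
  then have "l = l'" using inj_onD[OF Lf_image(2)[OF j(1)] o] l(1) l'(1) by simp
  then have "lact g l = lact h l" using l(2) l'(2) by simp
  then show ?thesis using free_lact2[OF g _] l(1) Lf_homeo(1)[OF j(1)] jk by blast
qed

lemma section_map:
  assumes j: "j \<in> alphabet F"
  obtains h where "continuous_on (Rt j) h" "\<And>p. p \<in> Rt j \<Longrightarrow> h p \<in> Lf j \<and> orbit \<Delta> (h p) = orbit \<Delta> p"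
proof -
  define Y where "Y = subtopology (T1X_topology \<Delta>) (Rj \<Delta> e F j)"
  have tY: "topspace Y = Rj \<Delta> e F j" using Rj_T1X[OF j] by (auto simp: Y_def topspace_T1X)
  obtain h0 where h0: "homeomorphic_maps (top_of_set (Lf j)) Y (orbit \<Delta>) h0"
    using Lf_homeo(2)[OF j] unfolding Y_def homeomorphic_map_maps by blast
  then have c: "continuous_map Y (top_of_set (Lf j)) h0" and i: "\<And>y. y \<in> Rj \<Delta> e F j \<Longrightarrow> orbit \<Delta> (h0 y) = y"
    using tY by (auto simp: homeomorphic_maps_def)
  have "Rt j \<subseteq> T1H" by (auto simp: Rt_def)
  then have "continuous_map (top_of_set (Rt j)) (T1X_topology \<Delta>) (orbit \<Delta>)"
    by (rule continuous_map_from_subtopology_mono[OF continuous_map_orbit])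
  then have "continuous_map (top_of_set (Rt j)) Y (orbit \<Delta>)"
    unfolding Y_def by (auto simp: continuous_map_in_subtopology Rt_def)
  then have ch: "continuous_map (top_of_set (Rt j)) (top_of_set (Lf j)) (h0 \<circ> orbit \<Delta>)"
    using c by (rule continuous_map_compose)
  then have c1: "continuous_on (Rt j) (h0 \<circ> orbit \<Delta>)" and c2: "(h0 \<circ> orbit \<Delta>) ` Rt j \<subseteq> Lf j"
    by (auto simp: continuous_map_in_subtopology)
  have "(h0 \<circ> orbit \<Delta>) p \<in> Lf j \<and> orbit \<Delta> ((h0 \<circ> orbit \<Delta>) p) = orbit \<Delta> p" if "p \<in> Rt j" for p
    using c2 i[of "orbit \<Delta> p"] that by (auto simp: Rt_def)
  with c1 show ?thesis by (rule that)
qed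

text \<open>The continuous inverse of \<open>orbit\<close> on the rectangle gives lifts that
  converge to \<open>p\<close>, and local freeness excludes that the \<open>x n\<close> are in
  another translate. So \<open>Lf j\<close> is relatively open in \<open>Rt j\<close>.\<close>

lemma Lf_limit:
  assumes j: "j \<in> alphabet F" and p: "p \<in> Lf j" and x: "(x \<longlongrightarrow> p) G" "\<forall>\<^sub>F n in G. x n \<in> Rt j"
  shows "\<forall>\<^sub>F n in G. x n \<in> Lf j"
proof -
  obtain h where h: "continuous_on (Rt j) h" "\<And>p. p \<in> Rt j \<Longrightarrow> h p \<in> Lf j \<and> orbit \<Delta> (h p) = orbit \<Delta> p"
    by (rule section_map[OF j]) blast
  have pR: "p \<in> Rt j" using p Lf_Rt[OF j] by blast
  then have hp: "h p = p" using h(2)[of p] inj_onD[OF Lf_image(2)[OF j]] p by metis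
  have lh: "((\<lambda>n. h (x n)) \<longlongrightarrow> p) G" using continuous_on_tendsto_compose[OF h(1) x(1) pR x(2)] hp by simp
  define g where "g n = (SOME g. g \<in> \<Delta> \<and> h (x n) = lact g (x n))" for n
  have g: "\<forall>\<^sub>F n in G. g n \<in> \<Delta> \<and> h (x n) = lact (g n) (x n)"
    using x(2)
  proof eventually_elim
    case (elim n)
    then have "\<exists>g. g \<in> \<Delta> \<and> h (x n) = lact g (x n)" using h(2) orbit_eq_iff by blast
    then show ?case unfolding g_def by (rule someI_ex)
  qed
  have "\<forall>\<^sub>F n in G. g n = mat 1"
  proof (rule tendsto_lact_trivial[OF _ x(1)])
    show "p \<in> T1H" using pR by (simp add: Rt_def)
    show "((\<lambda>n. lact (g n) (x n)) \<longlongrightarrow> p) G"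
      by (rule Lim_transform_eventually[OF lh]) (use g in eventually_elim, simp)
    show "\<forall>\<^sub>F n in G. g n \<in> \<Delta>" using g by eventually_elim simp
    show "\<forall>\<^sub>F n in G. x n \<in> T1H" using x(2) by eventually_elim (simp add: Rt_def)
  qed
  then show ?thesis using g x(2)
  proof eventually_elim
    case (elim n)
    then show ?case using h(2)[of "x n"] by simp
  qed
qed

text \<open>Orbits of points of the lift subconverge in the rectangle by \<open>Rt_compact\<close>,
  and continuity of the inverse of \<open>orbit\<close> brings this convergence back to the
  lift.\<close>

lemma Lf_bounded:
  assumes j: "j \<in> alphabet F"
  shows "bounded (Lf j)"
proof (rule ccontr)
  obtain h where h: "continuous_on (Rt j) h" "\<And>p. p \<in> Rt j \<Longrightarrow> h p \<in> Lf j \<and> orbit \<Delta> (h p) = orbit \<Delta> p"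
    by (rule section_map[OF j]) blast
  assume "\<not> bounded (Lf j)"
  then have "\<exists>l\<in>Lf j. norm l > real n" for n unfolding bounded_iff by (meson linorder_not_le)
  then obtain l where l: "\<And>n. l n \<in> Lf j" "\<And>n. norm (l n) > real n" by metis
  have "l n \<in> Rt j" for n using l(1) Lf_Rt[OF j] by blast
  then obtain r x q where r: "strict_mono r" "q \<in> Rt j" "x \<longlonglongrightarrow> q" "\<And>n. x n \<in> orbit \<Delta> (l (r n))"
    by (rule Rt_compact[OF j, of l]) blast+
  have o: "orbit \<Delta> (x n) = orbit \<Delta> (l (r n))" for n using orbit_eqI r(4) by blast
  have "x n \<in> T1H" for n
  proof -
    obtain g where "g \<in> \<Delta>" "x n = lact g (l (r n))" using r(4) orbitE by blast
    then show ?thesis using l(1)[of "r n"] Lf_homeo(1)[OF j] T1H_mem by auto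
  qed
  then have xR: "x n \<in> Rt j" for n using o[of n] l(1)[of "r n"] Lf_Rt[OF j] by (auto simp: Rt_def)
  have "h (x n) = l (r n)" for n
    using inj_onD[OF Lf_image(2)[OF j], of "h (x n)" "l (r n)"] h(2)[OF xR[of n]] o[of n] l(1) by simp
  moreover have "(\<lambda>n. h (x n)) \<longlonglongrightarrow> h q" by (rule continuous_on_tendsto_compose[OF h(1) r(3,2)]) (simp add: xR)
  ultimately have "(\<lambda>n. l (r n)) \<longlonglongrightarrow> h q" by simp
  then have "Bseq (\<lambda>n. l (r n))" by (rule convergent_imp_Bseq[OF convergentI])
  then obtain K where K: "\<And>n. norm (l (r n)) \<le> K" by (auto simp: Bseq_def)
  obtain n :: nat where "real n > K" using reals_Archimedean2 by blast
  moreover have "real n \<le> real (r n)" using seq_suble[OF r(1), of n] by simp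
  ultimately show False using K[of n] l(2)[of "r n"] by linarith
qed

definition LL :: "'n uvec set" where "LL = (\<Union>j\<in>alphabet F. Lf j)"

lemma LL_bounded: "bounded LL" and LL_T1H: "LL \<subseteq> T1H"
  using finite_alphabet Lf_bounded Lf_homeo(1) by (auto simp: LL_def)

lemma flow_bounded:
  assumes "bounded K"
  shows "bounded ((\<lambda>(t, p). flow t p) ` ({a..b} \<times> K))"
proof -
  have "compact ((\<lambda>(t, p). flow t p) ` ({a..b} \<times> closure K))"
    using assms by (intro compact_continuous_image compact_Times continuous_on_subset[OF continuous_flow])
      (auto simp: compact_closure)
  then show ?thesis
    by (rule bounded_subset[OF compact_imp_bounded]) (use closure_subset[of K] in \<open>intro image_mono, auto\<close>)
qed

text \<open>Being finite for bounded \<open>K\<close>, this set measures the ambiguity in replacing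
  a vector of \<open>K\<close> by a section hit shortly before it.\<close>

definition near :: "'n uvec set \<Rightarrow> 'n lorentz set" where
  "near K = {h \<in> \<Delta>. \<exists>l\<in>LL. \<exists>\<tau>\<in>{0..\<delta>}. flow \<tau> (lact h l) \<in> K}"

lemma near_finite:
  assumes "bounded K"
  shows "finite (near K)"
proof -
  define Bd where "Bd = ((\<lambda>(t, p). flow t p) ` ({-\<delta>..0} \<times> K) \<union> LL) \<inter> T1H"
  have "finite {g \<in> \<Delta>. \<exists>x\<in>Bd. lact g x \<in> Bd}"
    by (rule proper_bounded) (use flow_bounded[OF assms] LL_bounded in \<open>auto simp: Bd_def intro: bounded_Int\<close>)
  moreover have "near K \<subseteq> {g \<in> \<Delta>. \<exists>x\<in>Bd. lact g x \<in> Bd}"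
  proof
    fix h assume "h \<in> near K"
    then obtain l \<tau> where h: "h \<in> \<Delta>" "l \<in> LL" "\<tau> \<in> {0..\<delta>}" "flow \<tau> (lact h l) \<in> K" by (auto simp: near_def)
    have lT: "l \<in> T1H" using h(2) LL_T1H by blast
    have "lact h l = flow (-\<tau>) (flow \<tau> (lact h l))" by (simp add: flow_add)
    moreover have "-\<tau> \<in> {-\<delta>..0}" using h(3) by simp
    ultimately have "lact h l \<in> (\<lambda>(t, p). flow t p) ` ({-\<delta>..0} \<times> K)" using h(4) by (intro image_eqI[of _ _ "(-\<tau>, flow \<tau> (lact h l))"]) auto
    then have "lact h l \<in> Bd" "l \<in> Bd" using lT h(1,2) by (auto simp: Bd_def)
    with h(1) show "h \<in> {g \<in> \<Delta>. \<exists>x\<in>Bd. lact g x \<in> Bd}" by blast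
  qed
  ultimately show ?thesis by (rule finite_subset[rotated])
qed

text \<open>Every vector of \<open>Z\<close> is reached within time \<open>\<delta>\<close> from a
  translate of one of finitely many bounded lifts; \<open>K\<close> collects these flow
  segments.\<close>

lemma Z_cocompact:
  obtains K where "bounded K" "\<And>q. q \<in> Z \<Longrightarrow> \<exists>g\<in>\<Delta>. lact g q \<in> K"
proof -
  define K where "K = (\<lambda>(t, p). flow t p) ` ({0..\<delta>} \<times> LL)"
  have "\<exists>g\<in>\<Delta>. lact g q \<in> K" if q: "q \<in> Z" for q
  proof -
    obtain s where s: "s \<in> {0..\<delta>}" "flow (- s) q \<in> Rall" by (rule cover[OF q])
    then obtain j where j: "j \<in> alphabet F" "flow (- s) q \<in> Rt j" by (auto simp: Rall_def)
    obtain g where g: "g \<in> \<Delta>" "flow (- s) q \<in> lact g ` Lf j" by (rule Rt_Lf[OF j])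
    then obtain l where l: "l \<in> Lf j" "flow (- s) q = lact g l" by blast
    have "flow s (flow (-s) q) = flow s (lact g l)" using l(2) by simp
    then have "q = lact g (flow s l)" by (simp add: flow_add flow_lact)
    then have 1: "lact (matrix_inv g) q = flow s l" using g(1) by simp
    have "l \<in> LL" using l(1) j(1) by (auto simp: LL_def)
    then have "lact (matrix_inv g) q \<in> K" unfolding 1 K_def using s(1) by (intro image_eqI[of _ _ "(s, l)"]) auto
    with inv_mem[OF g(1)] show ?thesis by blast
  qed
  moreover have "bounded K" unfolding K_def by (rule flow_bounded[OF LL_bounded])
  ultimately show ?thesis using that by blast
qed

lemma return_time_eq:
  assumes p: "p \<in> T1H" and s: "s > 0" "flow s p \<in> Rall" "\<And>t. 0 < t \<Longrightarrow> t < s \<Longrightarrow> flow t p \<notin> Rall"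
  shows "return_time \<Delta> e F (orbit \<Delta> p) = s"
proof -
  have sec: "flow t ` orbit \<Delta> p \<in> section_set \<Delta> e F \<longleftrightarrow> flow t p \<in> Rall" for t
    unfolding flow_orbit using p by (simp add: section_set_def Rall_def Rt_def)
  show ?thesis
    unfolding return_time_def sec
  proof (rule cInf_eq_minimum)
    show "s \<in> {t. 0 < t \<and> flow t p \<in> Rall}" using s by simp
    show "s \<le> t" if "t \<in> {t. 0 < t \<and> flow t p \<in> Rall}" for t using that s(3)[of t] by force
  qed
qed

lemma It_nonempty:
  assumes j: "j \<in> alphabet F"
  obtains p where "p \<in> Lf j" "p \<in> It j"
proof -
  obtain p where "p \<in> Rt j" using bracket_rep[OF j rectD(3)[OF j] rectD(4)[OF j]] by metis
  then obtain Q where Q: "\<And>n::nat. Q n \<in> It j" by (rule It_dense[OF j]) blast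
  then have "Q 0 \<in> Rt j" using It_subset[OF j] by blast
  then obtain g where g: "g \<in> \<Delta>" "Q 0 \<in> lact g ` Lf j" by (rule Rt_Lf[OF j])
  then obtain l where "l \<in> Lf j" "Q 0 = lact g l" by blast
  then show ?thesis using that[of l] Q[of 0] g(1) by simp
qed

end

text \<open>Here \<open>c\<close> stands for the image of the cocycle value under the identification
  with isometries. It is prescribed by transitions between interiors, and therefore coding asks for
  geodesics that hit interiors.\<close>

locale coding = lifted \<Delta> \<epsilon>\<^sub>0 e \<delta> F Lf for \<Delta> :: "'n::finite lorentz set" and \<epsilon>\<^sub>0 e \<delta> F Lf +
  fixes c :: "nat \<Rightarrow> nat \<Rightarrow> 'n lorentz"
  assumes c_eq: "j \<in> alphabet F \<Longrightarrow> k \<in> alphabet F \<Longrightarrow> l \<in> Lf j \<Longrightarrow> l \<in> It j \<Longrightarrow> g \<in> \<Delta> \<Longrightarrow>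
      flow (return_time \<Delta> e F (orbit \<Delta> l)) l \<in> lact g ` Lf k \<Longrightarrow>
      flow (return_time \<Delta> e F (orbit \<Delta> l)) l \<in> It k \<Longrightarrow> c j k = g"
    and c_mem: "admissible \<Delta> e F j k \<Longrightarrow> c j k \<in> \<Delta>"
    and mixing: "topologically_mixing \<Delta> e F"
begin

text \<open>The index \<open>n\<close> counts transitions, so \<open>n = p + 1\<close> corresponds
  to the ingredients of \<open>return_products\<close> at \<open>p\<close>.\<close>

definition Bp :: "nat \<Rightarrow> nat \<Rightarrow> nat \<Rightarrow> 'n lorentz set" where
  "Bp j k n = {path_product c n \<alpha> | \<alpha>. \<alpha> \<in> admissible_seqs \<Delta> e F n j k}"

lemma Bp_append:
  assumes "g \<in> Bp j k m" "h \<in> Bp k l n"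
  shows "g ** h \<in> Bp j l (m + n)"
proof -
  obtain \<alpha> where \<alpha>: "\<alpha> \<in> admissible_seqs \<Delta> e F m j k" "g = path_product c m \<alpha>" using assms(1) by (auto simp: Bp_def)
  obtain \<beta> where \<beta>: "\<beta> \<in> admissible_seqs \<Delta> e F n k l" "h = path_product c n \<beta>" using assms(2) by (auto simp: Bp_def)
  define \<gamma> where "\<gamma> i = (if i \<le> m then \<alpha> i else \<beta> (i - m))" for i
  have m: "\<alpha> m = \<beta> 0" using \<alpha>(1) \<beta>(1) by (simp add: admissible_seqs_def)
  have 1: "\<gamma> i = \<alpha> i" if "i \<le> m" for i using that by (simp add: \<gamma>_def)
  have 2: "\<gamma> (m + i) = \<beta> i" for i using m by (cases i) (simp_all add: \<gamma>_def)
  have "admissible \<Delta> e F (\<gamma> i) (\<gamma> (Suc i))" if "i < m + n" for i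
  proof (cases "i < m")
    case True
    then show ?thesis using \<alpha>(1) 1 by (simp add: admissible_seqs_def)
  next
    case False
    define i' where "i' = i - m"
    have i': "i = m + i'" using False by (simp add: i'_def)
    then have "Suc i = m + Suc i'" "i' < n" using that by auto
    then show ?thesis using \<beta>(1) 2[of i'] 2[of "Suc i'"] i' by (simp add: admissible_seqs_def)
  qed
  then have "\<gamma> \<in> admissible_seqs \<Delta> e F (m + n) j l"
    using 1[of 0] 2[of n] \<alpha>(1) \<beta>(1) by (simp add: admissible_seqs_def)
  moreover have "g ** h = path_product c (m + n) \<gamma>"
    unfolding \<alpha>(2) \<beta>(2) using path_product_append[of m \<gamma> \<alpha> \<beta> c n, OF 1 2] by simp
  ultimately show ?thesis unfolding Bp_def by blast
qed

lemma Bp_mem: "g \<in> Bp j k n \<Longrightarrow> g \<in> \<Delta>"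
proof -
  have "path_product c n \<alpha> \<in> \<Delta>" if "\<forall>i<n. admissible \<Delta> e F (\<alpha> i) (\<alpha> (Suc i))" for \<alpha>
    using that by (induction n) (auto intro: mult_mem c_mem)
  then show "g \<in> Bp j k n \<Longrightarrow> g \<in> \<Delta>" by (auto simp: Bp_def admissible_seqs_def)
qed

lemma Bp_1: "admissible \<Delta> e F j k \<Longrightarrow> c j k \<in> Bp j k 1"
  unfolding Bp_def admissible_seqs_def
  by (rule CollectI, rule exI[of _ "\<lambda>i. if i = 0 then j else k"]) simp

text \<open>Mixing provides one length for which all pairs of symbols are connected. Every symbol
  has a predecessor, and appending the transition from it raises the length by one.\<close>

lemma Bp_nonempty:
  obtains q where "\<And>n j k. n \<ge> q \<Longrightarrow> j \<in> alphabet F \<Longrightarrow> k \<in> alphabet F \<Longrightarrow> Bp j k n \<noteq> {}"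
proof -
  obtain q where q: "q > 0" "\<And>j k. j \<in> alphabet F \<Longrightarrow> k \<in> alphabet F \<Longrightarrow>
      matrix_power (alphabet F) (transition_matrix \<Delta> e F) q j k > 0"
    using mixing unfolding topologically_mixing_def by blast
  have adm: "\<exists>\<alpha>. \<alpha> \<in> admissible_seqs \<Delta> e F q j k" if "j \<in> alphabet F" "k \<in> alphabet F" for j k
    using mixing_path[OF q(2)[OF that]] .
  have pred: "\<exists>l\<in>alphabet F. admissible \<Delta> e F l k" if k: "k \<in> alphabet F" for k
  proof -
    obtain \<alpha> where \<alpha>: "\<alpha> \<in> admissible_seqs \<Delta> e F q k k" using adm[OF k k] by blast
    then have "admissible \<Delta> e F (\<alpha> (q - 1)) k" using q(1) by (auto simp: admissible_seqs_def dest: spec[of _ "q - 1"])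
    then show ?thesis by (auto simp: admissible_def)
  qed
  have "Bp j k (q + n) \<noteq> {}" if "j \<in> alphabet F" "k \<in> alphabet F" for n j k
    using that
  proof (induction n arbitrary: k)
    case 0
    then show ?case using adm[of j k] by (auto simp: Bp_def)
  next
    case (Suc n)
    obtain l where l: "l \<in> alphabet F" "admissible \<Delta> e F l k" using pred[OF Suc.prems(2)] by blast
    obtain g where "g \<in> Bp j l (q + n)" using Suc.IH[OF Suc.prems(1) l(1)] by blast
    then have "g ** c l k \<in> Bp j k (q + n + 1)" by (rule Bp_append[OF _ Bp_1[OF l(2)]])
    then show ?case by auto
  qed
  then show ?thesis using that[of q] by (metis le_iff_add)
qed

text \<open>Moved back by \<open>g\<close>, consecutive hits are a vector of \<open>Lf j\<close> and
  its first return, which is the situation of \<open>c_eq\<close>.\<close>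

lemma step:
  assumes j: "j \<in> alphabet F" "k \<in> alphabet F" and g: "g \<in> \<Delta>" "h \<in> \<Delta>" and st: "s < t"
    and p: "flow s q \<in> lact g ` Lf j" "flow t q \<in> lact h ` Lf k" "flow s q \<in> It j" "flow t q \<in> It k"
    and no: "\<And>x. s < x \<Longrightarrow> x < t \<Longrightarrow> flow x q \<notin> Rall"
  shows "matrix_inv g ** h \<in> Bp j k 1"
proof -
  obtain l where l: "l \<in> Lf j" "flow s q = lact g l" using p(1) by blast
  obtain l' where l': "l' \<in> Lf k" "flow t q = lact h l'" using p(2) by blast
  have lT: "l \<in> T1H" using l(1) Lf_homeo(1)[OF j(1)] by blast
  have fl: "flow x l = lact (matrix_inv g) (flow (x + s) q)" for x
  proof -
    have "lact (matrix_inv g) (flow (x + s) q) = lact (matrix_inv g) (flow x (lact g l))" using l(2) by (simp flip: flow_add)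
    then show ?thesis using g(1) by (simp add: flow_lact)
  qed
  have Rl: "flow x l \<in> Rall \<longleftrightarrow> flow (x + s) q \<in> Rall" for x
    unfolding fl using inv_mem[OF g(1)] by (simp add: Rall_def)
  define \<tau> where "\<tau> = return_time \<Delta> e F (orbit \<Delta> l)"
  have \<tau>: "\<tau> = t - s" unfolding \<tau>_def
  proof (rule return_time_eq[OF lT])
    show "flow (t - s) l \<in> Rall" unfolding Rl using p(4) It_subset[OF j(2)] j(2) by (auto simp: Rall_def)
    show "flow x l \<notin> Rall" if "0 < x" "x < t - s" for x unfolding Rl using no[of "x + s"] that by simp
  qed (use st in simp)
  have lI: "l \<in> It j" using p(3) l(2) g(1) by simp
  have e: "flow \<tau> l = lact (matrix_inv g) (flow t q)" unfolding fl \<tau> by simp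
  have eI: "flow \<tau> l \<in> It k" unfolding e using p(4) inv_mem[OF g(1)] by simp
  have "flow \<tau> l = lact (matrix_inv g ** h) l'" unfolding e l'(2) by (simp add: lact_lact)
  then have "c j k = matrix_inv g ** h"
    using c_eq[OF j l(1) lI mult_mem[OF inv_mem[OF g(1)] g(2)]] l'(1) eI unfolding \<tau>_def by blast
  moreover have "admissible \<Delta> e F j k"
    unfolding admissible_def
  proof (intro conjI j bexI)
    show "poincare_map \<Delta> e F (orbit \<Delta> l) \<in> int_R \<Delta> e F k"
      using eI unfolding poincare_map_def flow_orbit \<tau>_def[symmetric] by (simp add: It_def)
    show "orbit \<Delta> l \<in> int_R \<Delta> e F j" using lI by (simp add: It_def)
  qed
  ultimately show ?thesis using Bp_1 by metis
qed

text \<open>Induction on the number of hits in between: a hit in the translate by \<open>f\<close>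
  splits the segment, and the products \<open>g^-1 f\<close> and \<open>f^-1 h\<close>
  telescope.\<close>

lemma path:
  assumes int: "\<And>x. a < x \<Longrightarrow> x < b \<Longrightarrow> flow x q \<in> Rall \<Longrightarrow> flow x q \<in> Iall"
    and j: "j \<in> alphabet F" "k \<in> alphabet F" and g: "g \<in> \<Delta>" "h \<in> \<Delta>" and st: "a < s" "s < t" "t < b"
    and p: "flow s q \<in> lact g ` Lf j" "flow t q \<in> lact h ` Lf k"
  shows "\<exists>n\<ge>1. matrix_inv g ** h \<in> Bp j k n"
proof -
  obtain \<epsilon> where \<epsilon>: "\<epsilon> > 0" "\<And>p t. p \<in> Rall \<Longrightarrow> 0 < t \<Longrightarrow> t < \<epsilon> \<Longrightarrow> flow t p \<notin> Rall" by (rule separation) blast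
  have fin: "finite {x \<in> {s<..<t}. flow x q \<in> Rall}" for s t
  proof (rule separated_card(1)[OF _ \<epsilon>(1)])
    fix x y assume "x \<in> {x \<in> {s<..<t}. flow x q \<in> Rall}" "y \<in> {x \<in> {s<..<t}. flow x q \<in> Rall}" "x < y"
    then have *: "flow x q \<in> Rall" "flow (y - x) (flow x q) \<in> Rall" "x < y" by (simp_all add: flow_add)
    show "\<epsilon> \<le> y - x" using \<epsilon>(2)[OF *(1), of "y - x"] *(2,3) by linarith
  qed auto
  have RR: "flow x q \<in> Rt j" if "flow x q \<in> lact g ` Lf j" "j \<in> alphabet F" "g \<in> \<Delta>" for x g j
    using that Lf_Rt[of j] by auto
  have RI: "flow x q \<in> It j" if "flow x q \<in> lact g ` Lf j" "j \<in> alphabet F" "g \<in> \<Delta>" "a < x" "x < b" for x g j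
  proof -
    have R: "flow x q \<in> Rt j" by (rule RR[OF that(1-3)])
    then have "flow x q \<in> Iall" using int[OF that(4,5)] that(2) by (auto simp: Rall_def)
    then obtain i where i: "i \<in> alphabet F" "flow x q \<in> It i" by (auto simp: Iall_def)
    then have "flow x q \<in> Rt i" using It_subset by blast
    then show ?thesis using Rt_disjoint[OF i(1) that(2) _ R] i(2) by simp
  qed
  show ?thesis using j g st p
  proof (induction "card {x \<in> {s<..<t}. flow x q \<in> Rall}" arbitrary: s t j k g h rule: less_induct)
    case less
    show ?case
    proof (cases "\<exists>x. s < x \<and> x < t \<and> flow x q \<in> Rall")
      case False
      have "matrix_inv g ** h \<in> Bp j k 1"
        by (rule step[where s = s and t = t and q = q]) (use less.prems False in \<open>auto intro: RI\<close>)
      then show ?thesis by blast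
    next
      case True
      then obtain x i where x: "s < x" "x < t" "i \<in> alphabet F" "flow x q \<in> Rt i" by (auto simp: Rall_def)
      obtain f where f: "f \<in> \<Delta>" "flow x q \<in> lact f ` Lf i" by (rule Rt_Lf[OF x(3,4)])
      have xR: "flow x q \<in> Rall" using x(3,4) by (auto simp: Rall_def)
      have "card {y \<in> {s<..<x}. flow y q \<in> Rall} < card {y \<in> {s<..<t}. flow y q \<in> Rall}"
        by (rule psubset_card_mono[OF fin]) (use x xR in auto)
      then have 1: "\<exists>n\<ge>1. matrix_inv g ** f \<in> Bp j i n"
        by (rule less.hyps) (use less.prems x f in auto)
      have "card {y \<in> {x<..<t}. flow y q \<in> Rall} < card {y \<in> {s<..<t}. flow y q \<in> Rall}"
        by (rule psubset_card_mono[OF fin]) (use x xR in auto)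
      then have 2: "\<exists>n\<ge>1. matrix_inv f ** h \<in> Bp i k n"
        by (rule less.hyps) (use less.prems x f in auto)
      from 1 2 obtain m n where mn: "m \<ge> 1" "matrix_inv g ** f \<in> Bp j i m" "n \<ge> 1" "matrix_inv f ** h \<in> Bp i k n" by blast
      have "matrix_inv g ** f ** (matrix_inv f ** h) = matrix_inv g ** (f ** matrix_inv f) ** h" by (simp add: matrix_mul_assoc)
      then have "matrix_inv g ** h \<in> Bp j k (m + n)" using Bp_append[OF mn(2,4)] f(1) by simp
      then show ?thesis using mn(1) by (intro exI[of _ "m + n"]) simp
    qed
  qed
qed

text \<open>The times \<open>s i\<close> are checkpoints, at which the geodesic of \<open>q\<close>
  is in the translate of \<open>K\<close> by \<open>f i\<close>. These are finitely many open
  conditions, so they survive the perturbation to interior hits. Section hits just before the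
  checkpoints are then connected by words, and \<open>near K\<close> bounds how far the translates
  \<open>\<gamma> i\<close> are from \<open>f i\<close>.\<close>

lemma shadow:
  assumes z: "z \<in> alphabet F" and p0: "p0 \<in> Lf z" "p0 \<in> It z"
  obtains \<rho> where "\<rho> > 0" "\<And>q (I :: nat set) s f K. q \<in> Z \<Longrightarrow> dist q p0 < \<rho> \<Longrightarrow> finite I \<Longrightarrow> open K \<Longrightarrow>
      (\<And>i. i \<in> I \<Longrightarrow> s i \<ge> \<delta> + 2 \<and> f i \<in> \<Delta> \<and> lact (matrix_inv (f i)) (flow (s i) q) \<in> K) \<Longrightarrow>
      \<exists>\<gamma> j. (\<forall>i\<in>I. \<gamma> i \<in> \<Delta> \<and> j i \<in> alphabet F \<and> matrix_inv (f i) ** \<gamma> i \<in> near K \<and> (\<exists>n\<ge>1. \<gamma> i \<in> Bp z (j i) n)) \<and>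
        (\<forall>i\<in>I. \<forall>i'\<in>I. s i + \<delta> < s i' \<longrightarrow> (\<exists>n\<ge>1. matrix_inv (\<gamma> i) ** \<gamma> i' \<in> Bp (j i) (j i') n))"
proof -
  \<comment> \<open>Vectors of \<open>Z\<close> near \<open>p0\<close> hit the lift
    \<open>Lf z\<close> itself, not another translate, at a time of absolute value below 1. All
    words start there.\<close>
  have "\<exists>\<rho>>0. \<forall>q. q \<in> Z \<and> dist q p0 < \<rho> \<longrightarrow> (\<exists>t. \<bar>t\<bar> < 1 \<and> flow t q \<in> Lf z)"
  proof (rule ccontr)
    assume "\<not> ?thesis"
    then have "\<exists>q. q \<in> Z \<and> dist q p0 < inverse (real (Suc n)) \<and> (\<forall>t. \<bar>t\<bar> < 1 \<longrightarrow> flow t q \<notin> Lf z)" for n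
      by (metis inverse_positive_iff_positive of_nat_0_less_iff zero_less_Suc)
    then obtain Q where Q: "\<And>n. Q n \<in> Z" "\<And>n. dist (Q n) p0 < inverse (real (Suc n))"
      "\<And>n t. \<bar>t\<bar> < 1 \<Longrightarrow> flow t (Q n) \<notin> Lf z" by metis
    have lQ: "Q \<longlonglongrightarrow> p0"
    proof (rule metric_LIMSEQ_I)
      fix r :: real assume "0 < r"
      then obtain N where N: "inverse (real (Suc N)) < r" using reals_Archimedean by blast
      have "dist (Q n) p0 < r" if "n \<ge> N" for n
      proof -
        have "inverse (real (Suc n)) \<le> inverse (real (Suc N))" using that by (intro le_imp_inverse_le) auto
        then show ?thesis using Q(2)[of n] N by linarith
      qed
      then show "\<exists>no. \<forall>n\<ge>no. dist (Q n) p0 < r" by blast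
    qed
    obtain T where T: "T \<longlonglongrightarrow> 0" "\<forall>\<^sub>F n in sequentially. flow (T n) (Q n) \<in> It z"
      by (rule It_open[OF z p0(2) lQ]) (use Q(1) in simp)
    have "(\<lambda>n. flow (T n) (Q n)) \<longlonglongrightarrow> flow 0 p0" by (intro tendsto_intros T(1) lQ)
    then have "(\<lambda>n. flow (T n) (Q n)) \<longlonglongrightarrow> p0" by simp
    then have "\<forall>\<^sub>F n in sequentially. flow (T n) (Q n) \<in> Lf z"
      by (rule Lf_limit[OF z p0(1)]) (use T(2) It_subset[OF z] in \<open>auto elim: eventually_mono\<close>)
    moreover have "\<forall>\<^sub>F n in sequentially. \<bar>T n\<bar> < 1" using tendstoD[OF T(1), of 1] by simp
    ultimately have "\<forall>\<^sub>F n in sequentially. False" by eventually_elim (use Q(3) in blast)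
    then show False by simp
  qed
  then obtain \<rho> where \<rho>: "\<rho> > 0" "\<And>q. q \<in> Z \<Longrightarrow> dist q p0 < \<rho> \<Longrightarrow> \<exists>t. \<bar>t\<bar> < 1 \<and> flow t q \<in> Lf z" by blast
  show ?thesis
  proof (rule that[OF \<rho>(1)])
    fix q s f K and I :: "nat set"
    assume q: "q \<in> Z" "dist q p0 < \<rho>" and I: "finite I" and K: "open K"
      and sf: "\<And>i. i \<in> I \<Longrightarrow> s i \<ge> \<delta> + 2 \<and> f i \<in> \<Delta> \<and> lact (matrix_inv (f i)) (flow (s i) q) \<in> K"
    define V where "V = ball p0 \<rho> \<inter> (\<Inter>i\<in>I. (\<lambda>x. lact (matrix_inv (f i)) (flow (s i) x)) -` K)"
    have "continuous_on UNIV (\<lambda>x. lact g (flow t x))" for g :: "'n lorentz" and t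
      by (auto simp: continuous_on_def intro!: tendsto_intros)
    then have "open V" unfolding V_def using I K by (intro open_Int open_INT open_ball ballI open_vimage)
    moreover have "q \<in> V" using q sf by (auto simp: V_def dist_commute)
    ultimately obtain q' where q': "q' \<in> V" "q' \<in> Z"
      "\<And>t. -2 < t \<Longrightarrow> t < Max (insert 0 (s ` I)) + 1 \<Longrightarrow> flow t q' \<in> Rall \<Longrightarrow> flow t q' \<in> Iall"
      using generic[of V q "-2" "Max (insert 0 (s ` I)) + 1"] q(1) by blast
    have "dist q' p0 < \<rho>" using q'(1) by (simp add: V_def dist_commute)
    then obtain t0 where t0: "\<bar>t0\<bar> < 1" "flow t0 q' \<in> Lf z" using \<rho>(2)[OF q'(2)] by blast
    have "\<exists>g j r. j \<in> alphabet F \<and> g \<in> \<Delta> \<and> r \<in> {0..\<delta>} \<and> flow (s i - r) q' \<in> lact g ` Lf j" for i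
    proof -
      have "flow (s i) q' \<in> Z" using q'(2) by simp
      then obtain r where r: "r \<in> {0..\<delta>}" "flow (- r) (flow (s i) q') \<in> Rall" by (rule cover)
      then obtain j where j: "j \<in> alphabet F" "flow (- r) (flow (s i) q') \<in> Rt j" by (auto simp: Rall_def)
      obtain g where "g \<in> \<Delta>" "flow (- r) (flow (s i) q') \<in> lact g ` Lf j" by (rule Rt_Lf[OF j])
      with r(1) j(1) show ?thesis by (auto simp: flow_add)
    qed
    then obtain \<gamma> j r where \<gamma>: "\<And>i. j i \<in> alphabet F" "\<And>i. \<gamma> i \<in> \<Delta>" "\<And>i. r i \<in> {0..\<delta>}"
      "\<And>i. flow (s i - r i) q' \<in> lact (\<gamma> i) ` Lf (j i)" by metis
    have sM: "s i \<le> Max (insert 0 (s ` I))" if "i \<in> I" for i using I that by (intro Max_ge) auto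
    have win: "-2 < s i - r i" "s i - r i < Max (insert 0 (s ` I)) + 1" "t0 < s i - r i" if "i \<in> I" for i
      using sf[OF that] \<gamma>(3)[of i] sM[OF that] t0(1) by (auto simp: abs_less_iff)
    have win0: "-2 < t0" using t0(1) by (auto simp: abs_less_iff)
    have m1: "matrix_inv (mat 1) = (mat 1 :: 'n lorentz)" using inv_left[OF one_mem] by simp
    show "\<exists>\<gamma> j. (\<forall>i\<in>I. \<gamma> i \<in> \<Delta> \<and> j i \<in> alphabet F \<and> matrix_inv (f i) ** \<gamma> i \<in> near K \<and> (\<exists>n\<ge>1. \<gamma> i \<in> Bp z (j i) n)) \<and>
        (\<forall>i\<in>I. \<forall>i'\<in>I. s i + \<delta> < s i' \<longrightarrow> (\<exists>n\<ge>1. matrix_inv (\<gamma> i) ** \<gamma> i' \<in> Bp (j i) (j i') n))"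
    proof (rule exI[of _ \<gamma>], rule exI[of _ j], intro conjI ballI impI)
      fix i assume i: "i \<in> I"
      show "\<gamma> i \<in> \<Delta>" "j i \<in> alphabet F" using \<gamma> by auto
      show "matrix_inv (f i) ** \<gamma> i \<in> near K"
      proof -
        obtain l where l: "l \<in> Lf (j i)" "flow (s i - r i) q' = lact (\<gamma> i) l" using \<gamma>(4)[of i] by blast
        have "flow (r i) (lact (matrix_inv (f i) ** \<gamma> i) l) = lact (matrix_inv (f i)) (flow (r i) (flow (s i - r i) q'))"
          unfolding l(2) by (simp add: flow_lact flip: lact_lact)
        also have "\<dots> = lact (matrix_inv (f i)) (flow (s i) q')" by (simp add: flow_add)
        also have "\<dots> \<in> K" using q'(1) i by (auto simp: V_def)
        finally have "flow (r i) (lact (matrix_inv (f i) ** \<gamma> i) l) \<in> K" .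
        moreover have "matrix_inv (f i) ** \<gamma> i \<in> \<Delta>" using sf[OF i] \<gamma>(2) by (intro mult_mem inv_mem) auto
        moreover have "l \<in> LL" using l(1) \<gamma>(1) by (auto simp: LL_def)
        ultimately show ?thesis using \<gamma>(3)[of i] unfolding near_def by blast
      qed
      have "\<exists>n\<ge>1. matrix_inv (mat 1) ** \<gamma> i \<in> Bp z (j i) n"
      proof (rule path[where q = q' and s = t0 and t = "s i - r i", OF q'(3) z \<gamma>(1) one_mem \<gamma>(2) win0 win(3)[OF i] win(2)[OF i] _ \<gamma>(4)])
        show "flow t0 q' \<in> lact (mat 1) ` Lf z" using t0(2) by force
      qed
      then show "\<exists>n\<ge>1. \<gamma> i \<in> Bp z (j i) n" by (simp add: m1)
    next
      fix i i' assume i: "i \<in> I" and i': "i' \<in> I" "s i + \<delta> < s i'"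
      have lt: "s i - r i < s i' - r i'" using i'(2) \<gamma>(3)[of i] \<gamma>(3)[of i'] by auto
      show "\<exists>n\<ge>1. matrix_inv (\<gamma> i) ** \<gamma> i' \<in> Bp (j i) (j i') n"
        by (rule path[where q = q', OF q'(3) \<gamma>(1) \<gamma>(1) \<gamma>(2) \<gamma>(2) win(1)[OF i] lt win(2)[OF i'(1)] \<gamma>(4) \<gamma>(4)])
    qed
  qed
qed

end

section \<open>Hyperbolic elements\<close>

text \<open>Cauchy-Schwarz for the space parts of \<open>w\<close> and \<open>e\<close> bounds the
  time coordinate of \<open>w\<close>, because \<open>e\<close> is timelike. So the form controls
  the Euclidean norm on the complement of \<open>e\<close>.\<close>

lemma hyp_perp_norm:
  assumes e: "e \<in> hyp_space" and w: "w \<star> e = 0"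
  shows "(norm w)\<^sup>2 \<le> 2 * (e $ None)\<^sup>2 * (w \<star> w)"
proof -
  define w' where "w' = w - w $ None *\<^sub>R e0"
  define e' where "e' = e - e $ None *\<^sub>R e0"
  define W E where "W = w \<star> w + (w $ None)\<^sup>2" and "E = (e $ None)\<^sup>2"
  have ee: "e \<star> e = -1" "e $ None > 0" using e by (auto simp: hyp_space_def)
  have c: "x \<star> e0 = - (x $ None)" for x :: "'a mvec" using minkowski_commute[of x e0] by simp
  have i: "w' \<bullet> w' = W" "e' \<bullet> e' = E - 1" "w' \<bullet> e' = w $ None * e $ None"
    unfolding inner_eq_minkowski w'_def e'_def W_def E_def
    using ee w by (simp_all add: mink_simps c power2_eq_square algebra_simps)
  have "(w $ None * e $ None)\<^sup>2 \<le> W * (E - 1)" using Cauchy_Schwarz_ineq[of w' e'] i by simp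
  then have 1: "(w $ None)\<^sup>2 * E \<le> W * (E - 1)" by (simp add: E_def power_mult_distrib)
  have E: "E > 0" using ee by (simp add: E_def)
  have W0: "W \<ge> 0" using inner_ge_zero[of w'] i by simp
  have 2: "w \<star> w = W - (w $ None)\<^sup>2" by (simp add: W_def)
  have "(w $ None)\<^sup>2 * E \<le> W * E" using 1 W0 by (simp add: algebra_simps)
  then have 3: "(w $ None)\<^sup>2 \<le> W" using E by simp
  have "W \<le> E * (w \<star> w)" using 1 unfolding 2 by (simp add: algebra_simps)
  then have "2 * W \<le> 2 * E * (w \<star> w)" by simp
  moreover have "(norm w)\<^sup>2 = W + (w $ None)\<^sup>2" unfolding norm_sq_minkowski by (simp add: W_def)
  ultimately show ?thesis using 3 unfolding E_def by linarith
qed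

text \<open>Subtracting the expected limit leaves a vector whose square and whose products with
  \<open>a\<close> and \<open>b\<close> tend to 0. With \<open>e\<close> a point of the geodesic
  between \<open>a\<close> and \<open>b\<close>, its component along \<open>e\<close> tends to 0,
  and the rest is controlled by a definite form.\<close>

lemma null_pair_limit:
  assumes a: "null a" "null b" "a \<star> b < 0" and y: "((\<lambda>k. y k \<star> a) \<longlongrightarrow> 0) G"
    "((\<lambda>k. y k \<star> b) \<longlongrightarrow> c) G" "((\<lambda>k. y k \<star> y k) \<longlongrightarrow> 0) G"
  shows "(y \<longlongrightarrow> (c / (a \<star> b)) *\<^sub>R a) G"
proof -
  define r where "r = -2 / (a \<star> b)"
  define e where "e = (1/2) *\<^sub>R (a + r *\<^sub>R b)"
  have e: "e \<in> hyp_space"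
    using fst_T1H[OF nmk_in_T1H[OF a]] by (simp add: nmk_def mk_def e_def r_def)
  have ee: "e \<star> e = -1" using e by (simp add: hyp_space_def)
  define v where "v k = y k - (c / (a \<star> b)) *\<^sub>R a" for k
  have aa: "a \<star> a = 0" using a by (simp add: null_def)
  have va: "((\<lambda>k. v k \<star> a) \<longlongrightarrow> 0) G" unfolding v_def using y(1) by (simp add: mink_simps aa)
  have vb: "((\<lambda>k. v k \<star> b) \<longlongrightarrow> 0) G"
  proof -
    have "((\<lambda>k. y k \<star> b - c) \<longlongrightarrow> c - c) G" by (intro tendsto_intros y)
    then show ?thesis unfolding v_def using a(3) by (simp add: mink_simps)
  qed
  have vv: "((\<lambda>k. v k \<star> v k) \<longlongrightarrow> 0) G"
  proof -
    have "((\<lambda>k. y k \<star> y k - 2 * (c / (a \<star> b)) * (y k \<star> a)) \<longlongrightarrow> 0 - 2 * (c / (a \<star> b)) * 0) G"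
      by (intro tendsto_intros y)
    moreover have "v k \<star> v k = y k \<star> y k - 2 * (c / (a \<star> b)) * (y k \<star> a)" for k
      unfolding v_def using minkowski_commute[of a "y k"] by (simp add: mink_simps aa)
    ultimately show ?thesis by simp
  qed
  have ve: "((\<lambda>k. v k \<star> e) \<longlongrightarrow> 0) G"
  proof -
    have "((\<lambda>k. 1/2 * (v k \<star> a + r * (v k \<star> b))) \<longlongrightarrow> 1/2 * (0 + r * 0)) G" by (intro tendsto_intros va vb)
    then show ?thesis unfolding e_def by (simp add: mink_simps)
  qed
  define w where "w k = v k + (v k \<star> e) *\<^sub>R e" for k
  have "w k \<star> e = 0" for k unfolding w_def by (simp add: mink_simps ee)
  then have nw: "(norm (w k))\<^sup>2 \<le> 2 * (e $ None)\<^sup>2 * (w k \<star> w k)" for k by (rule hyp_perp_norm[OF e])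
  have "w k \<star> w k = v k \<star> v k + (v k \<star> e)\<^sup>2" for k
    unfolding w_def using minkowski_commute[of e "v k"] by (simp add: mink_simps ee power2_eq_square)
  moreover have "((\<lambda>k. 2 * (e $ None)\<^sup>2 * (v k \<star> v k + (v k \<star> e)\<^sup>2)) \<longlongrightarrow> 2 * (e $ None)\<^sup>2 * (0 + 0\<^sup>2)) G"
    by (intro tendsto_intros vv ve)
  ultimately have "((\<lambda>k. 2 * (e $ None)\<^sup>2 * (w k \<star> w k)) \<longlongrightarrow> 0) G" by simp
  then have "((\<lambda>k. (norm (w k))\<^sup>2) \<longlongrightarrow> 0) G"
    by (rule tendsto_sandwich[OF _ _ tendsto_const, rotated 2]) (use nw in auto)
  then have "((\<lambda>k. sqrt ((norm (w k))\<^sup>2)) \<longlongrightarrow> sqrt 0) G" by (rule tendsto_real_sqrt)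
  then have lw: "(w \<longlongrightarrow> 0) G" by (simp add: tendsto_norm_zero_iff)
  have "((\<lambda>k. w k - (v k \<star> e) *\<^sub>R e + (c / (a \<star> b)) *\<^sub>R a) \<longlongrightarrow> 0 - 0 *\<^sub>R e + (c / (a \<star> b)) *\<^sub>R a) G"
    by (intro tendsto_intros lw ve)
  then show ?thesis by (simp add: w_def v_def)
qed

text \<open>A consequence of the Gram identity that acts as a triangle inequality:
  \<open>- (x \<star> x')\<close> is the hyperbolic cosine of the distance.\<close>

lemma hyp_time_bound:
  assumes "x \<in> hyp_space" "x' \<in> hyp_space"
  shows "x' $ None \<le> 2 * x $ None * - (x \<star> x')"
proof -
  have x: "x \<star> x = -1" "x $ None > 0" "x' \<star> x' = -1" "x' $ None > 0" using assms by (auto simp: hyp_space_def)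
  have "0 \<le> (x' $ None)\<^sup>2 * (x \<star> x) + (x $ None)\<^sup>2 * (x' \<star> x') - 2 * (x $ None) * (x' $ None) * (x \<star> x')"
    by (subst minkowski_gram[symmetric]) simp
  from this[unfolded x(1,3)] zero_le_power2[of "x $ None"]
  have "(x' $ None)\<^sup>2 \<le> 2 * (x $ None) * (x' $ None) * - (x \<star> x')"
    by linarith
  then have "x' $ None * x' $ None \<le> x' $ None * (2 * x $ None * - (x \<star> x'))" by (simp add: power2_eq_square ac_simps)
  then show ?thesis using x(4) by (simp only: mult_le_cancel_left_pos)
qed

section \<open>Fixed points and axes of group elements\<close>

context kleinian
begin

lemma matpow_eigen: "X *v a = r *\<^sub>R a \<Longrightarrow> matpow X k *v a = r ^ k *\<^sub>R a"
  by (induction k) (simp_all add: matrix_vector_mult_scaleR ac_simps flip: matrix_vector_mul_assoc)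

lemma matpow_inj:
  assumes X: "X \<in> \<Delta>" "X \<noteq> mat 1"
  shows "inj (matpow X)"
proof (rule ccontr)
  assume "\<not> inj (matpow X)"
  then obtain i j where ij: "i < j" "matpow X i = matpow X j"
    by (metis inj_def linorder_neqE_nat)
  have "matpow X i ** mat 1 = matpow X i ** matpow X (j - i)"
    using ij matpow_add[of X i "j - i"] by simp
  then have "matpow X (j - i) = mat 1" using left_cancel[OF matpow_mem[OF X(1)]] by metis
  then show False using tf[OF X(1), of "j - i"] ij X(2) by simp
qed

text \<open>The images of \<open>e0\<close> under powers of \<open>X\<close> go to infinity, while
  their products with \<open>a\<close> stay bounded because \<open>r\<close> is at least 1; after
  normalisation they converge to \<open>a\<close>. The case \<open>r = 1\<close> serves to exclude
  parabolic elements.\<close>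

lemma expanding_inL:
  assumes X: "X \<in> \<Delta>" "X \<noteq> mat 1" and a: "null a" "X *v a = r *\<^sub>R a" and r: "r \<ge> 1"
  shows "inL a"
proof -
  define T where "T n = (matpow X n *v e0) $ None" for n
  have he: "matpow X n *v e0 \<in> hyp_space" for n using e0_hyp_space matpow_mem[OF X(1)] by simp
  have T1: "T n \<ge> 1" for n unfolding T_def by (rule hyp_time_ge_1[OF he])
  have Tinf: "filterlim T at_top sequentially"
    unfolding filterlim_at_top
  proof
    fix C
    have "matpow X ` {n. T n \<le> C} \<subseteq> {g \<in> \<Delta>. (g *v e0) $ None \<le> C}"
      using matpow_mem[OF X(1)] by (auto simp: T_def)
    then have "finite (matpow X ` {n. T n \<le> C})" using finite_subset finite_time_bound by blast
    then have "finite {n. T n \<le> C}" by (rule finite_imageD) (rule inj_on_subset[OF matpow_inj[OF X]], simp)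
    then have "\<forall>\<^sub>F n in sequentially. n \<notin> {n. T n \<le> C}"
      by (simp add: cofinite_eq_sequentially[symmetric] eventually_cofinite)
    then show "\<forall>\<^sub>F n in sequentially. C \<le> T n" by eventually_elim simp
  qed
  then have iT: "(\<lambda>n. inverse (T n)) \<longlonglongrightarrow> 0"
    by (rule tendsto_inverse_0_at_top)
  define y where "y n = klein (matpow X n *v e0)" for n
  define a' where "a' = klein a"
  have a': "a' \<star> a' = 0" "a' $ None = 1" "a' \<in> boundary" using null_klein[OF a(1)] by (auto simp: a'_def null_def)
  have Xa': "X *v a' = r *\<^sub>R a'" unfolding a'_def klein_def using a(2) by (simp add: matrix_vector_mult_scaleR)
  have y1: "y n $ None = 1" for n using T1[of n] by (simp add: y_def klein_def T_def)
  have yy: "y n \<star> y n = - (inverse (T n) * inverse (T n))" for n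
    using he[of n] by (simp add: y_def klein_def T_def mink_simps hyp_space_def divide_inverse)
  have ya: "\<bar>y n \<star> a'\<bar> \<le> inverse (T n) * \<bar>e0 \<star> a'\<bar>" for n
  proof -
    have "r ^ n * ((matpow X n *v e0) \<star> a') = (matpow X n *v e0) \<star> (matpow X n *v a')"
      using matpow_eigen[OF Xa', of n] by (simp add: mink_simps)
    also have "\<dots> = e0 \<star> a'" by (rule iso[OF matpow_mem[OF X(1)]])
    finally have "\<bar>e0 \<star> a'\<bar> = \<bar>r ^ n * ((matpow X n *v e0) \<star> a')\<bar>" by simp
    then have "\<bar>e0 \<star> a'\<bar> = r ^ n * \<bar>(matpow X n *v e0) \<star> a'\<bar>" using r by (simp only: abs_mult) simp
    moreover have "1 \<le> r ^ n" using r by simp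
    ultimately have "\<bar>(matpow X n *v e0) \<star> a'\<bar> \<le> \<bar>e0 \<star> a'\<bar>" by (simp add: mult_le_cancel_right1)
    moreover have "y n \<star> a' = inverse (T n) * ((matpow X n *v e0) \<star> a')"
      by (simp add: y_def klein_def T_def mink_simps divide_inverse)
    ultimately show ?thesis using T1[of n] by (simp add: abs_mult mult_left_mono)
  qed
  have nn: "(norm (y n - a'))\<^sup>2 \<le> 2 * (inverse (T n) * \<bar>e0 \<star> a'\<bar>)" for n
  proof -
    have "(norm (y n - a'))\<^sup>2 = y n \<star> y n - 2 * (y n \<star> a')"
      unfolding norm_sq_minkowski using y1 a' minkowski_commute[of a' "y n"] by (simp add: mink_simps)
    also have "\<dots> \<le> 2 * \<bar>y n \<star> a'\<bar>" unfolding yy using zero_le_square[of "inverse (T n)"] by linarith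
    finally show ?thesis using ya[of n] by linarith
  qed
  have "(\<lambda>n. 2 * (inverse (T n) * \<bar>e0 \<star> a'\<bar>)) \<longlonglongrightarrow> 2 * (0 * \<bar>e0 \<star> a'\<bar>)" by (intro tendsto_intros iT)
  then have "(\<lambda>n. 2 * (inverse (T n) * \<bar>e0 \<star> a'\<bar>)) \<longlonglongrightarrow> 0" by simp
  then have "(\<lambda>n. (norm (y n - a'))\<^sup>2) \<longlonglongrightarrow> 0"
    by (rule tendsto_sandwich[OF _ _ tendsto_const, rotated 2]) (use nn in auto)
  then have "(\<lambda>n. sqrt ((norm (y n - a'))\<^sup>2)) \<longlonglongrightarrow> sqrt 0" by (rule tendsto_real_sqrt)
  then have "(\<lambda>n. y n - a') \<longlonglongrightarrow> 0" by (simp add: tendsto_norm_zero_iff)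
  then have "y \<longlonglongrightarrow> a'" by (simp add: LIM_zero_iff)
  then have "a' \<in> limit_set \<Delta>"
    unfolding limit_set_def using a'(3) matpow_mem[OF X(1)]
      \<open>y \<longlonglongrightarrow> a'\<close>[unfolded y_def e0_def]
    by (intro CollectI conjI exI[of _ "matpow X"]) auto
  then show ?thesis using a(1) by (simp add: inL_def a'_def)
qed

text \<open>Brouwer on the closed ball of the Klein model, on which \<open>X\<close> acts. A fixed
  point inside would be a fixed point in hyperbolic space, excluded by freeness, so it is on the
  boundary.\<close>

lemma fixed_causal:
  assumes X: "X \<in> \<Delta>" "X \<noteq> mat 1"
  obtains a r where "null a" "r > 0" "X *v a = r *\<^sub>R a"
proof -
  define S where "S = {\<xi> :: 'n mvec. \<xi> $ None = 1} \<inter> cball 0 (sqrt 2)"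
  have S: "\<xi> \<in> S \<longleftrightarrow> causal \<xi> \<and> \<xi> $ None = 1" for \<xi>
  proof -
    have "norm \<xi> \<le> sqrt 2 \<longleftrightarrow> (norm \<xi>)\<^sup>2 \<le> 2" by (simp add: real_le_rsqrt sqrt_le_D real_sqrt_le_iff flip: real_sqrt_le_iff[of "(norm \<xi>)\<^sup>2"])
    then show ?thesis by (auto simp: S_def causal_def norm_sq_minkowski)
  qed
  have "{\<xi> :: 'n mvec. \<xi> $ None = 1} = {\<xi>. axis None 1 \<bullet> \<xi> = 1}" by (simp add: inner_axis')
  then have "convex {\<xi> :: 'n mvec. \<xi> $ None = 1}" "closed {\<xi> :: 'n mvec. \<xi> $ None = 1}"
    by (simp_all only: convex_hyperplane closed_hyperplane)
  then have "convex S" "compact S" unfolding S_def by (auto intro: convex_Int closed_Int_compact)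
  moreover have "e0 \<in> S" unfolding S using e0_timelike by simp
  moreover have fS: "klein (X *v \<xi>) \<in> S" if "\<xi> \<in> S" for \<xi>
  proof -
    have c: "causal (X *v \<xi>)" using that X(1) by (simp add: S)
    then have "1 / (X *v \<xi>) $ None > 0" by (simp add: causal_def)
    from causal_scale[OF c this] c show ?thesis unfolding S klein_def by (simp add: causal_def)
  qed
  moreover have "continuous_on S (\<lambda>\<xi>. klein (X *v \<xi>))"
    unfolding continuous_on_def using X(1)
    by (auto intro!: tendsto_intros simp: S) (metis causal_def causal_mem less_irrefl)
  ultimately obtain \<xi> where \<xi>: "\<xi> \<in> S" "klein (X *v \<xi>) = \<xi>"
    using brouwer[of S "\<lambda>\<xi>. klein (X *v \<xi>)"] by blast
  define r where "r = (X *v \<xi>) $ None"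
  have c\<xi>: "causal \<xi>" "\<xi> $ None = 1" using \<xi>(1) S by auto
  then have "causal (X *v \<xi>)" using X(1) by simp
  then have r: "r > 0" by (simp add: r_def causal_def)
  have "r *\<^sub>R klein (X *v \<xi>) = X *v \<xi>" using r by (simp add: klein_def r_def)
  then have Xr: "X *v \<xi> = r *\<^sub>R \<xi>" using \<xi>(2) by simp
  have sq: "r * r * (\<xi> \<star> \<xi>) = \<xi> \<star> \<xi>" using iso[OF X(1), of \<xi> \<xi>] Xr by (simp add: mink_simps)
  have "\<xi> \<star> \<xi> = 0"
  proof (rule ccontr)
    assume n: "\<xi> \<star> \<xi> \<noteq> 0"
    then have neg: "\<xi> \<star> \<xi> < 0" using c\<xi> by (simp add: causal_def)
    have "r * r = 1" using sq n by simp
    then have "r = 1" using r by (simp add: power2_eq_1_iff flip: power2_eq_square)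
    define x where "x = (1 / sqrt (- (\<xi> \<star> \<xi>))) *\<^sub>R \<xi>"
    have "x \<in> hyp_space" using neg c\<xi> unfolding x_def hyp_space_def by (simp add: mink_simps)
    moreover have "X *v x = x" using Xr \<open>r = 1\<close> by (simp add: x_def matrix_vector_mult_scaleR)
    ultimately show False using free[OF X(1)] X(2) by blast
  qed
  then have "null \<xi>" using c\<xi> by (simp add: null_def)
  then show ?thesis using that r Xr by blast
qed

text \<open>The attracting endpoint is \<open>a\<close>, the repelling one \<open>b\<close>, and
  \<open>ln r\<close> is the translation length.\<close>

definition axis_of :: "'n lorentz \<Rightarrow> 'n mvec \<Rightarrow> 'n mvec \<Rightarrow> real \<Rightarrow> bool" where
  "axis_of X a b r \<longleftrightarrow> X \<in> \<Delta> \<and> r > 1 \<and> null a \<and> null b \<and> X *v a = r *\<^sub>R a \<and> X *v b = (1 / r) *\<^sub>R b"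

lemma axis_ofD:
  assumes "axis_of X a b r"
  shows "X \<in> \<Delta>" "r > 1" "null a" "null b" "X *v a = r *\<^sub>R a" "X *v b = (1 / r) *\<^sub>R b"
  using assms by (auto simp: axis_of_def)

lemma null_parallel:
  assumes "null a" "null b" "a \<star> b = 0"
  obtains s where "s > 0" "b = s *\<^sub>R a"
proof -
  have "b = (b $ None / a $ None) *\<^sub>R a" by (rule causal_orthogonal_parallel) (use assms null_causal in auto)
  moreover have "b $ None / a $ None > 0" using assms by (simp add: null_def)
  ultimately show ?thesis using that by blast
qed

lemma null_nonparallel_neg: "null a \<Longrightarrow> null b \<Longrightarrow> a \<star> b \<noteq> 0 \<Longrightarrow> a \<star> b < 0"
  using causal_minkowski_nonpos[of a b] null_causal by fastforce

lemma eigen_unique: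
  assumes "null a" "X *v a = r *\<^sub>R a" "X *v a = s *\<^sub>R a"
  shows "r = s"
  using assms null_nonzero[of a] by simp

lemma axis_neg:
  assumes "axis_of X a b r"
  shows "a \<star> b < 0"
proof (rule null_nonparallel_neg)
  note A = axis_ofD[OF assms]
  show "null a" "null b" using A by auto
  show "a \<star> b \<noteq> 0"
  proof
    assume "a \<star> b = 0"
    then obtain s where s: "b = s *\<^sub>R a" using null_parallel A(3,4) by blast
    then have "X *v b = r *\<^sub>R b" using A(5) by (simp add: matrix_vector_mult_scaleR)
    then have "r = 1 / r" using eigen_unique[OF A(4) _ A(6)] by simp
    then have "r * r = 1" using A(2) by (simp add: field_simps)
    moreover have "r * r > 1 * 1" using A(2) by (intro mult_strict_mono) auto
    ultimately show False by simp
  qed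
qed

lemma axis_inv: "axis_of X a b r \<Longrightarrow> axis_of (matrix_inv X) b a r"
proof -
  assume "axis_of X a b r"
  note A = axis_ofD[OF this]
  have "matrix_inv X *v (X *v b) = (1/r) *\<^sub>R (matrix_inv X *v b)" unfolding A(6) by (simp add: matrix_vector_mult_scaleR)
  then have "b = (1/r) *\<^sub>R (matrix_inv X *v b)" using A(1) by simp
  then have 1: "matrix_inv X *v b = r *\<^sub>R b" using A(2) by (metis (no_types) axis_of_def divide_self_if less_numeral_extra(4) nonzero_divide_eq_eq not_one_less_zero scaleR_one scaleR_scaleR mult.commute)
  have "matrix_inv X *v (X *v a) = r *\<^sub>R (matrix_inv X *v a)" unfolding A(5) by (simp add: matrix_vector_mult_scaleR)
  then have "a = r *\<^sub>R (matrix_inv X *v a)" using A(1) by simp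
  then have "(1/r) *\<^sub>R a = (1/r) *\<^sub>R r *\<^sub>R (matrix_inv X *v a)" by simp
  then have 2: "matrix_inv X *v a = (1/r) *\<^sub>R a" using A(2) by simp
  from 1 2 A show ?thesis by (simp add: axis_of_def inv_mem)
qed

lemma axis_pow: "axis_of X a b r \<Longrightarrow> n > 0 \<Longrightarrow> axis_of (matpow X n) a b (r ^ n)"
  using matpow_eigen[of X a r n] matpow_eigen[of X b "1/r" n]
  by (auto simp: axis_of_def matpow_mem power_one_over)

lemma axis_conj:
  assumes "axis_of X a b r" and g: "g \<in> \<Delta>"
  shows "axis_of (g ** X ** matrix_inv g) (g *v a) (g *v b) r"
proof -
  note A = axis_ofD[OF assms(1)]
  have "(g ** X ** matrix_inv g) *v (g *v v) = g *v (X *v v)" for v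
    using g by (simp flip: matrix_vector_mul_assoc)
  then show ?thesis using A g by (simp add: axis_of_def matrix_vector_mult_scaleR mult_mem inv_mem)
qed

lemma axis_inL:
  assumes "axis_of X a b r"
  shows "inL a" "inL b"
proof -
  have *: "inL a" if "axis_of X a b r" for X a b
  proof -
    note A = axis_ofD[OF that]
    have "X \<noteq> mat 1"
    proof
      assume "X = mat 1"
      then have "r = 1" using eigen_unique[OF A(3,5), of 1] by simp
      then show False using A(2) by simp
    qed
    then show ?thesis using expanding_inL[OF A(1) _ A(3,5)] A(2) by simp
  qed
  show "inL a" "inL b" using *[OF assms] *[OF axis_inv[OF assms]] by auto
qed

text \<open>If \<open>v\<close> were parallel to neither end, invariance of its products with
  \<open>a\<close> and \<open>b\<close> would require both \<open>r s = 1\<close> and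
  \<open>s = r\<close>, against \<open>r > 1\<close>.\<close>

lemma axis_fixed:
  assumes "axis_of X a b r" and v: "null v" "X *v v = s *\<^sub>R v"
  shows "v \<star> a = 0 \<or> v \<star> b = 0"
proof (rule ccontr)
  assume n: "\<not> ?thesis"
  note A = axis_ofD[OF assms(1)]
  have alg: "(i * s - 1) * w = 0" if "s * (i * w) = w" for i w :: real
  proof -
    have "(i * s - 1) * w = s * (i * w) - w" by (simp add: algebra_simps)
    then show ?thesis using that by simp
  qed
  have "(r * s - 1) * (v \<star> a) = 0"
    by (rule alg) (use iso[OF A(1), of v a] in \<open>simp only: A(5) v(2) mink.scaleR_left mink.scaleR_right real_scaleR_def mult.left_commute\<close>)
  moreover have "((1/r) * s - 1) * (v \<star> b) = 0"
    by (rule alg) (use iso[OF A(1), of v b] in \<open>simp only: A(6) v(2) mink.scaleR_left mink.scaleR_right real_scaleR_def mult.left_commute\<close>)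
  ultimately have "r * s = 1" "(1/r) * s = 1" using n by (simp_all only: mult_eq_0_iff de_Morgan_disj) simp_all
  then have "r * r = 1" using A(2) by (simp add: field_simps)
  moreover have "r * r > 1 * 1" using A(2) by (intro mult_strict_mono) auto
  ultimately show False by simp
qed

text \<open>Invariance makes the products with \<open>a\<close> and \<open>b\<close> explicit: after
  rescaling the first tends to 0 and the second is constant, as \<open>null_pair_limit\<close>
  requires.\<close>

lemma axis_limit:
  assumes "axis_of X a b r"
  shows "(\<lambda>k. (1/r)^k *\<^sub>R (matpow X k *v v)) \<longlonglongrightarrow> (v \<star> b / (a \<star> b)) *\<^sub>R a"
proof (rule null_pair_limit)
  note A = axis_ofD[OF assms]
  show "null a" "null b" "a \<star> b < 0" using A axis_neg[OF assms] by auto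
  have r0: "0 \<le> 1/r" "1/r < 1" using A(2) by auto
  then have p: "(\<lambda>k. (1/r)^k) \<longlonglongrightarrow> 0" by (intro LIMSEQ_realpow_zero)
  have z: "(\<lambda>k. (1/r)^k * ((1/r)^k * C)) \<longlonglongrightarrow> 0" for C
  proof -
    have "(\<lambda>k. (1/r)^k * ((1/r)^k * C)) \<longlonglongrightarrow> 0 * (0 * C)" by (intro tendsto_intros p)
    then show ?thesis by simp
  qed
  have e: "(matpow X k *v v) \<star> c = (1/s)^k * (v \<star> c)" if "X *v c = s *\<^sub>R c" "s > 0" for k c s
  proof -
    have "s ^ k * ((matpow X k *v v) \<star> c) = (matpow X k *v v) \<star> (matpow X k *v c)"
      using matpow_eigen[OF that(1), of k] by (simp add: mink_simps)
    also have "\<dots> = v \<star> c" by (rule iso[OF matpow_mem[OF A(1)]])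
    finally have "(1/s)^k * (s ^ k * ((matpow X k *v v) \<star> c)) = (1/s)^k * (v \<star> c)" by simp
    then show ?thesis using that(2) by (simp add: power_one_over)
  qed
  show "(\<lambda>k. ((1/r)^k *\<^sub>R (matpow X k *v v)) \<star> a) \<longlonglongrightarrow> 0"
    using z[of "v \<star> a"] e[OF A(5)] A(2) by (simp add: mink_simps)
  have "((1/r)^k *\<^sub>R (matpow X k *v v)) \<star> b = v \<star> b" for k
    using e[OF A(6), of k] A(2) by (simp add: mink_simps power_one_over)
  then show "(\<lambda>k. ((1/r)^k *\<^sub>R (matpow X k *v v)) \<star> b) \<longlonglongrightarrow> v \<star> b" by simp
  show "(\<lambda>k. ((1/r)^k *\<^sub>R (matpow X k *v v)) \<star> ((1/r)^k *\<^sub>R (matpow X k *v v))) \<longlonglongrightarrow> 0"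
    using z[of "v \<star> v"] iso[OF matpow_mem[OF A(1)]] by (simp add: mink_simps)
qed

text \<open>The conjugates \<open>X\<^sup>-\<^sup>n k X\<^sup>n\<close> move a point of the axis of \<open>X\<close> by a bounded distance, so two of them agree.\<close>

lemma axis_discrete:
  assumes "axis_of X a b r" and k: "k \<in> \<Delta>" "k *v a = s *\<^sub>R a"
  shows "(k *v b) \<star> b = 0"
proof -
  note A = axis_ofD[OF assms(1)]
  define t where "t = -2 / (a \<star> b)"
  define x where "x = (1/2) *\<^sub>R (a + t *\<^sub>R b)"
  have x: "x \<in> hyp_space"
    using fst_T1H[OF nmk_in_T1H[OF A(3,4) axis_neg[OF assms(1)]]] by (simp add: nmk_def mk_def x_def t_def)
  define Y where "Y n = matpow (matrix_inv X) n" for n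
  have Xi: "matrix_inv X \<in> \<Delta>" using A inv_mem by simp
  have YD: "Y n \<in> \<Delta>" "matpow X n \<in> \<Delta>" for n using matpow_mem A(1) Xi by (auto simp: Y_def)
  have YX: "Y n ** matpow X n = mat 1" for n
  proof (induction n)
    case (Suc n)
    have "Y (Suc n) ** matpow X (Suc n) = Y n ** matrix_inv X ** (X ** matpow X n)"
      unfolding Y_def by (simp add: matpow_commute[symmetric])
    also have "\<dots> = Y n ** (matrix_inv X ** X) ** matpow X n" by (simp add: matrix_mul_assoc)
    finally show ?case using Suc A(1) by simp
  qed (simp add: Y_def)
  have Yv: "(Y n *v u) \<star> v = u \<star> (matpow X n *v v)" for n u v
  proof -
    have "(Y n *v u) \<star> v = (Y n *v u) \<star> (Y n *v (matpow X n *v v))" using YX[of n] by (simp add: matrix_vector_mul_assoc)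
    then show ?thesis using iso[OF YD(1)] by simp
  qed
  define kk where "kk n = Y n ** (k ** matpow X n)" for n
  have kD: "kk n \<in> \<Delta>" for n unfolding kk_def using YD k(1) by (intro mult_mem)
  have Xa: "matpow X n *v a = r ^ n *\<^sub>R a" "matpow X n *v b = (1/r) ^ n *\<^sub>R b" for n
    using matpow_eigen A(5,6) by auto
  have form: "(kk n *v u) \<star> v = (k *v (matpow X n *v u)) \<star> (matpow X n *v v)" for n u v
    unfolding kk_def by (simp add: Yv flip: matrix_vector_mul_assoc)
  define C where "C = 2 * x $ None * (\<bar>s * (a \<star> b) * t\<bar> + \<bar>t * ((k *v b) \<star> a)\<bar> + \<bar>t * t * ((k *v b) \<star> b)\<bar>)"
  \<comment> \<open>In the displacement of \<open>x\<close> under \<open>kk n\<close> the powers of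
    \<open>r\<close> cancel in the terms with \<open>a\<close>, and the remaining term is
    damped.\<close>
  have bnd: "(kk n *v x) $ None \<le> C" for n
  proof -
    have rr: "(1/r)^n * r^n = 1" "r^n * (1/r)^n = 1" using A(2) by (simp_all add: power_one_over)
    have aa: "a \<star> a = 0" using A(3) by (simp add: null_def)
    have Mx: "matpow X n *v x = (1/2) *\<^sub>R (r^n *\<^sub>R a + (t * (1/r)^n) *\<^sub>R b)"
      unfolding x_def by (simp add: matrix_vector_mult_scaleR Xa matrix_vector_right_distrib)
    have "(kk n *v x) \<star> x = (k *v (matpow X n *v x)) \<star> (matpow X n *v x)" by (rule form)
    also have "\<dots> = 1/4 * (s * r^n * (1/r)^n * t * (a \<star> b) + t * ((1/r)^n * r^n) * ((k *v b) \<star> a)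
        + t * t * ((1/r)^n * (1/r)^n) * ((k *v b) \<star> b))"
      unfolding Mx using aa k(2) by (simp add: matrix_vector_mult_scaleR mink_simps matrix_vector_right_distrib algebra_simps)
    finally have eq: "(kk n *v x) \<star> x = 1/4 * (s * (a \<star> b) * t + t * ((k *v b) \<star> a)
        + t * t * ((k *v b) \<star> b) * ((1/r)^n * (1/r)^n))" using rr by (simp add: mult.assoc mult.commute mult.left_commute)
    have q: "0 \<le> (1/r)^n * (1/r)^n" "(1/r)^n * (1/r)^n \<le> 1"
    proof -
      have "0 \<le> (1/r)^n" "(1/r)^n \<le> 1" using A(2) by (auto intro: power_le_one)
      then show "0 \<le> (1/r)^n * (1/r)^n" "(1/r)^n * (1/r)^n \<le> 1" using mult_le_one[of "(1/r)^n" "(1/r)^n"] by auto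
    qed
    have "\<bar>t * t * ((k *v b) \<star> b) * ((1/r)^n * (1/r)^n)\<bar> \<le> \<bar>t * t * ((k *v b) \<star> b)\<bar> * 1"
      unfolding abs_mult[of _ "(1/r)^n * (1/r)^n"] by (rule mult_left_mono) (use q in auto)
    then have "- ((kk n *v x) \<star> x) \<le> \<bar>s * (a \<star> b) * t\<bar> + \<bar>t * ((k *v b) \<star> a)\<bar> + \<bar>t * t * ((k *v b) \<star> b)\<bar>"
      unfolding eq by argo
    then have 1: "2 * x $ None * - (x \<star> (kk n *v x)) \<le> C"
      unfolding C_def minkowski_commute[of x "kk n *v x"] using x by (intro mult_left_mono) (auto simp: hyp_space_def)
    have "kk n *v x \<in> hyp_space" using kD x by simp
    from hyp_time_bound[OF x this] 1 show ?thesis by linarith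
  qed
  have "range kk \<subseteq> {g \<in> \<Delta>. \<exists>y\<in>hyp_space. y $ None \<le> max C (x $ None) \<and> (g *v y) $ None \<le> max C (x $ None)}"
    using kD x bnd by (auto intro!: bexI[of _ x] simp: le_max_iff_disj)
  then have "finite (range kk)" using proper finite_subset by blast
  then have "\<not> inj kk" using finite_imageD infinite_UNIV_nat by blast
  then obtain i j where ij: "i < j" "kk i = kk j" by (metis inj_def linorder_neqE_nat)
  define m where "m = j - i"
  have m: "m > 0" "j = m + i" using ij(1) by (auto simp: m_def)
  have XY: "matpow X n ** Y n = mat 1" for n
    using YX[of n] by (simp add: matrix_left_right_inverse)
  have "matpow X j ** (kk i) ** Y i = matpow X j ** (kk j) ** Y i" using ij(2) by simp
  moreover have "matpow X j ** kk i ** Y i = matpow X m ** k"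
  proof -
    have "matpow X j ** kk i ** Y i = matpow X m ** (matpow X i ** Y i) ** k ** (matpow X i ** Y i)"
      unfolding kk_def m(2) matpow_add by (simp add: matrix_mul_assoc)
    then show ?thesis by (simp add: XY)
  qed
  moreover have "matpow X j ** kk j ** Y i = k ** matpow X m"
  proof -
    have "matpow X j ** kk j ** Y i = (matpow X j ** Y j) ** k ** (matpow X m ** (matpow X i ** Y i))"
      unfolding kk_def by (simp add: matrix_mul_assoc) (simp add: m(2) matpow_add matrix_mul_assoc)
    then show ?thesis by (simp add: XY)
  qed
  \<comment> \<open>Equality of two conjugates unwinds to commutation of \<open>k\<close> with
    \<open>X^m\<close>. Then \<open>k b\<close> is an eigenvector of \<open>X^m\<close> with the
    eigenvalue of \<open>b\<close>, which forces it to be parallel to \<open>b\<close>.\<close>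
  ultimately have comm: "matpow X m ** k = k ** matpow X m" by simp
  have "matpow X m *v (k *v b) = k *v (matpow X m *v b)" using comm by (simp add: matrix_vector_mul_assoc)
  then have kb: "matpow X m *v (k *v b) = (1/r)^m *\<^sub>R (k *v b)" by (simp add: Xa matrix_vector_mult_scaleR)
  have ax: "axis_of (matpow X m) a b (r ^ m)" by (rule axis_pow[OF assms(1) m(1)])
  have nkb: "null (k *v b)" using A(4) k(1) by simp
  show ?thesis
  proof (rule ccontr)
    assume "(k *v b) \<star> b \<noteq> 0"
    then have "a \<star> (k *v b) = 0" using axis_fixed[OF ax nkb kb] minkowski_commute[of a "k *v b"] by simp
    then obtain q where q: "q > 0" "k *v b = q *\<^sub>R a" using null_parallel[OF A(3) nkb] by blast
    then have "matpow X m *v (k *v b) = r ^ m *\<^sub>R (k *v b)" by (simp add: Xa matrix_vector_mult_scaleR)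
    then have "r ^ m = (1/r)^m" using eigen_unique[OF nkb _ kb] by blast
    then have "r ^ m * r ^ m = 1" using A(2) by (simp add: power_one_over field_simps)
    moreover have "r ^ m > 1" using A(2) m(1) by (simp add: one_less_power)
    then have "r ^ m * r ^ m > 1 * 1" by (intro mult_strict_mono) auto
    ultimately show False by simp
  qed
qed

end


section \<open>Consequences of cocompactness on \<open>Z\<close>: hyperbolicity and placement of
  axes\<close>

context lifted
begin

text \<open>If \<open>X\<close> fixed \<open>a\<close>, its displacement along a geodesic towards
  \<open>a\<close> would tend to 0; \<open>p0\<close> provides a limit point \<open>b\<close> for
  the other end. Cocompactness moves the geodesic back to a bounded set, where finitely many
  conjugates of \<open>X\<close> occur. One of them occurs infinitely often and fixes a limit point,
  against freeness.\<close>

lemma no_parabolic: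
  assumes X: "X \<in> \<Delta>" "X \<noteq> mat 1" and a: "null a" and p0: "p0 \<in> Z"
  shows "X *v a \<noteq> a"
proof
  assume Xa: "X *v a = a"
  have La: "inL a" by (rule expanding_inL[OF X a, of 1]) (use Xa in simp_all)
  note P = T1HD[OF Z_T1H[OF p0]]
  have "\<exists>b. inL b \<and> a \<star> b \<noteq> 0"
  proof (rule ccontr)
    assume "\<not> ?thesis"
    then have "a \<star> np p0 = 0" "a \<star> nm p0 = 0" using p0 by (auto simp: Z_def)
    then obtain s t where "np p0 = s *\<^sub>R a" "nm p0 = t *\<^sub>R a" using null_parallel[OF a P(1)] null_parallel[OF a P(2)] by metis
    then show False using P(3) a by (simp add: mink_simps null_def)
  qed
  then obtain b where b: "inL b" "a \<star> b < 0" using null_nonparallel_neg[OF a] inL_def by blast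
  define m where "m = nmk a b"
  define b' where "b' = nm m"
  have mT: "m \<in> T1H" unfolding m_def using nmk_in_T1H[OF a _ b(2)] b(1) by (simp add: inL_def)
  have npm: "np m = a" by (simp add: m_def nmk_def)
  have ab: "a \<star> b' = -2" "b' \<star> b' = 0" using T1HD[OF mT] npm by (auto simp: b'_def null_def)
  have "inL (nm m)" unfolding m_def nmk_def nm_mk using b by (subst inL_scale_iff) (simp_all add: divide_neg_neg)
  then have mZ: "m \<in> Z" using mT La npm by (simp add: Z_def)
  obtain K where K: "bounded K" "\<And>q. q \<in> Z \<Longrightarrow> \<exists>g\<in>\<Delta>. lact g q \<in> K" by (rule Z_cocompact) blast
  have "\<forall>n. \<exists>g. g \<in> \<Delta> \<and> lact g (flow (real n) m) \<in> K" using K(2) mZ Z_flow by blast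
  then obtain g where g: "\<And>n. g n \<in> \<Delta>" "\<And>n. lact (g n) (flow (real n) m) \<in> K" by metis
  define x where "x n = (1/2) *\<^sub>R (exp (real n) *\<^sub>R a + exp (- real n) *\<^sub>R b')" for n
  define z where "z n = g n *v x n" for n
  have fz: "fst (lact (g n) (flow (real n) m)) = z n" for n
    unfolding fst_np_nm z_def x_def by (simp add: npm b'_def matrix_vector_mult_scaleR matrix_vector_right_distrib)
  have zh: "z n \<in> hyp_space" for n unfolding fz[symmetric] using g(1) mT by (intro fst_T1H) simp
  obtain M where M: "\<And>p. p \<in> K \<Longrightarrow> fst p $ None \<le> M" by (rule time_bound_bounded[OF K(1)]) blast
  have zM: "z n $ None \<le> M" for n using M[OF g(2)[of n]] fz by simp
  define Y where "Y n = g n ** X ** matrix_inv (g n)" for n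
  have YD: "Y n \<in> \<Delta>" for n unfolding Y_def using g(1) X(1) by (intro mult_mem inv_mem)
  define q where "q = b' \<star> (X *v b')"
  have Xb: "a \<star> (X *v b') = -2" using iso[OF X(1), of a b'] Xa ab by simp
  \<comment> \<open>Up to sign this is the hyperbolic cosine of the displacement of \<open>X\<close>
    at time \<open>n\<close>; it tends to 1.\<close>
  have form: "z n \<star> (Y n *v z n) = -1 + exp (- real n) * exp (- real n) * q / 4" for n
  proof -
    have "Y n *v z n = g n *v (X *v x n)"
      unfolding Y_def z_def using g(1) by (simp flip: matrix_vector_mul_assoc)
    then have "z n \<star> (Y n *v z n) = x n \<star> (X *v x n)" unfolding z_def using iso[OF g(1)] by simp
    also have "X *v x n = (1/2) *\<^sub>R (exp (real n) *\<^sub>R a + exp (- real n) *\<^sub>R (X *v b'))"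
      unfolding x_def by (simp add: matrix_vector_mult_scaleR matrix_vector_right_distrib Xa)
    also have "x n \<star> \<dots> = 1/4 * (exp (real n) * exp (- real n) * (a \<star> (X *v b')) +
        exp (real n) * exp (- real n) * (b' \<star> a) + exp (- real n) * exp (- real n) * (b' \<star> (X *v b')))"
      unfolding x_def using a by (simp add: mink_simps null_def algebra_simps)
    also have "exp (real n) * exp (- real n) = 1" by (simp flip: exp_add)
    finally show ?thesis using ab Xb minkowski_commute[of b' a] by (simp add: q_def)
  qed
  define C where "C = 2 * M * (1 + \<bar>q\<bar>)"
  have M0: "M \<ge> 1" using zM[of 0] hyp_time_ge_1[OF zh[of 0]] by linarith
  have bnd: "(Y n *v z n) $ None \<le> C" for n
  proof -
    have "exp (- real n) \<le> 1" by simp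
    then have "exp (- real n) * exp (- real n) \<le> 1" by (simp add: mult_le_one)
    then have "exp (- real n) * exp (- real n) * \<bar>q\<bar> \<le> 1 * \<bar>q\<bar>" by (intro mult_right_mono) auto
    moreover have "\<bar>exp (- real n) * exp (- real n) * q\<bar> = exp (- real n) * exp (- real n) * \<bar>q\<bar>" by (simp add: abs_mult)
    ultimately have 1: "- (z n \<star> (Y n *v z n)) \<le> 1 + \<bar>q\<bar>" unfolding form by argo
    have 0: "0 \<le> - (z n \<star> (Y n *v z n))"
      using causal_minkowski_nonpos[of "z n" "Y n *v z n"] hyp_space_causal[OF zh[of n]] YD by simp
    have "(Y n *v z n) $ None \<le> 2 * z n $ None * - (z n \<star> (Y n *v z n))"
      using hyp_time_bound[OF zh[of n], of "Y n *v z n"] YD zh by simp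
    also have "\<dots> \<le> 2 * M * - (z n \<star> (Y n *v z n))" using zM[of n] 0 by (intro mult_right_mono) auto
    also have "\<dots> \<le> C" unfolding C_def using 1 M0 by (intro mult_left_mono) auto
    finally show ?thesis .
  qed
  have "range Y \<subseteq> {g \<in> \<Delta>. \<exists>y\<in>hyp_space. y $ None \<le> max C M \<and> (g *v y) $ None \<le> max C M}"
  proof
    fix h assume "h \<in> range Y"
    then obtain n where n: "h = Y n" by blast
    have "z n $ None \<le> max C M" "(h *v z n) $ None \<le> max C M" using zM[of n] bnd[of n] n by auto
    then show "h \<in> {g \<in> \<Delta>. \<exists>y\<in>hyp_space. y $ None \<le> max C M \<and> (g *v y) $ None \<le> max C M}" using zh[of n] YD[of n] n by blast
  qed
  then have "finite (range Y)" using proper finite_subset by blast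
  then obtain Y0 where "infinite (Y -` {Y0})" using inf_img_fin_domE[OF _ infinite_UNIV_nat] by blast
  then have inf: "infinite {n. Y n = Y0}" by (simp add: vimage_def)
  define r where "r = enumerate {n. Y n = Y0}"
  have r: "strict_mono r" "\<And>n. Y (r n) = Y0"
    unfolding r_def using strict_mono_enumerate[OF inf] enumerate_in_set[OF inf] by auto
  have "norm (z n) \<le> 2 * M" for n using causal_norm_le[OF hyp_space_causal[OF zh[of n]]] zM[of n] by linarith
  then have "bounded (range (\<lambda>n. z (r n)))" by (auto simp: bounded_iff)
  then obtain z0 r' where r': "strict_mono r'" "((\<lambda>n. z (r n)) \<circ> r') \<longlonglongrightarrow> z0" using bounded_imp_convergent_subsequence by blast
  define u where "u n = z (r (r' n))" for n
  have lu: "u \<longlonglongrightarrow> z0" using r'(2) unfolding u_def o_def .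
  have "(\<lambda>n. u n \<star> u n) \<longlonglongrightarrow> z0 \<star> z0" by (intro mink.tendsto lu)
  moreover have "u n \<star> u n = -1" for n using zh by (simp add: u_def hyp_space_def)
  ultimately have zz: "z0 \<star> z0 = -1" by (simp add: LIMSEQ_const_iff)
  have "(\<lambda>n. u n $ None) \<longlonglongrightarrow> z0 $ None" by (intro tendsto_intros lu)
  then have "z0 $ None \<ge> 1" by (rule LIMSEQ_le_const) (use hyp_time_ge_1[OF zh] in \<open>auto simp: u_def\<close>)
  then have z0h: "z0 \<in> hyp_space" using zz by (simp add: hyp_space_def)
  have rr: "strict_mono (\<lambda>n. r (r' n))" using r(1) r'(1) by (simp add: strict_mono_def)
  have "(\<lambda>n. exp (- real n)) \<longlonglongrightarrow> 0" by real_asymp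
  then have e1: "(\<lambda>n. exp (- real (r (r' n)))) \<longlonglongrightarrow> 0"
    using LIMSEQ_subseq_LIMSEQ[OF _ rr, of "\<lambda>n. exp (- real n)" 0] by (simp add: o_def)
  have Y0D: "Y0 \<in> \<Delta>" using YD[of "r 0"] r(2)[of 0] by simp
  have "(\<lambda>n. u n \<star> (Y0 *v u n)) \<longlonglongrightarrow> z0 \<star> (Y0 *v z0)" by (intro mink.tendsto tendsto_matrix_vector lu)
  moreover have "(\<lambda>n. u n \<star> (Y0 *v u n)) \<longlonglongrightarrow> -1"
  proof -
    have "(\<lambda>n. -1 + exp (- real (r (r' n))) * exp (- real (r (r' n))) * q / 4) \<longlonglongrightarrow> -1 + 0 * 0 * q / 4"
      by (intro tendsto_intros e1) simp
    moreover have "u n \<star> (Y0 *v u n) = -1 + exp (- real (r (r' n))) * exp (- real (r (r' n))) * q / 4" for n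
      using form[of "r (r' n)"] r(2)[of "r' n"] by (simp add: u_def)
    ultimately show ?thesis by simp
  qed
  ultimately have e: "z0 \<star> (Y0 *v z0) = -1" using LIMSEQ_unique by blast
  define y where "y = Y0 *v z0"
  have yh: "y \<star> y = -1" "y $ None > 0" "z0 $ None > 0" using z0h Y0D hyp_mem[OF Y0D, of z0] by (auto simp: y_def hyp_space_def)
  \<comment> \<open>Product -1 must give equality of points: the Gram identity forces the time
    coordinates to agree, and then \<open>y - z0\<close> has norm zero.\<close>
  have "(norm (y - z0))\<^sup>2 = 2 * (y $ None - z0 $ None)\<^sup>2"
    unfolding norm_sq_minkowski using e zz yh minkowski_commute[of y z0] by (simp add: mink_simps y_def)
  moreover have "(norm ((y $ None) *\<^sub>R z0 - (z0 $ None) *\<^sub>R y))\<^sup>2 = - ((y $ None - z0 $ None)\<^sup>2)"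
    unfolding minkowski_gram[of y z0] using e zz yh by (simp add: y_def power2_eq_square algebra_simps)
  then have "(y $ None - z0 $ None)\<^sup>2 \<le> 0" using zero_le_power2[of "norm ((y $ None) *\<^sub>R z0 - (z0 $ None) *\<^sub>R y)"] by linarith
  ultimately have "(norm (y - z0))\<^sup>2 \<le> 0" by simp
  then have "y = z0" by simp
  then have "Y0 = mat 1" using free[OF Y0D z0h] by (simp add: y_def)
  then have Y1: "g (r 0) ** X ** matrix_inv (g (r 0)) = mat 1" using r(2)[of 0] by (simp add: Y_def)
  have "g (r 0) ** X ** matrix_inv (g (r 0)) ** g (r 0) = g (r 0) ** X ** (matrix_inv (g (r 0)) ** g (r 0))"
    by (simp add: matrix_mul_assoc)
  then have "g (r 0) ** X = g (r 0) ** mat 1" unfolding Y1 using g(1) by simp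
  then have "X = mat 1" by (rule left_cancel[OF g(1)])
  then show False using X(2) by simp
qed

text \<open>The image of \<open>X - 1/s\<close> is orthogonal to \<open>a\<close>, so this map is
  not onto and has a kernel, an eigenvector for \<open>1/s\<close>. It is null because
  \<open>s\<close> squared is not 1, and up to sign it represents the other endpoint.\<close>

lemma hyperbolic:
  assumes X: "X \<in> \<Delta>" "X \<noteq> mat 1" and p0: "p0 \<in> Z"
  obtains a b r where "axis_of X a b r"
proof -
  obtain a s where a: "null a" "s > 0" "X *v a = s *\<^sub>R a" by (rule fixed_causal[OF X])
  have s1: "s \<noteq> 1" using no_parabolic[OF X a(1) p0] a(3) by auto
  define f where "f v = X *v v - (1/s) *\<^sub>R v" for v
  have lin: "linear f" unfolding f_def
    by (intro linear_compose_sub matrix_vector_mul_linear linear_scale_self)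
  have af: "a \<star> f v = 0" for v
  proof -
    have "s * (a \<star> (X *v v)) = a \<star> v" using iso[OF X(1), of a v] a(3) by (simp add: mink_simps)
    then have "a \<star> (X *v v) = (1/s) * (a \<star> v)" using a(2) by (simp add: field_simps)
    then show ?thesis by (simp add: f_def mink_simps)
  qed
  have "\<not> surj f"
  proof
    assume "surj f"
    then obtain v where "e0 = f v" by (meson surjD)
    then have "a \<star> e0 = 0" using af[of v] by metis
    then have "a $ None = 0" using minkowski_commute[of a e0] by simp
    then show False using a(1) by (simp add: null_def)
  qed
  then have "\<not> inj f" using linear_injective_imp_surjective[OF lin] by blast
  then obtain v where v: "v \<noteq> 0" "f v = 0" using linear_injective_0[OF lin] by blast
  then have Xv: "X *v v = (1/s) *\<^sub>R v" by (simp add: f_def)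
  have "(1/s) * ((1/s) * (v \<star> v)) = v \<star> v" using iso[OF X(1), of v v] Xv by (simp add: mink_simps)
  then have "(s * s - 1) * (v \<star> v) = 0" using a(2) by (simp add: field_simps)
  moreover have "s * s \<noteq> 1" using s1 a(2) by (simp add: power2_eq_1_iff flip: power2_eq_square)
  ultimately have vv: "v \<star> v = 0" by simp
  then have v0: "v $ None \<noteq> 0" using timelike_nonzero_time[of v] v(1) by simp
  define b where "b = (if v $ None > 0 then v else - v)"
  have "X *v (- v) = - (X *v v)" by (metis scaleR_minus1_left matrix_vector_mult_scaleR)
  then have b: "null b" "X *v b = (1/s) *\<^sub>R b"
    using vv v0 Xv by (auto simp: b_def null_def mink_simps not_less)
  show ?thesis
  proof (cases "s > 1")
    case True
    then have "axis_of X a b s" using X a b by (simp add: axis_of_def)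
    then show ?thesis by (rule that)
  next
    case False
    then have "1 / s > 1" using s1 a(2) by simp
    then have "axis_of X b a (1/s)" using X a b by (simp add: axis_of_def)
    then show ?thesis by (rule that)
  qed
qed

text \<open>If all axes ended at \<open>\<beta>\<close>, take one with ends \<open>a\<close>,
  parallel to \<open>\<beta>\<close>, and \<open>b\<close>. Conjugating it by any \<open>k\<close>
  and using discreteness shows that \<open>k\<close> fixes both ends. Then
  \<open>(h g)^-1 g h\<close> fixes \<open>a\<close> and \<open>b\<close> as vectors, hence a point
  of the axis, and is trivial by freeness.\<close>

lemma axis_avoiding:
  assumes nab: "g \<in> \<Delta>" "h \<in> \<Delta>" "g ** h \<noteq> h ** g" and p0: "p0 \<in> Z" and \<beta>: "null \<beta>"
  obtains X a b r where "axis_of X a b r" "a \<star> \<beta> \<noteq> 0" "b \<star> \<beta> \<noteq> 0"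
proof (rule ccontr)
  assume "\<not> thesis"
  then have H: "\<And>X a b r. axis_of X a b r \<Longrightarrow> a \<star> \<beta> = 0 \<or> b \<star> \<beta> = 0" using that by blast
  have "g \<noteq> mat 1" using nab(3) by auto
  then obtain X a b r where ax: "axis_of X a b r" and ab\<beta>: "a \<star> \<beta> = 0"
    using hyperbolic[OF nab(1) _ p0] H axis_inv by metis
  note A = axis_ofD[OF ax] and neg = axis_neg[OF ax]
  obtain s where s: "s > 0" "\<beta> = s *\<^sub>R a" using null_parallel[OF A(3) \<beta> ab\<beta>] by blast
  define t where "t = -2 / (a \<star> b)"
  define x where "x = (1/2) *\<^sub>R (a + t *\<^sub>R b)"
  have x: "x \<in> hyp_space"
    using fst_T1H[OF nmk_in_T1H[OF A(3,4) neg]] by (simp add: nmk_def mk_def x_def t_def)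
  have fixab: "k = mat 1" if "k \<in> \<Delta>" "k *v a = a" "k *v b = b" for k
    by (rule free[OF that(1) x]) (simp add: x_def that(2,3) matrix_vector_mult_scaleR matrix_vector_right_distrib)
  have Ha: "(k *v a) \<star> a = 0" if k: "k \<in> \<Delta>" for k
  proof (rule ccontr)
    assume n: "(k *v a) \<star> a \<noteq> 0"
    have nk: "null (k *v a)" "null (k *v b)" using A k by auto
    \<comment> \<open>The conjugate axis also ends at \<open>\<beta>\<close>; as \<open>k a\<close>
      is not parallel to \<open>a\<close>, it is \<open>k b\<close> that is. Discreteness makes
      \<open>k a\<close> parallel to \<open>b\<close>, so \<open>k\<close> exchanges the ends, its
      square is trivial, and torsion freeness gives the contradiction.\<close>
    define k' where "k' = k ** X ** matrix_inv k"
    have ax': "axis_of k' (k *v a) (k *v b) r" unfolding k'_def by (rule axis_conj[OF ax k])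
    have "(k *v b) \<star> a = 0" using H[OF ax'] s n by (simp add: mink_simps)
    then have "a \<star> (k *v b) = 0" using minkowski_commute[of a "k *v b"] by simp
    then obtain q where q: "q > 0" "k *v b = q *\<^sub>R a" using null_parallel[OF A(3) nk(2)] by blast
    have "q *\<^sub>R (k' *v a) = (1/r) *\<^sub>R (q *\<^sub>R a)" using axis_ofD(6)[OF ax'] q(2) by (simp add: matrix_vector_mult_scaleR)
    then have "(1/q) *\<^sub>R q *\<^sub>R (k' *v a) = (1/q) *\<^sub>R (1/r) *\<^sub>R (q *\<^sub>R a)" by simp
    then have k'a: "k' *v a = (1/r) *\<^sub>R a" using q(1) by simp
    have "(k' *v b) \<star> b = 0" by (rule axis_discrete[OF ax axis_ofD(1)[OF ax'] k'a])
    then have "b \<star> (k' *v b) = 0" using minkowski_commute[of b "k' *v b"] by simp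
    then obtain q' where q': "k' *v b = q' *\<^sub>R b"
      using null_parallel[OF A(4), of "k' *v b"] A(4) axis_ofD(1)[OF ax'] by (metis null_mem)
    have "b \<star> (k *v a) = 0 \<or> b \<star> (k *v b) = 0" by (rule axis_fixed[OF ax' A(4) q'])
    moreover have "b \<star> (k *v b) \<noteq> 0" using q neg minkowski_commute[of b a] by (simp add: mink_simps)
    ultimately have "b \<star> (k *v a) = 0" by simp
    then obtain u where u: "u > 0" "k *v a = u *\<^sub>R b" using null_parallel[OF A(4) nk(1)] by blast
    have "(k *v a) \<star> (k *v b) = a \<star> b" by (rule iso[OF k])
    then have "u * q * (a \<star> b) = a \<star> b"
      by (simp only: u(2) q(2) mink.scaleR_left mink.scaleR_right real_scaleR_def minkowski_commute[of b a] mult.left_commute mult.assoc)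
    then have uq: "u * q = 1" using neg mult_right_cancel[of "a \<star> b" "u * q" 1] by (metis less_irrefl mult_1)
    then have uq: "u * q = 1" "q * u = 1" by (simp_all add: mult.commute)
    have "(k ** k) *v a = a" "(k ** k) *v b = b"
      using u(2) q(2) uq by (simp_all add: matrix_vector_mult_scaleR flip: matrix_vector_mul_assoc)
    then have "k ** k = mat 1" by (rule fixab[OF mult_mem[OF k k]])
    then have "matpow k 2 = mat 1" by (simp add: numeral_2_eq_2)
    then have "k = mat 1" using tf[OF k, of 2] by simp
    then show False using n A(3) by (simp add: null_def)
  qed
  have ev: "\<exists>u v. k *v a = u *\<^sub>R a \<and> k *v b = v *\<^sub>R b" if k: "k \<in> \<Delta>" for k
  proof -
    have nk: "null (k *v a)" "null (k *v b)" using A k by auto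
    have "a \<star> (k *v a) = 0" using Ha[OF k] minkowski_commute[of a "k *v a"] by simp
    then obtain u where u: "k *v a = u *\<^sub>R a" using null_parallel[OF A(3) nk(1)] by blast
    have "b \<star> (k *v b) = 0" using axis_discrete[OF ax k u] minkowski_commute[of b "k *v b"] by simp
    then obtain v where "k *v b = v *\<^sub>R b" using null_parallel[OF A(4) nk(2)] by blast
    with u show ?thesis by blast
  qed
  obtain u v where uv: "g *v a = u *\<^sub>R a" "g *v b = v *\<^sub>R b" using ev[OF nab(1)] by blast
  obtain u' v' where uv': "h *v a = u' *\<^sub>R a" "h *v b = v' *\<^sub>R b" using ev[OF nab(2)] by blast
  have e: "(g ** h) *v a = (h ** g) *v a" "(g ** h) *v b = (h ** g) *v b"
    using uv uv' by (simp_all add: matrix_vector_mult_scaleR mult.commute flip: matrix_vector_mul_assoc)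
  have hg: "h ** g \<in> \<Delta>" "g ** h \<in> \<Delta>" using nab mult_mem by auto
  have "matrix_inv (h ** g) ** (g ** h) = mat 1"
    by (rule fixab) (use e hg in \<open>simp_all add: mult_mem inv_mem flip: matrix_vector_mul_assoc[of "matrix_inv (h ** g)"]\<close>)
  then have "(h ** g) ** (matrix_inv (h ** g) ** (g ** h)) = h ** g" by simp
  then have "g ** h = h ** g" unfolding matrix_mul_assoc[of "h ** g" "matrix_inv (h ** g)"] using hg by simp
  then show False using nab(3) by simp
qed

text \<open>The counterpart of \<open>nmk\<close>: here \<open>b\<close> is kept and
  \<open>a\<close> is rescaled, so the vector is in the unstable leaf given by \<open>nm\<close>
  equal to \<open>b\<close>.\<close>

definition into :: "'n mvec \<Rightarrow> 'n mvec \<Rightarrow> 'n uvec" where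
  "into a b = mk ((-2 / (a \<star> b)) *\<^sub>R a) b"

lemma into_scale: "r > 0 \<Longrightarrow> into (r *\<^sub>R a) b = into a b"
  by (simp add: into_def mink_simps)

text \<open>Flow \<open>p0\<close> forward and bring it back to a bounded set by \<open>f n\<close>.
  Along a subsequence the inverses of \<open>f n\<close> push every boundary point other than the
  limit \<open>\<beta>\<close> of the backward endpoints to the forward endpoint of
  \<open>p0\<close>. Applied to an axis that avoids \<open>\<beta>\<close>, this brings both ends
  there.\<close>

lemma axis_near:
  assumes nab: "g \<in> \<Delta>" "h \<in> \<Delta>" "g ** h \<noteq> h ** g" and p0: "p0 \<in> Z" and \<rho>: "\<rho> > 0"
  obtains X a b r where "axis_of X a b r" "a \<star> nm p0 < 0" "b \<star> nm p0 < 0"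
    "dist (into a (nm p0)) p0 < \<rho>" "dist (into b (nm p0)) p0 < \<rho>"
proof -
  note P = T1HD[OF Z_T1H[OF p0]]
  obtain K where K: "bounded K" "\<And>q. q \<in> Z \<Longrightarrow> \<exists>g\<in>\<Delta>. lact g q \<in> K" by (rule Z_cocompact) blast
  have "\<forall>n. \<exists>g. g \<in> \<Delta> \<and> lact g (flow (real n) p0) \<in> K" using K(2) p0 Z_flow by blast
  then obtain f where f: "\<And>n. f n \<in> \<Delta>" "\<And>n. lact (f n) (flow (real n) p0) \<in> K" by metis
  define k where "k n = lact (f n) (flow (real n) p0)" for n
  have "bounded (range k)" by (rule bounded_subset[OF K(1)]) (use f(2) in \<open>auto simp: k_def\<close>)
  then obtain kl r where r: "strict_mono r" "(k \<circ> r) \<longlonglongrightarrow> kl" using bounded_imp_convergent_subsequence by blast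
  have "(k \<circ> r) n \<in> Z" for n using f(1) p0 by (simp add: k_def)
  then have klZ: "kl \<in> Z" by (rule Z_closed_seq[OF _ r(2)])
  define \<beta> where "\<beta> = nm kl"
  have \<beta>: "null \<beta>" unfolding \<beta>_def using T1HD[OF Z_T1H[OF klZ]] by simp
  obtain X a b l where ax: "axis_of X a b l" "a \<star> \<beta> \<noteq> 0" "b \<star> \<beta> \<noteq> 0" by (rule axis_avoiding[OF nab p0 \<beta>])
  note A = axis_ofD[OF ax(1)]
  have "(\<lambda>n. exp (- real n)) \<longlonglongrightarrow> 0" by real_asymp
  then have e1: "(\<lambda>n. exp (- real (r n))) \<longlonglongrightarrow> 0"
    using LIMSEQ_subseq_LIMSEQ[OF _ r(1), of "\<lambda>n. exp (- real n)" 0] by (simp add: o_def)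
  have lk: "(\<lambda>n. np (k (r n))) \<longlonglongrightarrow> np kl" "(\<lambda>n. nm (k (r n))) \<longlonglongrightarrow> nm kl"
    using tendsto_np[OF r(2)] tendsto_nm[OF r(2)] by (simp_all add: o_def)
  have main: "\<forall>\<^sub>F n in sequentially. (matrix_inv (f (r n)) *v v) \<star> nm p0 < 0 \<and>
      dist (into (matrix_inv (f (r n)) *v v) (nm p0)) p0 < \<rho>"
    if v: "null v" "v \<star> \<beta> \<noteq> 0" for v
  proof -
    \<comment> \<open>After this rescaling the products with \<open>nm p0\<close> converge and those
      with \<open>np p0\<close> vanish, so \<open>null_pair_limit\<close> yields the direction
      \<open>np p0\<close>.\<close>
    define y where "y n = exp (- real (r n)) *\<^sub>R (matrix_inv (f (r n)) *v v)" for n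
    have c: "v \<star> \<beta> < 0" by (rule null_nonparallel_neg[OF v(1) \<beta> v(2)])
    have yb: "y n \<star> nm p0 = v \<star> nm (k (r n))" for n
      unfolding y_def k_def using inv_iso[OF f(1)[of "r n"], of v "nm p0"] by (simp add: mink_simps matrix_vector_mult_scaleR)
    have ya: "y n \<star> np p0 = exp (- real (r n)) * exp (- real (r n)) * (v \<star> np (k (r n)))" for n
      unfolding y_def k_def using inv_iso[OF f(1)[of "r n"], of v "np p0"]
      by (simp add: mink_simps matrix_vector_mult_scaleR mult.assoc exp_minus)
    have yy: "y n \<star> y n = 0" for n
      unfolding y_def using iso[OF inv_mem[OF f(1)], of "r n" v v] v(1) by (simp add: mink_simps null_def)
    have lb: "(\<lambda>n. y n \<star> nm p0) \<longlonglongrightarrow> v \<star> \<beta>" unfolding yb \<beta>_def by (intro mink.tendsto tendsto_const lk)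
    have "(\<lambda>n. exp (- real (r n)) * exp (- real (r n)) * (v \<star> np (k (r n)))) \<longlonglongrightarrow> 0 * 0 * (v \<star> np kl)"
      by (intro tendsto_mult e1 mink.tendsto tendsto_const lk)
    then have la: "(\<lambda>n. y n \<star> np p0) \<longlonglongrightarrow> 0" unfolding ya by simp
    have ly: "y \<longlonglongrightarrow> (v \<star> \<beta> / (np p0 \<star> nm p0)) *\<^sub>R np p0"
      by (rule null_pair_limit[OF P(1,2) _ la lb]) (simp_all add: P(3) yy)
    have "(\<lambda>n. mk ((-2 / (y n \<star> nm p0)) *\<^sub>R y n) (nm p0)) \<longlonglongrightarrow>
        mk ((-2 / (v \<star> \<beta>)) *\<^sub>R ((v \<star> \<beta> / (np p0 \<star> nm p0)) *\<^sub>R np p0)) (nm p0)"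
      using c by (intro tendsto_mk tendsto_scaleR tendsto_divide tendsto_const lb ly) auto
    then have "(\<lambda>n. into (y n) (nm p0)) \<longlonglongrightarrow> p0" using c P(3) by (simp add: into_def)
    then have "\<forall>\<^sub>F n in sequentially. dist (into (y n) (nm p0)) p0 < \<rho>" using \<rho> by (rule tendstoD)
    moreover have "\<forall>\<^sub>F n in sequentially. y n \<star> nm p0 < 0" by (rule order_tendstoD(2)[OF lb c])
    ultimately show ?thesis
      by eventually_elim (simp add: y_def into_scale mink_simps mult_less_0_iff)
  qed
  obtain n where n: "(matrix_inv (f (r n)) *v a) \<star> nm p0 < 0" "dist (into (matrix_inv (f (r n)) *v a) (nm p0)) p0 < \<rho>"
    "(matrix_inv (f (r n)) *v b) \<star> nm p0 < 0" "dist (into (matrix_inv (f (r n)) *v b) (nm p0)) p0 < \<rho>"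
    using eventually_conj[OF main[OF A(3) ax(2)] main[OF A(4) ax(3)]] unfolding eventually_sequentially by blast
  show ?thesis
    by (rule that[OF axis_conj[OF ax(1) inv_mem[OF f(1)[of "r n"]]]]) (use n in auto)
qed

end

section \<open>Finite index\<close>

context lifted
begin

lemma inv_mult:
  assumes "g \<in> \<Delta>" "h \<in> \<Delta>"
  shows "matrix_inv (g ** h) = matrix_inv h ** matrix_inv g"
proof (rule left_cancel[OF mult_mem[OF assms]])
  have "g ** h ** (matrix_inv h ** matrix_inv g) = g ** (h ** matrix_inv h) ** matrix_inv g" by (simp add: matrix_mul_assoc)
  then show "g ** h ** matrix_inv (g ** h) = g ** h ** (matrix_inv h ** matrix_inv g)" using assms mult_mem by simp
qed

lemma mult_inv_cancel: "g \<in> \<Delta> \<Longrightarrow> h ** g ** matrix_inv g = h"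
  by (simp flip: matrix_mul_assoc)

lemma matpow_right_inv: "X \<in> \<Delta> \<Longrightarrow> matpow X k ** matpow (matrix_inv X) k = mat 1"
proof (induction k)
  case (Suc k)
  have "matpow X (Suc k) ** matpow (matrix_inv X) (Suc k) = (matpow X k ** X) ** (matrix_inv X ** matpow (matrix_inv X) k)"
    by (simp only: matpow.simps matpow_commute)
  also have "\<dots> = matpow X k ** (X ** matrix_inv X) ** matpow (matrix_inv X) k" by (simp add: matrix_mul_assoc)
  finally show ?case using Suc by simp
qed simp

lemma matpow_inv:
  assumes "X \<in> \<Delta>"
  shows "matrix_inv (matpow X k) = matpow (matrix_inv X) k"
  by (rule left_cancel[OF matpow_mem[OF assms, of k]]) (use matpow_right_inv[OF assms] matpow_mem[OF assms] in simp)

lemma into_T1H: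
  assumes "null a" "null b" "a \<star> b < 0"
  shows "into a b \<in> T1H"
  unfolding into_def using assms by (intro mk_in_T1H null_scale) (auto simp: mink_simps divide_neg_neg)

lemma into_Z:
  assumes "inL a" "inL b" "a \<star> b < 0"
  shows "into a b \<in> Z"
proof -
  have "into a b \<in> T1H" using assms by (intro into_T1H) (auto simp: inL_def)
  moreover have "inL ((-2 / (a \<star> b)) *\<^sub>R a)" using assms by (intro inL_scale) (simp_all add: divide_neg_neg)
  ultimately show ?thesis using assms(2) by (simp add: Z_def into_def)
qed

end

context coding
begin

text \<open>The conclusion of \<open>shadow\<close> as a predicate of the radius, so that it can be
  carried as an assumption.\<close>

definition codes :: "nat \<Rightarrow> 'n uvec \<Rightarrow> real \<Rightarrow> bool" where
  "codes z p0 \<rho> \<longleftrightarrow> (\<forall>q (I :: nat set) s f K. q \<in> Z \<longrightarrow> dist q p0 < \<rho> \<longrightarrow> finite I \<longrightarrow> open K \<longrightarrow>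
      (\<forall>i\<in>I. s i \<ge> \<delta> + 2 \<and> f i \<in> \<Delta> \<and> lact (matrix_inv (f i)) (flow (s i) q) \<in> K) \<longrightarrow>
      (\<exists>\<gamma> j. (\<forall>i\<in>I. \<gamma> i \<in> \<Delta> \<and> j i \<in> alphabet F \<and> matrix_inv (f i) ** \<gamma> i \<in> near K \<and> (\<exists>n\<ge>1. \<gamma> i \<in> Bp z (j i) n)) \<and>
        (\<forall>i\<in>I. \<forall>i'\<in>I. s i + \<delta> < s i' \<longrightarrow> (\<exists>n\<ge>1. matrix_inv (\<gamma> i) ** \<gamma> i' \<in> Bp (j i) (j i') n))))"

lemma codes_exists:
  assumes "z \<in> alphabet F" "p0 \<in> Lf z" "p0 \<in> It z"
  shows "\<exists>\<rho>>0. codes z p0 \<rho>"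
proof (rule shadow[OF assms])
  fix \<rho> :: real
  assume \<rho>: "\<rho> > 0" and sh: "\<And>q (I :: nat set) s f K. q \<in> Z \<Longrightarrow> dist q p0 < \<rho> \<Longrightarrow> finite I \<Longrightarrow> open K \<Longrightarrow>
      (\<And>i. i \<in> I \<Longrightarrow> s i \<ge> \<delta> + 2 \<and> f i \<in> \<Delta> \<and> lact (matrix_inv (f i)) (flow (s i) q) \<in> K) \<Longrightarrow>
      \<exists>\<gamma> j. (\<forall>i\<in>I. \<gamma> i \<in> \<Delta> \<and> j i \<in> alphabet F \<and> matrix_inv (f i) ** \<gamma> i \<in> near K \<and> (\<exists>n\<ge>1. \<gamma> i \<in> Bp z (j i) n)) \<and>
        (\<forall>i\<in>I. \<forall>i'\<in>I. s i + \<delta> < s i' \<longrightarrow> (\<exists>n\<ge>1. matrix_inv (\<gamma> i) ** \<gamma> i' \<in> Bp (j i) (j i') n))"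
  have "codes z p0 \<rho>" unfolding codes_def by (intro allI impI, rule sh) blast+
  with \<rho> show ?thesis by blast
qed

lemma codesD:
  fixes I :: "nat set"
  assumes "codes z p0 \<rho>" "q \<in> Z" "dist q p0 < \<rho>" "finite I" "open K"
    and "\<And>i. i \<in> I \<Longrightarrow> s i \<ge> \<delta> + 2 \<and> f i \<in> \<Delta> \<and> lact (matrix_inv (f i)) (flow (s i) q) \<in> K"
  obtains \<gamma> j where "\<And>i. i \<in> I \<Longrightarrow> \<gamma> i \<in> \<Delta> \<and> j i \<in> alphabet F \<and> matrix_inv (f i) ** \<gamma> i \<in> near K \<and> (\<exists>n\<ge>1. \<gamma> i \<in> Bp z (j i) n)"
    "\<And>i i'. i \<in> I \<Longrightarrow> i' \<in> I \<Longrightarrow> s i + \<delta> < s i' \<Longrightarrow> (\<exists>n\<ge>1. matrix_inv (\<gamma> i) ** \<gamma> i' \<in> Bp (j i) (j i') n)"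
proof -
  have "\<exists>\<gamma> j. (\<forall>i\<in>I. \<gamma> i \<in> \<Delta> \<and> j i \<in> alphabet F \<and> matrix_inv (f i) ** \<gamma> i \<in> near K \<and> (\<exists>n\<ge>1. \<gamma> i \<in> Bp z (j i) n)) \<and>
        (\<forall>i\<in>I. \<forall>i'\<in>I. s i + \<delta> < s i' \<longrightarrow> (\<exists>n\<ge>1. matrix_inv (\<gamma> i) ** \<gamma> i' \<in> Bp (j i) (j i') n))"
    by (rule assms(1)[unfolded codes_def, rule_format, OF assms(2-5)]) (rule assms(6))
  then show ?thesis using that by blast
qed

text \<open>A geodesic asymptotic to the axis of \<open>X\<close> visits infinitely many \<open>X\<close>-translates of some rectangle.\<close>

lemma power_factor:
  assumes cd: "codes z p0 \<rho>" "p0 \<in> Z" and ax: "axis_of X a b r" "a \<star> nm p0 < 0" "dist (into a (nm p0)) p0 < \<rho>"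
  obtains N w g h i n where "N > 0" "w \<in> alphabet F" "g \<in> Bp z w i" "h \<in> Bp w w n" "n \<ge> 1" "i \<ge> 1"
    "matpow X N ** g = g ** h"
proof -
  note A = axis_ofD[OF ax(1)]
  note P = T1HD[OF Z_T1H[OF cd(2)]]
  define \<kappa> where "\<kappa> = -2 / (a \<star> nm p0)"
  define q where "q = into a (nm p0)"
  have qZ: "q \<in> Z" unfolding q_def by (rule into_Z) (use axis_inL[OF ax(1)] cd(2) ax(2) in \<open>auto simp: Z_def\<close>)
  have q: "np q = \<kappa> *\<^sub>R a" "nm q = nm p0" by (simp_all add: q_def into_def \<kappa>_def)
  define l where "l = ln r"
  have l: "l > 0" using A(2) by (simp add: l_def)
  have el: "exp (real k * l) = r ^ k" "exp (- (real k * l)) = (1/r) ^ k" for k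
    using A(2) by (simp_all add: l_def exp_of_nat_mult exp_minus power_one_over inverse_eq_divide)
  \<comment> \<open>The geodesic of \<open>q\<close> at multiples of the translation length
    \<open>l\<close>, seen from the powers of \<open>X\<close>. It converges because
    \<open>q\<close> is asymptotic to the axis, so all these vectors are in one ball
    \<open>K\<close>.\<close>
  define Q where "Q k = lact (matrix_inv (matpow X k)) (flow (real k * l) q)" for k
  have "Q = (\<lambda>k. mk (\<kappa> *\<^sub>R a) ((1/r) ^ k *\<^sub>R (matpow (matrix_inv X) k *v nm p0)))"
  proof
    fix k
    have inv: "matrix_inv (matpow X k) *v a = (1/r) ^ k *\<^sub>R a"
      unfolding matpow_inv[OF A(1)] by (rule matpow_eigen[OF axis_ofD(6)[OF axis_inv[OF ax(1)]]])
    have "np (Q k) = \<kappa> *\<^sub>R a"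
      using inv A(2) by (simp add: Q_def q el matrix_vector_mult_scaleR power_one_over)
    moreover have "nm (Q k) = (1/r) ^ k *\<^sub>R (matpow (matrix_inv X) k *v nm p0)"
      by (simp add: Q_def q el matrix_vector_mult_scaleR matpow_inv[OF A(1)])
    ultimately show "Q k = mk (\<kappa> *\<^sub>R a) ((1/r) ^ k *\<^sub>R (matpow (matrix_inv X) k *v nm p0))"
      by (intro uvec_eqI) simp_all
  qed
  moreover have "(\<lambda>k. mk (\<kappa> *\<^sub>R a) ((1/r) ^ k *\<^sub>R (matpow (matrix_inv X) k *v nm p0))) \<longlonglongrightarrow>
      mk (\<kappa> *\<^sub>R a) ((nm p0 \<star> a / (b \<star> a)) *\<^sub>R b)"
    by (intro tendsto_mk tendsto_const axis_limit[OF axis_inv[OF ax(1)]])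
  ultimately have "Bseq Q" by (intro convergent_imp_Bseq convergentI) simp
  then obtain C where C: "\<And>k. norm (Q k) \<le> C" by (auto simp: Bseq_def)
  define K where "K = ball (0 :: 'n uvec) (C + 1)"
  have QK: "Q k \<in> K" for k using C[of k] by (simp add: K_def)
  have fK: "finite (near K)" by (rule near_finite) (simp add: K_def)
  \<comment> \<open>Spacing of the checkpoints: consecutive ones are more than
    \<open>\<delta>\<close> apart and the first is later than \<open>\<delta> + 2\<close>, as
    \<open>codes\<close> asks.\<close>
  obtain M :: nat where M: "real M * l > \<bar>\<delta>\<bar> + 2" using reals_Archimedean3[OF l] by blast
  have M0: "M > 0" using M by (cases M) auto
  define s where "s i = real (M * Suc i) * l" for i
  define f where "f i = matpow X (M * Suc i)" for i
  \<comment> \<open>One checkpoint more than there are pairs of an element of \<open>near K\<close>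
    and a symbol. A repeated pair gives \<open>\<gamma> i' = X^N \<gamma> i\<close> with the same
    final symbol.\<close>
  define I where "I = {..card (near K \<times> alphabet F)}"
  have sM: "s i \<ge> real M * l" for i
  proof -
    have "real M \<le> real (M * Suc i)" by (simp only: of_nat_le_iff) simp
    then show ?thesis unfolding s_def using l by (intro mult_right_mono) auto
  qed
  have ss: "s i + \<delta> < s i'" if "i < i'" for i i'
  proof -
    have "M * Suc i + M \<le> M * Suc i'" using that by (metis Suc_leI add_mult_distrib2 mult_Suc_right add.commute mult_le_mono2 Suc_le_mono)
    then have "real (M * Suc i) + real M \<le> real (M * Suc i')" by (simp only: of_nat_le_iff flip: of_nat_add)
    then have "(real (M * Suc i) + real M) * l \<le> real (M * Suc i') * l" using l by (intro mult_right_mono) auto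
    then show ?thesis using M unfolding s_def distrib_right by linarith
  qed
  have fi: "s i \<ge> \<delta> + 2 \<and> f i \<in> \<Delta> \<and> lact (matrix_inv (f i)) (flow (s i) q) \<in> K" for i
    using sM[of i] M QK[of "M * Suc i"] matpow_mem[OF A(1)] by (auto simp: Q_def s_def f_def)
  have dq: "dist q p0 < \<rho>" using ax(3) by (simp add: q_def)
  obtain \<gamma> j where \<gamma>: "\<And>i. i \<in> I \<Longrightarrow> \<gamma> i \<in> \<Delta> \<and> j i \<in> alphabet F \<and> matrix_inv (f i) ** \<gamma> i \<in> near K \<and> (\<exists>n\<ge>1. \<gamma> i \<in> Bp z (j i) n)"
    "\<And>i i'. i \<in> I \<Longrightarrow> i' \<in> I \<Longrightarrow> s i + \<delta> < s i' \<Longrightarrow> (\<exists>n\<ge>1. matrix_inv (\<gamma> i) ** \<gamma> i' \<in> Bp (j i) (j i') n)"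
    by (rule codesD[OF cd(1) qZ dq, of I K s f]) (use fi in \<open>auto simp: I_def K_def\<close>)
  define G where "G i = (matrix_inv (f i) ** \<gamma> i, j i)" for i
  have "card (G ` I) \<le> card (near K \<times> alphabet F)"
    by (rule card_mono) (use \<gamma>(1) fK finite_alphabet in \<open>auto simp: G_def\<close>)
  also have "\<dots> < card I" by (simp add: I_def)
  finally have "\<not> inj_on G I" by (rule pigeonhole)
  then obtain i i' where ii: "i \<in> I" "i' \<in> I" "i < i'" "G i = G i'"
    unfolding inj_on_def by (metis linorder_neqE_nat)
  have same: "matrix_inv (f i) ** \<gamma> i = matrix_inv (f i') ** \<gamma> i'" "j i = j i'" using ii(4) by (auto simp: G_def)
  have \<gamma>f: "\<gamma> k = f k ** (matrix_inv (f k) ** \<gamma> k)" for k using fi[of k] by (simp add: matrix_mul_assoc)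
  define N where "N = M * (i' - i)"
  have N: "N > 0" using M0 ii(3) by (simp add: N_def)
  have "M * Suc i' = N + M * Suc i" using ii(3) by (simp add: N_def flip: distrib_left)
  then have "f i' = matpow X N ** f i" unfolding f_def by (simp only: matpow_add)
  then have "\<gamma> i' = matpow X N ** (f i ** (matrix_inv (f i) ** \<gamma> i))"
    using \<gamma>f[of i'] same(1) by (simp add: matrix_mul_assoc)
  then have g': "\<gamma> i' = matpow X N ** \<gamma> i" using \<gamma>f[of i] by simp
  have "\<gamma> i ** (matrix_inv (\<gamma> i) ** \<gamma> i') = \<gamma> i'" using \<gamma>(1)[OF ii(1)] by (simp add: matrix_mul_assoc)
  then have e: "matpow X N ** \<gamma> i = \<gamma> i ** (matrix_inv (\<gamma> i) ** \<gamma> i')" using g' by simp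
  obtain m where m: "m \<ge> 1" "\<gamma> i \<in> Bp z (j i) m" using \<gamma>(1)[OF ii(1)] by blast
  obtain n where n: "n \<ge> 1" "matrix_inv (\<gamma> i) ** \<gamma> i' \<in> Bp (j i) (j i) n" using \<gamma>(2)[OF ii(1,2) ss[OF ii(3)]] same(2) by auto
  show ?thesis using that[OF N _ m(2) n(2) n(1) m(1) e] \<gamma>(1)[OF ii(1)] by blast
qed

text \<open>Put \<open>h = Y^k g\<close>. For large \<open>k\<close> the geodesic from the backward
  endpoint of \<open>p0\<close> to \<open>h A0\<close> passes near \<open>p0\<close>. The comparison
  of \<open>A0\<close> with \<open>B0\<close> makes it pass the image under \<open>h\<close> of the
  base point of \<open>mk A0 B0\<close> at a distance that does not depend on \<open>g\<close>.
  Hence \<open>h f\<close> is a word for some \<open>f\<close> in a set fixed in advance.\<close>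

lemma absorb_dir:
  assumes cd: "codes z p0 \<rho>" "p0 \<in> Z" and ax: "axis_of Y a b r" "a \<star> nm p0 < 0" "dist (into a (nm p0)) p0 < \<rho>"
    and g: "g \<in> \<Delta>" and m: "mk A0 B0 \<in> Z" "(g *v A0) \<star> b \<le> (g *v B0) \<star> b"
  shows "\<exists>k. \<exists>f\<in>near (ball 0 (40 * fst (mk A0 B0) $ None + 1)). \<exists>j\<in>alphabet F. \<exists>n\<ge>1. matpow Y k ** g ** f \<in> Bp z j n"
proof -
  note A = axis_ofD[OF ax(1)] and neg = axis_neg[OF ax(1)]
  note P = T1HD[OF Z_T1H[OF cd(2)]]
  note T = T1HD[OF Z_T1H[OF m(1)], unfolded np_mk nm_mk]
  define b0 where "b0 = nm p0"
  define A1 B1 where "A1 = g *v A0" and "B1 = g *v B0"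
  have n1: "null A1" "null B1" "A1 \<star> B1 = -2" using T g iso[OF g] by (auto simp: A1_def B1_def)
  \<comment> \<open>If \<open>A1\<close> were parallel to \<open>b\<close>, the comparison would
    force the same for \<open>B1\<close>, but \<open>A1\<close> and \<open>B1\<close> are distinct
    endpoints.\<close>
  have Ab: "A1 \<star> b < 0"
  proof (rule null_nonparallel_neg[OF n1(1) A(4)], rule)
    assume 0: "A1 \<star> b = 0"
    then have "B1 \<star> b = 0" using m(2) causal_minkowski_nonpos[OF null_causal[OF n1(2)] null_causal[OF A(4)]]
      by (simp add: A1_def B1_def)
    then have "b \<star> A1 = 0" "b \<star> B1 = 0" using 0 minkowski_commute[of b A1] minkowski_commute[of b B1] by simp_all
    then obtain u v where "A1 = u *\<^sub>R b" "B1 = v *\<^sub>R b" using null_parallel[OF A(4) n1(1)] null_parallel[OF A(4) n1(2)] by metis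
    then show False using n1(3) A(4) by (simp add: mink_simps null_def)
  qed
  define y y' where "y k = (1/r) ^ k *\<^sub>R (matpow Y k *v A1)" and "y' k = (1/r) ^ k *\<^sub>R (matpow Y k *v B1)" for k
  define \<alpha> \<beta> where "\<alpha> = A1 \<star> b / (a \<star> b)" and "\<beta> = B1 \<star> b / (a \<star> b)"
  have \<alpha>: "\<alpha> > 0" using Ab neg by (simp add: \<alpha>_def divide_neg_neg)
  have \<beta>\<alpha>: "\<beta> \<le> \<alpha>" using m(2) neg by (simp add: \<alpha>_def \<beta>_def A1_def B1_def divide_right_mono_neg)
  have ly: "y \<longlonglongrightarrow> \<alpha> *\<^sub>R a" unfolding y_def \<alpha>_def by (rule axis_limit[OF ax(1)])
  have ly': "y' \<longlonglongrightarrow> \<beta> *\<^sub>R a" unfolding y'_def \<beta>_def by (rule axis_limit[OF ax(1)])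
  have ab0: "a \<star> b0 < 0" using ax(2) by (simp add: b0_def)
  have lyb: "(\<lambda>k. y k \<star> b0) \<longlonglongrightarrow> \<alpha> * (a \<star> b0)" using mink.tendsto[OF ly tendsto_const, of b0] by (simp add: mink_simps)
  have lyb': "(\<lambda>k. y' k \<star> b0) \<longlonglongrightarrow> \<beta> * (a \<star> b0)" using mink.tendsto[OF ly' tendsto_const, of b0] by (simp add: mink_simps)
  have c: "\<alpha> * (a \<star> b0) < 0" using \<alpha> ab0 by (rule mult_pos_neg)
  have e1: "\<forall>\<^sub>F k in sequentially. y k \<star> b0 < 0" by (rule order_tendstoD(2)[OF lyb c])
  have e2: "\<forall>\<^sub>F k in sequentially. dist (into (y k) b0) p0 < \<rho>"
  proof -
    have "(\<lambda>k. into (y k) b0) \<longlonglongrightarrow> mk ((-2 / (\<alpha> * (a \<star> b0))) *\<^sub>R (\<alpha> *\<^sub>R a)) b0"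
      unfolding into_def using c by (intro tendsto_mk tendsto_scaleR tendsto_divide tendsto_const lyb ly) auto
    moreover have "mk ((-2 / (\<alpha> * (a \<star> b0))) *\<^sub>R (\<alpha> *\<^sub>R a)) b0 = into a b0" using \<alpha> by (simp add: into_def)
    ultimately have "(\<lambda>k. dist (into (y k) b0) p0) \<longlonglongrightarrow> dist (into a b0) p0" by (intro tendsto_intros) simp
    then show ?thesis by (rule order_tendstoD(2)) (use ax(3) in \<open>simp add: b0_def\<close>)
  qed
  \<comment> \<open>The limit of the ratio is \<open>\<beta> / \<alpha>\<close>, which is at most 1,
    so any bound above 1 holds eventually; 3/2 leads to \<open>nm Q \<star> B0 > -3\<close>.\<close>
  have e3: "\<forall>\<^sub>F k in sequentially. (y' k \<star> b0) / (y k \<star> b0) < 3/2"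
  proof -
    have "(\<lambda>k. (y' k \<star> b0) / (y k \<star> b0)) \<longlonglongrightarrow> \<beta> * (a \<star> b0) / (\<alpha> * (a \<star> b0))"
      by (intro tendsto_divide lyb lyb' less_imp_neq c)
    moreover have "\<beta> * (a \<star> b0) / (\<alpha> * (a \<star> b0)) < 3/2" using ab0 \<alpha> \<beta>\<alpha> by (simp add: field_simps)
    ultimately show ?thesis by (rule order_tendstoD(2))
  qed
  have e4: "\<forall>\<^sub>F k in sequentially. 0 < - (y k \<star> b0) / 2 - (1/r)^k * exp (\<delta> + 2)"
  proof -
    have "(\<lambda>k. (1/r)^k) \<longlonglongrightarrow> 0" using A(2) by (intro LIMSEQ_realpow_zero) auto
    then have "(\<lambda>k. - (y k \<star> b0) / 2 - (1/r)^k * exp (\<delta> + 2)) \<longlonglongrightarrow> - (\<alpha> * (a \<star> b0)) / 2 - 0 * exp (\<delta> + 2)"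
      by (intro tendsto_diff tendsto_divide tendsto_minus tendsto_mult tendsto_const lyb) auto
    then show ?thesis by (rule order_tendstoD(1)) (use c in simp)
  qed
  obtain k where k: "y k \<star> b0 < 0" "dist (into (y k) b0) p0 < \<rho>" "(y' k \<star> b0) / (y k \<star> b0) < 3/2"
    "0 < - (y k \<star> b0) / 2 - (1/r)^k * exp (\<delta> + 2)"
    using eventually_conj[OF e1 eventually_conj[OF e2 eventually_conj[OF e3 e4]]] unfolding eventually_sequentially by blast
  define h where "h = matpow Y k ** g"
  have h: "h \<in> \<Delta>" unfolding h_def using matpow_mem[OF A(1)] g by (rule mult_mem)
  have rk: "(1/r)^k > 0" using A(2) by simp
  have hA: "y k = (1/r)^k *\<^sub>R (h *v A0)" "y' k = (1/r)^k *\<^sub>R (h *v B0)"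
    by (simp_all add: y_def y'_def h_def A1_def B1_def matrix_vector_mul_assoc)
  have hb: "(h *v A0) \<star> b0 < 0"
  proof -
    have "(1/r)^k * ((h *v A0) \<star> b0) < 0" using k(1) unfolding hA(1) by (simp only: mink.scaleR_left real_scaleR_def)
    then show ?thesis using rk by (metis mult_less_0_iff less_asym)
  qed
  have ratio: "((h *v B0) \<star> b0) / ((h *v A0) \<star> b0) < 3/2" using k(3) rk A(2) unfolding hA by (simp add: mink_simps)
  have big: "exp (\<delta> + 2) < - ((h *v A0) \<star> b0) / 2"
  proof -
    have "(1/r)^k * exp (\<delta> + 2) < (1/r)^k * (- ((h *v A0) \<star> b0) / 2)" using k(4) unfolding hA by (simp add: mink_simps)
    then show ?thesis using rk by (simp only: mult_less_cancel_left_pos)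
  qed
  define q where "q = into (h *v A0) b0"
  have qeq: "q = into (y k) b0" unfolding hA q_def using into_scale[OF rk] by simp
  have LA: "inL A0" "inL B0" using m(1) by (simp_all add: Z_def)
  have qZ: "q \<in> Z" unfolding q_def by (rule into_Z) (use LA h cd(2) hb in \<open>auto simp: Z_def b0_def\<close>)
  \<comment> \<open>The time at which the geodesic of \<open>q\<close>, moved back by
    \<open>h\<close>, has \<open>np\<close> equal to \<open>A0\<close>.\<close>
  define s where "s = ln (- ((h *v A0) \<star> b0) / 2)"
  have es: "exp s = - ((h *v A0) \<star> b0) / 2" unfolding s_def using hb by simp
  have es': "exp (- s) = -2 / ((h *v A0) \<star> b0)" using es hb by (simp add: exp_minus inverse_eq_divide)
  have s2: "s \<ge> \<delta> + 2" using big unfolding es[symmetric] by simp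
  define Q where "Q = lact (matrix_inv h) (flow s q)"
  have QT: "Q \<in> T1H" unfolding Q_def using inv_mem[OF h] Z_T1H[OF qZ] by simp
  have npQ: "np Q = A0" unfolding Q_def q_def into_def using h hb by (simp add: es matrix_vector_mult_scaleR)
  have nmQ: "nm Q = (-2 / ((h *v A0) \<star> b0)) *\<^sub>R (matrix_inv h *v b0)"
    unfolding Q_def q_def into_def by (simp only: lact_nm flow_nm nm_mk es' matrix_vector_mult_scaleR)
  have "nm Q \<star> B0 = (-2 / ((h *v A0) \<star> b0)) * (b0 \<star> (h *v B0))" unfolding nmQ by (simp add: mink_simps inv_iso[OF h])
  then have "nm Q \<star> B0 = -2 * (((h *v B0) \<star> b0) / ((h *v A0) \<star> b0))" using minkowski_commute[of b0 "h *v B0"] by simp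
  then have nQ: "nm Q \<star> B0 > -3" using ratio by linarith
  define x where "x = fst (mk A0 B0)"
  have xh: "x \<in> hyp_space" unfolding x_def by (rule fst_T1H[OF Z_T1H[OF m(1)]])
  have aQ: "A0 \<star> nm Q = -2" using T1HD(3)[OF QT] npQ by simp
  have "x \<star> fst Q = 1/4 * (A0 \<star> A0 + A0 \<star> nm Q + B0 \<star> A0 + B0 \<star> nm Q)"
    unfolding x_def fst_np_nm np_mk nm_mk npQ by (simp add: mink_simps algebra_simps)
  then have "- (x \<star> fst Q) \<le> 2"
    using nQ aQ T minkowski_commute[of B0 A0] minkowski_commute[of B0 "nm Q"] by (simp add: null_def)
  then have "2 * x $ None * - (x \<star> fst Q) \<le> 2 * x $ None * 2" using xh by (intro mult_left_mono) (auto simp: hyp_space_def)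
  then have "fst Q $ None \<le> 4 * x $ None" using hyp_time_bound[OF xh fst_T1H[OF QT]] by linarith
  \<comment> \<open>The factor 4 of the time bound and the factor 10 of \<open>T1H_norm_le\<close>
    make up the radius in the statement.\<close>
  then have "norm Q \<le> 40 * x $ None" using T1H_norm_le[OF QT] by linarith
  then have QK: "Q \<in> ball 0 (40 * x $ None + 1)" by simp
  obtain \<gamma> j where \<gamma>: "\<And>i. i \<in> {0::nat} \<Longrightarrow> \<gamma> i \<in> \<Delta> \<and> j i \<in> alphabet F \<and>
      matrix_inv h ** \<gamma> i \<in> near (ball 0 (40 * x $ None + 1)) \<and> (\<exists>n\<ge>1. \<gamma> i \<in> Bp z (j i) n)"
    by (rule codesD[OF cd(1) qZ, of "{0}" "ball 0 (40 * x $ None + 1)" "\<lambda>_. s" "\<lambda>_. h"])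
      (use k(2) qeq s2 h QK in \<open>auto simp: Q_def\<close>)
  have "h ** (matrix_inv h ** \<gamma> 0) = \<gamma> 0" using h by (simp add: matrix_mul_assoc)
  then show ?thesis using \<gamma>[of 0] unfolding x_def h_def by (metis singletonI)
qed

text \<open>After swapping the endpoints of \<open>p0\<close> if necessary, the comparison in
  \<open>absorb_dir\<close> holds. Both orders have the same base point, hence the same ball and one
  finite set for all \<open>g\<close>.\<close>

lemma absorb:
  assumes cd: "codes z p0 \<rho>" "p0 \<in> Z" and ax: "axis_of Y a b r" "a \<star> nm p0 < 0" "dist (into a (nm p0)) p0 < \<rho>"
  obtains F0 where "finite F0" "F0 \<subseteq> \<Delta>"
    "\<And>g. g \<in> \<Delta> \<Longrightarrow> \<exists>k. \<exists>f\<in>F0. \<exists>j\<in>alphabet F. \<exists>n\<ge>1. matpow Y k ** g ** f \<in> Bp z j n"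
proof
  let ?F = "near (ball 0 (40 * fst p0 $ None + 1))"
  show "finite ?F" by (rule near_finite) simp
  show "?F \<subseteq> \<Delta>" by (auto simp: near_def)
  fix g assume g: "g \<in> \<Delta>"
  define q where "q = mk (nm p0) (np p0)"
  have q: "q \<in> Z" "fst q = fst p0"
  proof -
    note P = T1HD[OF Z_T1H[OF cd(2)]]
    have "q \<in> T1H" unfolding q_def by (rule mk_in_T1H) (use P minkowski_commute[of "nm p0" "np p0"] in auto)
    then show "q \<in> Z" using cd(2) by (simp add: Z_def q_def)
    show "fst q = fst p0" unfolding fst_np_nm q_def by (simp add: add.commute)
  qed
  show "\<exists>k. \<exists>f\<in>?F. \<exists>j\<in>alphabet F. \<exists>n\<ge>1. matpow Y k ** g ** f \<in> Bp z j n"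
  proof (cases "(g *v np p0) \<star> b \<le> (g *v nm p0) \<star> b")
    case True
    then show ?thesis using absorb_dir[OF cd ax g, of "np p0" "nm p0"] cd(2) by simp
  next
    case False
    then show ?thesis using absorb_dir[OF cd ax g, of "nm p0" "np p0"] q unfolding q_def by simp
  qed
qed

text \<open>\<open>H\<close> enters through its closure properties and the products of equal length
  that it contains, so that the argument can run in \<open>\<Delta>\<close> for the image of a
  subgroup defined in \<open>\<Gamma>\<close>.\<close>

theorem finite_index:
  assumes yz: "y \<in> alphabet F" "z \<in> alphabet F" and nab: "g0 \<in> \<Delta>" "h0 \<in> \<Delta>" "g0 ** h0 \<noteq> h0 ** g0"
    and Hm: "\<And>a b. a \<in> H \<Longrightarrow> b \<in> H \<Longrightarrow> a ** b \<in> H" and Hi: "\<And>a. a \<in> H \<Longrightarrow> matrix_inv a \<in> H"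
    and gen: "\<And>n u u'. n \<ge> 2 \<Longrightarrow> u \<in> Bp y z n \<Longrightarrow> u' \<in> Bp y z n \<Longrightarrow> u ** matrix_inv u' \<in> H"
  shows "\<exists>W. finite W \<and> W \<subseteq> \<Delta> \<and> (\<forall>x\<in>\<Delta>. \<exists>w\<in>W. x ** matrix_inv w \<in> H)"
proof -
  obtain p0 where p0: "p0 \<in> Lf z" "p0 \<in> It z" by (rule It_nonempty[OF yz(2)])
  have p0Z: "p0 \<in> Z" using p0(1) Lf_Rt[OF yz(2)] Rt_Z[OF yz(2)] by blast
  obtain \<rho> where \<rho>: "\<rho> > 0" "codes z p0 \<rho>" using codes_exists[OF yz(2) p0] by blast
  obtain X a b r where ax: "axis_of X a b r" "a \<star> nm p0 < 0" "b \<star> nm p0 < 0"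
    "dist (into a (nm p0)) p0 < \<rho>" "dist (into b (nm p0)) p0 < \<rho>"
    by (rule axis_near[OF nab p0Z \<rho>(1)])
  have ax': "axis_of (matrix_inv X) b a r" by (rule axis_inv[OF ax(1)])
  have XD: "X \<in> \<Delta>" "matrix_inv X \<in> \<Delta>" using axis_ofD(1)[OF ax(1)] inv_mem by auto
  obtain q0 where q0': "\<And>n j k. n \<ge> q0 \<Longrightarrow> j \<in> alphabet F \<Longrightarrow> k \<in> alphabet F \<Longrightarrow> Bp j k n \<noteq> {}" by (rule Bp_nonempty) blast
  define Q where "Q = q0 + 2"
  have ne: "\<exists>u. u \<in> Bp j k n" if "n \<ge> Q" "j \<in> alphabet F" "k \<in> alphabet F" for n j k using q0'[of n j k] that by (auto simp: Q_def)
  \<comment> \<open>Lying in the same right coset of \<open>H\<close>; the relation is preserved by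
    multiplication on the right.\<close>
  define R where "R u v \<longleftrightarrow> u \<in> \<Delta> \<and> v \<in> \<Delta> \<and> u ** matrix_inv v \<in> H" for u v
  have Rtrans: "R u w" if "R u v" "R v w" for u v w
  proof -
    have "u ** matrix_inv v ** (v ** matrix_inv w) = u ** (matrix_inv v ** v) ** matrix_inv w" by (simp add: matrix_mul_assoc)
    then show ?thesis using Hm[of "u ** matrix_inv v" "v ** matrix_inv w"] that by (simp add: R_def)
  qed
  have inv2: "matrix_inv (matrix_inv u) = u" if "u \<in> \<Delta>" for u
    by (rule left_cancel[OF inv_mem[OF that]]) (use that inv_mem in simp)
  have Rsym: "R v u" if "R u v" for u v
    using Hi[of "u ** matrix_inv v"] that by (simp add: R_def inv_mult inv_mem inv2)
  have Rmul: "R (u ** k) (v ** k)" if "R u v" "k \<in> \<Delta>" for u v k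
  proof -
    have "u ** k ** (matrix_inv k ** matrix_inv v) = u ** (k ** matrix_inv k) ** matrix_inv v" by (simp add: matrix_mul_assoc)
    then show ?thesis using that by (simp add: R_def inv_mult mult_mem)
  qed
  have R1: "R u u'" if "u \<in> Bp y z n" "u' \<in> Bp y z n" "n \<ge> 2" for u u' n
    using gen[OF that(3,1,2)] Bp_mem that(1,2) by (auto simp: R_def)
  have shift: "\<exists>N n. N > 0 \<and> n \<ge> 1 \<and> (\<forall>m u u'. u \<in> Bp y z m \<longrightarrow> u' \<in> Bp y z (m + n) \<longrightarrow> R (u ** matpow X N) u')"
    if ax: "axis_of X a b r" "a \<star> nm p0 < 0" "dist (into a (nm p0)) p0 < \<rho>" for X a b
  proof -
    obtain N w g h i n where N: "N > 0" "w \<in> alphabet F" "g \<in> Bp z w i" "h \<in> Bp w w n" "n \<ge> 1" "i \<ge> 1"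
      "matpow X N ** g = g ** h" by (rule power_factor[OF \<rho>(2) p0Z ax])
    obtain v where v: "v \<in> Bp w z Q" using ne[of Q w z] N(2) yz by blast
    have "R (u ** matpow X N) u'" if u: "u \<in> Bp y z m" "u' \<in> Bp y z (m + n)" for m u u'
    proof -
      \<comment> \<open>The two words have the same length: since \<open>X^N g = g h\<close>, the
        factor \<open>X^N\<close> is traded for the word \<open>h\<close> of length
        \<open>n\<close>, and \<open>v\<close> closes both words up at \<open>z\<close>.\<close>
      have 1: "u ** g ** h ** v \<in> Bp y z (m + i + n + Q)" by (intro Bp_append[OF _ v] Bp_append[OF _ N(4)] Bp_append[OF u(1) N(3)])
      have 2: "u' ** g ** v \<in> Bp y z (m + n + i + Q)" by (intro Bp_append[OF _ v] Bp_append[OF u(2) N(3)])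
      have "m + n + i + Q = m + i + n + Q" by simp
      from 2[unfolded this] have "R (u ** g ** h ** v) (u' ** g ** v)" by (rule R1[OF 1]) (simp add: Q_def)
      moreover have "u ** g ** h = u ** matpow X N ** g" using N(7) by (simp flip: matrix_mul_assoc)
      ultimately have "R (u ** matpow X N ** (g ** v)) (u' ** (g ** v))" by (simp add: matrix_mul_assoc)
      moreover have gv: "g ** v \<in> \<Delta>" using Bp_mem N(3) v mult_mem by blast
      ultimately have "R (u ** matpow X N ** (g ** v) ** matrix_inv (g ** v)) (u' ** (g ** v) ** matrix_inv (g ** v))"
        using Rmul inv_mem by blast
      then show ?thesis unfolding mult_inv_cancel[OF gv] .
    qed
    then show ?thesis using N(1,5) by blast
  qed
  have iter: "R (u ** matpow T k) u'"
    if T: "T \<in> \<Delta>" and st: "\<And>m u u'. u \<in> Bp y z m \<Longrightarrow> u' \<in> Bp y z (m + n) \<Longrightarrow> m \<ge> Q \<Longrightarrow> R (u ** T) u'"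
      and u: "u \<in> Bp y z m" "u' \<in> Bp y z (m + n * k)" "m \<ge> Q" for T n m u u' k
    using u(2)
  proof (induction k arbitrary: u')
    case 0
    then show ?case using R1[OF u(1), of u'] u(3) by (simp add: Q_def)
  next
    case (Suc k)
    obtain v where v: "v \<in> Bp y z (m + n * k)" using ne[of "m + n * k" y z] u(3) yz by auto
    have "u' \<in> Bp y z (m + n * k + n)" using Suc.prems by (simp add: add_ac)
    then have "R (v ** T) u'" using st[OF v] u(3) by simp
    moreover have "R (u ** matpow T k ** T) (v ** T)" by (rule Rmul[OF Suc.IH[OF v] T])
    ultimately have "R (u ** matpow T k ** T) u'" using Rtrans by blast
    then show ?case by (simp add: matpow_commute[symmetric] flip: matrix_mul_assoc)
  qed
  obtain N n where N: "N > 0" "n \<ge> 1" "\<And>m u u'. u \<in> Bp y z m \<Longrightarrow> u' \<in> Bp y z (m + n) \<Longrightarrow> R (u ** matpow X N) u'"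
    using shift[OF ax(1,2,4)] by blast
  obtain N' n' where N': "N' > 0" "n' \<ge> 1" "\<And>m u u'. u \<in> Bp y z m \<Longrightarrow> u' \<in> Bp y z (m + n') \<Longrightarrow> R (u ** matpow (matrix_inv X) N') u'"
    using shift[OF ax' ax(3,5)] by blast
  have XN: "matpow X N \<in> \<Delta>" "matpow (matrix_inv X) N' \<in> \<Delta>" using matpow_mem XD by auto
  \<comment> \<open>The power \<open>N N'\<close> of \<open>X\<close> adds \<open>n N'\<close> to
    the length and its inverse adds \<open>n' N\<close>. Applied in turn they cancel, so adding
    \<open>L\<close> to the length keeps the coset.\<close>
  define L where "L = n * N' + n' * N"
  have "n * N' > 0" using N(2) N'(1) by simp
  then have L: "L \<ge> 1" unfolding L_def by linarith
  have period1: "R u u'" if u: "u \<in> Bp y z m" "u' \<in> Bp y z (m + L)" "m \<ge> Q" for m u u'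
  proof -
    obtain v where v: "v \<in> Bp y z (m + n * N')" using ne[of "m + n * N'" y z] u(3) yz by auto
    have "R (u ** matpow (matpow X N) N') v" by (rule iter[OF XN(1) N(3) u(1) v u(3)])
    then have 1: "R (u ** matpow X (N * N')) v" by (simp add: matpow_mult)
    have "R (v ** matpow (matpow (matrix_inv X) N') N) u'"
      by (rule iter[OF XN(2) N'(3) v]) (use u in \<open>simp_all add: L_def add.assoc\<close>)
    then have 2: "R (v ** matpow (matrix_inv X) (N * N')) u'" by (simp add: matpow_mult[symmetric] mult.commute)
    have "R (u ** matpow X (N * N') ** matpow (matrix_inv X) (N * N')) (v ** matpow (matrix_inv X) (N * N'))"
      by (rule Rmul[OF 1 matpow_mem[OF XD(2)]])
    then have "R u (v ** matpow (matrix_inv X) (N * N'))" using matpow_right_inv[OF XD(1)] by (simp flip: matrix_mul_assoc)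
    then show ?thesis using 2 Rtrans by blast
  qed
  have period: "R u u'" if u: "u \<in> Bp y z m" "u' \<in> Bp y z (m + L * k)" "m \<ge> Q" for m u u' k
  proof -
    \<comment> \<open>\<open>iter\<close> with the identity as group element, since a shift by
      \<open>L\<close> already keeps the coset.\<close>
    have "R (u ** matpow (mat 1) k) u'" by (rule iter[OF one_mem _ u]) (use period1 in simp)
    moreover have "matpow (mat 1) k = (mat 1 :: 'n lorentz)" by (induction k) simp_all
    ultimately show ?thesis by simp
  qed
  \<comment> \<open>This power of \<open>X\<close> adds \<open>n L\<close> to the length, a multiple
    of the period, so it fixes the coset of \<open>u0\<close>.\<close>
  define Y where "Y = matpow X (N * L)"
  have NL: "N * L > 0" using N L by simp
  have axY: "axis_of Y a b (r ^ (N * L))" unfolding Y_def by (rule axis_pow[OF ax(1) NL])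
  have YD: "Y \<in> \<Delta>" using axis_ofD(1)[OF axY] .
  obtain u0 where u0: "u0 \<in> Bp y z Q" using ne[of Q y z] yz by blast
  have u0D: "u0 \<in> \<Delta>" using Bp_mem u0 by blast
  have RY: "R (u0 ** Y) u0"
  proof -
    obtain u' where u': "u' \<in> Bp y z (Q + n * L)" using ne[of "Q + n * L" y z] yz by auto
    have "R (u0 ** matpow (matpow X N) L) u'" by (rule iter[OF XN(1) N(3) u0 u' order_refl])
    then have "R (u0 ** Y) u'" by (simp add: Y_def matpow_mult)
    moreover have "R u0 u'" by (rule period[of _ Q _ n]) (use u0 u' in \<open>simp_all add: mult.commute\<close>)
    ultimately show ?thesis using Rtrans Rsym by blast
  qed
  have RYk: "R (u0 ** matpow Y k) u0" for k
  proof (induction k)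
    case 0
    then show ?case using R1[OF u0 u0] by (simp add: Q_def)
  next
    case (Suc k)
    have "R (u0 ** Y ** matpow Y k) (u0 ** matpow Y k)" by (rule Rmul[OF RY matpow_mem[OF YD]])
    from Rtrans[OF this Suc] show ?case by (simp add: matrix_mul_assoc)
  qed
  obtain F0 where F0: "finite F0" "F0 \<subseteq> \<Delta>"
    "\<And>g. g \<in> \<Delta> \<Longrightarrow> \<exists>k. \<exists>f\<in>F0. \<exists>j\<in>alphabet F. \<exists>n\<ge>1. matpow Y k ** g ** f \<in> Bp z j n"
    by (rule absorb[OF \<rho>(2) p0Z axY ax(2,4)]) blast
  \<comment> \<open>Representatives: \<open>w m\<close> of each length from \<open>y\<close> to
    \<open>z\<close>, and words \<open>v j\<close> that lead from any final symbol \<open>j\<close>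
    back to \<open>z\<close>.\<close>
  define w where "w m = (SOME u. u \<in> Bp y z m)" for m
  have w: "w m \<in> Bp y z m" if "m \<ge> Q" for m unfolding w_def by (rule someI_ex) (use ne that yz in blast)
  define v where "v j = (SOME u. u \<in> Bp j z Q)" for j
  have v: "v j \<in> Bp j z Q" if "j \<in> alphabet F" for j unfolding v_def by (rule someI_ex) (use ne that yz in blast)
  define W where "W = (\<lambda>(m, f, j). w m ** matrix_inv (f ** v j)) ` ({Q..<Q + L} \<times> F0 \<times> alphabet F)"
  have "finite W" unfolding W_def using F0(1) finite_alphabet by (intro finite_imageI finite_cartesian_product) auto
  moreover have "W \<subseteq> \<Delta>"
  proof
    fix x assume "x \<in> W"
    then obtain m f j where x: "x = w m ** matrix_inv (f ** v j)" "m \<ge> Q" "f \<in> F0" "j \<in> alphabet F" unfolding W_def by auto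
    then show "x \<in> \<Delta>" using Bp_mem[OF w] Bp_mem[OF v] F0(2) by (auto intro!: mult_mem inv_mem)
  qed
  moreover have "\<exists>t\<in>W. x ** matrix_inv t \<in> H" if x: "x \<in> \<Delta>" for x
  proof -
    \<comment> \<open>\<open>absorb\<close> is applied to \<open>u0^-1 x\<close>. The product
      \<open>u0 Y^k (u0^-1 x) f\<close>, completed by \<open>v j\<close>, is a word from
      \<open>y\<close> to \<open>z\<close>, and dropping \<open>Y^k\<close> leaves
      \<open>x f v j\<close> in the same coset.\<close>
    have gD: "matrix_inv u0 ** x \<in> \<Delta>" using u0D x by (intro mult_mem inv_mem)
    obtain k f j n where k: "f \<in> F0" "j \<in> alphabet F" "n \<ge> 1" "matpow Y k ** (matrix_inv u0 ** x) ** f \<in> Bp z j n"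
      using F0(3)[OF gD] by blast
    have fD: "f \<in> \<Delta>" using k(1) F0(2) by blast
    define c where "c = f ** v j"
    have cD: "c \<in> \<Delta>" unfolding c_def using fD Bp_mem[OF v[OF k(2)]] by (rule mult_mem)
    define u where "u = u0 ** (matpow Y k ** (matrix_inv u0 ** x) ** f) ** v j"
    have u: "u \<in> Bp y z (Q + n + Q)" unfolding u_def by (intro Bp_append[OF _ v[OF k(2)]] Bp_append[OF u0 k(4)])
    have "R (u0 ** matpow Y k ** (matrix_inv u0 ** x ** c)) (u0 ** (matrix_inv u0 ** x ** c))"
      by (rule Rmul[OF RYk mult_mem[OF gD cD]])
    moreover have "u0 ** matpow Y k ** (matrix_inv u0 ** x ** c) = u" by (simp add: u_def c_def matrix_mul_assoc)
    moreover have "u0 ** (matrix_inv u0 ** x ** c) = x ** c" using u0D by (simp add: matrix_mul_assoc)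
    ultimately have 1: "R (x ** c) u" using Rsym by simp
    \<comment> \<open>The length \<open>Q + n + Q\<close> is reduced modulo the period to the finite
      range over which \<open>W\<close> is built.\<close>
    define m where "m = Q + (n + Q) mod L"
    have m: "m \<ge> Q" "m < Q + L" "m + L * ((n + Q) div L) = Q + n + Q" using L by (simp_all add: m_def)
    have "R (w m) u" by (rule period[OF w[OF m(1)] _ m(1), of _ "(n + Q) div L"]) (use u m(3) in simp)
    then have "R (x ** c) (w m)" using 1 Rtrans Rsym by blast
    then have "R (x ** c ** matrix_inv c) (w m ** matrix_inv c)" by (rule Rmul[OF _ inv_mem[OF cD]])
    then have "R x (w m ** matrix_inv c)" using cD by (simp flip: matrix_mul_assoc)
    moreover have "w m ** matrix_inv c \<in> W"
      unfolding W_def c_def using m k(1,2) by (intro image_eqI[of _ _ "(m, f, j)"]) auto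
    ultimately show ?thesis by (auto simp: R_def)
  qed
  ultimately show ?thesis by blast
qed

end

section \<open>Matrix groups\<close>

lemma GL_simps [simp]: "carrier GL = {g. invertible g}" "x \<otimes>\<^bsub>GL\<^esub> y = x ** y" "\<one>\<^bsub>GL\<^esub> = mat 1"
  by (simp_all add: GL_def)

lemma group_GL: "group (GL :: ('a::field ^ 'm::finite ^ 'm) monoid)"
proof (rule groupI)
  fix x :: "'a ^ 'm ^ 'm" assume "x \<in> carrier GL"
  then have x: "invertible x" by simp
  then have "matrix_inv x \<in> carrier GL" "matrix_inv x \<otimes>\<^bsub>GL\<^esub> x = \<one>\<^bsub>GL\<^esub>"
    using matrix_inv_inverse[OF x] by (auto simp: invertible_def)
  then show "\<exists>y\<in>carrier GL. y \<otimes>\<^bsub>GL\<^esub> x = \<one>\<^bsub>GL\<^esub>" by blast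
next
  show "\<one>\<^bsub>GL\<^esub> \<in> carrier (GL :: ('a ^ 'm ^ 'm) monoid)" by (auto simp: invertible_def intro!: exI[of _ "mat 1"])
qed (auto simp: invertible_mult matrix_mul_assoc)

lemma inv_GL: "invertible x \<Longrightarrow> inv\<^bsub>GL\<^esub> x = matrix_inv x"
  by (rule group.inv_equality[OF group_GL]) (use matrix_inv_inverse[of x] in \<open>auto simp: invertible_def\<close>)

lemma linear_regfun:
  fixes a :: "'m::finite \<times> 'm \<Rightarrow> complex"
  obtains f :: "('m, complex) regfun" where "\<And>g. regfun_eval id f g = (\<Sum>(i, j)\<in>UNIV. a (i, j) * g $ i $ j)"
proof -
  define s :: "'m \<times> 'm \<Rightarrow> ('m \<times> 'm) option \<Rightarrow>\<^sub>0 nat" where "s v = Poly_Mapping.single (Some v) 1" for v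
  have s: "s v = s w \<longleftrightarrow> v = w" for v w
  proof
    assume "s v = s w"
    then have "Poly_Mapping.keys (s v) = Poly_Mapping.keys (s w)" by simp
    then show "v = w" by (simp add: s_def)
  qed simp
  define f where "f = (\<Sum>v\<in>UNIV. Poly_Mapping.single (s v) (a v))"
  have lf: "Poly_Mapping.lookup f m = (\<Sum>v\<in>UNIV. if s v = m then a v else 0)" for m
    by (simp add: f_def lookup_sum lookup_single when_def)
  have lfs: "Poly_Mapping.lookup f (s v) = a v" for v by (simp add: lf s)
  have kf: "Poly_Mapping.keys f \<subseteq> s ` UNIV"
  proof
    fix m assume "m \<in> Poly_Mapping.keys f"
    then have n: "(\<Sum>v\<in>UNIV. if s v = m then a v else 0) \<noteq> 0" by (simp add: lf in_keys_iff)
    show "m \<in> s ` UNIV"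
    proof (rule ccontr)
      assume "m \<notin> s ` UNIV"
      then have "s v \<noteq> m" for v by blast
      then show False using n by simp
    qed
  qed
  have "regfun_eval id f g = (\<Sum>(i, j)\<in>UNIV. a (i, j) * g $ i $ j)" for g
  proof -
    define t where "t m = id (Poly_Mapping.lookup f m) * (\<Prod>v\<in>Poly_Mapping.keys m. coordinate g v ^ Poly_Mapping.lookup m v)" for m
    have "regfun_eval id f g = sum t (Poly_Mapping.keys f)" by (simp add: regfun_eval_def t_def)
    also have "\<dots> = sum t (s ` UNIV)"
      by (rule sum.mono_neutral_left[OF _ kf]) (auto simp: t_def in_keys_iff)
    also have "\<dots> = sum (t \<circ> s) UNIV" by (rule sum.reindex) (simp add: inj_on_def s)
    also have "\<dots> = (\<Sum>(i, j)\<in>UNIV. a (i, j) * g $ i $ j)"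
    proof (rule sum.cong)
      fix v :: "'m \<times> 'm"
      have "Poly_Mapping.keys (s v) = {Some v}" "Poly_Mapping.lookup (s v) (Some v) = 1" by (simp_all add: s_def)
      then show "(t \<circ> s) v = (case v of (i, j) \<Rightarrow> a (i, j) * g $ i $ j)" by (cases v) (simp add: t_def lfs)
    qed simp
    finally show ?thesis .
  qed
  then show ?thesis by (rule that)
qed

lemma det_complex_matrix: "det (complex_matrix g) = complex_of_real (det g)"
  by (simp add: det_def complex_matrix_def)

lemma complex_matrix_mult: "complex_matrix (g ** h) = complex_matrix g ** complex_matrix h"
  by (simp add: complex_matrix_def matrix_matrix_mult_def vec_eq_iff)

lemma complex_matrix_inj: "complex_matrix g = complex_matrix h \<longleftrightarrow> g = h"
  by (auto simp: complex_matrix_def vec_eq_iff)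

lemma real_points_complex:
  assumes "g \<in> real_points P"
  shows "complex_matrix g \<in> complex_points P"
proof -
  have c: "coordinate (complex_matrix g) v = complex_of_real (coordinate g v)" for v
  proof (cases v)
    case None
    then show ?thesis by (simp add: det_complex_matrix)
  next
    case (Some w)
    then show ?thesis by (cases w) (simp add: complex_matrix_def)
  qed
  have "regfun_eval complex_of_real p (complex_matrix g) = complex_of_real (regfun_eval id p g)" for p
    by (simp add: regfun_eval_def c)
  moreover have "invertible (complex_matrix g)"
    using assms by (simp add: points_def invertible_det_nz det_complex_matrix)
  ultimately show ?thesis using assms by (simp add: points_def)
qed

text \<open>For fixed \<open>h\<close> the condition \<open>g h = h g\<close> is linear in the entries of \<open>g\<close>.\<close>

lemma zariski_commute:
  assumes Z: "zariski_dense P \<Gamma>" and c: "\<And>g. g \<in> \<Gamma> \<Longrightarrow> g ** h = h ** g" and g: "g \<in> real_points P"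
  shows "g ** h = h ** g"
proof -
  let ?h = "complex_matrix h"
  have "(complex_matrix g ** ?h) $ i $ j = (?h ** complex_matrix g) $ i $ j" for i j
  proof -
    \<comment> \<open>The coefficients of the \<open>(i, j)\<close> entry of
      \<open>g h - h g\<close> as a linear function of the entries of \<open>g\<close>.\<close>
    define a where "a = (\<lambda>(k, l). (if k = i then ?h $ l $ j else 0) - (if l = j then ?h $ i $ k else 0))"
    obtain f where f: "\<And>g. regfun_eval id f g = (\<Sum>(k, l)\<in>UNIV. a (k, l) * g $ k $ l)" by (rule linear_regfun[of a]) blast
    have ev: "regfun_eval id f g = (g ** ?h) $ i $ j - (?h ** g) $ i $ j" for g
    proof -
      have "regfun_eval id f g = (\<Sum>k\<in>UNIV. \<Sum>l\<in>UNIV. a (k, l) * g $ k $ l)"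
        unfolding f by (simp add: sum.cartesian_product)
      also have "\<dots> = (\<Sum>k\<in>UNIV. \<Sum>l\<in>UNIV. (if k = i then ?h $ l $ j * g $ k $ l else 0) - (if l = j then ?h $ i $ k * g $ k $ l else 0))"
        by (intro sum.cong) (auto simp: a_def algebra_simps)
      also have "\<dots> = (\<Sum>k\<in>UNIV. (if k = i then (\<Sum>l\<in>UNIV. ?h $ l $ j * g $ k $ l) else 0)) - (\<Sum>k\<in>UNIV. ?h $ i $ k * g $ k $ j)"
      proof -
        have "(\<Sum>l\<in>UNIV. (if k = i then ?h $ l $ j * g $ k $ l else 0) - (if l = j then ?h $ i $ k * g $ k $ l else 0)) =
            (if k = i then (\<Sum>l\<in>UNIV. ?h $ l $ j * g $ k $ l) else 0) - ?h $ i $ k * g $ k $ j" for k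
          by (cases "k = i") (simp_all add: sum_subtractf sum_negf)
        then show ?thesis by (simp only: sum_subtractf)
      qed
      also have "\<dots> = (g ** ?h) $ i $ j - (?h ** g) $ i $ j"
        by (simp add: matrix_matrix_mult_def mult.commute)
      finally show ?thesis .
    qed
    have "regfun_eval id f (complex_matrix g) = 0" if "g \<in> \<Gamma>" for g
      unfolding ev using c[OF that] by (simp flip: complex_matrix_mult)
    then have "regfun_eval id f (complex_matrix g) = 0"
      using Z real_points_complex[OF g] unfolding zariski_dense_def by blast
    then show ?thesis by (simp add: ev)
  qed
  then have "complex_matrix g ** ?h = ?h ** complex_matrix g" by (simp add: vec_eq_iff)
  then show ?thesis by (simp add: complex_matrix_inj flip: complex_matrix_mult)
qed

definition signed_perm :: "('n::finite option \<Rightarrow> 'n option) \<Rightarrow> ('n option \<Rightarrow> real) \<Rightarrow> 'n lorentz" where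
  "signed_perm p d = (\<chi> x. (\<chi> x y. if x = y then d x else 0) $ p x)"

lemma signed_perm_mult: "(signed_perm p d *v v) $ x = d (p x) * v $ p x"
  by (simp add: signed_perm_def matrix_vector_mult_def if_distrib[of "\<lambda>a. a * _"] cong: if_cong)

text \<open>Permuting space coordinates and multiplying coordinates by signs preserves the form, and
  the determinant is the sign of the permutation times the product of the signs. This supplies
  explicit elements of \<open>SO_n_1\<close>.\<close>

lemma signed_perm_SO:
  assumes p: "p permutes UNIV" "p None = None" and d: "\<And>x. d x * d x = 1"
    and det: "of_int (sign p) * prod d UNIV = 1"
  shows "signed_perm p d \<in> SO_n_1"
proof -
  have "det (signed_perm p d) = of_int (sign p) * det (\<chi> x y. if x = y then d x else 0)"
    unfolding signed_perm_def by (rule det_permute_rows[OF p(1)])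
  also have "det (\<chi> x y. if x = y then d x else 0) = prod d UNIV" by (subst det_diagonal) auto
  finally have "det (signed_perm p d) = 1" using det by simp
  moreover have "(signed_perm p d *v v) \<star> (signed_perm p d *v w) = v \<star> w" for v w
  proof -
    have f: "d x * a * (d x * b) = a * b" for x a b
    proof -
      have "d x * a * (d x * b) = d x * d x * (a * b)" by simp
      then show ?thesis using d[of x] by simp
    qed
    have "(signed_perm p d *v v) \<bullet> (signed_perm p d *v w) = (\<Sum>x\<in>UNIV. v $ p x * w $ p x)"
      "(signed_perm p d *v v) $ None * (signed_perm p d *v w) $ None = v $ None * w $ None"
      by (simp_all only: inner_vec_def inner_real_def signed_perm_mult p(2) f)
    moreover have "(\<Sum>x\<in>UNIV. v $ p x * w $ p x) = v \<bullet> w"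
      unfolding inner_vec_def using sum.permute[OF p(1), of "\<lambda>x. v $ x * w $ x"] by (simp add: o_def)
    ultimately show ?thesis by (simp add: minkowski_eq_inner)
  qed
  ultimately show ?thesis by (simp add: SO_n_1_def)
qed

lemma SO_n_1_noncommutative:
  assumes "CARD('n::finite) \<ge> 2"
  obtains g h :: "'n::finite lorentz" where "g \<in> SO_n_1" "h \<in> SO_n_1" "g ** h \<noteq> h ** g"
proof -
  obtain i j :: 'n where ij: "i \<noteq> j"
  proof -
    have "\<not> card (UNIV :: 'n set) \<le> Suc 0" using assms by simp
    then show ?thesis using that by (auto simp: card_le_Suc0_iff_eq)
  qed
  define p where "p = Transposition.transpose (Some i) (Some j)"
  \<comment> \<open>The signs make both determinants 1: two sign changes without a permutation, and
    one sign change together with a transposition.\<close>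
  define d1 :: "'n option \<Rightarrow> real" where "d1 x = (if x \<in> {None, Some i} then -1 else 1)" for x
  define d2 :: "'n option \<Rightarrow> real" where "d2 x = (if x \<in> {Some j} then -1 else 1)" for x
  have pr: "(\<Prod>x\<in>UNIV. if x \<in> A then -1 else 1) = (-1 :: real) ^ card A" for A :: "'n option set"
    by (subst prod.inter_filter[symmetric]) (simp_all add: prod_constant)
  have "signed_perm id d1 \<in> SO_n_1"
    by (rule signed_perm_SO) (use pr[of "{None, Some i}"] in \<open>auto simp: d1_def permutes_id sign_id\<close>)
  moreover have "signed_perm p d2 \<in> SO_n_1"
    by (rule signed_perm_SO)
      (use pr[of "{Some j}"] ij in \<open>auto simp: d2_def p_def permutes_swap_id sign_swap_id Transposition.transpose_def\<close>)
  moreover have "signed_perm id d1 ** signed_perm p d2 \<noteq> signed_perm p d2 ** signed_perm id d1"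
  proof
    assume "signed_perm id d1 ** signed_perm p d2 = signed_perm p d2 ** signed_perm id d1"
    then have "((signed_perm id d1 ** signed_perm p d2) *v axis (Some i) 1) $ Some j = ((signed_perm p d2 ** signed_perm id d1) *v axis (Some i) 1) $ Some j"
      by simp
    then show False using ij
      by (simp add: signed_perm_mult p_def d1_def d2_def axis_def flip: matrix_vector_mul_assoc)
  qed
  ultimately show ?thesis by (rule that)
qed

lemma path_product_hom:
  assumes "\<And>g h. g \<in> \<Gamma> \<Longrightarrow> h \<in> \<Gamma> \<Longrightarrow> g ** h \<in> \<Gamma> \<and> \<phi> (g ** h) = \<phi> g ** \<phi> h"
    and "mat 1 \<in> \<Gamma>" "\<phi> (mat 1) = mat 1" and "\<And>i. i < n \<Longrightarrow> c (\<alpha> i) (\<alpha> (Suc i)) \<in> \<Gamma>"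
  shows "path_product c n \<alpha> \<in> \<Gamma> \<and> \<phi> (path_product c n \<alpha>) = path_product (\<lambda>j k. \<phi> (c j k)) n \<alpha>"
  using assms(4) by (induction n) (simp_all add: assms(1-3))

section \<open>The cocycle\<close>

locale marked = lifted "\<phi> ` \<Gamma>" \<epsilon>\<^sub>0 e \<delta> F Lf
  for \<phi> :: "'g \<Rightarrow> 'n::finite lorentz" and \<Gamma> :: "'g set" and \<epsilon>\<^sub>0 e \<delta> F Lf +
  assumes inj: "inj_on \<phi> \<Gamma>"
begin

lemma cocycle_eq:
  assumes j: "j \<in> alphabet F" "k \<in> alphabet F" and l: "l \<in> Lf j" and g: "g \<in> \<Gamma>"
    and fl: "flow (return_time (\<phi> ` \<Gamma>) e F (orbit (\<phi> ` \<Gamma>) l)) l \<in> lact (\<phi> g) ` Lf k"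
  shows "cocycle \<phi> \<Gamma> e F Lf (orbit (\<phi> ` \<Gamma>) l) = g"
proof -
  have lift: "lift F Lf (orbit (\<phi> ` \<Gamma>) l) = l"
    unfolding lift_def
  proof (rule the_equality)
    show "l \<in> lifted_section F Lf \<and> l \<in> orbit (\<phi> ` \<Gamma>) l" using j l by (auto simp: lifted_section_def)
    fix p assume "p \<in> lifted_section F Lf \<and> p \<in> orbit (\<phi> ` \<Gamma>) l"
    then obtain i h where i: "i \<in> alphabet F" "p \<in> Lf i" "h \<in> \<phi> ` \<Gamma>" "p = lact h l"
      by (auto simp: lifted_section_def elim!: orbitE)
    have "p \<in> lact h ` Lf j" "p \<in> lact (mat 1) ` Lf i" using i l by force+
    then have "h = mat 1" using Lf_unique[OF j(1) i(1) i(3) one_mem] by blast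
    then show "p = l" using i(4) by simp
  qed
  show ?thesis
    unfolding cocycle_def lift
  proof (rule the_equality)
    show "g \<in> \<Gamma> \<and> flow (return_time (\<phi> ` \<Gamma>) e F (orbit (\<phi> ` \<Gamma>) l)) l \<in> lact (\<phi> g) ` lifted_section F Lf"
      using g fl j(2) by (auto simp: lifted_section_def)
    fix h assume h: "h \<in> \<Gamma> \<and> flow (return_time (\<phi> ` \<Gamma>) e F (orbit (\<phi> ` \<Gamma>) l)) l \<in> lact (\<phi> h) ` lifted_section F Lf"
    then obtain i where i: "i \<in> alphabet F" "flow (return_time (\<phi> ` \<Gamma>) e F (orbit (\<phi> ` \<Gamma>) l)) l \<in> lact (\<phi> h) ` Lf i"
      by (auto simp: lifted_section_def)
    have "\<phi> h = \<phi> g" using Lf_unique[OF i(1) j(2) _ _ i(2) fl] h g by blast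
    then show "h = g" using inj_onD[OF inj] h g by blast
  qed
qed

text \<open>\<open>cocycle_value\<close> is defined by a universal condition over the transition
  set, so it is determined once the cocycle is constant there and the set is nonempty; the lift
  \<open>l\<close> provides a point of it.\<close>

lemma cocycle_value_eq:
  assumes const: "cocycle \<phi> \<Gamma> e F Lf constant_on transition_set (\<phi> ` \<Gamma>) e F j k"
    and j: "j \<in> alphabet F" "k \<in> alphabet F" and l: "l \<in> Lf j" and g: "g \<in> \<Gamma>"
    and fl: "flow (return_time (\<phi> ` \<Gamma>) e F (orbit (\<phi> ` \<Gamma>) l)) l \<in> lact (\<phi> g) ` Lf k"
  shows "cocycle_value \<phi> \<Gamma> e F Lf j k = g"
proof -
  let ?u = "orbit (\<phi> ` \<Gamma>) l"
  let ?x = "flow (return_time (\<phi> ` \<Gamma>) e F ?u) l"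
  have gD: "\<phi> g \<in> \<phi> ` \<Gamma>" using g by blast
  have "l \<in> Rt j" using l Lf_Rt[OF j(1)] by blast
  moreover have "?x \<in> Rt k" using fl Lf_Rt[OF j(2)] gD by auto
  ultimately have u: "?u \<in> transition_set (\<phi> ` \<Gamma>) e F j k"
    by (simp add: transition_set_def poincare_map_def flow_orbit Rt_def)
  obtain v where v: "\<And>u. u \<in> transition_set (\<phi> ` \<Gamma>) e F j k \<Longrightarrow> cocycle \<phi> \<Gamma> e F Lf u = v"
    using const unfolding constant_on_def by blast
  have "v = g" using v[OF u] cocycle_eq[OF j l g fl] by simp
  then show ?thesis unfolding cocycle_value_def using v u by (intro the_equality) auto
qed

lemma admissible_lift:
  assumes adm: "admissible (\<phi> ` \<Gamma>) e F j k"
  obtains l g where "l \<in> Lf j" "g \<in> \<Gamma>" "flow (return_time (\<phi> ` \<Gamma>) e F (orbit (\<phi> ` \<Gamma>) l)) l \<in> lact (\<phi> g) ` Lf k"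
proof -
  obtain u where u: "j \<in> alphabet F" "k \<in> alphabet F" "u \<in> int_R (\<phi> ` \<Gamma>) e F j"
    "poincare_map (\<phi> ` \<Gamma>) e F u \<in> int_R (\<phi> ` \<Gamma>) e F k" using adm by (auto simp: admissible_def)
  have "u \<in> Rj (\<phi> ` \<Gamma>) e F j" using u(3) int_R_subset[OF u(1)] by blast
  then obtain l where l: "l \<in> Lf j" "u = orbit (\<phi> ` \<Gamma>) l" using Lf_image(1)[OF u(1)] by blast
  define x where "x = flow (return_time (\<phi> ` \<Gamma>) e F (orbit (\<phi> ` \<Gamma>) l)) l"
  have "x \<in> T1H" unfolding x_def using l(1) Lf_homeo(1)[OF u(1)] by auto
  moreover have "orbit (\<phi> ` \<Gamma>) x \<in> Rj (\<phi> ` \<Gamma>) e F k"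
    using u(4) int_R_subset[OF u(2)] unfolding l(2) poincare_map_def flow_orbit x_def by blast
  ultimately have "x \<in> Rt k" by (simp add: Rt_def)
  then obtain h where "h \<in> \<phi> ` \<Gamma>" "x \<in> lact h ` Lf k" by (rule Rt_Lf[OF u(2)])
  then show ?thesis using that[OF l(1)] unfolding x_def by blast
qed

end

text \<open>The isomorphism carries \<open>\<Gamma>\<close> to a group of isometries, where the
  locales apply; its injectivity brings the finitely many cosets back to
  \<open>\<Gamma>\<close>.\<close>

theorem theorem8p3:
  fixes K :: "real set"
    and P :: "('m::finite, real) regfun set"
    and Pt :: "('k::finite, real) regfun set"
    and \<pi> :: "'m \<Rightarrow> 'm \<Rightarrow> ('k, real) regfun"
    and \<phi> :: "real ^ 'm ^ 'm \<Rightarrow> 'n::finite lorentz"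
    and \<Gamma> :: "(real ^ 'm ^ 'm) set"
    and \<Gamma>t :: "(real ^ 'k ^ 'k) set"
    and \<epsilon>\<^sub>0 \<epsilon>\<^sub>0' \<delta> :: real
    and F :: "'n rect_family"
    and Lf :: "nat \<Rightarrow> 'n uvec set"
    and y z :: nat
  assumes "CARD('n) \<ge> 2"
    and "totally_real_number_field K"
    and "algebraic_group K P"
    and "\<phi> \<in> iso (GL\<lparr>carrier := real_points P\<rparr>) (GL\<lparr>carrier := SO_n_1\<rparr>)"
    and "\<exists>\<psi>. homeomorphism (real_points P) SO_n_1 \<phi> \<psi>"
    and "\<And>\<sigma> :: real \<Rightarrow> real. field_embedding K \<sigma> \<Longrightarrow> \<exists>x\<in>K. \<sigma> x \<noteq> x \<Longrightarrow> compact (points \<sigma> P)"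
    and "simply_connected_cover K Pt \<pi> P"
    and "subgroup \<Gamma> GL"
    and "\<Gamma> \<subseteq> K_points K P \<inter> identity_component (real_points P)"
    and "zariski_dense P \<Gamma>"
    and "torsion_free \<Gamma>"
    and "convex_cocompact (\<phi> ` \<Gamma>)"
    and "\<Gamma>t \<subseteq> integral_points K Pt"
    and "cover_preimage Pt \<pi> \<Gamma> = complex_matrix ` \<Gamma>t"
    and "generated_field (tr_Ad Pt ` \<Gamma>t) = K"
    and "local_product_structure (\<phi> ` \<Gamma>) \<epsilon>\<^sub>0 \<epsilon>\<^sub>0'"
    and "0 < \<delta>" and "\<delta> < min 1 (min \<epsilon>\<^sub>0 \<epsilon>\<^sub>0')"
    and "ereal \<delta> < injectivity_radius (\<phi> ` \<Gamma>) / 4"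
    and "markov_section (\<phi> ` \<Gamma>) \<epsilon>\<^sub>0 \<epsilon>\<^sub>0' \<delta> F"
    and "topologically_mixing (\<phi> ` \<Gamma>) \<epsilon>\<^sub>0' F"
    and "homeomorphic_lifts (\<phi> ` \<Gamma>) \<epsilon>\<^sub>0' F Lf"
    and "\<And>j k. admissible (\<phi> ` \<Gamma>) \<epsilon>\<^sub>0' F j k \<Longrightarrow>
           cocycle \<phi> \<Gamma> \<epsilon>\<^sub>0' F Lf constant_on transition_set (\<phi> ` \<Gamma>) \<epsilon>\<^sub>0' F j k"
    and "y \<in> alphabet F" and "z \<in> alphabet F"
  shows "subgroup (return_subgroup \<phi> \<Gamma> \<epsilon>\<^sub>0' F Lf y z) (GL\<lparr>carrier := \<Gamma>\<rparr>) \<and>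
         finite (rcosets\<^bsub>GL\<lparr>carrier := \<Gamma>\<rparr>\<^esub> (return_subgroup \<phi> \<Gamma> \<epsilon>\<^sub>0' F Lf y z))"
proof -
  define R where "R = real_points P"
  define \<Delta> where "\<Delta> = \<phi> ` \<Gamma>"
  have \<phi>h: "\<And>g h. g \<in> R \<Longrightarrow> h \<in> R \<Longrightarrow> \<phi> (g ** h) = \<phi> g ** \<phi> h" and \<phi>b: "bij_betw \<phi> R SO_n_1"
    using assms(4) unfolding iso_def hom_def R_def by auto
  have \<Gamma>R: "\<Gamma> \<subseteq> R" using assms(9) by (auto simp: K_points_def R_def)
  have \<Gamma>1: "mat 1 \<in> \<Gamma>" using subgroup.one_closed[OF assms(8)] by simp
  have \<Gamma>inv: "invertible g" if "g \<in> \<Gamma>" for g using subgroup.subset[OF assms(8)] that by auto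
  have \<Gamma>m: "g ** h \<in> \<Gamma>" if "g \<in> \<Gamma>" "h \<in> \<Gamma>" for g h using subgroup.m_closed[OF assms(8) that] by simp
  have \<Gamma>i: "matrix_inv g \<in> \<Gamma>" if "g \<in> \<Gamma>" for g
    using subgroup.m_inv_closed[OF assms(8) that] inv_GL[OF \<Gamma>inv[OF that]] by simp
  have SO: "\<phi> g \<in> SO_n_1" if "g \<in> R" for g using \<phi>b that by (auto simp: bij_betw_def)
  have SOinv: "invertible g" if "g \<in> SO_n_1" for g :: "'n lorentz" using that by (simp add: SO_n_1_def invertible_det_nz)
  have inj: "inj_on \<phi> R" using \<phi>b by (simp add: bij_betw_def)
  have inj\<Gamma>: "inj_on \<phi> \<Gamma>" using inj \<Gamma>R by (rule inj_on_subset)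
  have \<phi>m: "\<phi> (g ** h) = \<phi> g ** \<phi> h" if "g \<in> \<Gamma>" "h \<in> \<Gamma>" for g h using \<phi>h \<Gamma>R that by blast
  have \<phi>1: "\<phi> (mat 1) = mat 1"
  proof -
    have i: "invertible (\<phi> (mat 1))" using SOinv SO \<Gamma>R \<Gamma>1 by blast
    have "matrix_inv (\<phi> (mat 1)) ** (\<phi> (mat 1) ** \<phi> (mat 1)) = matrix_inv (\<phi> (mat 1)) ** \<phi> (mat 1)"
      using \<phi>m[OF \<Gamma>1 \<Gamma>1] by simp
    then show ?thesis using matrix_inv_inverse[OF i] by (simp add: matrix_mul_assoc)
  qed
  have \<phi>i: "matrix_inv (\<phi> g) = \<phi> (matrix_inv g)" if g: "g \<in> \<Gamma>" for g
  proof -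
    have i: "invertible (\<phi> g)" using SOinv SO \<Gamma>R g by blast
    have "\<phi> g ** \<phi> (matrix_inv g) = mat 1" using \<phi>m[OF g \<Gamma>i[OF g]] matrix_inv_inverse[OF \<Gamma>inv[OF g]] \<phi>1 by simp
    then have "matrix_inv (\<phi> g) ** (\<phi> g ** \<phi> (matrix_inv g)) = matrix_inv (\<phi> g)" by simp
    then show ?thesis using matrix_inv_inverse[OF i] by (simp add: matrix_mul_assoc)
  qed
  \<comment> \<open>Square -1 prevents the time coordinate of the image of \<open>e0\<close> from
    vanishing, and it is 1 at the identity; on the connected identity component it stays
    positive.\<close>
  have orth: "(\<phi> g *v e0) $ None > 0" if g: "g \<in> \<Gamma>" for g
  proof -
    define C where "C = connected_component_set R (mat 1)"
    define T where "T h = (\<phi> h *v e0) $ None" for h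
    have C: "connected C" "C \<subseteq> R" "mat 1 \<in> C" "g \<in> C"
      using g assms(9) \<Gamma>1 \<Gamma>R by (auto simp: C_def identity_component_def R_def connected_component_refl connected_component_in)
    have "continuous_on R \<phi>" using assms(5) unfolding R_def homeomorphism_def by blast
    then have "continuous_on C \<phi>" using C(2) continuous_on_subset by blast
    then have "continuous_on C T"
      unfolding T_def matrix_vector_mult_def by (intro continuous_intros) simp_all
    then have cT: "connected (T ` C)" using C(1) by (rule connected_continuous_image)
    have T0: "T h \<noteq> 0" if "h \<in> C" for h
    proof
      assume 0: "T h = 0"
      have "(\<phi> h *v e0) \<star> (\<phi> h *v e0) = e0 \<star> (e0 :: 'n mvec)" using SO[of h] C(2) that by (auto simp: SO_n_1_def)
      then have "(\<phi> h *v e0) \<bullet> (\<phi> h *v e0) = -1"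
        using 0 minkowski_eq_inner[of "\<phi> h *v e0" "\<phi> h *v e0"] by (simp add: T_def)
      then show False using inner_ge_zero[of "\<phi> h *v e0"] by linarith
    qed
    have "T (mat 1) = 1" by (simp add: T_def \<phi>1)
    then have "1 \<in> T ` C" using C(3) by force
    moreover have "T g \<in> T ` C" using C(4) by blast
    moreover have "0 \<notin> T ` C" using T0 by force
    ultimately have "\<not> T g \<le> 0" using connectedD_interval[OF cT, of "T g" 1 0] by auto
    then show ?thesis by (simp add: T_def)
  qed
  have pow: "g [^]\<^bsub>GL\<^esub> k \<in> \<Gamma> \<and> \<phi> (g [^]\<^bsub>GL\<^esub> k) = matpow (\<phi> g) k" if g: "g \<in> \<Gamma>" for g and k :: nat
  proof (induction k)
    case 0
    then show ?case using \<Gamma>1 \<phi>1 by simp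
  next
    case (Suc k)
    then show ?case using \<Gamma>m[OF _ g] \<phi>m[OF _ g] matpow_commute[of "\<phi> g" k] by simp
  qed
  interpret kleinian \<Delta>
  proof unfold_locales
    show "CARD('n) \<ge> 2" by (rule assms(1))
    show "mat 1 \<in> \<Delta>" unfolding \<Delta>_def using \<Gamma>1 \<phi>1 by force
    show "discrete \<Delta>" using assms(12) by (simp add: convex_cocompact_def \<Delta>_def)
  next
    fix g assume "g \<in> \<Delta>"
    then obtain g' where g': "g' \<in> \<Gamma>" "g = \<phi> g'" by (auto simp: \<Delta>_def)
    have gSO: "g \<in> SO_n_1" using SO \<Gamma>R g' by blast
    show "invertible g" using SOinv gSO by blast
    show "matrix_inv g \<in> \<Delta>" using \<phi>i[OF g'(1)] \<Gamma>i[OF g'(1)] g'(2) by (simp add: \<Delta>_def)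
    show "(g *v x) \<star> (g *v y) = x \<star> y" for x y using gSO by (simp add: SO_n_1_def)
    show "(g *v e0) $ None > 0" using orth g' by simp
    show "g ** h \<in> \<Delta>" if "h \<in> \<Delta>" for h
    proof -
      obtain h' where h': "h' \<in> \<Gamma>" "h = \<phi> h'" using \<open>h \<in> \<Delta>\<close> by (auto simp: \<Delta>_def)
      have "g ** h = \<phi> (g' ** h')" using \<phi>m[OF g'(1) h'(1)] g'(2) h'(2) by simp
      then show ?thesis using \<Gamma>m[OF g'(1) h'(1)] by (simp add: \<Delta>_def)
    qed
    fix k :: nat assume k: "k > 0" "matpow g k = mat 1"
    have "\<phi> (g' [^]\<^bsub>GL\<^esub> k) = \<phi> (mat 1)" using pow[OF g'(1), of k] k(2) g'(2) \<phi>1 by simp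
    then have "g' [^]\<^bsub>GL\<^esub> k = mat 1" using inj_onD[OF inj\<Gamma>] pow[OF g'(1), of k] \<Gamma>1 by blast
    then have "g' = mat 1" using assms(11) g'(1) k(1) unfolding torsion_free_def by blast
    then show "g = mat 1" using g'(2) \<phi>1 by simp
  qed
  interpret markov \<Delta> \<epsilon>\<^sub>0 \<epsilon>\<^sub>0' \<delta> F
    by unfold_locales (use assms(16,20) in \<open>simp_all add: \<Delta>_def\<close>)
  interpret lifted \<Delta> \<epsilon>\<^sub>0 \<epsilon>\<^sub>0' \<delta> F Lf
    by unfold_locales (use assms(22) in \<open>simp add: \<Delta>_def\<close>)
  interpret M: marked \<phi> \<Gamma> \<epsilon>\<^sub>0 \<epsilon>\<^sub>0' \<delta> F Lf
    unfolding marked_def marked_axioms_def using lifted_axioms inj\<Gamma> by (simp add: \<Delta>_def)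
  define c0 where "c0 = cocycle_value \<phi> \<Gamma> \<epsilon>\<^sub>0' F Lf"
  have c0: "c0 j k \<in> \<Gamma>" if adm: "admissible \<Delta> \<epsilon>\<^sub>0' F j k" for j k
  proof -
    obtain l g where l: "l \<in> Lf j" "g \<in> \<Gamma>" "flow (return_time (\<phi> ` \<Gamma>) \<epsilon>\<^sub>0' F (orbit (\<phi> ` \<Gamma>) l)) l \<in> lact (\<phi> g) ` Lf k"
      by (rule M.admissible_lift[OF adm[unfolded \<Delta>_def]])
    have "j \<in> alphabet F" "k \<in> alphabet F" using adm by (auto simp: admissible_def)
    then have "c0 j k = g" unfolding c0_def using M.cocycle_value_eq[OF assms(23)[OF adm[unfolded \<Delta>_def]] _ _ l] by blast
    then show ?thesis using l(2) by simp
  qed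
  interpret coding \<Delta> \<epsilon>\<^sub>0 \<epsilon>\<^sub>0' \<delta> F Lf "\<lambda>j k. \<phi> (c0 j k)"
  proof unfold_locales
    fix j k l g
    assume j: "j \<in> alphabet F" "k \<in> alphabet F" "l \<in> Lf j" "l \<in> It j" "g \<in> \<Delta>"
      and fl: "flow (return_time \<Delta> \<epsilon>\<^sub>0' F (orbit \<Delta> l)) l \<in> lact g ` Lf k"
        "flow (return_time \<Delta> \<epsilon>\<^sub>0' F (orbit \<Delta> l)) l \<in> It k"
    obtain g' where g': "g' \<in> \<Gamma>" "g = \<phi> g'" using j(5) by (auto simp: \<Delta>_def)
    have "admissible \<Delta> \<epsilon>\<^sub>0' F j k"
      unfolding admissible_def
    proof (intro conjI j(1,2) bexI)
      show "poincare_map \<Delta> \<epsilon>\<^sub>0' F (orbit \<Delta> l) \<in> int_R \<Delta> \<epsilon>\<^sub>0' F k"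
        using fl(2) unfolding poincare_map_def flow_orbit by (simp add: It_def)
      show "orbit \<Delta> l \<in> int_R \<Delta> \<epsilon>\<^sub>0' F j" using j(4) by (simp add: It_def)
    qed
    then have "cocycle \<phi> \<Gamma> \<epsilon>\<^sub>0' F Lf constant_on transition_set (\<phi> ` \<Gamma>) \<epsilon>\<^sub>0' F j k"
      using assms(23) by (simp add: \<Delta>_def)
    then have "c0 j k = g'"
      unfolding c0_def by (rule M.cocycle_value_eq[OF _ j(1-3) g'(1)]) (use fl(1) g'(2) in \<open>simp add: \<Delta>_def\<close>)
    then show "\<phi> (c0 j k) = g" using g'(2) by simp
  next
    show "\<phi> (c0 j k) \<in> \<Delta>" if "admissible \<Delta> \<epsilon>\<^sub>0' F j k" for j k using c0[OF that] by (simp add: \<Delta>_def)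
    show "topologically_mixing \<Delta> \<epsilon>\<^sub>0' F" using assms(21) by (simp add: \<Delta>_def)
  qed
  have pp: "path_product c0 n \<alpha> \<in> \<Gamma> \<and> \<phi> (path_product c0 n \<alpha>) = path_product (\<lambda>j k. \<phi> (c0 j k)) n \<alpha>"
    if "\<alpha> \<in> admissible_seqs \<Delta> \<epsilon>\<^sub>0' F n j k" for \<alpha> n j k
    by (rule path_product_hom) (use that c0 \<Gamma>m \<phi>m \<Gamma>1 \<phi>1 in \<open>auto simp: admissible_seqs_def\<close>)
  define G where "G = (\<Union>p\<in>{1..}. return_products \<phi> \<Gamma> \<epsilon>\<^sub>0' F Lf p y z)"
  define H where "H = return_subgroup \<phi> \<Gamma> \<epsilon>\<^sub>0' F Lf y z"
  have HG: "H = generate GL G" by (simp add: H_def return_subgroup_def G_def)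
  have G\<Gamma>: "G \<subseteq> \<Gamma>"
  proof
    fix x assume "x \<in> G"
    then obtain p \<alpha> \<alpha>' where x: "x = path_product c0 (p + 1) \<alpha> ** matrix_inv (path_product c0 (p + 1) \<alpha>')"
      "\<alpha> \<in> admissible_seqs \<Delta> \<epsilon>\<^sub>0' F (p + 1) y z" "\<alpha>' \<in> admissible_seqs \<Delta> \<epsilon>\<^sub>0' F (p + 1) y z"
      unfolding G_def return_products_def c0_def \<Delta>_def by blast
    show "x \<in> \<Gamma>" unfolding x(1) using pp[OF x(2)] pp[OF x(3)] by (intro \<Gamma>m \<Gamma>i) blast+
  qed
  then have "G \<subseteq> carrier GL" using \<Gamma>inv by auto
  then have Hsub: "subgroup H GL" unfolding HG by (rule group.generate_is_subgroup[OF group_GL])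
  have H\<Gamma>: "H \<subseteq> \<Gamma>" unfolding HG by (rule group.generate_subgroup_incl[OF group_GL G\<Gamma> assms(8)])
  have sub: "subgroup H (GL\<lparr>carrier := \<Gamma>\<rparr>)" by (rule group.subgroup_incl[OF group_GL Hsub assms(8) H\<Gamma>])
  \<comment> \<open>If \<open>\<Gamma>\<close> were commutative, Zariski density in one factor and
    then in the other would make all real points commute, hence also \<open>SO_n_1\<close>.\<close>
  have "\<exists>g\<in>\<Gamma>. \<exists>h\<in>\<Gamma>. g ** h \<noteq> h ** g"
  proof (rule ccontr)
    assume "\<not> ?thesis"
    then have c: "g ** h = h ** g" if "g \<in> \<Gamma>" "h \<in> \<Gamma>" for g h using that by blast
    have c1: "g ** h = h ** g" if "g \<in> R" "h \<in> \<Gamma>" for g h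
      using zariski_commute[OF assms(10) c] that by (simp add: R_def)
    have c2: "g ** h = h ** g" if "g \<in> R" "h \<in> R" for g h
      using zariski_commute[OF assms(10), of h g] c1 that by (simp add: R_def)
    obtain g h :: "'n lorentz" where gh: "g \<in> SO_n_1" "h \<in> SO_n_1" "g ** h \<noteq> h ** g"
      by (rule SO_n_1_noncommutative[OF assms(1)])
    obtain g' where g': "g' \<in> R" "g = \<phi> g'" using gh(1) \<phi>b by (auto simp: bij_betw_def)
    obtain h' where h': "h' \<in> R" "h = \<phi> h'" using gh(2) \<phi>b by (auto simp: bij_betw_def)
    show False using gh(3) c2[OF g'(1) h'(1)] \<phi>h[OF g'(1) h'(1)] \<phi>h[OF h'(1) g'(1)] g'(2) h'(2) by simp
  qed
  then obtain g1 h1 where gh: "g1 \<in> \<Gamma>" "h1 \<in> \<Gamma>" "g1 ** h1 \<noteq> h1 ** g1" by blast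
  have "\<phi> g1 ** \<phi> h1 \<noteq> \<phi> h1 ** \<phi> g1"
    using inj_onD[OF inj\<Gamma>, of "g1 ** h1" "h1 ** g1"] gh \<Gamma>m \<phi>m by metis
  then have "\<exists>W. finite W \<and> W \<subseteq> \<Delta> \<and> (\<forall>x\<in>\<Delta>. \<exists>w\<in>W. x ** matrix_inv w \<in> \<phi> ` H)"
  proof (rule finite_index[OF assms(24,25), rotated 2])
    show "\<phi> g1 \<in> \<Delta>" "\<phi> h1 \<in> \<Delta>" using gh by (auto simp: \<Delta>_def)
  next
    fix a b assume "a \<in> \<phi> ` H" "b \<in> \<phi> ` H"
    then obtain a' b' where ab: "a' \<in> H" "b' \<in> H" "a = \<phi> a'" "b = \<phi> b'" by blast
    have "a' ** b' \<in> H" using subgroup.m_closed[OF Hsub ab(1,2)] by simp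
    moreover have "a ** b = \<phi> (a' ** b')" using \<phi>m ab H\<Gamma> by (metis subsetD)
    ultimately show "a ** b \<in> \<phi> ` H" by blast
  next
    fix a assume "a \<in> \<phi> ` H"
    then obtain a' where a: "a' \<in> H" "a = \<phi> a'" by blast
    have a\<Gamma>: "a' \<in> \<Gamma>" using a(1) H\<Gamma> by blast
    have "matrix_inv a' \<in> H" using subgroup.m_inv_closed[OF Hsub a(1)] inv_GL[OF \<Gamma>inv[OF a\<Gamma>]] by simp
    then show "matrix_inv a \<in> \<phi> ` H" using \<phi>i[OF a\<Gamma>] a(2) by simp
  next
    fix n u u'
    assume n: "n \<ge> 2" and u: "u \<in> Bp y z n" "u' \<in> Bp y z n"
    obtain \<alpha> where \<alpha>: "\<alpha> \<in> admissible_seqs \<Delta> \<epsilon>\<^sub>0' F n y z" "u = path_product (\<lambda>j k. \<phi> (c0 j k)) n \<alpha>" using u(1) by (auto simp: Bp_def)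
    obtain \<alpha>' where \<alpha>': "\<alpha>' \<in> admissible_seqs \<Delta> \<epsilon>\<^sub>0' F n y z" "u' = path_product (\<lambda>j k. \<phi> (c0 j k)) n \<alpha>'" using u(2) by (auto simp: Bp_def)
    have u\<phi>: "u = \<phi> (path_product c0 n \<alpha>)" "u' = \<phi> (path_product c0 n \<alpha>')" "path_product c0 n \<alpha> \<in> \<Gamma>" "path_product c0 n \<alpha>' \<in> \<Gamma>"
      using pp[OF \<alpha>(1)] pp[OF \<alpha>'(1)] \<alpha>(2) \<alpha>'(2) by auto
    \<comment> \<open>The products at \<open>p\<close> use sequences with \<open>p + 1\<close>
      transitions, and \<open>p\<close> starts at 1, so the lengths start at 2.\<close>
    define p where "p = n - 1"
    have p: "n = p + 1" "p \<in> {1..}" using n by (auto simp: p_def)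
    have "path_product c0 n \<alpha> ** matrix_inv (path_product c0 n \<alpha>') \<in> return_products \<phi> \<Gamma> \<epsilon>\<^sub>0' F Lf p y z"
      unfolding return_products_def c0_def p(1) using \<alpha>(1) \<alpha>'(1) unfolding p(1) \<Delta>_def by blast
    then have "path_product c0 n \<alpha> ** matrix_inv (path_product c0 n \<alpha>') \<in> G" unfolding G_def using p(2) by blast
    then have "path_product c0 n \<alpha> ** matrix_inv (path_product c0 n \<alpha>') \<in> H" unfolding HG by (rule generate.incl)
    moreover have "u ** matrix_inv u' = \<phi> (path_product c0 n \<alpha> ** matrix_inv (path_product c0 n \<alpha>'))"
      using u\<phi> \<phi>i \<phi>m \<Gamma>i by simp
    ultimately show "u ** matrix_inv u' \<in> \<phi> ` H" by blast
  qed
  then obtain W where W: "finite W" "W \<subseteq> \<Delta>" "\<forall>x\<in>\<Delta>. \<exists>w\<in>W. x ** matrix_inv w \<in> \<phi> ` H"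
    by (elim exE conjE)
  obtain V where V: "V \<subseteq> \<Gamma>" "finite V" "W = \<phi> ` V" using finite_subset_image[OF W(1) W(2)[unfolded \<Delta>_def]] by blast
  have grp: "group (GL\<lparr>carrier := \<Gamma>\<rparr>)" by (rule subgroup.subgroup_is_group[OF assms(8) group_GL])
  have "rcosets\<^bsub>GL\<lparr>carrier := \<Gamma>\<rparr>\<^esub> H \<subseteq> (\<lambda>v. H #>\<^bsub>GL\<lparr>carrier := \<Gamma>\<rparr>\<^esub> v) ` V"
  proof
    fix S assume "S \<in> rcosets\<^bsub>GL\<lparr>carrier := \<Gamma>\<rparr>\<^esub> H"
    then obtain x where x: "x \<in> \<Gamma>" "S = H #>\<^bsub>GL\<lparr>carrier := \<Gamma>\<rparr>\<^esub> x" by (auto simp: RCOSETS_def)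
    have "\<phi> x \<in> \<Delta>" using x(1) by (simp add: \<Delta>_def)
    from bspec[OF W(3) this] obtain w where w: "w \<in> W" "\<phi> x ** matrix_inv w \<in> \<phi> ` H" by (rule bexE)
    from w(1)[unfolded V(3)] obtain v where "w = \<phi> v" "v \<in> V" by (rule imageE)
    with w(2) have v: "v \<in> V" "\<phi> x ** matrix_inv (\<phi> v) \<in> \<phi> ` H" by simp_all
    have v\<Gamma>: "v \<in> \<Gamma>" using v(1) V(1) by blast
    have "\<phi> (x ** matrix_inv v) \<in> \<phi> ` H" using v(2) \<phi>i[OF v\<Gamma>] \<phi>m[OF x(1) \<Gamma>i[OF v\<Gamma>]] by simp
    then obtain h where h: "h \<in> H" "\<phi> (x ** matrix_inv v) = \<phi> h" by blast
    have "x ** matrix_inv v = h"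
      using inj_onD[OF inj\<Gamma> h(2)] \<Gamma>m[OF x(1) \<Gamma>i[OF v\<Gamma>]] h(1) H\<Gamma> by blast
    then have "h ** v = x" using matrix_inv_inverse[OF \<Gamma>inv[OF v\<Gamma>]] by (auto simp flip: matrix_mul_assoc)
    then have "x \<in> H #>\<^bsub>GL\<lparr>carrier := \<Gamma>\<rparr>\<^esub> v" using h(1) by (auto simp: r_coset_def)
    then have "H #>\<^bsub>GL\<lparr>carrier := \<Gamma>\<rparr>\<^esub> v = H #>\<^bsub>GL\<lparr>carrier := \<Gamma>\<rparr>\<^esub> x"
      by (rule group.repr_independence[OF grp _ _ sub]) (simp add: v\<Gamma>)
    then show "S \<in> (\<lambda>v. H #>\<^bsub>GL\<lparr>carrier := \<Gamma>\<rparr>\<^esub> v) ` V" using x(2) v(1) by blast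
  qed
  then have "finite (rcosets\<^bsub>GL\<lparr>carrier := \<Gamma>\<rparr>\<^esub> H)" using V(2) finite_surj by blast
  with sub show ?thesis unfolding H_def by blast
qed

end
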